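(* Let $\mathcal{G}\rightrightarrows\mathcal{M}$ be an $n$-graded Lie groupoid with graded Lie algebroid $\mathcal{A}$, and let $(L_{\mathcal{G}},d,[\cdot,\cdot])$ be the differential graded Lie algebra with $L^i_{\mathcal{G}}=\Gamma^{i+1}\mathcal{A}\oplus\mathfrak{X}^{1,i}_{mul}(\mathcal{G})$. Then there is a canonical one-to-one correspondence between Maurer-Cartan elements of $(L_{\mathcal{G}},d,[\cdot,\cdot])$ and quasi $Q$-groupoid structures $(Q,q)$ on $\mathcal{G}\rightrightarrows\mathcal{M}$.
   Context: An $n$-manifold $\mathcal{M}=(M,C^\bullet(\mathcal{M}))$ is a smooth manifold with a sheaf of graded commutative algebras locally isomorphic to $C^\infty(U)\otimes\mathrm{Sym}\,\mathbf{V}$, $\mathbf V=\oplus_{i=1}^nV_i$. Degree $k$ vector fields $\mathfrak{X}^{1,k}(\mathcal{M})$ are degree $k$ derivations of $C^\bullet(\mathcal{M})$, equivalently sections $\mathcal{M}\to T[k]\mathcal{M}$; $[\cdot,\cdot]$ is the graded commutator. An $n$-graded Lie groupoid $\mathcal{G}\rightrightarrows\mathcal{M}$ is a groupoid object in $n$-manifolds with source $\mathtt s$ and target $\mathtt t$ submersions (multiplication $\mathtt m$ on $\mathcal{G}{}_{\mathtt s}\times_{\mathtt t}\mathcal{G}$, unit $\mathtt u$, inverse $\mathtt i$). Its graded Lie algebroid is $\mathcal{A}=\mathtt u^*\ker T\mathtt s$, with degree $j$ sections $\Gamma^j\mathcal{A}$. For $a\in\Gamma^j\mathcal{A}$, $a^r=T[j]\mathtt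 m(a\circ\mathtt t,0)$ and $a^l=-T[j]\mathtt m(0,T[j]\mathtt i\circ a\circ\mathtt s)$ are the right- and left-invariant vector fields, so $a^l-a^r$ is multiplicative. A vector field $X\in\mathfrak{X}^{1,k}(\mathcal{G})$ is multiplicative ($X\in\mathfrak{X}^{1,k}_{mul}(\mathcal{G})$) if $(X,X_0):\mathcal{G}\to T[k]\mathcal{G}$ is a groupoid morphism for some $X_0\in\mathfrak{X}^{1,k}(\mathcal{M})$. The dgla structure on $L_{\mathcal{G}}$: $d(a)=a^r-a^l$ for $a\in\Gamma^\bullet\mathcal{A}$ and $d(X)=0$ for $X\in\mathfrak{X}^{1,\bullet}_{mul}(\mathcal{G})$; $[X,Y]$ is the commutator; $[X,a]=(-1)^{|X|}[X,a^r]\circ\mathtt u$, i.e. up to the sign, the unique section whose right-invariant extension is $[X,a^r]$; $[a,b]=0$; extended by graded antisymmetry. A Maurer-Cartan element is a degree $1$ element $Y$ with $dY+\tfrac12[Y,Y]=0$. A quasi $Q$-groupoid structure on $\mathcal{G}\rightrightarrows\mathcal{M}$ is a pair $Q\in\mathfrak{X}^{1,1}_{mul}(\mathcal{G})$, $q\in\Gamma^2\mathcal{A}$ with $Q^2=q^l-q^r$ and $[Q,q^r]=0$. *)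

theory Defs
  imports "HOL-Analysis.Analysis" "HOL-Library.Function_Algebras"
begin

text \<open>
  Functions into a real vector space carry the pointwise vector space structure
  (\<open>+\<close>, \<open>0\<close> and \<open>-\<close> on functions come from the libraries).
\<close>

instantiation "fun" :: (type, scaleR) scaleR
begin
definition scaleR_fun_def: "c *\<^sub>R f = (\<lambda>x. c *\<^sub>R f x)"
instance ..
end

instance "fun" :: (type, real_vector) real_vector
  by standard (simp_all add: scaleR_fun_def fun_eq_iff scaleR_add_right scaleR_add_left)

definition linear_map_on :: "'a::real_vector set \<Rightarrow> ('a \<Rightarrow> 'b::real_vector) \<Rightarrow> bool" where
  "linear_map_on S f \<longleftrightarrow>
     (\<forall>x\<in>S. \<forall>y\<in>S. f (x + y) = f x + f y) \<and> (\<forall>c. \<forall>x\<in>S. f (c *\<^sub>R x) = c *\<^sub>R f x)"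


section \<open>Sheaves of graded commutative algebras\<close>

text \<open>
  A graded algebra is given by its homogeneous elements: \<open>gsec M U k\<close> is the vector space of
  sections of degree \<open>k\<close> over the open set \<open>U\<close>, realised as a linear subspace of the ambient
  vector space \<open>'a\<close>; different degrees meet only in \<open>0\<close>.  Nothing is required of the fields on
  sets which are not open.
\<close>

record ('p, 'a) graded_space =
  base :: "'p topology"
  gsec :: "'p set \<Rightarrow> int \<Rightarrow> 'a set"
  gmult :: "'p set \<Rightarrow> 'a \<Rightarrow> 'a \<Rightarrow> 'a"
  gone :: "'p set \<Rightarrow> 'a"
  gres :: "'p set \<Rightarrow> 'p set \<Rightarrow> 'a \<Rightarrow> 'a"

abbreviation points :: "('p, 'a) graded_space \<Rightarrow> 'p set" where
  "points M \<equiv> topspace (base M)"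

definition homogeneous :: "('p, 'a) graded_space \<Rightarrow> 'p set \<Rightarrow> 'a set" where
  "homogeneous M U = (\<Union>k. gsec M U k)"

definition graded_commutative_algebra ::
    "(int \<Rightarrow> 'a::real_vector set) \<Rightarrow> ('a \<Rightarrow> 'a \<Rightarrow> 'a) \<Rightarrow> 'a \<Rightarrow> bool" where
  "graded_commutative_algebra A mul e \<longleftrightarrow>
     (\<forall>k. subspace (A k)) \<and>
     (\<forall>j k. j \<noteq> k \<longrightarrow> A j \<inter> A k = {0}) \<and>
     (\<forall>j k. \<forall>x\<in>A j. \<forall>y\<in>A k. mul x y \<in> A (j + k)) \<and>
     (\<forall>j k. \<forall>x\<in>A j. linear_map_on (A k) (mul x)) \<and>
     (\<forall>j k. \<forall>y\<in>A k. linear_map_on (A j) (\<lambda>x. mul x y)) \<and>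
     (\<forall>i j k. \<forall>x\<in>A i. \<forall>y\<in>A j. \<forall>z\<in>A k. mul (mul x y) z = mul x (mul y z)) \<and>
     e \<in> A 0 \<and> (\<forall>k. \<forall>x\<in>A k. mul e x = x \<and> mul x e = x) \<and>
     (\<forall>j k. \<forall>x\<in>A j. \<forall>y\<in>A k. mul x y = ((-1) powi (j * k)) *\<^sub>R mul y x)"

text \<open>
  Unique gluing is required degree by degree, i.e. each \<open>gsec M _ k\<close> is a sheaf.
\<close>

definition graded_sheaf :: "('p, 'a::real_vector) graded_space \<Rightarrow> bool" where
  "graded_sheaf M \<longleftrightarrow>
     (\<forall>U. openin (base M) U \<longrightarrow> graded_commutative_algebra (gsec M U) (gmult M U) (gone M U)) \<and>
     (\<forall>U V. openin (base M) U \<and> openin (base M) V \<and> V \<subseteq> U \<longrightarrow>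
        (\<forall>k. gres M U V ` gsec M U k \<subseteq> gsec M V k \<and> linear_map_on (gsec M U k) (gres M U V)) \<and>
        gres M U V (gone M U) = gone M V \<and>
        (\<forall>x\<in>homogeneous M U. \<forall>y\<in>homogeneous M U.
           gres M U V (gmult M U x y) = gmult M V (gres M U V x) (gres M U V y))) \<and>
     (\<forall>U. openin (base M) U \<longrightarrow> (\<forall>x\<in>homogeneous M U. gres M U U x = x)) \<and>
     (\<forall>U V W. openin (base M) U \<and> openin (base M) V \<and> openin (base M) W \<and> W \<subseteq> V \<and> V \<subseteq> U \<longrightarrow>
        (\<forall>x\<in>homogeneous M U. gres M V W (gres M U V x) = gres M U W x)) \<and>
     (\<forall>\<U> s k. (\<forall>V\<in>\<U>. openin (base M) V \<and> s V \<in> gsec M V k) \<and>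
        (\<forall>V\<in>\<U>. \<forall>W\<in>\<U>. gres M V (V \<inter> W) (s V) = gres M W (V \<inter> W) (s W)) \<longrightarrow>
        (\<exists>!x. x \<in> gsec M (\<Union>\<U>) k \<and> (\<forall>V\<in>\<U>. gres M (\<Union>\<U>) V x = s V)))"

definition open_subspace :: "('p, 'a) graded_space \<Rightarrow> 'p set \<Rightarrow> ('p, 'a) graded_space" where
  "open_subspace M U = M\<lparr>base := subtopology (base M) U\<rparr>"


section \<open>Morphisms\<close>

text \<open>
  A morphism consists of a continuous map and of a morphism of sheaves of graded algebras over it.
  Both components are normalised outside their meaningful domain (\<open>undefined\<close> off the space,
  \<open>0\<close> on anything but homogeneous sections over open sets), so that equality of morphisms is
  equality in the logic.  For the spaces considered below the stalks of the degree \<open>0\<close> part are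
  those of smooth functions, hence compatibility with evaluation at points (locality) is automatic.
\<close>

record ('p, 'a, 'q, 'b) graded_map =
  mdom :: "('p, 'a) graded_space"
  mcod :: "('q, 'b) graded_space"
  bmap :: "'p \<Rightarrow> 'q"
  pull :: "'q set \<Rightarrow> 'b \<Rightarrow> 'a"

definition preim :: "('p, 'a, 'q, 'b) graded_map \<Rightarrow> 'q set \<Rightarrow> 'p set" where
  "preim \<phi> V = {x \<in> points (mdom \<phi>). bmap \<phi> x \<in> V}"

definition mors :: "('p, 'a::real_vector) graded_space \<Rightarrow> ('q, 'b::real_vector) graded_space \<Rightarrow>
    ('p, 'a, 'q, 'b) graded_map set" where
  "mors M N = {\<phi>. mdom \<phi> = M \<and> mcod \<phi> = N \<and>
     bmap \<phi> \<in> extensional (points M) \<and> continuous_map (base M) (base N) (bmap \<phi>) \<and>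
     (\<forall>V f. \<not> (openin (base N) V \<and> f \<in> homogeneous N V) \<longrightarrow> pull \<phi> V f = 0) \<and>
     (\<forall>V. openin (base N) V \<longrightarrow>
        (\<forall>k. pull \<phi> V ` gsec N V k \<subseteq> gsec M (preim \<phi> V) k \<and>
             linear_map_on (gsec N V k) (pull \<phi> V)) \<and>
        pull \<phi> V (gone N V) = gone M (preim \<phi> V) \<and>
        (\<forall>f\<in>homogeneous N V. \<forall>g\<in>homogeneous N V.
           pull \<phi> V (gmult N V f g) = gmult M (preim \<phi> V) (pull \<phi> V f) (pull \<phi> V g)) \<and>
        (\<forall>W. openin (base N) W \<and> W \<subseteq> V \<longrightarrow> (\<forall>f\<in>homogeneous N V.
           pull \<phi> W (gres N V W f) = gres M (preim \<phi> V) (preim \<phi> W) (pull \<phi> V f))))}"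

definition id_mor :: "('p, 'a::real_vector) graded_space \<Rightarrow> ('p, 'a, 'p, 'a) graded_map" where
  "id_mor M = \<lparr>mdom = M, mcod = M, bmap = restrict id (points M),
     pull = (\<lambda>V f. if openin (base M) V \<and> f \<in> homogeneous M V then f else 0)\<rparr>"

definition comp_mor :: "('q, 'b, 'r, 'c) graded_map \<Rightarrow> ('p, 'a, 'q, 'b) graded_map \<Rightarrow>
    ('p, 'a, 'r, 'c) graded_map"  (infixl "\<odot>" 70) where
  "\<psi> \<odot> \<phi> = \<lparr>mdom = mdom \<phi>, mcod = mcod \<psi>,
     bmap = restrict (bmap \<psi> \<circ> bmap \<phi>) (points (mdom \<phi>)),
     pull = (\<lambda>V f. pull \<phi> (preim \<psi> V) (pull \<psi> V f))\<rparr>"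

definition isomorphic :: "('p, 'a::real_vector) graded_space \<Rightarrow> ('q, 'b::real_vector) graded_space
    \<Rightarrow> bool" where
  "isomorphic M N \<longleftrightarrow>
     (\<exists>\<phi>\<in>mors M N. \<exists>\<psi>\<in>mors N M. \<psi> \<odot> \<phi> = id_mor M \<and> \<phi> \<odot> \<psi> = id_mor N)"


section \<open>The local models\<close>

text \<open>
  \<open>\<real>\<^sup>m\<close> is the library's \<^const>\<open>Euclidean_space\<close> \<open>m\<close>, a space of sequences vanishing from index \<open>m\<close> on.
  \<open>C_diff m r U f\<close> says that \<open>f\<close> is \<open>r\<close> times continuously differentiable on the open set \<open>U\<close>,
  in terms of iterated partial derivatives.
\<close>

primrec C_diff :: "nat \<Rightarrow> nat \<Rightarrow> (nat \<Rightarrow> real) set \<Rightarrow> ((nat \<Rightarrow> real) \<Rightarrow> real) \<Rightarrow> bool" where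
  "C_diff m 0 U f \<longleftrightarrow> continuous_map (subtopology (Euclidean_space m) U) euclideanreal f"
| "C_diff m (Suc r) U f \<longleftrightarrow>
     continuous_map (subtopology (Euclidean_space m) U) euclideanreal f \<and>
     (\<forall>i<m. \<exists>g. (\<forall>x\<in>U. ((\<lambda>y. f (x(i := y))) has_real_derivative g x) (at (x i))) \<and> C_diff m r U g)"

definition smooth :: "nat \<Rightarrow> (nat \<Rightarrow> real) set \<Rightarrow> ((nat \<Rightarrow> real) \<Rightarrow> real) \<Rightarrow> bool" where
  "smooth m U f \<longleftrightarrow> (\<forall>r. C_diff m r U f)"

text \<open>
  A graded vector space \<open>V\<close> is given by the list \<open>w\<close> of the degrees of the elements
  \<open>\<xi>\<^sub>0, \<xi>\<^sub>1, \<dots>\<close> of a homogeneous basis.  \<open>Sym V\<close> has as basis the monomials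
  \<open>\<xi>\<^sub>0\<^bsup>\<alpha> 0\<^esup> \<xi>\<^sub>1\<^bsup>\<alpha> 1\<^esup> \<dots>\<close> in which generators of odd degree have exponent at most \<open>1\<close>.
\<close>

definition monomials :: "nat list \<Rightarrow> (nat \<Rightarrow> nat) set" where
  "monomials w = {\<alpha>. (\<forall>j\<ge>length w. \<alpha> j = 0) \<and> (\<forall>j<length w. odd (w ! j) \<longrightarrow> \<alpha> j \<le> 1)}"

definition mdegree :: "nat list \<Rightarrow> (nat \<Rightarrow> nat) \<Rightarrow> int" where
  "mdegree w \<alpha> = (\<Sum>j<length w. int (\<alpha> j * w ! j))"

text \<open>
  The sign in \<open>\<xi>\<^sup>\<alpha> \<xi>\<^sup>\<beta> = \<plusminus> \<xi>\<^bsup>\<alpha> + \<beta>\<^esup>\<close>: every \<open>\<xi>\<^sub>i\<close> of the first factor is moved past every \<open>\<xi>\<^sub>j\<close>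
  with \<open>j < i\<close> of the second one.
\<close>

definition koszul_sign :: "nat list \<Rightarrow> (nat \<Rightarrow> nat) \<Rightarrow> (nat \<Rightarrow> nat) \<Rightarrow> real" where
  "koszul_sign w \<alpha> \<beta> = (-1) ^ (\<Sum>i<length w. \<Sum>j<i. (\<alpha> i * w ! i) * (\<beta> j * w ! j))"

text \<open>
  The graded domain over the open set \<open>U\<^sub>0\<close> of \<open>\<real>\<^sup>m\<close>, with algebra \<open>C\<^sup>\<infinity>(U) \<otimes> Sym V\<close> over \<open>U\<close>:
  a section \<open>F\<close> stands for \<open>\<Sum>\<^sub>\<alpha> F \<alpha> \<xi>\<^sup>\<alpha>\<close>, where the coefficient functions are extended by \<open>0\<close>
  outside \<open>U\<close>.  If all entries of \<open>w\<close> are positive, only finitely many monomials have a given degree.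
\<close>

type_synonym model_section = "(nat \<Rightarrow> nat) \<Rightarrow> (nat \<Rightarrow> real) \<Rightarrow> real"

definition graded_domain ::
    "nat \<Rightarrow> nat list \<Rightarrow> (nat \<Rightarrow> real) set \<Rightarrow> (nat \<Rightarrow> real, model_section) graded_space" where
  "graded_domain m w U\<^sub>0 =
     \<lparr>base = subtopology (Euclidean_space m) U\<^sub>0,
      gsec = (\<lambda>U k. {F. (\<forall>\<alpha>. smooth m U (F \<alpha>)) \<and> (\<forall>\<alpha> x. x \<notin> U \<longrightarrow> F \<alpha> x = 0) \<and>
                        (\<forall>\<alpha>. \<not> (\<alpha> \<in> monomials w \<and> mdegree w \<alpha> = k) \<longrightarrow> F \<alpha> = 0)}),
      gmult = (\<lambda>U F G \<gamma> x. if \<gamma> \<in> monomials w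
                 then \<Sum>\<alpha> | \<forall>j. \<alpha> j \<le> \<gamma> j.
                        koszul_sign w \<alpha> (\<lambda>j. \<gamma> j - \<alpha> j) * F \<alpha> x * G (\<lambda>j. \<gamma> j - \<alpha> j) x
                 else 0),
      gone = (\<lambda>U \<alpha> x. if (\<forall>j. \<alpha> j = 0) \<and> x \<in> U then 1 else 0),
      gres = (\<lambda>U V F \<alpha> x. if x \<in> V then F \<alpha> x else 0)\<rparr>"


section \<open>\<open>n\<close>-manifolds\<close>

text \<open>
  The smooth structure of the body is not a separate datum: it is the one for which the degree \<open>0\<close>
  part of the sheaf is the sheaf of smooth functions (all generators have positive degree).
\<close>

definition n_manifold :: "nat \<Rightarrow> ('p, 'a::real_vector) graded_space \<Rightarrow> bool" where
  "n_manifold n M \<longleftrightarrow>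
     Hausdorff_space (base M) \<and> second_countable (base M) \<and> graded_sheaf M \<and>
     (\<exists>m w. (\<forall>d\<in>set w. 1 \<le> d \<and> d \<le> n) \<and>
        (\<forall>p\<in>points M. \<exists>U U\<^sub>0. openin (base M) U \<and> p \<in> U \<and> openin (Euclidean_space m) U\<^sub>0 \<and>
           isomorphic (open_subspace M U) (graded_domain m w U\<^sub>0)))"

text \<open>
  Points and sections of \<open>n\<close>-manifolds may have arbitrary types.  Where all \<open>n\<close>-manifolds have to be
  quantified over (the universal property of fibre products), those with the points and sections
  below are used.  Every \<open>n\<close>-manifold is isomorphic to one of them: its body has at most as many
  points as \<open>\<real>\<close>, the spaces of sections over the open sets have at most that dimension, and
  \<open>model_section\<close> is a vector space of larger dimension.
\<close>

type_synonym univ_space = "(nat \<Rightarrow> real, model_section) graded_space"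

definition is_fibre_product ::
    "nat \<Rightarrow> ('p, 'a::real_vector, 'q, 'b::real_vector) graded_map \<Rightarrow>
     ('r, 'c::real_vector, 'q, 'b) graded_map \<Rightarrow> ('s, 'd::real_vector) graded_space \<Rightarrow>
     ('s, 'd, 'p, 'a) graded_map \<Rightarrow> ('s, 'd, 'r, 'c) graded_map \<Rightarrow> bool" where
  "is_fibre_product n f g P p\<^sub>1 p\<^sub>2 \<longleftrightarrow>
     n_manifold n P \<and> p\<^sub>1 \<in> mors P (mdom f) \<and> p\<^sub>2 \<in> mors P (mdom g) \<and> f \<odot> p\<^sub>1 = g \<odot> p\<^sub>2 \<and>
     (\<forall>T :: univ_space. n_manifold n T \<longrightarrow>
        (\<forall>a\<in>mors T (mdom f). \<forall>b\<in>mors T (mdom g). f \<odot> a = g \<odot> b \<longrightarrow>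
           (\<exists>!h. h \<in> mors T P \<and> p\<^sub>1 \<odot> h = a \<and> p\<^sub>2 \<odot> h = b)))"


section \<open>Vector fields and tangent maps\<close>

text \<open>
  For \<open>\<phi> : M \<rightarrow> N\<close>, the maps \<open>M \<rightarrow> T[k]N\<close> over \<open>\<phi>\<close> are the derivations of degree \<open>k\<close> along \<open>\<phi>\<close>, that
  is from the sheaf of \<open>N\<close> to that of \<open>M\<close> via the pullback by \<open>\<phi>\<close>.  The same normalisation as for
  pullbacks makes equality of derivations equality in the logic.
\<close>

definition derivations_along :: "('p, 'a::real_vector, 'q, 'b::real_vector) graded_map \<Rightarrow> int \<Rightarrow>
    ('q set \<Rightarrow> 'b \<Rightarrow> 'a) set" where
  "derivations_along \<phi> k = {D. let M = mdom \<phi>; N = mcod \<phi> in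
     (\<forall>V f. \<not> (openin (base N) V \<and> f \<in> homogeneous N V) \<longrightarrow> D V f = 0) \<and>
     (\<forall>V. openin (base N) V \<longrightarrow>
        (\<forall>j. D V ` gsec N V j \<subseteq> gsec M (preim \<phi> V) (j + k) \<and> linear_map_on (gsec N V j) (D V)) \<and>
        (\<forall>j. \<forall>f\<in>gsec N V j. \<forall>g\<in>homogeneous N V.
           D V (gmult N V f g) = gmult M (preim \<phi> V) (D V f) (pull \<phi> V g)
             + ((-1) powi (k * j)) *\<^sub>R gmult M (preim \<phi> V) (pull \<phi> V f) (D V g)) \<and>
        (\<forall>W. openin (base N) W \<and> W \<subseteq> V \<longrightarrow> (\<forall>f\<in>homogeneous N V.
           D W (gres N V W f) = gres M (preim \<phi> V) (preim \<phi> W) (D V f))))}"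

definition vector_fields :: "('p, 'a::real_vector) graded_space \<Rightarrow> int \<Rightarrow>
    ('p set \<Rightarrow> 'a \<Rightarrow> 'a) set" where
  "vector_fields M k = derivations_along (id_mor M) k"

text \<open>\<open>tangent \<psi> D\<close> is \<open>T[k]\<psi> \<circ> D : M \<rightarrow> T[k]L\<close> for \<open>D : M \<rightarrow> T[k]N\<close> and \<open>\<psi> : N \<rightarrow> L\<close>.\<close>

definition tangent :: "('q, 'b, 'r, 'c) graded_map \<Rightarrow> ('q set \<Rightarrow> 'b \<Rightarrow> 'a) \<Rightarrow>
    ('r set \<Rightarrow> 'c \<Rightarrow> 'a)" where
  "tangent \<psi> D = (\<lambda>V f. D (preim \<psi> V) (pull \<psi> V f))"

text \<open>\<open>precomp \<phi> D \<kappa>\<close> is \<open>D \<circ> \<kappa> : K \<rightarrow> T[k]N\<close> for \<open>D : M \<rightarrow> T[k]N\<close> over \<open>\<phi> : M \<rightarrow> N\<close> and \<open>\<kappa> : K \<rightarrow> M\<close>.\<close>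

definition precomp :: "('p, 'a, 'q, 'b) graded_map \<Rightarrow> ('q set \<Rightarrow> 'b \<Rightarrow> 'a) \<Rightarrow>
    ('s, 'd, 'p, 'a) graded_map \<Rightarrow> ('q set \<Rightarrow> 'b \<Rightarrow> 'd)" where
  "precomp \<phi> D \<kappa> = (\<lambda>V f. pull \<kappa> (preim \<phi> V) (D V f))"

text \<open>The commutator of vector fields of degrees \<open>k\<close> and \<open>l\<close>.\<close>

definition commutator :: "int \<Rightarrow> int \<Rightarrow> ('p set \<Rightarrow> 'a::real_vector \<Rightarrow> 'a) \<Rightarrow> ('p set \<Rightarrow> 'a \<Rightarrow> 'a) \<Rightarrow>
    ('p set \<Rightarrow> 'a \<Rightarrow> 'a)" where
  "commutator k l X Y = (\<lambda>V f. X V (Y V f) - ((-1) powi (k * l)) *\<^sub>R Y V (X V f))"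

text \<open>
  A submersion is a morphism whose tangent map \<open>T\<^sub>xM \<rightarrow> T\<^bsub>\<phi>(x)\<^esub>N\<close> is surjective, in all degrees, at
  every point.  A point is a morphism from the one-point manifold, and tangent vectors
  at it are the derivations along this morphism.
\<close>

definition one_point :: univ_space where
  "one_point = graded_domain 0 [] (topspace (Euclidean_space 0))"

definition submersion :: "('p, 'a::real_vector, 'q, 'b::real_vector) graded_map \<Rightarrow> bool" where
  "submersion \<phi> \<longleftrightarrow> (\<forall>x\<in>mors one_point (mdom \<phi>). \<forall>k.
     derivations_along (\<phi> \<odot> x) k \<subseteq> tangent \<phi> ` derivations_along x k)"


section \<open>Graded Lie groupoids\<close>

text \<open>\<open>pairs\<close> with its projections \<open>pr\<^sub>1\<close>, \<open>pr\<^sub>2\<close> is the fibre product of composable pairs \<open>(g, h)\<close>, \<open>s(g) = t(h)\<close>.\<close>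

record ('p, 'a, 'q, 'b, 'r, 'c) groupoid_data =
  objects :: "('p, 'a) graded_space"
  arrows :: "('q, 'b) graded_space"
  pairs :: "('r, 'c) graded_space"
  pr\<^sub>1 :: "('r, 'c, 'q, 'b) graded_map"
  pr\<^sub>2 :: "('r, 'c, 'q, 'b) graded_map"
  src :: "('q, 'b, 'p, 'a) graded_map"
  tgt :: "('q, 'b, 'p, 'a) graded_map"
  mul :: "('r, 'c, 'q, 'b) graded_map"
  unt :: "('p, 'a, 'q, 'b) graded_map"
  ivt :: "('q, 'b, 'q, 'b) graded_map"

text \<open>The morphism \<open>(a, b)\<close> into the composable pairs, as a relation.\<close>

definition is_pairing :: "('p, 'a, 'q, 'b, 'r, 'c) groupoid_data \<Rightarrow>
    ('s, 'd::real_vector, 'q, 'b) graded_map \<Rightarrow> ('s, 'd, 'q, 'b) graded_map \<Rightarrow>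
    ('s, 'd, 'r, 'c::real_vector) graded_map \<Rightarrow> bool" where
  "is_pairing \<G> a b h \<longleftrightarrow> h \<in> mors (mdom a) (pairs \<G>) \<and> pr\<^sub>1 \<G> \<odot> h = a \<and> pr\<^sub>2 \<G> \<odot> h = b"

text \<open>
  In the associativity law \<open>E\<close>, with projections \<open>e\<close> to the pair \<open>(g, h)\<close> and \<open>r\<close> to \<open>k\<close>, is the
  manifold of composable triples \<open>(g, h, k)\<close>, and the three pairings are \<open>(h, k)\<close>, \<open>(gh, k)\<close>
  and \<open>(g, hk)\<close>.
\<close>

definition graded_lie_groupoid ::
    "nat \<Rightarrow> ('p, 'a::real_vector, 'q, 'b::real_vector, 'r, 'c::real_vector) groupoid_data \<Rightarrow> bool" where
  "graded_lie_groupoid n \<G> \<longleftrightarrow>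
     (let M = objects \<G>; G = arrows \<G>; P = pairs \<G>; s = src \<G>; t = tgt \<G>; m = mul \<G>;
          u = unt \<G>; i = ivt \<G>; p = pr\<^sub>1 \<G>; q = pr\<^sub>2 \<G>
      in n_manifold n M \<and> n_manifold n G \<and>
         s \<in> mors G M \<and> t \<in> mors G M \<and> u \<in> mors M G \<and> i \<in> mors G G \<and> m \<in> mors P G \<and>
         submersion s \<and> submersion t \<and> is_fibre_product n s t P p q \<and>
         s \<odot> m = s \<odot> q \<and> t \<odot> m = t \<odot> p \<and>
         s \<odot> u = id_mor M \<and> t \<odot> u = id_mor M \<and> s \<odot> i = t \<and> t \<odot> i = s \<and>
         (\<exists>h. is_pairing \<G> (u \<odot> t) (id_mor G) h \<and> m \<odot> h = id_mor G) \<and>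
         (\<exists>h. is_pairing \<G> (id_mor G) (u \<odot> s) h \<and> m \<odot> h = id_mor G) \<and>
         (\<exists>h. is_pairing \<G> (id_mor G) i h \<and> m \<odot> h = u \<odot> t) \<and>
         (\<exists>h. is_pairing \<G> i (id_mor G) h \<and> m \<odot> h = u \<odot> s) \<and>
         (\<exists>(E :: univ_space) e r l x y. is_fibre_product n (s \<odot> q) t E e r \<and>
            is_pairing \<G> (q \<odot> e) r l \<and> is_pairing \<G> (m \<odot> e) r x \<and> is_pairing \<G> (p \<odot> e) (m \<odot> l) y \<and>
            m \<odot> x = m \<odot> y))"


section \<open>Invariant and multiplicative vector fields\<close>

text \<open>
  For \<open>A : K \<rightarrow> T[k]G\<close> over \<open>a\<close> and \<open>B : K \<rightarrow> T[k]G\<close> over \<open>b\<close> such that \<open>(a, b)\<close> and \<open>(A, B)\<close> are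
  composable, this is \<open>(A, B)\<close> as a map from \<open>K\<close> to the composable pairs of \<open>T[k]G\<close>, i.e. to the tangent
  bundle of the manifold of composable pairs.
\<close>

definition tangent_pair :: "('p, 'a, 'q, 'b::real_vector, 'r, 'c::real_vector) groupoid_data \<Rightarrow> int \<Rightarrow>
    ('s, 'd::real_vector, 'q, 'b) graded_map \<Rightarrow> ('q set \<Rightarrow> 'b \<Rightarrow> 'd) \<Rightarrow>
    ('s, 'd, 'q, 'b) graded_map \<Rightarrow> ('q set \<Rightarrow> 'b \<Rightarrow> 'd) \<Rightarrow> ('r set \<Rightarrow> 'c \<Rightarrow> 'd)" where
  "tangent_pair \<G> k a A b B = (THE D. \<exists>h. is_pairing \<G> a b h \<and> D \<in> derivations_along h k \<and>
     tangent (pr\<^sub>1 \<G>) D = A \<and> tangent (pr\<^sub>2 \<G>) D = B)"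

text \<open>\<open>algebroid_sections \<G> j\<close> is \<open>\<Gamma>\<^sup>j A\<close> for \<open>A = u\<^sup>* ker Ts\<close>.\<close>

definition algebroid_sections :: "('p, 'a::real_vector, 'q, 'b::real_vector, 'r, 'c) groupoid_data \<Rightarrow>
    int \<Rightarrow> ('q set \<Rightarrow> 'b \<Rightarrow> 'a) set" where
  "algebroid_sections \<G> j = {a \<in> derivations_along (unt \<G>) j. tangent (src \<G>) a = 0}"

definition right_inv :: "('p, 'a::real_vector, 'q, 'b::real_vector, 'r, 'c::real_vector) groupoid_data
    \<Rightarrow> int \<Rightarrow> ('q set \<Rightarrow> 'b \<Rightarrow> 'a) \<Rightarrow> ('q set \<Rightarrow> 'b \<Rightarrow> 'b)" where
  "right_inv \<G> j a = tangent (mul \<G>)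
     (tangent_pair \<G> j (unt \<G> \<odot> tgt \<G>) (precomp (unt \<G>) a (tgt \<G>)) (id_mor (arrows \<G>)) 0)"

definition left_inv :: "('p, 'a::real_vector, 'q, 'b::real_vector, 'r, 'c::real_vector) groupoid_data
    \<Rightarrow> int \<Rightarrow> ('q set \<Rightarrow> 'b \<Rightarrow> 'a) \<Rightarrow> ('q set \<Rightarrow> 'b \<Rightarrow> 'b)" where
  "left_inv \<G> j a = - tangent (mul \<G>)
     (tangent_pair \<G> j (id_mor (arrows \<G>)) 0 (ivt \<G> \<odot> (unt \<G> \<odot> src \<G>))
        (tangent (ivt \<G>) (precomp (unt \<G>) a (src \<G>))))"

text \<open>
  \<open>(X, X\<^sub>0)\<close> is a morphism from \<open>\<G>\<close> to the groupoid \<open>T[k]\<G>\<close>, whose structure maps are the tangent maps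
  of those of \<open>\<G>\<close>: it is compatible with source, target, units and multiplication.
\<close>

definition multiplicative_fields ::
    "('p, 'a::real_vector, 'q, 'b::real_vector, 'r, 'c::real_vector) groupoid_data \<Rightarrow> int \<Rightarrow>
     ('q set \<Rightarrow> 'b \<Rightarrow> 'b) set" where
  "multiplicative_fields \<G> k = {X \<in> vector_fields (arrows \<G>) k.
     \<exists>X\<^sub>0\<in>vector_fields (objects \<G>) k.
       tangent (src \<G>) X = precomp (id_mor (objects \<G>)) X\<^sub>0 (src \<G>) \<and>
       tangent (tgt \<G>) X = precomp (id_mor (objects \<G>)) X\<^sub>0 (tgt \<G>) \<and>
       tangent (unt \<G>) X\<^sub>0 = precomp (id_mor (arrows \<G>)) X (unt \<G>) \<and>
       tangent (mul \<G>) (tangent_pair \<G> k (pr\<^sub>1 \<G>) (precomp (id_mor (arrows \<G>)) X (pr\<^sub>1 \<G>))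
                                       (pr\<^sub>2 \<G>) (precomp (id_mor (arrows \<G>)) X (pr\<^sub>2 \<G>)))
         = precomp (id_mor (arrows \<G>)) X (mul \<G>)}"


section \<open>The differential graded Lie algebra of a graded Lie groupoid\<close>

text \<open>A pair \<open>(a, X)\<close> stands for \<open>a + X\<close>.\<close>

type_synonym ('a, 'q, 'b) L_element = "('q set \<Rightarrow> 'b \<Rightarrow> 'a) \<times> ('q set \<Rightarrow> 'b \<Rightarrow> 'b)"

definition L_space :: "('p, 'a::real_vector, 'q, 'b::real_vector, 'r, 'c::real_vector) groupoid_data \<Rightarrow>
    int \<Rightarrow> ('a, 'q, 'b) L_element set" where
  "L_space \<G> i = algebroid_sections \<G> (i + 1) \<times> multiplicative_fields \<G> i"

definition L_diff :: "('p, 'a::real_vector, 'q, 'b::real_vector, 'r, 'c::real_vector) groupoid_data \<Rightarrow>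
    int \<Rightarrow> ('a, 'q, 'b) L_element \<Rightarrow> ('a, 'q, 'b) L_element" where
  "L_diff \<G> i = (\<lambda>(a, X). (0, right_inv \<G> (i + 1) a - left_inv \<G> (i + 1) a))"

text \<open>\<open>[X, a]\<close> for \<open>X\<close> of degree \<open>i\<close> and \<open>a \<in> \<Gamma>\<^bsup>j + 1\<^esup> A\<close>, which has degree \<open>j\<close> in \<open>L\<close>.\<close>

definition L_action :: "('p, 'a::real_vector, 'q, 'b::real_vector, 'r, 'c::real_vector) groupoid_data \<Rightarrow>
    int \<Rightarrow> int \<Rightarrow> ('q set \<Rightarrow> 'b \<Rightarrow> 'b) \<Rightarrow> ('q set \<Rightarrow> 'b \<Rightarrow> 'a) \<Rightarrow> ('q set \<Rightarrow> 'b \<Rightarrow> 'a)" where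
  "L_action \<G> i j X a = ((-1) powi i) *\<^sub>R
     precomp (id_mor (arrows \<G>)) (commutator i (j + 1) X (right_inv \<G> (j + 1) a)) (unt \<G>)"

text \<open>The bracket of elements of degrees \<open>i\<close> and \<open>j\<close>; \<open>[a, Y] = - (-1)\<^bsup>i j\<^esup> [Y, a]\<close> and \<open>[a, b] = 0\<close>.\<close>

definition L_bracket :: "('p, 'a::real_vector, 'q, 'b::real_vector, 'r, 'c::real_vector) groupoid_data \<Rightarrow>
    int \<Rightarrow> int \<Rightarrow> ('a, 'q, 'b) L_element \<Rightarrow> ('a, 'q, 'b) L_element \<Rightarrow> ('a, 'q, 'b) L_element" where
  "L_bracket \<G> i j = (\<lambda>(a, X) (b, Y).
     (L_action \<G> i j X b - ((-1) powi (i * j)) *\<^sub>R L_action \<G> j i Y a, commutator i j X Y))"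

definition maurer_cartan :: "(int \<Rightarrow> 'l::real_vector set) \<Rightarrow> (int \<Rightarrow> 'l \<Rightarrow> 'l) \<Rightarrow>
    (int \<Rightarrow> int \<Rightarrow> 'l \<Rightarrow> 'l \<Rightarrow> 'l) \<Rightarrow> 'l set" where
  "maurer_cartan L d br = {Y \<in> L 1. d 1 Y + (1/2) *\<^sub>R br 1 1 Y Y = 0}"


section \<open>Quasi \<open>Q\<close>-groupoids\<close>

definition quasi_Q_structures ::
    "('p, 'a::real_vector, 'q, 'b::real_vector, 'r, 'c::real_vector) groupoid_data \<Rightarrow>
     (('q set \<Rightarrow> 'b \<Rightarrow> 'b) \<times> ('q set \<Rightarrow> 'b \<Rightarrow> 'a)) set" where
  "quasi_Q_structures \<G> = {(Q, q). Q \<in> multiplicative_fields \<G> 1 \<and> q \<in> algebroid_sections \<G> 2 \<and>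
     (\<lambda>V f. Q V (Q V f)) = left_inv \<G> 2 q - right_inv \<G> 2 q \<and>
     commutator 1 2 Q (right_inv \<G> 2 q) = 0}"

end

(*
Passing from a Maurer-Cartan element to a quasi Q-groupoid, the only issue is that the section [Q, q^r] o u determines
the field [Q, q^r]. The multiplicative field Q lifts to the field (Q, Q) on the manifold of composable pairs, and q^r to
the field (q^r, 0), which is related to q^r along the multiplication because of associativity. So the commutator of the
two lifts is related to [Q, q^r] along the multiplication and the first projection, and to 0 along the second one.
Restricted to the pairs (1, g) both its components vanish if [Q, q^r] o u = 0; hence so does its image [Q, q^r].

The argument needs that the tangent bundle of a fibre product along a submersion is the fibre product of the tangent
bundles. Locally, the product of two charts retracts onto the subspace cut out by the equations of the fibre product:
the retraction eliminates one coordinate at a time, by the implicit function theorem in degree 0 and by a linear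
substitution in positive degrees. The universal property maps the domain of the retraction to the fibre product.
*)

theory Submission imports Defs begin

text \<open>The universal property of a fibre product tests morphisms out of n-manifolds. A
  derivation of degree \<open>k\<close> along a morphism amounts to a morphism out of a space
  thickened by dual numbers, in general no n-manifold, so the universal property says nothing about
  derivations directly. This is what the retraction \<open>\<rho>\<close> is for. It maps a whole
  open set \<open>W1\<close> into the zero set of the equations, hence induces a morphism
  \<open>c\<close> from the graded domain over \<open>W1\<close> to the fibre product; and a
  derivation along a map into the zero set that also satisfies the linearized equations is its own
  image under \<open>\<rho>\<close>. The image of such a derivation under \<open>c\<close> is the
  required derivation into the fibre product. Uniqueness holds because a chart of the fibre product
  factors through \<open>c\<close>. In degree one the two components of the Maurer-Cartan equation
  separate: the section component is minus the restriction of \<open>[Q, q^r]\<close> along the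
  units, and the field component says that \<open>Q^2 = q^l - q^r\<close>.\<close>

abbreviation eopen :: "nat => (nat => real) set => bool" where "eopen m \<equiv> openin (Euclidean_space m)"

abbreviation gopen :: "('p, 'a) graded_space => 'p set => bool" where "gopen M \<equiv> openin (base M)"

abbreviation (input) gdom :: "nat => nat list => (nat => real) set => univ_space" where "gdom \<equiv> graded_domain"

abbreviation (input) ders :: "('p, 'a::real_vector, 'q, 'b::real_vector) graded_map => int => ('q set => 'b => 'a) set"
 where "ders \<equiv> derivations_along"

section \<open>Calculus on open subsets of Euclidean space\<close>

lemma Euclidean_space_top_of_set: "Euclidean_space m = top_of_set {x. \<forall>i\<ge>m. x i = 0}"
 by (simp add: Euclidean_space_def euclidean_product_topology)

text \<open>The coordinates from \<open>m\<close> on are held fixed, so only the first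
  \<open>m\<close> factors of a basic open box matter, and the radius is a minimum over finitely
  many coordinates, taken by induction on \<open>m\<close>.\<close>

lemma open_fun_contains_box:
 fixes T :: "(nat => real) set"
 assumes "open T" "x \<in> T"
 shows "\<exists>\<delta>>0. \<forall>y. (\<forall>i<m. \<bar>y i - x i\<bar> < \<delta>) \<and> (\<forall>i\<ge>m. y i = x i) --> y \<in> T"
proof -
 have "openin (product_topology (\<lambda>i::nat. euclidean::real topology) UNIV) T"
  using assms(1) by (simp add: euclidean_product_topology)
 from product_topology_open_contains_basis[OF this assms(2)]
 obtain X where X: "x \<in> (\<Pi>\<^sub>E i\<in>UNIV. X i)" "\<And>i. open (X i)" "(\<Pi>\<^sub>E i\<in>UNIV. X i) \<subseteq> T"
  by auto
 have "\<exists>\<delta>>0. \<forall>i<m. \<forall>z. \<bar>z - x i\<bar> < \<delta> --> z \<in> X i"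
 proof (induction m)
  case 0
  then show ?case by (intro exI[of _ 1]) auto
 next
  case (Suc m)
  then obtain d where d: "d > 0" "\<forall>i<m. \<forall>z. \<bar>z - x i\<bar> < d --> z \<in> X i" by auto
  have "x m \<in> X m" using X(1) by auto
  then obtain e where e: "e > 0" "\<And>z. \<bar>z - x m\<bar> < e ==> z \<in> X m"
   using X(2)[of m] by (metis open_dist dist_real_def)
  show ?case
   using d e by (intro exI[of _ "min d e"]) (auto simp: less_Suc_eq)
 qed
 then obtain \<delta> where \<delta>: "\<delta> > 0" "\<forall>i<m. \<forall>z. \<bar>z - x i\<bar> < \<delta> --> z \<in> X i" by auto
 have "y \<in> T" if "\<forall>i<m. \<bar>y i - x i\<bar> < \<delta>" "\<forall>i\<ge>m. y i = x i" for y
 proof -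
  have "y i \<in> X i" for i
   using that \<delta>(2) X(1) by (cases "i < m") (auto simp: PiE_iff)
  then show ?thesis using X(3) by (auto simp: PiE_iff subset_iff)
 qed
 with \<delta>(1) show ?thesis by blast
qed

text \<open>Cubes are used instead of balls: replacing single coordinates within the range and
  shrinking towards the centre both stay inside, and no interplay between coordinates has to be
  estimated.\<close>

definition cube :: "nat => (nat => real) => real => (nat => real) set" where
 "cube m x \<delta> = {y. (\<forall>i<m. \<bar>y i - x i\<bar> < \<delta>) \<and> (\<forall>i\<ge>m. y i = 0)}"

lemma openin_cube: "eopen m (cube m x \<delta>)"
proof -
 have "open (\<Inter>i<m. (\<lambda>y::nat=>real. y i) -` ball (x i) \<delta>)"
  by (intro open_INT ballI open_vimage finite_lessThan open_ball continuous_on_product_coordinates)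
 moreover have "cube m x \<delta> = {x. \<forall>i\<ge>m. x i = 0} \<inter> (\<Inter>i<m. (\<lambda>y::nat=>real. y i) -` ball (x i) \<delta>)"
  by (auto simp: cube_def dist_real_def abs_minus_commute)
 ultimately show ?thesis
  unfolding Euclidean_space_top_of_set openin_open by blast
qed

lemma openin_Euclidean_space_support:
 assumes "eopen m U" "x \<in> U" "m \<le> i"
 shows "x i = 0"
 using openin_subset[OF assms(1)] assms(2,3) by (auto simp: topspace_Euclidean_space)

lemma openin_Euclidean_space_cubeE:
 assumes "eopen m U" "x \<in> U"
 obtains \<delta> where "\<delta> > 0" "cube m x \<delta> \<subseteq> U"
proof -
 obtain T where T: "open T" "U = {x. \<forall>i\<ge>m. x i = 0} \<inter> T"
  using assms(1) unfolding Euclidean_space_top_of_set openin_open by blast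
 then have "x \<in> T" "\<forall>i\<ge>m. x i = 0" using assms(2) by auto
 with open_fun_contains_box[OF T(1), of x m] obtain \<delta> where
  \<delta>: "\<delta> > 0" "\<forall>y. (\<forall>i<m. \<bar>y i - x i\<bar> < \<delta>) \<and> (\<forall>i\<ge>m. y i = x i) --> y \<in> T" by auto
 have "cube m x \<delta> \<subseteq> U"
  unfolding T(2) cube_def using \<delta>(2) \<open>\<forall>i\<ge>m. x i = 0\<close> by auto
 with \<delta>(1) show ?thesis by (rule that)
qed

lemma centre_in_cube:
 assumes "eopen m U" "x \<in> U" "\<delta> > 0"
 shows "x \<in> cube m x \<delta>"
 using assms openin_Euclidean_space_support by (auto simp: cube_def)

lemma continuous_on_cube:
 assumes U: "eopen m U" and f: "continuous_on U f" and x: "x \<in> U" and e: "0 < (e::real)"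
 obtains \<delta> where "\<delta> > 0" "cube m x \<delta> \<subseteq> U" "\<forall>y\<in>cube m x \<delta>. \<bar>f y - f x\<bar> < e"
proof -
 have "openin (top_of_set U) (U \<inter> f -` ball (f x) e)"
  using f by (rule continuous_openin_preimage_gen) auto
 then have "eopen m (U \<inter> f -` ball (f x) e)"
  using U unfolding Euclidean_space_top_of_set by (rule openin_trans)
 moreover have "x \<in> U \<inter> f -` ball (f x) e" using x e by auto
 ultimately obtain \<delta> where \<delta>: "\<delta> > 0" "cube m x \<delta> \<subseteq> U \<inter> f -` ball (f x) e"
  by (rule openin_Euclidean_space_cubeE)
 show ?thesis by (rule that[OF \<delta>(1)]) (use \<delta>(2) in "auto simp: dist_real_def abs_minus_commute")
qed

lemma openin_Euclidean_space_fun_upd: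
 assumes "eopen m U" "x \<in> U" "i < m"
 shows "\<forall>\<^sub>F y in nhds (x i). x(i := y) \<in> U"
proof -
 obtain \<delta> where \<delta>: "\<delta> > 0" "cube m x \<delta> \<subseteq> U"
  using openin_Euclidean_space_cubeE[OF assms(1,2)] .
 have "x(i := y) \<in> U" if "dist y (x i) < \<delta>" for y
  using that \<delta> assms openin_Euclidean_space_support[OF assms(1,2)]
  by (intro subsetD[OF \<delta>(2)]) (auto simp: dist_real_def cube_def)
 with \<delta>(1) show ?thesis unfolding eventually_nhds_metric by blast
qed

section \<open>Continuity, partial derivatives and the classes \<open>C_diff\<close>\<close>

lemma continuous_map_Euclidean_subspace:
 assumes "U \<subseteq> topspace (Euclidean_space m)"
 shows "continuous_map (subtopology (Euclidean_space m) U) euclideanreal f \<longleftrightarrow> continuous_on U f"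
proof -
 have "subtopology (Euclidean_space m) U = top_of_set U"
  using assms unfolding Euclidean_space_top_of_set subtopology_subtopology
  by (simp add: Int_absorb1)
 then show ?thesis by simp
qed

text \<open>\<open>C_diff\<close> only asserts that partial derivatives exist. A total operator,
  meaningful where the derivative exists, allows formulas to be written for them.\<close>

definition pd :: "nat => ((nat => real) => real) => (nat => real) => real" where
 "pd i f x = deriv (\<lambda>y. f (x(i := y))) (x i)"

lemma pd_eqI: "((\<lambda>y. f (x(i := y))) has_real_derivative d) (at (x i)) ==> pd i f x = d"
 unfolding pd_def by (rule DERIV_imp_deriv)

text \<open>Only values near \<open>x\<close> on the line in direction \<open>i\<close> enter, and
  these points lie in the open set \<open>U\<close>.\<close>

lemma has_partial_derivative_cong:
 assumes "eopen m U" "x \<in> U" "i < m" "\<And>x. x \<in> U ==> f x = g x"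
  "((\<lambda>y. f (x(i := y))) has_real_derivative d) (at (x i))"
 shows "((\<lambda>y. g (x(i := y))) has_real_derivative d) (at (x i))"
proof -
 have ev: "\<forall>\<^sub>F y in nhds (x i). f (x(i := y)) = g (x(i := y))"
  using openin_Euclidean_space_fun_upd[OF assms(1-3)] by eventually_elim (use assms(4) in auto)
 show ?thesis using DERIV_cong_ev[OF refl ev refl] assms(5) by blast
qed

lemma C_diff_Suc_iff:
 assumes "eopen m U"
 shows "C_diff m (Suc r) U f \<longleftrightarrow> continuous_on U f \<and>
   (\<forall>i<m. \<exists>g. (\<forall>x\<in>U. ((\<lambda>y. f (x(i := y))) has_real_derivative g x) (at (x i))) \<and> C_diff m r U g)"
 using continuous_map_Euclidean_subspace[OF openin_subset[OF assms]] by simp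

lemma C_diff_0_iff:
 assumes "eopen m U"
 shows "C_diff m 0 U f \<longleftrightarrow> continuous_on U f"
 using continuous_map_Euclidean_subspace[OF openin_subset[OF assms]] by simp

lemma C_diff_continuous_on:
 assumes "eopen m U" "C_diff m r U f"
 shows "continuous_on U f"
 using assms C_diff_0_iff C_diff_Suc_iff by (cases r) auto

lemma C_diff_cong:
 assumes "eopen m U" "\<And>x. x \<in> U ==> f x = g x" "C_diff m r U f"
 shows "C_diff m r U g"
proof (cases r)
 case 0
 then show ?thesis using assms continuous_on_cong[of U U f g] by (auto simp: C_diff_0_iff simp del: C_diff.simps)
next
 case (Suc r')
 have c: "continuous_on U f \<longleftrightarrow> continuous_on U g" using assms by (intro continuous_on_cong) auto
 show ?thesis
  unfolding Suc C_diff_Suc_iff[OF assms(1)]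
 proof (intro conjI allI impI)
  show "continuous_on U g" using assms c C_diff_continuous_on by blast
  fix i assume "i < m"
  with assms(3)[unfolded Suc C_diff_Suc_iff[OF assms(1)]] obtain h where
   "\<forall>x\<in>U. ((\<lambda>y. f (x(i := y))) has_real_derivative h x) (at (x i))" "C_diff m r' U h" by blast
  then show "\<exists>h. (\<forall>x\<in>U. ((\<lambda>y. g (x(i := y))) has_real_derivative h x) (at (x i))) \<and> C_diff m r' U h"
   using has_partial_derivative_cong[OF assms(1) _ \<open>i < m\<close>, of _ f g] assms(2) by (intro exI[of _ h]) blast
 qed
qed

text \<open>Partial derivatives are unique, so the existential witness in \<open>C_diff\<close> may
  be replaced by the fixed operator \<open>pd\<close>. This is the form in which most inductions on
  the order run.\<close>

lemma C_diff_Suc_pd: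
 assumes "eopen m U"
 shows "C_diff m (Suc r) U f \<longleftrightarrow> continuous_on U f \<and>
   (\<forall>i<m. (\<forall>x\<in>U. ((\<lambda>y. f (x(i := y))) has_real_derivative pd i f x) (at (x i))) \<and> C_diff m r U (pd i f))"
 unfolding C_diff_Suc_iff[OF assms]
proof (intro conj_cong refl all_cong1 imp_cong iffI)
 fix i assume "i < m" and "\<exists>g. (\<forall>x\<in>U. ((\<lambda>y. f (x(i := y))) has_real_derivative g x) (at (x i))) \<and> C_diff m r U g"
 then obtain g where g: "\<forall>x\<in>U. ((\<lambda>y. f (x(i := y))) has_real_derivative g x) (at (x i))" "C_diff m r U g" by blast
 then have "pd i f x = g x" if "x \<in> U" for x using that pd_eqI by blast
 then show "(\<forall>x\<in>U. ((\<lambda>y. f (x(i := y))) has_real_derivative pd i f x) (at (x i))) \<and> C_diff m r U (pd i f)"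
  using g C_diff_cong[OF assms, of g "pd i f"] by auto
qed blast

lemma C_diff_Suc_lower: "eopen m U ==> C_diff m (Suc r) U f ==> C_diff m r U f"
proof (induction r arbitrary: f)
 case 0
 then show ?case by (simp only: C_diff_0_iff C_diff_Suc_pd)
next
 case (Suc r)
 then show ?case using C_diff_Suc_pd[OF Suc.prems(1), of "Suc r" f] C_diff_Suc_pd[OF Suc.prems(1), of r f] by blast
qed

lemma C_diff_subset:
 assumes "eopen m U" "eopen m V" "V \<subseteq> U"
 shows "C_diff m r U f ==> C_diff m r V f"
proof (induction r arbitrary: f)
 case 0
 then show ?case using assms continuous_on_subset by (simp only: C_diff_0_iff) blast
next
 case (Suc r)
 then show ?case using assms continuous_on_subset[of U f V] by (simp only: C_diff_Suc_pd) blast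
qed

text \<open>With \<open>pd\<close> as a fixed operator no local witnesses have to be patched
  together: existence of the derivatives is pointwise, and continuity is checked through openness of
  preimages.\<close>

lemma C_diff_local:
 assumes "eopen m U"
  "\<And>x. x \<in> U ==> \<exists>V. eopen m V \<and> x \<in> V \<and> V \<subseteq> U \<and> C_diff m r V f"
 shows "C_diff m r U f"
proof -
 have cont: "continuous_on U f" if *: "\<And>x. x \<in> U ==> \<exists>V. eopen m V \<and> x \<in> V \<and> V \<subseteq> U \<and> continuous_on V f" for f :: "(nat => real) => real"
  unfolding continuous_openin_preimage_eq
 proof (intro allI impI)
  fix T :: "real set" assume T: "open T"
  show "openin (top_of_set U) (U \<inter> f -` T)"
  proof (subst openin_subopen, intro ballI)
   fix x assume "x \<in> U \<inter> f -` T"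
   then obtain V where V: "eopen m V" "x \<in> V" "V \<subseteq> U" "continuous_on V f" using * by blast
   have "openin (top_of_set U) V"
    using V(1,3) openin_subset[OF assms(1)] unfolding Euclidean_space_top_of_set
    by (intro openin_subset_trans[of _ V U]) (auto dest: openin_subset)
   then have "openin (top_of_set U) (V \<inter> f -` T)"
    using V(4) T unfolding continuous_openin_preimage_eq by (blast intro: openin_trans)
   with V show "\<exists>W. openin (top_of_set U) W \<and> x \<in> W \<and> W \<subseteq> U \<inter> f -` T"
    using \<open>x \<in> U \<inter> f -` T\<close> by blast
  qed
 qed
 have cont': "continuous_on U f"
  if *: "\<And>x. x \<in> U ==> \<exists>V. eopen m V \<and> x \<in> V \<and> V \<subseteq> U \<and> C_diff m r V f" for f r
 proof (rule cont)
  fix x assume "x \<in> U"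
  from *[OF this] obtain V where "eopen m V" "x \<in> V" "V \<subseteq> U" "C_diff m r V f" by auto
  then show "\<exists>V. eopen m V \<and> x \<in> V \<and> V \<subseteq> U \<and> continuous_on V f"
   using C_diff_continuous_on[of m V r f] by auto
 qed
 show ?thesis using assms(2)
 proof (induction r arbitrary: f)
  case 0
  show ?case unfolding C_diff_0_iff[OF assms(1)] by (rule cont'[OF 0])
 next
  case (Suc r)
  show ?case unfolding C_diff_Suc_pd[OF assms(1)]
  proof (intro conjI allI impI ballI)
   show "continuous_on U f" by (rule cont'[OF Suc.prems])
  next
   fix i x assume i: "i < m" and "x \<in> U"
   from Suc.prems[OF this(2)] obtain V where V: "eopen m V" "x \<in> V" "V \<subseteq> U" "C_diff m (Suc r) V f" by auto
   then show "((\<lambda>y. f (x(i := y))) has_real_derivative pd i f x) (at (x i))"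
    using C_diff_Suc_pd[OF V(1), of r f] i by auto
  next
   fix i assume i: "i < m"
   show "C_diff m r U (pd i f)"
   proof (rule Suc.IH)
    fix x assume "x \<in> U"
    from Suc.prems[OF this] obtain V where V: "eopen m V" "x \<in> V" "V \<subseteq> U" "C_diff m (Suc r) V f" by auto
    then show "\<exists>V. eopen m V \<and> x \<in> V \<and> V \<subseteq> U \<and> C_diff m r V (pd i f)"
     using C_diff_Suc_pd[OF V(1), of r f] i by auto
   qed
  qed
 qed
qed

lemma C_diff_const [simp]: "eopen m U ==> C_diff m r U (\<lambda>x. c)"
proof (induction r arbitrary: c)
 case 0 then show ?case by (simp only: C_diff_0_iff continuous_on_const)
next
 case (Suc r)
 show ?case unfolding C_diff_Suc_iff[OF Suc.prems]
  using Suc by (auto intro!: exI[of _ "\<lambda>_. 0"] simp del: C_diff.simps)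
qed

lemma C_diff_coordinate: "eopen m U ==> C_diff m r U (\<lambda>x. x i)"
proof (cases r)
 case 0
 assume "eopen m U"
 then show ?thesis unfolding 0 by (simp add: C_diff_0_iff continuous_on_product_coordinates[THEN continuous_on_subset] del: C_diff.simps)
next
 case (Suc r')
 assume U: "eopen m U"
 show ?thesis unfolding Suc C_diff_Suc_iff[OF U]
 proof (intro conjI allI impI)
  show "continuous_on U (\<lambda>x. x i)" by (rule continuous_on_subset[OF continuous_on_product_coordinates]) simp
  fix j assume "j < m"
  show "\<exists>g. (\<forall>x\<in>U. ((\<lambda>y. (x(j := y)) i) has_real_derivative g x) (at (x j))) \<and> C_diff m r' U g"
   by (rule exI[of _ "\<lambda>x. if i = j then 1 else 0"]) (auto simp: U simp del: C_diff.simps)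
 qed
qed

lemma C_diff_add:
 "eopen m U ==> C_diff m r U f ==> C_diff m r U g ==> C_diff m r U (\<lambda>x. f x + g x)"
proof (induction r arbitrary: f g)
 case 0 then show ?case by (simp only: C_diff_0_iff) (rule continuous_on_add)
next
 case (Suc r)
 note f = Suc.prems(2)[unfolded C_diff_Suc_pd[OF Suc.prems(1)]]
 note g = Suc.prems(3)[unfolded C_diff_Suc_pd[OF Suc.prems(1)]]
 show ?case unfolding C_diff_Suc_iff[OF Suc.prems(1)]
 proof (intro conjI allI impI)
  show "continuous_on U (\<lambda>x. f x + g x)" using f g by (intro continuous_on_add) auto
  fix i assume "i < m"
  then show "\<exists>h. (\<forall>x\<in>U. ((\<lambda>y. f (x(i := y)) + g (x(i := y))) has_real_derivative h x) (at (x i))) \<and> C_diff m r U h"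
   using f g Suc.IH[OF Suc.prems(1), of "pd i f" "pd i g"]
   by (intro exI[of _ "\<lambda>x. pd i f x + pd i g x"]) (auto intro!: DERIV_add simp del: C_diff.simps)
 qed
qed

lemma C_diff_mult:
 "eopen m U ==> C_diff m r U f ==> C_diff m r U g ==> C_diff m r U (\<lambda>x. f x * g x)"
proof (induction r arbitrary: f g)
 case 0 then show ?case by (simp only: C_diff_0_iff) (rule continuous_on_mult)
next
 case (Suc r)
 note f = Suc.prems(2)[unfolded C_diff_Suc_pd[OF Suc.prems(1)]]
 note g = Suc.prems(3)[unfolded C_diff_Suc_pd[OF Suc.prems(1)]]
 note fg' = Suc.prems(2,3)[THEN C_diff_Suc_lower[OF Suc.prems(1)]]
 show ?case unfolding C_diff_Suc_iff[OF Suc.prems(1)]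
 proof (intro conjI allI impI)
  show "continuous_on U (\<lambda>x. f x * g x)" using f g by (intro continuous_on_mult) auto
  fix i assume i: "i < m"
  have "((\<lambda>y. f (x(i := y)) * g (x(i := y))) has_real_derivative pd i f x * g x + pd i g x * f x) (at (x i))" if "x \<in> U" for x
   using DERIV_mult[of "\<lambda>y. f (x(i := y))" "pd i f x" "x i" UNIV "\<lambda>y. g (x(i := y))" "pd i g x"] f g i that
   by simp
  then show "\<exists>h. (\<forall>x\<in>U. ((\<lambda>y. f (x(i := y)) * g (x(i := y))) has_real_derivative h x) (at (x i))) \<and> C_diff m r U h"
   using f g i fg' Suc.prems(1)
   by (intro exI[of _ "\<lambda>x. pd i f x * g x + pd i g x * f x"]) (auto intro!: C_diff_add Suc.IH simp del: C_diff.simps)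
 qed
qed

lemma C_diff_sum:
 "eopen m U ==> (\<And>a. a \<in> A ==> C_diff m r U (f a)) ==> C_diff m r U (\<lambda>x. \<Sum>a\<in>A. f a x)"
 by (induction A rule: infinite_finite_induct) (auto intro!: C_diff_add simp del: C_diff.simps)

lemma C_diff_minus: "eopen m U ==> C_diff m r U f ==> C_diff m r U (\<lambda>x. - f x)"
 using C_diff_mult[of m U r "\<lambda>_. -1" f] by simp

lemma C_diff_inverse:
 "eopen m U ==> C_diff m r U f ==> (\<And>x. x \<in> U ==> f x \<noteq> 0) ==> C_diff m r U (\<lambda>x. inverse (f x))"
proof (induction r)
 case 0 then show ?case by (simp only: C_diff_0_iff) (rule continuous_on_inverse, auto)
next
 case (Suc r)
 note f = Suc.prems(2)[unfolded C_diff_Suc_pd[OF Suc.prems(1)]]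
 note IH = Suc.IH[OF Suc.prems(1) C_diff_Suc_lower[OF Suc.prems(1,2)] Suc.prems(3)]
 show ?case unfolding C_diff_Suc_iff[OF Suc.prems(1)]
 proof (intro conjI allI impI)
  show "continuous_on U (\<lambda>x. inverse (f x))" using f Suc.prems by (intro continuous_on_inverse) auto
  fix i assume i: "i < m"
  have "((\<lambda>y. inverse (f (x(i := y)))) has_real_derivative - (inverse (f x) * pd i f x * inverse (f x))) (at (x i))" if "x \<in> U" for x
   using DERIV_inverse'[of "\<lambda>y. f (x(i := y))" "pd i f x" "x i" UNIV] f i that Suc.prems(3)[OF that]
   by simp
  then show "\<exists>h. (\<forall>x\<in>U. ((\<lambda>y. inverse (f (x(i := y)))) has_real_derivative h x) (at (x i))) \<and> C_diff m r U h"
   using f i IH Suc.prems(1)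
   by (intro exI[of _ "\<lambda>x. - (inverse (f x) * pd i f x * inverse (f x))"]) (auto intro!: C_diff_minus C_diff_mult simp del: C_diff.simps)
 qed
qed

text \<open>The increment of \<open>f\<close> is telescoped over the coordinates, one of which changes at a time.\<close>

lemma has_derivative_along_curve:
 fixes \<gamma> :: "real => nat => real"
 assumes V: "eopen k V" and f: "C_diff k 1 V f"
  and \<gamma>: "\<gamma> s0 \<in> V" "\<And>s i. i \<ge> k ==> \<gamma> s i = 0"
  and d: "\<And>i. i < k ==> ((\<lambda>s. \<gamma> s i) has_real_derivative \<gamma>' i) (at s0)"
 shows "((\<lambda>s. f (\<gamma> s)) has_real_derivative (\<Sum>i<k. pd i f (\<gamma> s0) * \<gamma>' i)) (at s0)"
proof -
 define q where "q = \<gamma> s0"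
 have q: "q \<in> V" using \<gamma> q_def by simp
 have q0: "q i = 0" if "i \<ge> k" for i using openin_Euclidean_space_support[OF V q that] .
 have near: "\<forall>\<^sub>F s in nhds s0. \<forall>i<n. \<bar>\<gamma> s i - q i\<bar> < e" if "e > 0" "n \<le> k" for e n
  using that(2)
 proof (induction n)
  case (Suc n)
  have "isCont (\<lambda>s. \<gamma> s n) s0" using d[of n] Suc.prems DERIV_isCont by auto
  then have "\<forall>\<^sub>F s in nhds s0. \<bar>\<gamma> s n - q n\<bar> < e"
   using that(1) unfolding q_def isCont_def tendsto_iff dist_real_def eventually_at_filter
   by (auto elim!: eventually_mono simp: \<open>e>0\<close> dest!: spec[of _ e])
  with Suc.IH Suc.prems have "\<forall>\<^sub>F s in nhds s0. (\<forall>i<n. \<bar>\<gamma> s i - q i\<bar> < e) \<and> \<bar>\<gamma> s n - q n\<bar> < e"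
   by (simp add: eventually_conj)
  then show ?case by (rule eventually_mono) (auto simp: less_Suc_eq)
 qed simp
 \<comment> \<open>The first \<open>n\<close> coordinates have already moved along the curve, the
   others still rest at \<open>q\<close>; passing from \<open>z n\<close> to
   \<open>z (Suc n)\<close> changes the coordinate \<open>n\<close> only.\<close>
 define z where "z n s = (\<lambda>i. if i < n then \<gamma> s i else q i)" for n :: nat and s
 have z_supp: "z n s i = 0" if "i \<ge> k" for n s i
  using that \<gamma> by (auto simp: z_def q_def)
 have "((\<lambda>s. f (z n s)) has_real_derivative (\<Sum>i<n. pd i f q * \<gamma>' i)) (at s0)" if "n \<le> k" for n
  using that
 proof (induction n)
  case 0 then show ?case by (simp add: z_def)
 next
  case (Suc n)
  then have n: "n < k" by simp
  define B where "B s = f (z (Suc n) s) - f (z n s)" for s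
  have zS: "z (Suc n) s = (z n s)(n := \<gamma> s n)" for s by (auto simp: z_def)
  have zn: "z n s n = q n" for s by (simp add: z_def)
  \<comment> \<open>The difference quotient of \<open>f\<close> in the coordinate \<open>n\<close>,
    with the value that makes it continuous where the curve has not moved in this coordinate. The
    increment is \<open>\<phi>\<close> times the increment of the coordinate, which is the form
    required by Caratheodory's characterization of derivatives.\<close>
  define \<phi> where "\<phi> s = (if \<gamma> s n = q n then pd n f q else B s / (\<gamma> s n - q n))" for s
  have B\<phi>: "B s = \<phi> s * (\<gamma> s n - q n)" for s
  proof (cases "\<gamma> s n = q n")
   case True
   then have "z (Suc n) s = z n s" using zS[of s] zn[of s] by (metis fun_upd_triv)
   then show ?thesis using True by (simp add: B_def)
  next
   case False then show ?thesis by (simp add: \<phi>_def)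
  qed
  have pdc: "continuous_on V (pd n f)" and pdd: "\<And>x. x \<in> V ==> ((\<lambda>y. f (x(n := y))) has_real_derivative pd n f x) (at (x n))"
   using f n unfolding One_nat_def C_diff_Suc_pd[OF V] C_diff_0_iff[OF V] by auto
  have \<phi>s0: "\<phi> s0 = pd n f q" by (simp add: \<phi>_def q_def)
  \<comment> \<open>By the mean value theorem the quotient is a value of \<open>pd n f\<close> at an
    intermediate point, which lies in a small cube around \<open>q\<close>; continuity of
    \<open>pd n f\<close> does the rest.\<close>
  have "isCont \<phi> s0"
   unfolding isCont_def tendsto_iff
  proof (intro allI impI)
   fix e :: real assume "e > 0"
   obtain \<delta> where \<delta>: "\<delta> > 0" "cube k q \<delta> \<subseteq> V" "\<forall>y\<in>cube k q \<delta>. \<bar>pd n f y - pd n f q\<bar> < e"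
    by (rule continuous_on_cube[OF V pdc q \<open>e>0\<close>])
   have "\<bar>\<phi> s - pd n f q\<bar> < e" if s: "\<forall>i<k. \<bar>\<gamma> s i - q i\<bar> < \<delta>" for s
   proof (cases "\<gamma> s n = q n")
    case True then show ?thesis using \<open>e>0\<close> by (simp add: \<phi>_def)
   next
    case False
    have in_box: "(z n s)(n := y) \<in> V \<and> \<bar>pd n f ((z n s)(n := y)) - pd n f q\<bar> < e" if "\<bar>y - q n\<bar> < \<delta>" for y
    proof -
     have "(z n s)(n := y) \<in> cube k q \<delta>"
      unfolding cube_def using that s z_supp n \<delta>(1) q0 by (auto simp: z_def)
     then show ?thesis using \<delta>(2,3) by blast
    qed
    have dd: "((\<lambda>y. f ((z n s)(n := y))) has_real_derivative pd n f ((z n s)(n := y))) (at y)" if "\<bar>y - q n\<bar> < \<delta>" for y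
     using pdd[of "(z n s)(n := y)"] in_box[OF that] by simp
    have sn: "\<bar>\<gamma> s n - q n\<bar> < \<delta>" using s n by auto
    have "\<exists>\<xi>. \<bar>\<xi> - q n\<bar> < \<delta> \<and> B s = (\<gamma> s n - q n) * pd n f ((z n s)(n := \<xi>))"
    proof (cases "\<gamma> s n > q n")
     case True
     have "\<exists>\<xi>>q n. \<xi> < \<gamma> s n \<and> f ((z n s)(n := \<gamma> s n)) - f ((z n s)(n := q n)) = (\<gamma> s n - q n) * pd n f ((z n s)(n := \<xi>))"
      by (rule MVT2[OF True]) (use sn in "auto intro!: dd simp del: fun_upd_apply")
     then obtain \<xi> where "\<xi> > q n" "\<xi> < \<gamma> s n" "f ((z n s)(n := \<gamma> s n)) - f ((z n s)(n := q n)) = (\<gamma> s n - q n) * pd n f ((z n s)(n := \<xi>))" by blast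
     moreover have "(z n s)(n := q n) = z n s" using zn by (metis fun_upd_triv)
     ultimately show ?thesis using sn by (intro exI[of _ \<xi>]) (auto simp: B_def zS)
    next
     case False
     with \<open>\<gamma> s n \<noteq> q n\<close> have lt: "\<gamma> s n < q n" by simp
     have "\<exists>\<xi>>\<gamma> s n. \<xi> < q n \<and> f ((z n s)(n := q n)) - f ((z n s)(n := \<gamma> s n)) = (q n - \<gamma> s n) * pd n f ((z n s)(n := \<xi>))"
      by (rule MVT2[OF lt]) (use sn in "auto intro!: dd simp del: fun_upd_apply")
     then obtain \<xi> where "\<xi> > \<gamma> s n" "\<xi> < q n" "f ((z n s)(n := q n)) - f ((z n s)(n := \<gamma> s n)) = (q n - \<gamma> s n) * pd n f ((z n s)(n := \<xi>))" by blast
     moreover have "(z n s)(n := q n) = z n s" using zn by (metis fun_upd_triv)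
     ultimately show ?thesis using sn by (intro exI[of _ \<xi>]) (auto simp: B_def zS algebra_simps)
    qed
    then show ?thesis using in_box False by (auto simp: \<phi>_def)
   qed
   with \<phi>s0 show "\<forall>\<^sub>F s in at s0. dist (\<phi> s) (\<phi> s0) < e"
    unfolding eventually_at_filter dist_real_def
    by (intro eventually_mono[OF near[OF \<delta>(1) order_refl]]) simp
  qed
  moreover obtain g where g: "\<And>s. \<gamma> s n - q n = g s * (s - s0)" "isCont g s0" "g s0 = \<gamma>' n"
   using d[OF n] unfolding CARAT_DERIV q_def by blast
  ultimately have "(B has_real_derivative pd n f q * \<gamma>' n) (at s0)"
   unfolding CARAT_DERIV
   by (intro exI[of _ "\<lambda>s. \<phi> s * g s"]) (auto simp: B\<phi> q_def[symmetric] \<phi>s0 mult.assoc[symmetric] intro!: continuous_mult)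
  from DERIV_add[OF Suc.IH this] n show ?case by (simp add: B_def)
 qed
 from this[of k] have "((\<lambda>s. f (z k s)) has_real_derivative (\<Sum>i<k. pd i f q * \<gamma>' i)) (at s0)" by simp
 moreover have "z k s = \<gamma> s" for s using \<gamma> by (auto simp: z_def q_def)
 ultimately show ?thesis by (simp add: q_def)
qed

lemma continuous_on_into_Euclidean:
 assumes "\<And>i. i < k ==> continuous_on U (\<lambda>x. h x i)" "\<And>x i. x \<in> U ==> i \<ge> k ==> h x i = 0"
 shows "continuous_on U (h :: 'a::topological_space => nat => real)"
proof (rule continuous_on_coordinatewise_then_product)
 fix i
 show "continuous_on U (\<lambda>x. h x i)"
 proof (cases "i < k")
  case False
  then have "continuous_on U (\<lambda>x. h x i) \<longleftrightarrow> continuous_on U (\<lambda>x. 0::real)"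
   using assms(2) by (intro continuous_on_cong) auto
  then show ?thesis by simp
 qed (use assms in auto)
qed

text \<open>Induction on the order with \<open>f\<close> varying: the chain rule expresses a
  derivative through \<open>pd i f\<close> composed with \<open>h\<close>, to which the induction
  hypothesis applies because \<open>h\<close> is also of the lower order.\<close>

lemma C_diff_compose:
 assumes "eopen m U" "eopen k V"
  "\<And>x. x \<in> U ==> h x \<in> V"
  and "C_diff k r V f" "\<And>i. i < k ==> C_diff m r U (\<lambda>x. h x i)"
 shows "C_diff m r U (\<lambda>x. f (h x))"
proof -
 have supp: "h x i = 0" if "x \<in> U" "i \<ge> k" for x i
  using that assms(2,3) openin_Euclidean_space_support by blast
 have cont: "continuous_on U (\<lambda>x. f (h x))" if "C_diff k r V f" "\<And>i. i < k ==> C_diff m r U (\<lambda>x. h x i)" for r f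
 proof (rule continuous_on_compose2[OF C_diff_continuous_on[OF assms(2) that(1)]])
  show "continuous_on U h"
   using C_diff_continuous_on[OF assms(1) that(2)] supp by (rule continuous_on_into_Euclidean)
 qed (use assms(3) in auto)
 show ?thesis using assms(4,5)
 proof (induction r arbitrary: f)
  case 0 show ?case unfolding C_diff_0_iff[OF assms(1)] by (rule cont[OF 0])
 next
  case (Suc r)
  have f: "\<And>i. i < k ==> C_diff k r V (pd i f)" using Suc.prems C_diff_Suc_pd[OF assms(2)] by auto
  have f1: "C_diff k 1 V f"
   using Suc.prems(1) unfolding One_nat_def C_diff_Suc_pd[OF assms(2)] C_diff_0_iff[OF assms(2)]
   using C_diff_continuous_on[OF assms(2)] by blast
  have hS: "i < k ==> j < m ==> (\<forall>x\<in>U. ((\<lambda>y. h (x(j := y)) i) has_real_derivative pd j (\<lambda>x. h x i) x) (at (x j))) \<and> C_diff m r U (pd j (\<lambda>x. h x i))" for i j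
   using Suc.prems(2)[of i, THEN iffD1[OF C_diff_Suc_pd[OF assms(1)]]] by (auto simp del: fun_upd_apply)
  have h: "\<And>i j. i < k ==> j < m ==> C_diff m r U (pd j (\<lambda>x. h x i))"
   "\<And>i j x. i < k ==> j < m ==> x \<in> U ==> ((\<lambda>y. h (x(j := y)) i) has_real_derivative pd j (\<lambda>x. h x i) x) (at (x j))"
   "\<And>i. i < k ==> C_diff m r U (\<lambda>x. h x i)"
   using hS Suc.prems(2)[THEN C_diff_Suc_lower[OF assms(1)]] by blast+
  show ?case unfolding C_diff_Suc_iff[OF assms(1)]
  proof (intro conjI allI impI)
   show "continuous_on U (\<lambda>x. f (h x))" by (rule cont[OF Suc.prems])
   fix j assume j: "j < m"
   show "\<exists>g. (\<forall>x\<in>U. ((\<lambda>y. f (h (x(j := y)))) has_real_derivative g x) (at (x j))) \<and> C_diff m r U g"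
   proof (intro exI conjI ballI)
    fix x assume x: "x \<in> U"
    \<comment> \<open>The curve has to vanish from index \<open>k\<close> on at every parameter,
      whereas \<open>h\<close> guarantees this only for arguments in \<open>U\<close>; hence the
      truncation.\<close>
    define \<gamma> where "\<gamma> y = (\<lambda>i. if i < k then h (x(j := y)) i else 0)" for y
    have ev: "\<forall>\<^sub>F y in nhds (x j). f (\<gamma> y) = f (h (x(j := y)))"
     using openin_Euclidean_space_fun_upd[OF assms(1) x j]
    proof eventually_elim
     case (elim y)
     then have "\<gamma> y = h (x(j := y))" using supp by (auto simp: \<gamma>_def)
     then show ?case by simp
    qed
    have \<gamma>x: "\<gamma> (x j) = h x" using supp[OF x] by (auto simp: \<gamma>_def)
    have d: "((\<lambda>s. \<gamma> s i) has_real_derivative pd j (\<lambda>x. h x i) x) (at (x j))" if "i < k" for i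
     using h(2)[OF that j x] that by (simp add: \<gamma>_def del: fun_upd_apply)
    have "((\<lambda>s. f (\<gamma> s)) has_real_derivative (\<Sum>i<k. pd i f (\<gamma> (x j)) * pd j (\<lambda>x. h x i) x)) (at (x j))"
     by (rule has_derivative_along_curve[OF assms(2) f1 _ _ d]) (use x assms(3) \<gamma>x in "auto simp: \<gamma>_def")
    then show "((\<lambda>y. f (h (x(j := y)))) has_real_derivative (\<Sum>i<k. pd i f (h x) * pd j (\<lambda>x. h x i) x)) (at (x j))"
     using DERIV_cong_ev[OF refl ev refl] \<gamma>x by simp
   next
    have "C_diff m r U (\<lambda>x. pd i f (h x))" if "i < k" for i
     by (rule Suc.IH[OF f[OF that] h(3)])
    then show "C_diff m r U (\<lambda>x. \<Sum>i<k. pd i f (h x) * pd j (\<lambda>x. h x i) x)"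
     using h(1) j by (intro C_diff_sum C_diff_mult assms(1)) auto
   qed
  qed
 qed
qed

section \<open>Hadamard's lemma and the implicit function theorem\<close>

lemma smooth_pd:
 assumes "eopen m U" "smooth m U f" "i < m"
 shows "smooth m U (pd i f)" and
  "x \<in> U ==> ((\<lambda>y. f (x(i := y))) has_real_derivative pd i f x) (at (x i))"
 using assms C_diff_Suc_pd[OF assms(1), of _ f] unfolding smooth_def by (auto simp del: fun_upd_apply C_diff.simps)

lemma smooth_continuous_on: "eopen m U ==> smooth m U f ==> continuous_on U f"
 using C_diff_continuous_on unfolding smooth_def by blast

lemma smooth_cong: "eopen m U ==> (\<And>x. x \<in> U ==> f x = g x) ==> smooth m U f ==> smooth m U g"
 unfolding smooth_def using C_diff_cong by blast

lemma smooth_subset: "eopen m U ==> eopen m V ==> V \<subseteq> U ==> smooth m U f ==> smooth m V f"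
 unfolding smooth_def using C_diff_subset by blast

lemma smooth_local:
 assumes "eopen m U"
  "\<And>x. x \<in> U ==> \<exists>V. eopen m V \<and> x \<in> V \<and> V \<subseteq> U \<and> smooth m V f"
 shows "smooth m U f"
 unfolding smooth_def
proof
 fix r show "C_diff m r U f"
 proof (rule C_diff_local[OF assms(1)])
  fix x assume "x \<in> U"
  from assms(2)[OF this] show "\<exists>V. eopen m V \<and> x \<in> V \<and> V \<subseteq> U \<and> C_diff m r V f"
   unfolding smooth_def by auto
 qed
qed

lemma smooth_const: "eopen m U ==> smooth m U (\<lambda>x. c)"
 and smooth_coordinate: "eopen m U ==> smooth m U (\<lambda>x. x i)"
 and smooth_add: "eopen m U ==> smooth m U f ==> smooth m U g ==> smooth m U (\<lambda>x. f x + g x)"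
 and smooth_mult: "eopen m U ==> smooth m U f ==> smooth m U g ==> smooth m U (\<lambda>x. f x * g x)"
 and smooth_minus: "eopen m U ==> smooth m U f ==> smooth m U (\<lambda>x. - f x)"
 and smooth_inverse: "eopen m U ==> smooth m U f ==> (\<And>x. x \<in> U ==> f x \<noteq> 0) ==> smooth m U (\<lambda>x. inverse (f x))"
 and smooth_sum: "eopen m U ==> (\<And>a. a \<in> A ==> smooth m U (F a)) ==> smooth m U (\<lambda>x. \<Sum>a\<in>A. F a x)"
 unfolding smooth_def
 by (simp_all add: C_diff_const C_diff_coordinate C_diff_add C_diff_mult C_diff_minus C_diff_inverse C_diff_sum del: C_diff.simps)

lemma smooth_compose:
 assumes "eopen m U" "eopen k V" "\<And>x. x \<in> U ==> h x \<in> V"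
  "smooth k V f" "\<And>i. i < k ==> smooth m U (\<lambda>x. h x i)"
 shows "smooth m U (\<lambda>x. f (h x))"
 unfolding smooth_def
proof
 fix r show "C_diff m r U (\<lambda>x. f (h x))"
  by (rule C_diff_compose[OF assms(1-3)]) (use assms(4,5) in "auto simp: smooth_def")
qed

text \<open>The weight \<open>t ^ n\<close> makes the family of these integrals closed under
  differentiation: a derivative in direction \<open>j\<close> replaces \<open>g\<close> by
  \<open>pd j g\<close> and raises the power of \<open>t\<close> by one. Hence the induction runs
  over all \<open>g\<close> and \<open>n\<close> at once.\<close>

lemma C_diff_radial_integral:
 fixes q :: "nat => real" and \<delta> :: real
 assumes q: "\<And>i. i \<ge> m ==> q i = 0" and "\<delta> > 0"
 shows "smooth m (cube m q \<delta>) g ==>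
  C_diff m r (cube m q \<delta>) (\<lambda>x. integral {0..1} (\<lambda>t. t ^ n * g (\<lambda>i. q i + t * (x i - q i))))"
proof (induction r arbitrary: g n)
 let ?B = "cube m q \<delta>"
 have B: "eopen m ?B" by (rule openin_cube)
 have in_B: "(\<lambda>i. q i + t * (x i - q i)) \<in> ?B" if "x \<in> ?B" "0 \<le> t" "t \<le> 1" for x t
  unfolding cube_def
 proof (intro CollectI conjI allI impI)
  fix i assume "i < m"
  then have "\<bar>x i - q i\<bar> < \<delta>" using that by (auto simp: cube_def)
  moreover have "\<bar>t * (x i - q i)\<bar> \<le> 1 * \<bar>x i - q i\<bar>"
   unfolding abs_mult by (rule mult_right_mono) (use that in auto)
  ultimately show "\<bar>q i + t * (x i - q i) - q i\<bar> < \<delta>" by simp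
 qed (use q that in "auto simp: cube_def")
 have cont: "continuous_on (S \<times> {0..1}) (\<lambda>p. snd p ^ n * g (\<lambda>i. q i + snd p * (h (fst p) i - q i)))"
  if g: "smooth m ?B g" and h: "\<And>y. y \<in> S ==> h y \<in> ?B" "\<And>i. continuous_on S (\<lambda>y. h y i)"
  for g n and S :: "'x::topological_space set" and h
 proof (intro continuous_on_mult continuous_on_power continuous_on_snd continuous_on_id)
  have "continuous_on (S \<times> {0..1}) (\<lambda>p. (\<lambda>i. q i + snd p * (h (fst p) i - q i)))"
  proof (intro continuous_on_coordinatewise_then_product continuous_intros)
   fix i show "continuous_on (S \<times> {0..1}) (\<lambda>p. h (fst p) i)"
    by (rule continuous_on_compose2[OF h(2) continuous_on_fst[OF continuous_on_id]]) auto
  qed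
  then show "continuous_on (S \<times> {0..1}) (\<lambda>p. g (\<lambda>i. q i + snd p * (h (fst p) i - q i)))"
   by (rule continuous_on_compose2[OF smooth_continuous_on[OF B g]]) (use in_B h(1) in auto)
 qed
 have cont_int: "continuous_on ?B (\<lambda>x. integral {0..1} (\<lambda>t. t ^ n * g (\<lambda>i. q i + t * (x i - q i))))"
  if "smooth m ?B g" for g n
  unfolding cbox_interval[symmetric]
 proof (rule integral_continuous_on_param)
  show "continuous_on (?B \<times> cbox 0 1) (\<lambda>(x, t). t ^ n * g (\<lambda>i. q i + t * (x i - q i)))"
   using cont[OF that, of ?B "\<lambda>x. x" n]
   by (simp add: case_prod_unfold continuous_on_product_coordinates[THEN continuous_on_subset])
 qed
 {
  case 0 show ?case unfolding C_diff_0_iff[OF B] by (rule cont_int[OF 0])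
 next
  case (Suc r)
  show ?case unfolding C_diff_Suc_iff[OF B]
  proof (intro conjI allI impI)
   show "continuous_on ?B (\<lambda>x. integral {0..1} (\<lambda>t. t ^ n * g (\<lambda>i. q i + t * (x i - q i))))"
    by (rule cont_int[OF Suc.prems])
   fix j assume j: "j < m"
   let ?g = "\<lambda>x. integral {0..1} (\<lambda>t. t ^ Suc n * pd j g (\<lambda>i. q i + t * (x i - q i)))"
   have pg: "smooth m ?B (pd j g)" by (rule smooth_pd(1)[OF B Suc.prems j])
   show "\<exists>h. (\<forall>x\<in>?B. ((\<lambda>y. integral {0..1} (\<lambda>t. t ^ n * g (\<lambda>i. q i + t * ((x(j := y)) i - q i)))) has_real_derivative h x) (at (x j))) \<and> C_diff m r ?B h"
   proof (intro exI[of _ ?g] conjI ballI Suc.IH[OF pg])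
    fix x assume x: "x \<in> ?B"
    \<comment> \<open>The range of the coordinate \<open>j\<close> inside the cube: an open
      interval, over which differentiation under the integral is justified.\<close>
    let ?I = "{q j - \<delta> <..< q j + \<delta>}"
    have xI: "x j \<in> ?I" using x j by (auto simp: cube_def abs_less_iff)
    have xB: "x(j := y) \<in> ?B" if "y \<in> ?I" for y
     using that x j by (auto simp: cube_def abs_less_iff)
    have ch: "continuous_on ?I (\<lambda>y. (x(j := y)) i)" for i
     by (cases "i = j") (auto intro: continuous_intros)
    have "((\<lambda>y. integral (cbox 0 1) (\<lambda>t. t ^ n * g (\<lambda>i. q i + t * ((x(j := y)) i - q i)))) has_real_derivative
      integral (cbox 0 1) (\<lambda>t. t ^ Suc n * pd j g (\<lambda>i. q i + t * ((x(j := x j)) i - q i)))) (at (x j) within ?I)"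
    proof (rule leibniz_rule_field_derivative[where fx = "\<lambda>y t. t ^ Suc n * pd j g (\<lambda>i. q i + t * ((x(j := y)) i - q i))"])
     fix y t :: real assume y: "y \<in> ?I" and "t \<in> cbox 0 1"
     then have t: "0 \<le> t" "t \<le> 1" by auto
     let ?z = "\<lambda>i. q i + t * ((x(j := y)) i - q i)"
     have z: "?z \<in> ?B" by (rule in_B[OF xB[OF y] t])
     have "((\<lambda>v. g (?z(j := v))) has_real_derivative pd j g ?z) (at (?z j))"
      by (rule smooth_pd(2)[OF B Suc.prems j z])
     moreover have "((\<lambda>y. q j + t * (y - q j)) has_real_derivative t) (at y)"
      by (auto intro!: derivative_eq_intros)
     ultimately have "((\<lambda>v. g (?z(j := q j + t * (v - q j)))) has_real_derivative pd j g ?z * t) (at y)"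
      by (intro DERIV_chain2[where g = "\<lambda>y. q j + t * (y - q j)" and f = "\<lambda>v. g (?z(j := v))"]) simp_all
     moreover have "?z(j := q j + t * (v - q j)) = (\<lambda>i. q i + t * ((x(j := v)) i - q i))" for v by auto
     ultimately have "((\<lambda>v. g (\<lambda>i. q i + t * ((x(j := v)) i - q i))) has_real_derivative pd j g ?z * t) (at y)"
      by simp
     from DERIV_cmult[OF this, of "t ^ n"]
     have "((\<lambda>v. t ^ n * g (\<lambda>i. q i + t * ((x(j := v)) i - q i))) has_real_derivative t ^ Suc n * pd j g ?z) (at y)"
      by (simp add: mult_ac del: fun_upd_apply)
     then show "((\<lambda>v. t ^ n * g (\<lambda>i. q i + t * ((x(j := v)) i - q i))) has_real_derivative t ^ Suc n * pd j g ?z) (at y within ?I)"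
      by (rule has_field_derivative_at_within)
    next
     fix y assume y: "y \<in> ?I"
     have "continuous_on ({y} \<times> {0..1}) (\<lambda>p. snd p ^ n * g (\<lambda>i. q i + snd p * ((x(j := fst p)) i - q i)))"
      by (rule cont[OF Suc.prems]) (use xB[OF y] y in "auto intro: continuous_on_subset[OF ch] simp del: fun_upd_apply")
     then have "continuous_on {0..1} ((\<lambda>p. snd p ^ n * g (\<lambda>i. q i + snd p * ((x(j := fst p)) i - q i))) \<circ> Pair y)"
      by (intro continuous_on_compose) (auto intro!: continuous_intros elim!: continuous_on_subset simp del: fun_upd_apply)
     then have "continuous_on {0..1} (\<lambda>t. t ^ n * g (\<lambda>i. q i + t * ((x(j := y)) i - q i)))"
      by (simp add: o_def del: fun_upd_apply)
     then show "(\<lambda>t. t ^ n * g (\<lambda>i. q i + t * ((x(j := y)) i - q i))) integrable_on cbox 0 1"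
      unfolding cbox_interval by (rule integrable_continuous_interval)
    next
     show "continuous_on (?I \<times> cbox 0 1) (\<lambda>(y, t). t ^ Suc n * pd j g (\<lambda>i. q i + t * ((x(j := y)) i - q i)))"
      using cont[OF pg, of ?I "\<lambda>y. x(j := y)" "Suc n"] xB ch
      by (simp add: case_prod_unfold del: fun_upd_apply)
    qed (use xI in auto)
    then show "((\<lambda>y. integral {0..1} (\<lambda>t. t ^ n * g (\<lambda>i. q i + t * ((x(j := y)) i - q i)))) has_real_derivative ?g x) (at (x j))"
     using xI at_within_open[of "x j" ?I] unfolding cbox_interval fun_upd_triv by simp
   qed
  qed
 }
qed

text \<open>The derivative of \<open>f\<close> along the segment from \<open>q\<close> to
  \<open>x\<close> is a sum of terms with factor \<open>x i - q i\<close>; integrating it over the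
  segment gives the increment of \<open>f\<close>, and the remaining integrals are the smooth
  coefficients.\<close>

lemma Hadamard:
 assumes U: "eopen m U" and f: "smooth m U f" and q: "q \<in> U"
 obtains B H where "eopen m B" "q \<in> B" "B \<subseteq> U"
  "\<forall>i<m. smooth m B (H i)" "\<forall>x\<in>B. f x = f q + (\<Sum>i<m. (x i - q i) * H i x)"
  "\<forall>i<m. H i q = pd i f q"
proof -
 obtain \<delta> where \<delta>: "\<delta> > 0" "cube m q \<delta> \<subseteq> U" by (rule openin_Euclidean_space_cubeE[OF U q])
 let ?B = "cube m q \<delta>"
 have q0: "q i = 0" if "i \<ge> m" for i using openin_Euclidean_space_support[OF U q that] .
 have B: "eopen m ?B" by (rule openin_cube)
 have fB: "smooth m ?B f" by (rule smooth_subset[OF U B \<delta>(2) f])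
 have f1: "C_diff m 1 ?B f" using fB unfolding smooth_def by blast
 \<comment> \<open>The factor \<open>t ^ 0\<close> brings the coefficient into the weighted form of
   \<open>C_diff_radial_integral\<close>.\<close>
 define H where "H i x = integral {0..1} (\<lambda>t. t ^ 0 * pd i f (\<lambda>k. q k + t * (x k - q k)))" for i x
 have H: "smooth m ?B (H i)" if "i < m" for i
  unfolding smooth_def H_def using C_diff_radial_integral[OF q0 \<delta>(1) smooth_pd(1)[OF B fB that]] by blast
 have eq: "f x = f q + (\<Sum>i<m. (x i - q i) * H i x)" if x: "x \<in> ?B" for x
 proof -
  let ?\<gamma> = "\<lambda>t k. q k + t * (x k - q k)"
  have \<gamma>: "?\<gamma> t \<in> ?B" if "t \<in> {0..1}" for t
   unfolding cube_def
  proof (intro CollectI conjI allI impI)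
   fix i assume "i < m"
   then have "\<bar>x i - q i\<bar> < \<delta>" using x by (auto simp: cube_def)
   moreover have "\<bar>t * (x i - q i)\<bar> \<le> 1 * \<bar>x i - q i\<bar>"
    unfolding abs_mult by (rule mult_right_mono) (use that in auto)
   ultimately show "\<bar>q i + t * (x i - q i) - q i\<bar> < \<delta>" by simp
  qed (use q0 x in "auto simp: cube_def")
  have x0: "x i = 0" if "i \<ge> m" for i using x that by (auto simp: cube_def)
  have d: "((\<lambda>t. f (?\<gamma> t)) has_real_derivative (\<Sum>i<m. pd i f (?\<gamma> t) * (x i - q i))) (at t)" if "t \<in> {0..1}" for t
   using that q0 x0
   by (intro has_derivative_along_curve[where \<gamma> = ?\<gamma> and V = ?B] B f1 \<gamma>) (auto intro!: derivative_eq_intros)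
  have "((\<lambda>t. \<Sum>i<m. pd i f (?\<gamma> t) * (x i - q i)) has_integral (f (?\<gamma> 1) - f (?\<gamma> 0))) {0..1}"
   by (rule fundamental_theorem_of_calculus)
     (auto intro!: has_field_derivative_at_within[OF d] simp: has_real_derivative_iff_has_vector_derivative[symmetric])
  then have 1: "integral {0..1} (\<lambda>t. \<Sum>i<m. pd i f (?\<gamma> t) * (x i - q i)) = f x - f q"
   by (simp add: integral_unique)
  have c: "continuous_on {0..1} (\<lambda>t. pd i f (?\<gamma> t))" if "i < m" for i
  proof (rule continuous_on_compose2[OF smooth_continuous_on[OF B smooth_pd(1)[OF B fB that]]])
   show "continuous_on {0..1} ?\<gamma>"
    by (intro continuous_on_coordinatewise_then_product continuous_intros)
  qed (use \<gamma> in auto)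
  have "integral {0..1} (\<lambda>t. \<Sum>i<m. pd i f (?\<gamma> t) * (x i - q i)) = (\<Sum>i<m. integral {0..1} (\<lambda>t. pd i f (?\<gamma> t) * (x i - q i)))"
   by (rule integral_sum) (auto intro!: integrable_continuous_interval continuous_intros c)
  also have "\<dots> = (\<Sum>i<m. (x i - q i) * H i x)"
   by (simp add: H_def mult.commute)
  finally show ?thesis using 1 by simp
 qed
 have "H i q = pd i f q" if "i < m" for i by (simp add: H_def)
 with H eq show ?thesis by (intro that[OF B centre_in_cube[OF U q \<delta>(1)] \<delta>(2)]) auto
qed

section \<open>The implicit function theorem\<close>

lemma continuous_onI_cube:
 fixes f :: "(nat => real) => real"
 assumes W: "eopen m W"
  and *: "\<And>x e. x \<in> W ==> 0 < e ==> \<exists>\<delta>>0. \<forall>y\<in>cube m x \<delta> \<inter> W. \<bar>f y - f x\<bar> < e"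
 shows "continuous_on W f"
 unfolding continuous_on_def tendsto_iff
proof (intro ballI allI impI)
 fix x e assume x: "x \<in> W" and "0 < (e::real)"
 from *[OF this] obtain \<delta> where \<delta>: "\<delta> > 0" "\<forall>y\<in>cube m x \<delta> \<inter> W. \<bar>f y - f x\<bar> < e" by blast
 obtain T where T: "open T" "cube m x \<delta> = {x. \<forall>i\<ge>m. x i = 0} \<inter> T"
  using openin_cube[of m x \<delta>] unfolding Euclidean_space_top_of_set openin_open by blast
 have "y \<in> cube m x \<delta>" if "y \<in> W" "y \<in> T" for y
  using that openin_Euclidean_space_support[OF W] unfolding T(2) by auto
 moreover have "x \<in> T" using centre_in_cube[OF W x \<delta>(1)] unfolding T(2) by blast
 ultimately show "\<forall>\<^sub>F y in at x within W. dist (f y) (f x) < e"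
  unfolding eventually_at_topological dist_real_def using T(1) \<delta>(2) by blast
qed

text \<open>Since \<open>pd i F\<close> is positive on a cube, \<open>F\<close> increases strictly
  in the coordinate \<open>i\<close>; it has opposite signs at two ends of a segment, and this
  persists nearby. So there is exactly one zero \<open>g x\<close> on each parallel segment. As a
  function of all coordinates \<open>g\<close> does not depend on the coordinate \<open>i\<close>,
  and replacing this coordinate by \<open>g x\<close> maps into the zero set of \<open>F\<close> and
  fixes its points. Smoothness follows by bootstrapping from the formula for the
  derivatives.\<close>

lemma implicit_function_pos:
 assumes U: "eopen m U" and F: "smooth m U F" and p: "p \<in> U" "F p = 0"
  and i: "i < m" "pd i F p > 0"
 obtains W g where "eopen m W" "p \<in> W" "W \<subseteq> U" "smooth m W g"
  "\<forall>x\<in>W. x(i := g x) \<in> U \<and> F (x(i := g x)) = 0 \<and> pd i F (x(i := g x)) > 0"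
  "\<forall>x\<in>W. F x = 0 --> g x = x i" "\<forall>x\<in>W. pd i g x = 0"
  "\<forall>x\<in>W. \<forall>k<m. k \<noteq> i --> pd k g x = - pd k F (x(i := g x)) / pd i F (x(i := g x))"
proof -
 have "continuous_on U (pd i F)" by (rule smooth_continuous_on[OF U smooth_pd(1)[OF U F i(1)]])
 from continuous_on_cube[OF U this p(1) i(2)] obtain \<delta>1 where
  \<delta>1: "\<delta>1 > 0" "cube m p \<delta>1 \<subseteq> U" "\<forall>y\<in>cube m p \<delta>1. \<bar>pd i F y - pd i F p\<bar> < pd i F p" by metis
 define C where "C = cube m p \<delta>1"
 have C: "eopen m C" unfolding C_def by (rule openin_cube)
 have CU: "C \<subseteq> U" using \<delta>1 C_def by simp
 have Cpos: "pd i F y > 0" if "y \<in> C" for y using \<delta>1(3) that unfolding C_def by fastforce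
 have FC: "smooth m C F" by (rule smooth_subset[OF U C CU F])
 have pdC: "((\<lambda>t. F (x(j := t))) has_real_derivative pd j F x) (at (x j))" if "x \<in> C" "j < m" for x j
  by (rule smooth_pd(2)[OF C FC that(2,1)])
 have updC: "x(i := t) \<in> C" if "x \<in> C" "\<bar>t - p i\<bar> < \<delta>1" for x t
  using that i(1) unfolding C_def cube_def by auto
 have dC: "((\<lambda>t. F (x(i := t))) has_real_derivative pd i F (x(i := t))) (at t)" if "x \<in> C" "\<bar>t - p i\<bar> < \<delta>1" for x t
  using pdC[OF updC[OF that] i(1)] by (simp del: fun_upd_apply add: fun_upd_same)
 have mono: "F (x(i := s)) < F (x(i := t))" if "x \<in> C" "\<bar>s - p i\<bar> < \<delta>1" "\<bar>t - p i\<bar> < \<delta>1" "s < t" for x s t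
 proof (rule DERIV_pos_imp_increasing[OF that(4)])
  fix u assume "s \<le> u" "u \<le> t"
  then have u: "\<bar>u - p i\<bar> < \<delta>1" using that by auto
  show "\<exists>y. ((\<lambda>t. F (x(i := t))) has_real_derivative y) (at u) \<and> 0 < y"
   using dC[OF that(1) u] Cpos[OF updC[OF that(1) u]] by blast
 qed
 \<comment> \<open>Half the radius, so that the closed segment of radius \<open>\<epsilon>\<close>
   still lies in the cube on which \<open>F\<close> is monotone.\<close>
 define \<epsilon> where "\<epsilon> = \<delta>1 / 2"
 have \<epsilon>: "\<epsilon> > 0" "\<epsilon> < \<delta>1" using \<delta>1 by (auto simp: \<epsilon>_def)
 have pC: "p \<in> C" unfolding C_def by (rule centre_in_cube[OF U p(1) \<delta>1(1)])
 define a where "a = p(i := p i - \<epsilon>)"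
 define b where "b = p(i := p i + \<epsilon>)"
 have ab: "a \<in> C" "b \<in> C" unfolding a_def b_def by (rule updC[OF pC]; use \<epsilon> in simp)+
 have Fa: "F a < 0" using mono[OF pC, of "p i - \<epsilon>" "p i"] p(2) \<epsilon> \<delta>1(1) by (simp add: a_def del: fun_upd_apply)
 have Fb: "F b > 0" using mono[OF pC, of "p i" "p i + \<epsilon>"] p(2) \<epsilon> \<delta>1(1) by (simp add: b_def del: fun_upd_apply)
 have Fc: "continuous_on C F" by (rule smooth_continuous_on[OF C FC])
 from Fa have "0 < - F a" by simp
 from continuous_on_cube[OF C Fc ab(1) this] obtain \<delta>a where
  \<delta>a: "\<delta>a > 0" "cube m a \<delta>a \<subseteq> C" "\<forall>y\<in>cube m a \<delta>a. \<bar>F y - F a\<bar> < - F a" by metis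
 from continuous_on_cube[OF C Fc ab(2) Fb] obtain \<delta>b where
  \<delta>b: "\<delta>b > 0" "cube m b \<delta>b \<subseteq> C" "\<forall>y\<in>cube m b \<delta>b. \<bar>F y - F b\<bar> < F b" by metis
 \<comment> \<open>The bounds by \<open>\<delta>a\<close> and \<open>\<delta>b\<close> preserve the
   signs at the two ends. The bound by \<open>\<epsilon>\<close> puts the coordinate
   \<open>x i\<close> of a point of \<open>W\<close> into the interval in which the zero is sought,
   whence \<open>g x = x i\<close> on the zero set.\<close>
 define \<delta>2 where "\<delta>2 = min (min \<delta>a \<delta>b) \<epsilon>"
 have \<delta>2: "\<delta>2 > 0" "\<delta>2 \<le> \<delta>a" "\<delta>2 \<le> \<delta>b" "\<delta>2 \<le> \<epsilon>" using \<delta>a \<delta>b \<epsilon> by (auto simp: \<delta>2_def)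
 define W where "W = cube m p \<delta>2"
 have W: "eopen m W" unfolding W_def by (rule openin_cube)
 have WC: "W \<subseteq> C" unfolding W_def C_def cube_def using \<delta>2 \<epsilon> by fastforce
 have ends: "F (x(i := p i - \<epsilon>)) < 0" "F (x(i := p i + \<epsilon>)) > 0" if "x \<in> W" for x
 proof -
  have "x(i := p i - \<epsilon>) \<in> cube m a \<delta>a"
   using that \<delta>2 i(1) \<delta>a(1) unfolding W_def cube_def a_def by fastforce
  then show "F (x(i := p i - \<epsilon>)) < 0" using \<delta>a(3) by fastforce
  have "x(i := p i + \<epsilon>) \<in> cube m b \<delta>b"
   using that \<delta>2 i(1) \<delta>b(1) unfolding W_def cube_def b_def by fastforce
  then show "F (x(i := p i + \<epsilon>)) > 0" using \<delta>b(3) by fastforce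
 qed
 define g where "g x = (THE t. \<bar>t - p i\<bar> < \<epsilon> \<and> F (x(i := t)) = 0)" for x
 have ex1: "\<exists>!t. \<bar>t - p i\<bar> < \<epsilon> \<and> F (x(i := t)) = 0" if x: "x \<in> W" for x
 proof -
  have xC: "x \<in> C" using WC x by blast
  have "continuous_on {p i - \<epsilon>..p i + \<epsilon>} (\<lambda>t. F (x(i := t)))"
   by (rule DERIV_continuous_on[where D = "\<lambda>t. pd i F (x(i := t))"])
     (use \<epsilon> in "auto intro!: has_field_derivative_at_within dC[OF xC] simp del: fun_upd_apply")
  with IVT'[of "\<lambda>t. F (x(i := t))" "p i - \<epsilon>" 0 "p i + \<epsilon>"] ends[OF x] \<epsilon>
  obtain t where t: "p i - \<epsilon> \<le> t" "t \<le> p i + \<epsilon>" "F (x(i := t)) = 0" by force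
  then have "t \<noteq> p i - \<epsilon>" "t \<noteq> p i + \<epsilon>" using ends[OF x] by auto
  with t have t': "\<bar>t - p i\<bar> < \<epsilon>" by auto
  show ?thesis
  proof (rule ex1I[of _ t])
   show "\<bar>t - p i\<bar> < \<epsilon> \<and> F (x(i := t)) = 0" using t t' by simp
   fix u assume u: "\<bar>u - p i\<bar> < \<epsilon> \<and> F (x(i := u)) = 0"
   then show "u = t" using mono[OF xC, of u t] mono[OF xC, of t u] t' t(3) \<epsilon> by (cases u t rule: linorder_cases) auto
  qed
 qed
 have g: "\<bar>g x - p i\<bar> < \<epsilon>" "F (x(i := g x)) = 0" if "x \<in> W" for x
  using theI'[OF ex1[OF that]] unfolding g_def by auto
 have g_eqI: "g x = t" if "x \<in> W" "\<bar>t - p i\<bar> < \<epsilon>" "F (x(i := t)) = 0" for x t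
  unfolding g_def by (rule the1_equality[OF ex1[OF that(1)]]) (use that in auto)
 have gC: "x(i := g x) \<in> C" if "x \<in> W" for x
  by (rule updC) (use WC that g(1)[OF that] \<epsilon> in auto)
 have g_gt: "t < g x" if "x \<in> W" "\<bar>t - p i\<bar> < \<delta>1" "F (x(i := t)) < 0" for x t
  using mono[of x "g x" t] g[OF that(1)] \<epsilon> that WC by (cases t "g x" rule: linorder_cases) (auto simp del: fun_upd_apply)
 have g_lt: "g x < t" if "x \<in> W" "\<bar>t - p i\<bar> < \<delta>1" "F (x(i := t)) > 0" for x t
  using mono[of x t "g x"] g[OF that(1)] \<epsilon> that WC by (cases t "g x" rule: linorder_cases) (auto simp del: fun_upd_apply)
 have cont_slice: "continuous_on W (\<lambda>x. F (x(i := c)))" if "\<bar>c - p i\<bar> < \<delta>1" for c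
 proof (rule smooth_continuous_on[OF W], rule smooth_compose[OF W C _ FC])
  fix x assume "x \<in> W" then show "x(i := c) \<in> C" using updC WC that by blast
 next
  fix j show "smooth m W (\<lambda>x. (x(i := c)) j)"
   by (cases "j = i") (auto intro: smooth_const smooth_coordinate W)
 qed
 have g_cont: "continuous_on W g"
 proof (rule continuous_onI_cube[OF W])
  fix x and e :: real assume x: "x \<in> W" and e: "0 < e"
  \<comment> \<open>Smaller than \<open>e\<close>, and small enough that \<open>g x - h\<close> and
    \<open>g x + h\<close> stay in the interval around \<open>p i\<close>. Different signs of
    \<open>F\<close> at these two values persist for nearby points and enclose the zero.\<close>
  define h where "h = min e (\<epsilon> - \<bar>g x - p i\<bar>) / 2"
  have "h > 0" "h \<le> e / 2" "h \<le> (\<epsilon> - \<bar>g x - p i\<bar>) / 2"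
   using e g(1)[OF x] by (auto simp: h_def)
  then have h: "h > 0" "h < e" "\<bar>g x - h - p i\<bar> < \<epsilon>" "\<bar>g x + h - p i\<bar> < \<epsilon>"
   using e by (simp_all add: abs_real_def split: if_splits)
  have h': "\<bar>g x - h - p i\<bar> < \<delta>1" "\<bar>g x + h - p i\<bar> < \<delta>1" "\<bar>g x - p i\<bar> < \<delta>1" using h \<epsilon> g(1)[OF x] by auto
  have l: "0 < - F (x(i := g x - h))" using mono[of x "g x - h" "g x"] g(2)[OF x] h h' WC x by (auto simp del: fun_upd_apply)
  have r: "0 < F (x(i := g x + h))" using mono[of x "g x" "g x + h"] g(2)[OF x] h h' WC x by (auto simp del: fun_upd_apply)
  from continuous_on_cube[OF W cont_slice[OF h'(1)] x l] obtain d1 where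
   d1: "d1 > 0" "\<forall>y\<in>cube m x d1. \<bar>F (y(i := g x - h)) - F (x(i := g x - h))\<bar> < - F (x(i := g x - h))" by metis
  from continuous_on_cube[OF W cont_slice[OF h'(2)] x r] obtain d2 where
   d2: "d2 > 0" "\<forall>y\<in>cube m x d2. \<bar>F (y(i := g x + h)) - F (x(i := g x + h))\<bar> < F (x(i := g x + h))" by metis
  have "\<bar>g y - g x\<bar> < e" if y: "y \<in> cube m x (min d1 d2)" "y \<in> W" for y
  proof -
   have "y \<in> cube m x d1" "y \<in> cube m x d2" using y by (auto simp: cube_def)
   then have "F (y(i := g x - h)) < 0" "F (y(i := g x + h)) > 0" using d1(2) d2(2) by fastforce+
   then have "g x - h < g y" "g y < g x + h" using g_gt[OF y(2) h'(1)] g_lt[OF y(2) h'(2)] by auto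
   then show ?thesis using h by auto
  qed
  then show "\<exists>\<delta>>0. \<forall>y\<in>cube m x \<delta> \<inter> W. \<bar>g y - g x\<bar> < e"
   using d1(1) d2(1) by (intro exI[of _ "min d1 d2"]) auto
 qed
 \<comment> \<open>The derivative obtained by differentiating \<open>F (x(i := g x)) = 0\<close>
   formally; it is \<open>0\<close> for \<open>k = i\<close> because \<open>g\<close> ignores this
   coordinate.\<close>
 define D where "D k x = (if k = i then 0 else - pd k F (x(i := g x)) / pd i F (x(i := g x)))" for k x
 have g_deriv: "((\<lambda>s. g (x(k := s))) has_real_derivative D k x) (at (x k))" if x: "x \<in> W" and k: "k < m" for x k
 proof (cases "k = i")
  case True
  have "g (x(i := s)) = g x" for s by (simp add: g_def)
  then show ?thesis using True by (simp add: D_def)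
 next
  case False
  define t0 where "t0 = g x"
  define y where "y = x(i := t0)"
  define P where "P s t = F ((x(k := s))(i := t))" for s t
  have yC: "y \<in> C" unfolding y_def t0_def by (rule gC[OF x])
  have yk: "(x(k := s))(i := t0) = y(k := s)" for s unfolding y_def by (rule fun_upd_twist[OF False])
  have yk': "y k = x k" using False by (simp add: y_def)
  define A where "A s = P s t0 - P (x k) t0" for s
  have A: "((\<lambda>s. A s / (s - x k)) \<longlongrightarrow> pd k F y) (at (x k))"
   using pdC[OF yC k] unfolding has_field_derivative_iff yk' A_def P_def yk by simp
  have ev: "\<forall>\<^sub>F s in nhds (x k). x(k := s) \<in> W" by (rule openin_Euclidean_space_fun_upd[OF W x k])
  \<comment> \<open>\<open>F\<close> vanishes at both points of the graph of \<open>g\<close>, so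
    its increment in the coordinate \<open>i\<close> cancels the increment \<open>A s\<close> in the
    coordinate \<open>k\<close>. The mean value theorem rewrites the former through
    \<open>pd i F\<close> at an intermediate point.\<close>
  have "\<exists>z. \<bar>z - t0\<bar> \<le> \<bar>g (x(k := s)) - t0\<bar> \<and> \<bar>z - p i\<bar> < \<delta>1 \<and> (g (x(k := s)) - t0) * pd i F ((x(k := s))(i := z)) = - A s"
   if s: "x(k := s) \<in> W" for s
  proof -
   let ?x = "x(k := s)"
   have xC: "?x \<in> C" using s WC by blast
   have P0: "P s (g ?x) = 0" "P (x k) t0 = 0" using g(2)[OF s] g(2)[OF x] by (auto simp: P_def t0_def)
   have rng: "\<bar>g ?x - p i\<bar> < \<delta>1" "\<bar>t0 - p i\<bar> < \<delta>1" using g(1)[OF s] g(1)[OF x] \<epsilon> by (auto simp: t0_def)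
   show ?thesis
   proof (cases "g ?x" t0 rule: linorder_cases)
    case equal
    then show ?thesis using P0 rng by (intro exI[of _ t0]) (auto simp: A_def)
   next
    case less
    have "\<exists>z>g ?x. z < t0 \<and> F (?x(i := t0)) - F (?x(i := g ?x)) = (t0 - g ?x) * pd i F (?x(i := z))"
     by (rule MVT2[OF less]) (use rng in "auto intro!: dC[OF xC] simp del: fun_upd_apply")
    then obtain z where "z > g ?x" "z < t0" "F (?x(i := t0)) - F (?x(i := g ?x)) = (t0 - g ?x) * pd i F (?x(i := z))" by blast
    then show ?thesis using P0 rng by (intro exI[of _ z]) (auto simp: A_def P_def algebra_simps simp del: fun_upd_apply)
   next
    case greater
    have "\<exists>z>t0. z < g ?x \<and> F (?x(i := g ?x)) - F (?x(i := t0)) = (g ?x - t0) * pd i F (?x(i := z))"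
     by (rule MVT2[OF greater]) (use rng in "auto intro!: dC[OF xC] simp del: fun_upd_apply")
    then obtain z where "z > t0" "z < g ?x" "F (?x(i := g ?x)) - F (?x(i := t0)) = (g ?x - t0) * pd i F (?x(i := z))" by blast
    then show ?thesis using P0 rng by (intro exI[of _ z]) (auto simp: A_def P_def algebra_simps simp del: fun_upd_apply)
   qed
  qed
  then obtain z where z: "\<And>s. x(k := s) \<in> W ==> \<bar>z s - t0\<bar> \<le> \<bar>g (x(k := s)) - t0\<bar> \<and> \<bar>z s - p i\<bar> < \<delta>1 \<and>
    (g (x(k := s)) - t0) * pd i F ((x(k := s))(i := z s)) = - A s" by metis
  define Q where "Q s = pd i F ((x(k := s))(i := z s))" for s
  have Q: "(Q \<longlongrightarrow> pd i F y) (at (x k))"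
   unfolding tendsto_iff
  proof (intro allI impI)
   fix e :: real assume e: "e > 0"
   have "continuous_on C (pd i F)" by (rule smooth_continuous_on[OF C smooth_pd(1)[OF C FC i(1)]])
   from continuous_on_cube[OF C this yC e] obtain d where
    d: "d > 0" "\<forall>w\<in>cube m y d. \<bar>pd i F w - pd i F y\<bar> < e" by metis
   from continuous_on_cube[OF W g_cont x d(1)] obtain d' where
    d': "d' > 0" "\<forall>w\<in>cube m x d'. \<bar>g w - g x\<bar> < d" by metis
   have ev2: "\<forall>\<^sub>F s in nhds (x k). \<bar>s - x k\<bar> < min d d'"
    using d(1) d'(1) by (auto simp: eventually_nhds_metric dist_real_def intro!: exI[of _ "min d d'"])
   have "\<forall>\<^sub>F s in nhds (x k). dist (Q s) (pd i F y) < e"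
    using ev ev2
   proof eventually_elim
    case (elim s)
    have "x(k := s) \<in> cube m x d'"
     using elim x W openin_Euclidean_space_support[OF W elim(1)] d' by (auto simp: cube_def)
    then have "\<bar>z s - t0\<bar> < d" using z[OF elim(1)] d'(2) unfolding t0_def by fastforce
    then have "(x(k := s))(i := z s) \<in> cube m y d"
     using elim openin_Euclidean_space_support[OF W elim(1)] d(1) False i(1) by (auto simp: cube_def y_def)
    then show ?case using d(2) by (simp add: Q_def dist_real_def del: fun_upd_apply)
   qed
   then show "\<forall>\<^sub>F s in at (x k). dist (Q s) (pd i F y) < e" by (simp add: eventually_nhds_conv_at)
  qed
  have y_nz: "pd i F y \<noteq> 0" using Cpos[OF yC] by simp
  have lim: "((\<lambda>s. - (A s / (s - x k)) / Q s) \<longlongrightarrow> - pd k F y / pd i F y) (at (x k))"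
   by (intro tendsto_divide tendsto_minus A Q y_nz)
  have "\<forall>\<^sub>F s in at (x k). - (A s / (s - x k)) / Q s = (g (x(k := s)) - g (x(k := x k))) / (s - x k)"
   using ev[unfolded eventually_nhds_conv_at, THEN conjunct1]
  proof eventually_elim
   case (elim s)
   have "Q s > 0" unfolding Q_def by (rule Cpos, rule updC) (use z[OF elim] elim WC in auto)
   moreover have "(g (x(k := s)) - t0) * Q s = - A s" using z[OF elim] by (simp add: Q_def)
   ultimately have "g (x(k := s)) - t0 = - A s / Q s" by (simp add: field_simps)
   then show ?case by (simp add: t0_def divide_divide_eq_left mult.commute del: fun_upd_apply)
  qed
  from Lim_transform_eventually[OF lim this] show ?thesis
   unfolding has_field_derivative_iff using False by (simp add: D_def y_def t0_def del: fun_upd_apply)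
 qed
 \<comment> \<open>If \<open>g\<close> is of class \<open>r\<close>, then so are the functions
   \<open>D k\<close>, which are built from \<open>g\<close> and derivatives of \<open>F\<close>; as
   these are the derivatives of \<open>g\<close>, the class rises by one.\<close>
 have "C_diff m r W g" for r
 proof (induction r)
  case 0 show ?case using g_cont by (simp only: C_diff_0_iff[OF W])
 next
  case (Suc r)
  have comp: "C_diff m r W (\<lambda>x. pd k F (x(i := g x)))" if "k < m" for k
  proof (rule C_diff_compose[OF W C gC])
   show "C_diff m r C (pd k F)" using smooth_pd(1)[OF C FC that] by (simp add: smooth_def)
   show "C_diff m r W (\<lambda>x. (x(i := g x)) j)" for j
    by (cases "j = i") (auto simp: Suc C_diff_coordinate[OF W] simp del: C_diff.simps)
  qed
  have "C_diff m r W (D k)" if "k < m" for k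
  proof (cases "k = i")
   case True
   then have "D k = (\<lambda>x. 0)" by (auto simp: D_def)
   then show ?thesis using C_diff_const[OF W] by simp
  next
   case False
   have "C_diff m r W (\<lambda>x. - pd k F (x(i := g x)) * inverse (pd i F (x(i := g x))))"
    using Cpos gC by (intro C_diff_mult C_diff_minus C_diff_inverse W comp that i(1)) (auto simp del: fun_upd_apply dest!: Cpos gC)
   moreover have "D k = (\<lambda>x. - pd k F (x(i := g x)) * inverse (pd i F (x(i := g x))))"
    using False by (auto simp: D_def divide_inverse)
   ultimately show ?thesis by simp
  qed
  then show ?case unfolding C_diff_Suc_iff[OF W] using g_deriv g_cont by blast
 qed
 then have gs: "smooth m W g" by (simp add: smooth_def)
 have pdg: "pd k g x = D k x" if "x \<in> W" "k < m" for k x by (rule pd_eqI[OF g_deriv[OF that]])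
 show ?thesis
 proof (rule that[OF W _ _ gs])
  show "p \<in> W" unfolding W_def by (rule centre_in_cube[OF U p(1) \<delta>2(1)])
  show "W \<subseteq> U" using WC CU by blast
  show "\<forall>x\<in>W. x(i := g x) \<in> U \<and> F (x(i := g x)) = 0 \<and> pd i F (x(i := g x)) > 0"
   using gC CU g(2) Cpos by blast
  show "\<forall>x\<in>W. F x = 0 --> g x = x i"
  proof (intro ballI impI)
   fix x assume x: "x \<in> W" "F x = 0"
   then have "\<bar>x i - p i\<bar> < \<epsilon>" using i(1) \<delta>2(4) unfolding W_def cube_def by fastforce
   then show "g x = x i" using g_eqI[OF x(1)] x(2) by simp
  qed
  show "\<forall>x\<in>W. pd i g x = 0" using pdg i(1) by (simp add: D_def)
  show "\<forall>x\<in>W. \<forall>k<m. k \<noteq> i --> pd k g x = - pd k F (x(i := g x)) / pd i F (x(i := g x))"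
   using pdg by (simp add: D_def)
 qed
qed

text \<open>A negative derivative is made positive by passing to \<open>- F\<close>, which has the
  same zeros; the quotients of derivatives do not change.\<close>

lemma implicit_function:
 assumes U: "eopen m U" and F: "smooth m U F" and p: "p \<in> U" "F p = 0"
  and i: "i < m" "pd i F p \<noteq> 0"
 obtains W g where "eopen m W" "p \<in> W" "W \<subseteq> U" "smooth m W g"
  "\<forall>x\<in>W. x(i := g x) \<in> U \<and> F (x(i := g x)) = 0 \<and> pd i F (x(i := g x)) \<noteq> 0"
  "\<forall>x\<in>W. F x = 0 --> g x = x i" "\<forall>x\<in>W. pd i g x = 0"
  "\<forall>x\<in>W. \<forall>k<m. k \<noteq> i --> pd k g x = - pd k F (x(i := g x)) / pd i F (x(i := g x))"
proof (cases "pd i F p > 0")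
 case True
 obtain W g where W: "eopen m W" "p \<in> W" "W \<subseteq> U" "smooth m W g"
  "\<forall>x\<in>W. x(i := g x) \<in> U \<and> F (x(i := g x)) = 0 \<and> pd i F (x(i := g x)) > 0"
  "\<forall>x\<in>W. F x = 0 --> g x = x i" "\<forall>x\<in>W. pd i g x = 0"
  "\<forall>x\<in>W. \<forall>k<m. k \<noteq> i --> pd k g x = - pd k F (x(i := g x)) / pd i F (x(i := g x))"
  by (rule implicit_function_pos[OF U F p i(1) True])
 show ?thesis by (rule that[OF W(1-4) _ W(6-8)]) (use W(5) in fastforce)
next
 case False
 let ?F = "\<lambda>x. - F x"
 have pdm: "pd k ?F x = - pd k F x" if "x \<in> U" "k < m" for k x
  by (rule pd_eqI, rule DERIV_minus, rule smooth_pd(2)[OF U F that(2,1)])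
 have pos: "pd i ?F p > 0" using False i pdm[OF p(1) i(1)] by simp
 have F0: "?F p = 0" using p by simp
 obtain W g where W: "eopen m W" "p \<in> W" "W \<subseteq> U" "smooth m W g"
  "\<forall>x\<in>W. x(i := g x) \<in> U \<and> ?F (x(i := g x)) = 0 \<and> pd i ?F (x(i := g x)) > 0"
  "\<forall>x\<in>W. ?F x = 0 --> g x = x i" "\<forall>x\<in>W. pd i g x = 0"
  "\<forall>x\<in>W. \<forall>k<m. k \<noteq> i --> pd k g x = - pd k ?F (x(i := g x)) / pd i ?F (x(i := g x))"
  by (rule implicit_function_pos[OF U smooth_minus[OF U F] p(1) F0 i(1) pos])
 show ?thesis
 proof (rule that[OF W(1-4) _ _ W(7)])
  show "\<forall>x\<in>W. x(i := g x) \<in> U \<and> F (x(i := g x)) = 0 \<and> pd i F (x(i := g x)) \<noteq> 0"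
   using W(5) pdm[OF _ i(1)] by fastforce
  show "\<forall>x\<in>W. F x = 0 --> g x = x i" using W(6) by auto
  show "\<forall>x\<in>W. \<forall>k<m. k \<noteq> i --> pd k g x = - pd k F (x(i := g x)) / pd i F (x(i := g x))"
   using W(5,8) pdm i(1) by (auto simp del: fun_upd_apply)
 qed
qed

section \<open>Graded sheaves, morphisms and derivations\<close>

lemma linear_map_on_add: "linear_map_on S f ==> x \<in> S ==> y \<in> S ==> f (x + y) = f x + f y"
 and linear_map_on_scale: "linear_map_on S f ==> x \<in> S ==> f (c *\<^sub>R x) = c *\<^sub>R f x"
 by (auto simp: linear_map_on_def)

lemma linear_map_on_0: "linear_map_on S f ==> subspace S ==> f 0 = 0"
 using linear_map_on_scale[of S f 0 0] subspace_0 by force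

lemma linear_map_on_diff:
 assumes "linear_map_on S f" "subspace S" "x \<in> S" "y \<in> S"
 shows "f (x - y) = f x - f y"
 using linear_map_on_add[OF assms(1,3), of "(-1) *\<^sub>R y"] linear_map_on_scale[OF assms(1,4), of "-1"]
  subspace_scale[OF assms(2,4), of "-1"] by simp

lemma linear_map_on_sum:
 assumes "linear_map_on S f" "subspace S" "\<And>a. a \<in> A ==> x a \<in> S"
 shows "f (\<Sum>a\<in>A. x a) = (\<Sum>a\<in>A. f (x a))"
 using assms(3)
 by (induction A rule: infinite_finite_induct)
   (auto simp: linear_map_on_0[OF assms(1,2)] linear_map_on_add[OF assms(1)] subspace_sum[OF assms(2)])

locale gc_algebra =
 fixes A :: "int => 'a::real_vector set" and m :: "'a => 'a => 'a" and e :: 'a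
 assumes gca: "graded_commutative_algebra A m e"
begin

lemmas gca_conjuncts = gca[unfolded graded_commutative_algebra_def]

lemma sub: "subspace (A k)" using gca by (simp add: graded_commutative_algebra_def)
lemma closed: "x \<in> A j ==> y \<in> A k ==> m x y \<in> A (j + k)"
 using gca_conjuncts[THEN conjunct2, THEN conjunct2, THEN conjunct1] by blast
lemma lin_right: "x \<in> A j ==> linear_map_on (A k) (m x)" using gca by (simp add: graded_commutative_algebra_def)
lemma lin_left: "y \<in> A k ==> linear_map_on (A j) (\<lambda>x. m x y)" using gca by (simp add: graded_commutative_algebra_def)
lemma assoc: "x \<in> A i ==> y \<in> A j ==> z \<in> A k ==> m (m x y) z = m x (m y z)"
 using gca unfolding graded_commutative_algebra_def by blast
lemma one: "e \<in> A 0" "x \<in> A k ==> m e x = x" "x \<in> A k ==> m x e = x"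
 using gca unfolding graded_commutative_algebra_def by blast+
lemma comm: "x \<in> A j ==> y \<in> A k ==> m x y = ((-1) powi (j * k)) *\<^sub>R m y x"
 using gca unfolding graded_commutative_algebra_def by blast
lemma degree_unique:
 assumes "x \<in> A j" "x \<in> A k" "x \<noteq> 0"
 shows "j = k"
proof (rule ccontr)
 assume "j \<noteq> k"
 then have "A j \<inter> A k = {0}" using gca by (simp add: graded_commutative_algebra_def)
 then show False using assms by blast
qed

lemma zero [simp]: "0 \<in> A k" using sub subspace_0 by blast
lemma add: "x \<in> A k ==> y \<in> A k ==> x + y \<in> A k" using sub subspace_add by blast
lemma scale: "x \<in> A k ==> c *\<^sub>R x \<in> A k" using sub subspace_scale by blast
lemma sum: "(\<And>i. i \<in> I ==> f i \<in> A k) ==> (\<Sum>i\<in>I. f i) \<in> A k" using sub subspace_sum by metis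

lemma mult_0 [simp]: "x \<in> A j ==> m x 0 = 0" "x \<in> A j ==> m 0 x = 0"
 using linear_map_on_0[OF lin_right sub] linear_map_on_0[OF lin_left sub] by blast+
lemma add_right: "x \<in> A j ==> y \<in> A k ==> z \<in> A k ==> m x (y + z) = m x y + m x z"
 using linear_map_on_add[OF lin_right] by blast
lemma add_left: "x \<in> A j ==> y \<in> A j ==> z \<in> A k ==> m (x + y) z = m x z + m y z"
 using linear_map_on_add[OF lin_left] by blast
lemma scale_right: "x \<in> A j ==> y \<in> A k ==> m x (c *\<^sub>R y) = c *\<^sub>R m x y"
 using linear_map_on_scale[OF lin_right] by blast
lemma scale_left: "x \<in> A j ==> y \<in> A k ==> m (c *\<^sub>R x) y = c *\<^sub>R m x y"
 using linear_map_on_scale[OF lin_left] by blast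
lemma sum_right: "x \<in> A j ==> (\<And>i. i \<in> I ==> f i \<in> A k) ==> m x (\<Sum>i\<in>I. f i) = (\<Sum>i\<in>I. m x (f i))"
 using linear_map_on_sum[OF lin_right sub] by blast
lemma sum_left: "x \<in> A j ==> (\<And>i. i \<in> I ==> f i \<in> A k) ==> m (\<Sum>i\<in>I. f i) x = (\<Sum>i\<in>I. m (f i) x)"
 using linear_map_on_sum[OF lin_left sub] by blast

end

section \<open>Sections of a graded sheaf\<close>

locale gsheaf =
 fixes M :: "('p, 'a::real_vector) graded_space"
 assumes graded_sheaf: "graded_sheaf M"
begin

lemma gca: "gopen M U ==> gc_algebra (gsec M U) (gmult M U) (gone M U)"
 using graded_sheaf unfolding graded_sheaf_def gc_algebra_def by simp

lemma res_closed: "gopen M U ==> gopen M V ==> V \<subseteq> U ==> x \<in> gsec M U k ==> gres M U V x \<in> gsec M V k"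
 using graded_sheaf unfolding graded_sheaf_def by (simp add: image_subset_iff)

lemma res_linear: "gopen M U ==> gopen M V ==> V \<subseteq> U ==> linear_map_on (gsec M U k) (gres M U V)"
 using graded_sheaf unfolding graded_sheaf_def by simp

lemma res_one: "gopen M U ==> gopen M V ==> V \<subseteq> U ==> gres M U V (gone M U) = gone M V"
 using graded_sheaf unfolding graded_sheaf_def by simp

lemma res_mult: "gopen M U ==> gopen M V ==> V \<subseteq> U ==> x \<in> homogeneous M U ==> y \<in> homogeneous M U ==>
  gres M U V (gmult M U x y) = gmult M V (gres M U V x) (gres M U V y)"
 using graded_sheaf unfolding graded_sheaf_def by simp

lemma res_id: "gopen M U ==> x \<in> homogeneous M U ==> gres M U U x = x"
 using graded_sheaf unfolding graded_sheaf_def by simp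

lemma res_res: "gopen M U ==> gopen M V ==> gopen M W ==> W \<subseteq> V ==> V \<subseteq> U ==> x \<in> homogeneous M U ==>
  gres M V W (gres M U V x) = gres M U W x"
 using graded_sheaf unfolding graded_sheaf_def by simp

lemma glue:
 assumes "\<And>V. V \<in> \<U> ==> gopen M V \<and> s V \<in> gsec M V k"
  "\<And>V W. V \<in> \<U> ==> W \<in> \<U> ==> gres M V (V \<inter> W) (s V) = gres M W (V \<inter> W) (s W)"
 shows "\<exists>!x. x \<in> gsec M (\<Union>\<U>) k \<and> (\<forall>V\<in>\<U>. gres M (\<Union>\<U>) V x = s V)"
 by (rule graded_sheaf[unfolded graded_sheaf_def, THEN conjunct2, THEN conjunct2, THEN conjunct2, THEN conjunct2,
    THEN spec, of \<U>, THEN spec, of s, THEN spec, of k, THEN mp]) (use assms in blast)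

lemma subspace: "gopen M U ==> subspace (gsec M U k)"
 using gc_algebra.sub[OF gca] .

lemma zero_sec: "gopen M U ==> 0 \<in> gsec M U k"
 using subspace subspace_0 by blast

lemma mult_homogeneous: "gopen M U ==> x \<in> homogeneous M U ==> y \<in> homogeneous M U ==> gmult M U x y \<in> homogeneous M U"
 using gc_algebra.closed[OF gca] unfolding homogeneous_def by blast

lemma res_homogeneous: "gopen M U ==> gopen M V ==> V \<subseteq> U ==> x \<in> homogeneous M U ==> gres M U V x \<in> homogeneous M V"
 using res_closed unfolding homogeneous_def by blast

text \<open>The restrictions of \<open>x\<close> form a compatible family, which both
  \<open>x\<close> and \<open>y\<close> glue; the gluing is unique.\<close>

lemma sections_eqI:
 assumes "\<And>i. i \<in> I ==> gopen M (U i)" "x \<in> gsec M (\<Union>i\<in>I. U i) k" "y \<in> gsec M (\<Union>i\<in>I. U i) k"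
  "\<And>i. i \<in> I ==> gres M (\<Union>i\<in>I. U i) (U i) x = gres M (\<Union>i\<in>I. U i) (U i) y"
 shows "x = y"
proof -
 let ?W = "\<Union>i\<in>I. U i"
 have W: "gopen M ?W" using assms(1) by (intro openin_Union) auto
 have x: "x \<in> homogeneous M ?W" using assms(2) by (auto simp: homogeneous_def)
 define P where "P z \<longleftrightarrow> z \<in> gsec M (\<Union>(U ` I)) k \<and> (\<forall>V\<in>U ` I. gres M (\<Union>(U ` I)) V z = gres M ?W V x)" for z
 have "\<exists>!z. P z"
  unfolding P_def
 proof (rule glue)
  fix V assume "V \<in> U ` I" then show "gopen M V \<and> gres M ?W V x \<in> gsec M V k"
   using assms(1,2) W by (auto intro!: res_closed)
 next
  fix V V' assume "V \<in> U ` I" "V' \<in> U ` I"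
  then show "gres M V (V \<inter> V') (gres M ?W V x) = gres M V' (V \<inter> V') (gres M ?W V' x)"
   using assms(1) W x by (subst (1 2) res_res) auto
 qed
 moreover have "P x" using assms(2) by (simp add: P_def)
 moreover have "P y" using assms(3,4) by (simp add: P_def)
 ultimately show ?thesis by blast
qed

text \<open>The sheaf axiom attaches one section to each set of a cover, whereas different indices
  may have the same set. Compatibility forces their sections to agree, so any index may be
  chosen.\<close>

lemma glue_indexed:
 assumes "\<And>i. i \<in> I ==> gopen M (U i)" "\<And>i. i \<in> I ==> s i \<in> gsec M (U i) k"
  "\<And>i j. i \<in> I ==> j \<in> I ==> gres M (U i) (U i \<inter> U j) (s i) = gres M (U j) (U i \<inter> U j) (s j)"
 shows "\<exists>x. x \<in> gsec M (\<Union>i\<in>I. U i) k \<and> (\<forall>i\<in>I. gres M (\<Union>i\<in>I. U i) (U i) x = s i)"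
proof -
 define t where "t V = s (SOME i. i \<in> I \<and> U i = V)" for V
 have t: "t (U i) = s i" if "i \<in> I" for i
 proof -
  let ?j = "SOME j. j \<in> I \<and> U j = U i"
  have j: "?j \<in> I \<and> U ?j = U i" using someI[of "\<lambda>j. j \<in> I \<and> U j = U i" i] that by simp
  have "gres M (U i) (U i) (s ?j) = gres M (U i) (U i) (s i)"
   using assms(3)[OF j[THEN conjunct1] that] j by simp
  moreover have "s ?j \<in> homogeneous M (U i)" "s i \<in> homogeneous M (U i)"
   using assms(2)[OF j[THEN conjunct1]] assms(2)[OF that] j by (auto simp: homogeneous_def)
  ultimately show ?thesis using res_id[OF assms(1)[OF that]] by (simp add: t_def)
 qed
 have "\<exists>!z. z \<in> gsec M (\<Union>(U ` I)) k \<and> (\<forall>V\<in>U ` I. gres M (\<Union>(U ` I)) V z = t V)"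
  by (rule glue) (use assms t in auto)
 then show ?thesis using t by auto
qed

end

lemma homogeneousI: "x \<in> gsec M U k ==> x \<in> homogeneous M U"
 by (auto simp: homogeneous_def)

lemma homogeneousE: "x \<in> homogeneous M U ==> (\<And>k. x \<in> gsec M U k ==> P) ==> P"
 by (auto simp: homogeneous_def)

section \<open>Morphisms and their composition\<close>

lemma mors_simps: "\<phi> \<in> mors M N ==> mdom \<phi> = M" "\<phi> \<in> mors M N ==> mcod \<phi> = N"
 by (auto simp: mors_def)

locale morphism =
 fixes M :: "('p, 'a::real_vector) graded_space" and N :: "('q, 'b::real_vector) graded_space" and \<phi>
 assumes mor: "\<phi> \<in> mors M N"
begin

lemma dom [simp]: "mdom \<phi> = M" and cod [simp]: "mcod \<phi> = N" using mor by (auto simp: mors_def)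
lemma bmap_ext: "bmap \<phi> \<in> extensional (points M)" using mor by (auto simp: mors_def)
lemma cont: "continuous_map (base M) (base N) (bmap \<phi>)" using mor by (auto simp: mors_def)
lemma bmap_closed: "x \<in> points M ==> bmap \<phi> x \<in> points N" using continuous_map_image_subset_topspace[OF cont] by blast
lemma preim_eq: "preim \<phi> V = {x \<in> points M. bmap \<phi> x \<in> V}" by (simp add: preim_def)
lemma preim_open: "gopen N V ==> gopen M (preim \<phi> V)"
 using openin_continuous_map_preimage[OF cont] by (simp add: preim_eq)
lemma preim_mono: "V \<subseteq> W ==> preim \<phi> V \<subseteq> preim \<phi> W" by (auto simp: preim_def)
lemma junk: "\<not> (gopen N V \<and> f \<in> homogeneous N V) ==> pull \<phi> V f = 0" using mor by (auto simp: mors_def)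
lemma closed: "gopen N V ==> f \<in> gsec N V k ==> pull \<phi> V f \<in> gsec M (preim \<phi> V) k"
 using mor by (simp add: mors_def image_subset_iff)
lemma linear: "gopen N V ==> linear_map_on (gsec N V k) (pull \<phi> V)"
 using mor by (simp add: mors_def)
lemma one: "gopen N V ==> pull \<phi> V (gone N V) = gone M (preim \<phi> V)"
 using mor by (simp add: mors_def)
lemma mult: "gopen N V ==> f \<in> homogeneous N V ==> g \<in> homogeneous N V ==>
  pull \<phi> V (gmult N V f g) = gmult M (preim \<phi> V) (pull \<phi> V f) (pull \<phi> V g)"
 using mor by (simp add: mors_def)
lemma res: "gopen N V ==> gopen N W ==> W \<subseteq> V ==> f \<in> homogeneous N V ==>
  pull \<phi> W (gres N V W f) = gres M (preim \<phi> V) (preim \<phi> W) (pull \<phi> V f)"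
 using mor by (simp add: mors_def)
lemma homog: "gopen N V ==> f \<in> homogeneous N V ==> pull \<phi> V f \<in> homogeneous M (preim \<phi> V)"
 using closed unfolding homogeneous_def by blast
lemma add: "gopen N V ==> f \<in> gsec N V k ==> g \<in> gsec N V k ==> pull \<phi> V (f + g) = pull \<phi> V f + pull \<phi> V g"
 using linear_map_on_add[OF linear] by blast
lemma scale: "gopen N V ==> f \<in> gsec N V k ==> pull \<phi> V (c *\<^sub>R f) = c *\<^sub>R pull \<phi> V f"
 using linear_map_on_scale[OF linear] by blast
text \<open>The normalization of pullbacks covers the case in which \<open>0\<close> is no section
  over an open set, so the rule has no side condition.\<close>

lemma pull_0 [simp]: "pull \<phi> V 0 = 0"
proof (cases "gopen N V \<and> 0 \<in> homogeneous N V")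
 case True
 then obtain k where "0 \<in> gsec N V k" by (auto simp: homogeneous_def)
 then show ?thesis using scale[of V 0 k 0] True by simp
qed (rule junk)

end

lemma morphismI: "\<phi> \<in> mors M N ==> morphism M N \<phi>" by (simp add: morphism_def)

lemma mors_eqI:
 assumes "\<phi> \<in> mors M N" "\<psi> \<in> mors M N" "\<And>x. x \<in> points M ==> bmap \<phi> x = bmap \<psi> x"
  "\<And>V f k. gopen N V ==> f \<in> gsec N V k ==> pull \<phi> V f = pull \<psi> V f"
 shows "\<phi> = \<psi>"
proof -
 interpret p: morphism M N \<phi> by (rule morphismI[OF assms(1)])
 interpret q: morphism M N \<psi> by (rule morphismI[OF assms(2)])
 have "bmap \<phi> = bmap \<psi>" by (rule extensionalityI[OF p.bmap_ext q.bmap_ext assms(3)])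
 moreover have "pull \<phi> V f = pull \<psi> V f" for V f
  using assms(4) p.junk q.junk unfolding homogeneous_def by (metis UN_E)
 then have "pull \<phi> = pull \<psi>" by blast
 ultimately show ?thesis by (intro graded_map.equality) auto
qed

lemma morsI:
 assumes "mdom \<phi> = M" "mcod \<phi> = N" "bmap \<phi> \<in> extensional (points M)" "continuous_map (base M) (base N) (bmap \<phi>)"
  "\<And>V f. \<not> (gopen N V \<and> f \<in> homogeneous N V) ==> pull \<phi> V f = 0"
  "\<And>V k f. gopen N V ==> f \<in> gsec N V k ==> pull \<phi> V f \<in> gsec M (preim \<phi> V) k"
  "\<And>V k. gopen N V ==> linear_map_on (gsec N V k) (pull \<phi> V)"
  "\<And>V. gopen N V ==> pull \<phi> V (gone N V) = gone M (preim \<phi> V)"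
  "\<And>V f g. gopen N V ==> f \<in> homogeneous N V ==> g \<in> homogeneous N V ==>
    pull \<phi> V (gmult N V f g) = gmult M (preim \<phi> V) (pull \<phi> V f) (pull \<phi> V g)"
  "\<And>V W f. gopen N V ==> gopen N W ==> W \<subseteq> V ==> f \<in> homogeneous N V ==>
    pull \<phi> W (gres N V W f) = gres M (preim \<phi> V) (preim \<phi> W) (pull \<phi> V f)"
 shows "\<phi> \<in> mors M N"
 unfolding mors_def using assms by (simp add: image_subset_iff)

lemma preim_comp:
 assumes "\<phi> \<in> mors M N" "\<psi> \<in> mors N L"
 shows "preim (\<psi> \<odot> \<phi>) V = preim \<phi> (preim \<psi> V)"
proof -
 interpret p: morphism M N \<phi> by (rule morphismI[OF assms(1)])
 interpret q: morphism N L \<psi> by (rule morphismI[OF assms(2)])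
 show ?thesis using p.bmap_closed by (auto simp: preim_def comp_mor_def)
qed

lemma comp_simps [simp]: "mdom (\<psi> \<odot> \<phi>) = mdom \<phi>" "mcod (\<psi> \<odot> \<phi>) = mcod \<psi>"
 "pull (\<psi> \<odot> \<phi>) V f = pull \<phi> (preim \<psi> V) (pull \<psi> V f)"
 by (simp_all add: comp_mor_def)

lemma comp_bmap: "x \<in> points (mdom \<phi>) ==> bmap (\<psi> \<odot> \<phi>) x = bmap \<psi> (bmap \<phi> x)"
 by (simp add: comp_mor_def)

lemma comp_mors:
 assumes "\<phi> \<in> mors M N" "\<psi> \<in> mors N L"
 shows "\<psi> \<odot> \<phi> \<in> mors M L"
proof -
 interpret p: morphism M N \<phi> by (rule morphismI[OF assms(1)])
 interpret q: morphism N L \<psi> by (rule morphismI[OF assms(2)])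
 note pc = preim_comp[OF assms]
 show ?thesis
 proof (rule morsI)
  show "bmap (\<psi> \<odot> \<phi>) \<in> extensional (points M)" by (simp add: comp_mor_def)
  have "continuous_map (base M) (base L) (bmap \<psi> \<circ> bmap \<phi>)" by (rule continuous_map_compose[OF p.cont q.cont])
  then show "continuous_map (base M) (base L) (bmap (\<psi> \<odot> \<phi>))"
   by (rule continuous_map_eq) (simp add: comp_mor_def)
 next
  fix V f assume "\<not> (gopen L V \<and> f \<in> homogeneous L V)"
  then show "pull (\<psi> \<odot> \<phi>) V f = 0" using q.junk by simp
 next
  fix V k f assume "gopen L V" "f \<in> gsec L V k"
  then show "pull (\<psi> \<odot> \<phi>) V f \<in> gsec M (preim (\<psi> \<odot> \<phi>) V) k"
   unfolding pc by (simp add: p.closed q.closed q.preim_open)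
 next
  fix V k assume V: "gopen L V"
  show "linear_map_on (gsec L V k) (pull (\<psi> \<odot> \<phi>) V)"
   unfolding linear_map_on_def
   by (simp add: q.add[OF V] q.scale[OF V] p.add[OF q.preim_open[OF V] q.closed[OF V] q.closed[OF V]]
     p.scale[OF q.preim_open[OF V] q.closed[OF V]])
 next
  fix V assume "gopen L V"
  then show "pull (\<psi> \<odot> \<phi>) V (gone L V) = gone M (preim (\<psi> \<odot> \<phi>) V)"
   unfolding pc by (simp add: p.one q.one q.preim_open)
 next
  fix V f g assume "gopen L V" "f \<in> homogeneous L V" "g \<in> homogeneous L V"
  then show "pull (\<psi> \<odot> \<phi>) V (gmult L V f g) = gmult M (preim (\<psi> \<odot> \<phi>) V) (pull (\<psi> \<odot> \<phi>) V f) (pull (\<psi> \<odot> \<phi>) V g)"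
   unfolding pc by (simp add: p.mult q.mult q.preim_open q.homog)
 next
  fix V W f assume "gopen L V" "gopen L W" "W \<subseteq> V" "f \<in> homogeneous L V"
  then show "pull (\<psi> \<odot> \<phi>) W (gres L V W f) = gres M (preim (\<psi> \<odot> \<phi>) V) (preim (\<psi> \<odot> \<phi>) W) (pull (\<psi> \<odot> \<phi>) V f)"
   unfolding pc by (simp add: p.res q.res q.preim_open q.homog q.preim_mono)
 qed simp_all
qed

lemma comp_assoc:
 assumes "\<phi> \<in> mors M N" "\<psi> \<in> mors N L" "\<omega> \<in> mors L K"
 shows "(\<omega> \<odot> \<psi>) \<odot> \<phi> = \<omega> \<odot> (\<psi> \<odot> \<phi>)"
proof (rule mors_eqI)
 show "(\<omega> \<odot> \<psi>) \<odot> \<phi> \<in> mors M K" "\<omega> \<odot> (\<psi> \<odot> \<phi>) \<in> mors M K"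
  using assms by (meson comp_mors)+
next
 fix x assume "x \<in> points M"
 then show "bmap ((\<omega> \<odot> \<psi>) \<odot> \<phi>) x = bmap (\<omega> \<odot> (\<psi> \<odot> \<phi>)) x"
  using morphism.bmap_closed[OF morphismI[OF assms(1)]] assms by (simp add: comp_bmap mors_simps)
next
 fix V f k
 show "pull ((\<omega> \<odot> \<psi>) \<odot> \<phi>) V f = pull (\<omega> \<odot> (\<psi> \<odot> \<phi>)) V f"
  by (simp add: preim_comp[OF assms(2,3)])
qed

lemma preim_id: "V \<subseteq> points M ==> preim (id_mor M) V = V"
 by (auto simp: preim_def id_mor_def)

lemma id_simps [simp]: "mdom (id_mor M) = M" "mcod (id_mor M) = M"
 by (simp_all add: id_mor_def)

lemma id_pull: "gopen M V ==> f \<in> homogeneous M V ==> pull (id_mor M) V f = f"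
 by (simp add: id_mor_def)

lemma id_mors:
 assumes "graded_sheaf M" shows "id_mor M \<in> mors M M"
proof -
 interpret gsheaf M by (simp add: gsheaf_def assms)
 show ?thesis
 proof (rule morsI)
  show "continuous_map (base M) (base M) (bmap (id_mor M))"
   by (rule continuous_map_eq[OF continuous_map_id]) (simp add: id_mor_def)
 next
  fix V f k assume "gopen M V" "f \<in> gsec M V k"
  then show "pull (id_mor M) V f \<in> gsec M (preim (id_mor M) V) k"
   by (simp add: id_pull homogeneousI preim_id openin_subset)
 next
  fix V k assume V: "gopen M V"
  show "linear_map_on (gsec M V k) (pull (id_mor M) V)"
   unfolding linear_map_on_def
   by (simp add: id_pull[OF V homogeneousI[of _ M V k]] subspace_add[OF subspace[OF V, of k]] subspace_scale[OF subspace[OF V, of k]])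
 next
  fix V assume V: "gopen M V"
  have "gone M V \<in> homogeneous M V" using gc_algebra.one(1)[OF gca[OF V]] by (rule homogeneousI)
  then show "pull (id_mor M) V (gone M V) = gone M (preim (id_mor M) V)"
   using V by (simp add: id_pull preim_id openin_subset)
 next
  fix V f g assume "gopen M V" "f \<in> homogeneous M V" "g \<in> homogeneous M V"
  then show "pull (id_mor M) V (gmult M V f g) = gmult M (preim (id_mor M) V) (pull (id_mor M) V f) (pull (id_mor M) V g)"
   by (simp add: id_pull preim_id openin_subset mult_homogeneous)
 next
  fix V W f assume "gopen M V" "gopen M W" "W \<subseteq> V" "f \<in> homogeneous M V"
  then show "pull (id_mor M) W (gres M V W f) = gres M (preim (id_mor M) V) (preim (id_mor M) W) (pull (id_mor M) V f)"
   by (simp add: id_pull preim_id openin_subset res_homogeneous)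
 qed (auto simp: id_mor_def)
qed

lemma id_comp:
 assumes "\<phi> \<in> mors M N"
 shows "id_mor N \<odot> \<phi> = \<phi>"
proof -
 interpret p: morphism M N \<phi> by (rule morphismI[OF assms])
 have *: "preim \<phi> V = preim \<phi> (V \<inter> points N)" for V using p.bmap_closed by (auto simp: p.preim_eq)
 show ?thesis
 proof (rule graded_map.equality)
  show "bmap (id_mor N \<odot> \<phi>) = bmap \<phi>"
   using p.bmap_closed by (intro extensionalityI[OF _ p.bmap_ext]) (auto simp: comp_mor_def id_mor_def)
  show "pull (id_mor N \<odot> \<phi>) = pull \<phi>"
  proof (intro ext)
   fix V f show "pull (id_mor N \<odot> \<phi>) V f = pull \<phi> V f"
   proof (cases "gopen N V \<and> f \<in> homogeneous N V")
    case True then show ?thesis by (simp add: id_pull preim_id openin_subset)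
   next
    case False then show ?thesis using p.junk by (auto simp: id_mor_def)
   qed
  qed
 qed auto
qed

lemma comp_id:
 assumes "graded_sheaf M" "\<phi> \<in> mors M N"
 shows "\<phi> \<odot> id_mor M = \<phi>"
proof (rule mors_eqI[OF comp_mors[OF id_mors[OF assms(1)] assms(2)] assms(2)])
 interpret p: morphism M N \<phi> by (rule morphismI[OF assms(2)])
 fix x assume "x \<in> points M" then show "bmap (\<phi> \<odot> id_mor M) x = bmap \<phi> x" by (simp add: comp_bmap id_mor_def)
next
 interpret p: morphism M N \<phi> by (rule morphismI[OF assms(2)])
 fix V f k assume "gopen N V" "f \<in> gsec N V k"
 then show "pull (\<phi> \<odot> id_mor M) V f = pull \<phi> V f"
  by (simp add: id_pull p.preim_open p.homog homogeneousI)
qed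

section \<open>Derivations along morphisms\<close>

locale derivation =
 fixes M :: "('p, 'a::real_vector) graded_space" and N :: "('q, 'b::real_vector) graded_space" and \<phi> k D
 assumes mor: "\<phi> \<in> mors M N" and der: "D \<in> ders \<phi> k"
begin

sublocale morphism M N \<phi> by (rule morphismI[OF mor])

lemma der_junk: "\<not> (gopen N V \<and> f \<in> homogeneous N V) ==> D V f = 0"
 using der unfolding derivations_along_def Let_def dom cod by blast
lemma der_closed: "gopen N V ==> f \<in> gsec N V j ==> D V f \<in> gsec M (preim \<phi> V) (j + k)"
 using der unfolding derivations_along_def Let_def dom cod by (simp add: image_subset_iff)
lemma der_linear: "gopen N V ==> linear_map_on (gsec N V j) (D V)"
 using der unfolding derivations_along_def Let_def dom cod by simp
lemma leibniz: "gopen N V ==> f \<in> gsec N V j ==> g \<in> homogeneous N V ==>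
  D V (gmult N V f g) = gmult M (preim \<phi> V) (D V f) (pull \<phi> V g)
       + ((-1) powi (k * j)) *\<^sub>R gmult M (preim \<phi> V) (pull \<phi> V f) (D V g)"
 using der unfolding derivations_along_def Let_def dom cod by simp
lemma der_res: "gopen N V ==> gopen N W ==> W \<subseteq> V ==> f \<in> homogeneous N V ==>
  D W (gres N V W f) = gres M (preim \<phi> V) (preim \<phi> W) (D V f)"
 using der unfolding derivations_along_def Let_def dom cod by simp
lemma der_homog: "gopen N V ==> f \<in> homogeneous N V ==> D V f \<in> homogeneous M (preim \<phi> V)"
 using der_closed unfolding homogeneous_def by blast
lemma der_add: "gopen N V ==> f \<in> gsec N V j ==> g \<in> gsec N V j ==> D V (f + g) = D V f + D V g"
 using linear_map_on_add[OF der_linear] by blast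
lemma der_scale: "gopen N V ==> f \<in> gsec N V j ==> D V (c *\<^sub>R f) = c *\<^sub>R D V f"
 using linear_map_on_scale[OF der_linear] by blast
lemma der_0 [simp]: "D V 0 = 0"
proof (cases "gopen N V \<and> 0 \<in> homogeneous N V")
 case True
 then obtain j where "0 \<in> gsec N V j" by (auto simp: homogeneous_def)
 then show ?thesis using der_scale[of V 0 j 0] True by simp
qed (rule der_junk)

end

lemma derivationI: "\<phi> \<in> mors M N ==> D \<in> ders \<phi> k ==> derivation M N \<phi> k D"
 by (simp add: derivation_def)

lemma derivations_alongI:
 assumes "\<phi> \<in> mors M N"
  "\<And>V f. \<not> (gopen N V \<and> f \<in> homogeneous N V) ==> D V f = 0"
  "\<And>V f j. gopen N V ==> f \<in> gsec N V j ==> D V f \<in> gsec M (preim \<phi> V) (j + k)"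
  "\<And>V j. gopen N V ==> linear_map_on (gsec N V j) (D V)"
  "\<And>V f g j. gopen N V ==> f \<in> gsec N V j ==> g \<in> homogeneous N V ==>
   D V (gmult N V f g) = gmult M (preim \<phi> V) (D V f) (pull \<phi> V g)
       + ((-1) powi (k * j)) *\<^sub>R gmult M (preim \<phi> V) (pull \<phi> V f) (D V g)"
  "\<And>V W f. gopen N V ==> gopen N W ==> W \<subseteq> V ==> f \<in> homogeneous N V ==>
    D W (gres N V W f) = gres M (preim \<phi> V) (preim \<phi> W) (D V f)"
 shows "D \<in> ders \<phi> k"
 unfolding derivations_along_def Let_def mors_simps[OF assms(1)]
 using assms(2-) by (simp add: image_subset_iff)

lemma derivations_eqI:
 assumes "\<phi> \<in> mors M N" "D \<in> ders \<phi> k" "D' \<in> ders \<phi> k'"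
  "\<And>V f j. gopen N V ==> f \<in> gsec N V j ==> D V f = D' V f"
 shows "D = D'"
proof (intro ext)
 interpret d: derivation M N \<phi> k D by (rule derivationI[OF assms(1,2)])
 interpret d': derivation M N \<phi> k' D' by (rule derivationI[OF assms(1,3)])
 fix V f show "D V f = D' V f"
  using assms(4) d.der_junk d'.der_junk unfolding homogeneous_def by (metis UN_E)
qed

lemma zero_derivation:
 assumes "graded_sheaf M" "\<phi> \<in> mors M N"
 shows "0 \<in> ders \<phi> k"
proof -
 interpret M: gsheaf M by (simp add: gsheaf_def assms)
 interpret morphism M N \<phi> by (rule morphismI[OF assms(2)])
 show ?thesis
 proof (rule derivations_alongI[OF assms(2)])
  fix V f g j assume V: "gopen N V" "f \<in> gsec N V j" "g \<in> homogeneous N V"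
  interpret gc_algebra "gsec M (preim \<phi> V)" "gmult M (preim \<phi> V)" "gone M (preim \<phi> V)"
   by (rule M.gca[OF preim_open[OF V(1)]])
  from V(3) obtain l where "g \<in> gsec N V l" by (rule homogeneousE)
  then show "0 V (gmult N V f g) = gmult M (preim \<phi> V) (0 V f) (pull \<phi> V g)
       + ((-1) powi (k * j)) *\<^sub>R gmult M (preim \<phi> V) (pull \<phi> V f) (0 V g)"
   using mult_0(1)[OF morphism.closed[OF morphismI[OF assms(2)] V(1,2)]] mult_0(2)[OF morphism.closed[OF morphismI[OF assms(2)] V(1)]]
   by simp
 next
  fix V W f assume V: "gopen N V" "gopen N W" "W \<subseteq> V"
  have "gres M (preim \<phi> V) (preim \<phi> W) 0 = 0"
   by (rule linear_map_on_0[OF M.res_linear M.subspace]) (use V preim_open preim_mono in auto)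
  then show "0 W (gres N V W f) = gres M (preim \<phi> V) (preim \<phi> W) (0 V f)" by simp
 qed (auto simp: linear_map_on_def M.zero_sec preim_open)
qed

lemma tangent_derivation:
 assumes "\<phi> \<in> mors M N" "\<psi> \<in> mors N L" "D \<in> ders \<phi> k"
 shows "tangent \<psi> D \<in> ders (\<psi> \<odot> \<phi>) k"
proof -
 interpret d: derivation M N \<phi> k D by (rule derivationI[OF assms(1,3)])
 interpret q: morphism N L \<psi> by (rule morphismI[OF assms(2)])
 note pc = preim_comp[OF assms(1,2)]
 show ?thesis
 proof (rule derivations_alongI[OF comp_mors[OF assms(1,2)]])
  fix V f assume "\<not> (gopen L V \<and> f \<in> homogeneous L V)"
  then show "tangent \<psi> D V f = 0" using q.junk by (simp add: tangent_def)
 next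
  fix V f j assume "gopen L V" "f \<in> gsec L V j"
  then show "tangent \<psi> D V f \<in> gsec M (preim (\<psi> \<odot> \<phi>) V) (j + k)"
   unfolding pc tangent_def by (simp add: d.der_closed q.closed q.preim_open)
 next
  fix V j assume V: "gopen L V"
  show "linear_map_on (gsec L V j) (tangent \<psi> D V)"
   unfolding linear_map_on_def tangent_def
   by (simp add: q.add[OF V] q.scale[OF V] d.der_add[OF q.preim_open[OF V] q.closed[OF V] q.closed[OF V]]
     d.der_scale[OF q.preim_open[OF V] q.closed[OF V]])
 next
  fix V f g j assume "gopen L V" "f \<in> gsec L V j" "g \<in> homogeneous L V"
  then show "tangent \<psi> D V (gmult L V f g) = gmult M (preim (\<psi> \<odot> \<phi>) V) (tangent \<psi> D V f) (pull (\<psi> \<odot> \<phi>) V g)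
       + ((-1) powi (k * j)) *\<^sub>R gmult M (preim (\<psi> \<odot> \<phi>) V) (pull (\<psi> \<odot> \<phi>) V f) (tangent \<psi> D V g)"
   unfolding pc tangent_def by (simp add: q.mult homogeneousI d.leibniz[of _ _ j] q.preim_open q.homog q.closed)
 next
  fix V W f assume "gopen L V" "gopen L W" "W \<subseteq> V" "f \<in> homogeneous L V"
  then show "tangent \<psi> D W (gres L V W f) = gres M (preim (\<psi> \<odot> \<phi>) V) (preim (\<psi> \<odot> \<phi>) W) (tangent \<psi> D V f)"
   unfolding pc tangent_def by (simp add: d.der_res q.res q.preim_open q.homog q.preim_mono)
 qed
qed

lemma precomp_derivation:
 assumes "\<kappa> \<in> mors K M" "\<phi> \<in> mors M N" "D \<in> ders \<phi> k" "graded_sheaf M"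
 shows "precomp \<phi> D \<kappa> \<in> ders (\<phi> \<odot> \<kappa>) k"
proof -
 interpret d: derivation M N \<phi> k D by (rule derivationI[OF assms(2,3)])
 interpret q: morphism K M \<kappa> by (rule morphismI[OF assms(1)])
 note pc = preim_comp[OF assms(1,2)]
 show ?thesis
 proof (rule derivations_alongI[OF comp_mors[OF assms(1,2)]])
  fix V f assume "\<not> (gopen N V \<and> f \<in> homogeneous N V)"
  then show "precomp \<phi> D \<kappa> V f = 0" using d.der_junk by (simp add: precomp_def)
 next
  fix V f j assume "gopen N V" "f \<in> gsec N V j"
  then show "precomp \<phi> D \<kappa> V f \<in> gsec K (preim (\<phi> \<odot> \<kappa>) V) (j + k)"
   unfolding pc precomp_def by (simp add: d.der_closed q.closed d.preim_open)
 next
  fix V j assume V: "gopen N V"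
  show "linear_map_on (gsec N V j) (precomp \<phi> D \<kappa> V)"
   unfolding linear_map_on_def precomp_def
   by (simp add: d.der_add[OF V] d.der_scale[OF V] q.add[OF d.preim_open[OF V] d.der_closed[OF V] d.der_closed[OF V]]
     q.scale[OF d.preim_open[OF V] d.der_closed[OF V]])
 next
  fix V f g j assume V: "gopen N V" and f: "f \<in> gsec N V j" and g: "g \<in> homogeneous N V"
  from g obtain l where gl: "g \<in> gsec N V l" by (rule homogeneousE)
  show "precomp \<phi> D \<kappa> V (gmult N V f g) = gmult K (preim (\<phi> \<odot> \<kappa>) V) (precomp \<phi> D \<kappa> V f) (pull (\<phi> \<odot> \<kappa>) V g)
       + ((-1) powi (k * j)) *\<^sub>R gmult K (preim (\<phi> \<odot> \<kappa>) V) (pull (\<phi> \<odot> \<kappa>) V f) (precomp \<phi> D \<kappa> V g)"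
  proof -
   interpret a: gc_algebra "gsec M (preim \<phi> V)" "gmult M (preim \<phi> V)" "gone M (preim \<phi> V)"
    by (rule gsheaf.gca[OF gsheaf.intro[OF assms(4)] d.preim_open[OF V]])
   have 1: "gmult M (preim \<phi> V) (D V f) (pull \<phi> V g) \<in> gsec M (preim \<phi> V) (j + k + l)"
    by (intro a.closed d.der_closed d.closed V f gl)
   have 2: "gmult M (preim \<phi> V) (pull \<phi> V f) (D V g) \<in> gsec M (preim \<phi> V) (j + k + l)"
    using a.closed[OF d.closed[OF V f] d.der_closed[OF V gl]] by (simp add: ac_simps)
   show ?thesis
    unfolding pc precomp_def
    by (simp add: d.leibniz[OF V f g] q.add[OF d.preim_open[OF V] 1 a.scale[OF 2]] q.scale[OF d.preim_open[OF V] 2]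
      q.mult d.preim_open[OF V] d.der_homog[OF V] d.homog[OF V] g homogeneousI[OF f])
  qed
 next
  fix V W f assume "gopen N V" "gopen N W" "W \<subseteq> V" "f \<in> homogeneous N V"
  then show "precomp \<phi> D \<kappa> W (gres N V W f) = gres K (preim (\<phi> \<odot> \<kappa>) V) (preim (\<phi> \<odot> \<kappa>) W) (precomp \<phi> D \<kappa> V f)"
   unfolding pc precomp_def by (simp add: d.der_res q.res d.preim_open d.der_homog d.preim_mono)
 qed
qed

section \<open>Open subspaces and open embeddings\<close>

lemma open_subspace_simps [simp]: "base (open_subspace M U) = subtopology (base M) U"
 "gsec (open_subspace M U) = gsec M" "gmult (open_subspace M U) = gmult M"
 "gone (open_subspace M U) = gone M" "gres (open_subspace M U) = gres M"
 by (simp_all add: open_subspace_def)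

lemma openin_open_subspace:
 "gopen M U ==> openin (subtopology (base M) U) V \<longleftrightarrow> gopen M V \<and> V \<subseteq> U"
 by (rule openin_open_subtopology)

lemma homogeneous_open_subspace [simp]: "homogeneous (open_subspace M U) = homogeneous M"
 by (auto simp: homogeneous_def)

lemma graded_sheaf_open_subspace:
 assumes "graded_sheaf M" "gopen M U"
 shows "graded_sheaf (open_subspace M U)"
proof -
 interpret gsheaf M by (simp add: gsheaf_def assms)
 show ?thesis
  unfolding graded_sheaf_def open_subspace_simps homogeneous_open_subspace openin_open_subspace[OF assms(2)]
 proof (intro conjI, goal_cases)
  case 1 then show ?case using gca by (simp add: gc_algebra_def)
 next
  case 2 then show ?case by (auto simp: res_closed res_linear res_one res_mult)
 next
  case 3 then show ?case by (simp add: res_id)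
 next
  case 4 then show ?case by (simp add: res_res)
 next
  case 5 then show ?case by (intro allI impI glue) auto
 qed
qed

definition incl :: "('p, 'a::real_vector) graded_space => 'p set => ('p, 'a, 'p, 'a) graded_map" where
 "incl M U = \<lparr>mdom = open_subspace M U, mcod = M, bmap = restrict id U,
   pull = (\<lambda>V f. if gopen M V \<and> f \<in> homogeneous M V then gres M V (V \<inter> U) f else 0)\<rparr>"

text \<open>An isomorphism onto an open subspace, expressed by bijective pullbacks over images of
  open sets, so that no inverse morphism has to be carried along. Both charts and inclusions of open
  subspaces are of this kind.\<close>

definition open_emb :: "('p, 'a::real_vector) graded_space => ('q, 'b::real_vector) graded_space =>
  ('p, 'a, 'q, 'b) graded_map => bool" where
 "open_emb M N \<phi> \<longleftrightarrow> \<phi> \<in> mors M N \<and> inj_on (bmap \<phi>) (points M) \<and>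
   (\<forall>V. gopen M V --> gopen N (bmap \<phi> ` V) \<and>
    (\<forall>k. bij_betw (pull \<phi> (bmap \<phi> ` V)) (gsec N (bmap \<phi> ` V) k) (gsec M V k)))"

lemma incl_pull:
 "gopen M V ==> f \<in> homogeneous M V ==> pull (incl M U) V f = gres M V (V \<inter> U) f"
 by (simp add: incl_def)

lemma preim_incl:
 assumes "gopen M U"
 shows "preim (incl M U) V = V \<inter> U"
 using openin_subset[OF assms] by (auto simp: preim_def incl_def)

lemma incl_mors:
 assumes "graded_sheaf M" and U: "gopen M U"
 shows "incl M U \<in> mors (open_subspace M U) M"
proof -
 interpret gsheaf M by (simp add: gsheaf_def assms)
 have pts: "points (open_subspace M U) = U" using openin_subset[OF U] by auto
 have VU: "gopen M (V \<inter> U)" if "gopen M V" for V using that U by auto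
 note [simp] = preim_incl[OF U]
 show ?thesis
 proof (rule morsI)
  show "bmap (incl M U) \<in> extensional (points (open_subspace M U))" unfolding pts by (simp add: incl_def)
  have "continuous_map (subtopology (base M) U) (base M) id" by (rule continuous_map_from_subtopology) simp
  then show "continuous_map (base (open_subspace M U)) (base M) (bmap (incl M U))"
   unfolding open_subspace_simps
   by (rule continuous_map_eq) (auto simp: incl_def)
 next
  fix V k f assume "gopen M V" "f \<in> gsec M V k"
  then show "pull (incl M U) V f \<in> gsec (open_subspace M U) (preim (incl M U) V) k"
   using VU by (simp add: incl_pull homogeneousI res_closed)
 next
  fix V k assume V: "gopen M V"
  show "linear_map_on (gsec M V k) (pull (incl M U) V)"
   using res_linear[OF V VU[OF V], of k] subspace[OF V, of k]
   unfolding linear_map_on_def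
   by (simp add: incl_pull[OF V homogeneousI[of _ M V k]] subspace_add subspace_scale)
 next
  fix V assume V: "gopen M V"
  have "gone M V \<in> homogeneous M V" using gc_algebra.one(1)[OF gca[OF V]] by (rule homogeneousI)
  then show "pull (incl M U) V (gone M V) = gone (open_subspace M U) (preim (incl M U) V)"
   using V VU[OF V] by (simp add: incl_pull res_one)
 next
  fix V f g assume "gopen M V" "f \<in> homogeneous M V" "g \<in> homogeneous M V"
  then show "pull (incl M U) V (gmult M V f g) = gmult (open_subspace M U) (preim (incl M U) V) (pull (incl M U) V f) (pull (incl M U) V g)"
   using VU by (simp add: incl_pull mult_homogeneous res_mult)
 next
  fix V W f assume a: "gopen M V" "gopen M W" "W \<subseteq> V" "f \<in> homogeneous M V"
  then have "W \<inter> U \<subseteq> V \<inter> U" by blast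
  with a show "pull (incl M U) W (gres M V W f) = gres (open_subspace M U) (preim (incl M U) V) (preim (incl M U) W) (pull (incl M U) V f)"
   using VU[of V] VU[of W] by (simp add: incl_pull res_homogeneous res_res le_infI1)
 qed (auto simp: incl_def)
qed

lemma open_emb_incl:
 assumes "graded_sheaf M" and U: "gopen M U"
 shows "open_emb (open_subspace M U) M (incl M U)"
 unfolding open_emb_def
proof (intro conjI allI impI)
 interpret gsheaf M by (simp add: gsheaf_def assms)
 show "incl M U \<in> mors (open_subspace M U) M" by (rule incl_mors[OF assms])
 show "inj_on (bmap (incl M U)) (points (open_subspace M U))" by (auto simp: incl_def inj_on_def)
 fix V assume "gopen (open_subspace M U) V"
 then have V: "gopen M V" "V \<subseteq> U" using openin_open_subspace[OF U] by auto
 have im: "bmap (incl M U) ` V = V" using V(2) by (force simp: incl_def)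
 show "gopen M (bmap (incl M U) ` V)" using V im by simp
 fix k
 have "bij_betw (\<lambda>f. f) (gsec M V k) (gsec M V k)" by (simp add: bij_betw_def)
 then show "bij_betw (pull (incl M U) (bmap (incl M U) ` V)) (gsec M (bmap (incl M U) ` V) k) (gsec (open_subspace M U) V k)"
  unfolding im open_subspace_simps
  by (rule bij_betw_cong[THEN iffD1, rotated])
    (use V in "simp add: incl_def homogeneousI Int_absorb2 res_id")
qed

lemma open_emb_comp:
 assumes "open_emb M N \<phi>" "open_emb N L \<psi>"
 shows "open_emb M L (\<psi> \<odot> \<phi>)"
proof -
 have m: "\<phi> \<in> mors M N" "\<psi> \<in> mors N L" using assms by (auto simp: open_emb_def)
 interpret p: morphism M N \<phi> by (rule morphismI[OF m(1)])
 interpret q: morphism N L \<psi> by (rule morphismI[OF m(2)])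
 show ?thesis
  unfolding open_emb_def
 proof (intro conjI allI impI)
  show "\<psi> \<odot> \<phi> \<in> mors M L" by (rule comp_mors[OF m])
  have i: "inj_on (bmap \<phi>) (points M)" "inj_on (bmap \<psi>) (points N)" using assms by (auto simp: open_emb_def)
  show "inj_on (bmap (\<psi> \<odot> \<phi>)) (points M)"
  proof (rule inj_onI)
   fix x y assume xy: "x \<in> points M" "y \<in> points M" "bmap (\<psi> \<odot> \<phi>) x = bmap (\<psi> \<odot> \<phi>) y"
   then have "bmap \<psi> (bmap \<phi> x) = bmap \<psi> (bmap \<phi> y)" by (simp add: comp_bmap)
   then have "bmap \<phi> x = bmap \<phi> y" using inj_onD[OF i(2)] p.bmap_closed xy by blast
   then show "x = y" using inj_onD[OF i(1)] xy by blast
  qed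
  fix V assume V: "gopen M V"
  have VM: "V \<subseteq> points M" by (rule openin_subset[OF V])
  have im: "bmap (\<psi> \<odot> \<phi>) ` V = bmap \<psi> ` (bmap \<phi> ` V)"
   unfolding image_image by (rule image_cong[OF refl]) (use VM in "auto simp: comp_bmap")
  have W: "gopen N (bmap \<phi> ` V)" using assms(1) V by (simp add: open_emb_def)
  show "gopen L (bmap (\<psi> \<odot> \<phi>) ` V)" unfolding im using assms(2) W by (simp add: open_emb_def)
  have pre: "preim \<psi> (bmap \<psi> ` (bmap \<phi> ` V)) = bmap \<phi> ` V"
   using i(2) openin_subset[OF W] unfolding q.preim_eq inj_on_def by blast
  fix k
  have "bij_betw (pull \<psi> (bmap \<psi> ` (bmap \<phi> ` V))) (gsec L (bmap \<psi> ` (bmap \<phi> ` V)) k) (gsec N (bmap \<phi> ` V) k)"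
   using assms(2) W by (simp add: open_emb_def)
  moreover have "bij_betw (pull \<phi> (bmap \<phi> ` V)) (gsec N (bmap \<phi> ` V) k) (gsec M V k)"
   using assms(1) V by (simp add: open_emb_def)
  ultimately have "bij_betw (pull \<phi> (bmap \<phi> ` V) \<circ> pull \<psi> (bmap \<psi> ` (bmap \<phi> ` V))) (gsec L (bmap \<psi> ` (bmap \<phi> ` V)) k) (gsec M V k)"
   by (rule bij_betw_trans)
  moreover have "pull \<phi> (bmap \<phi> ` V) \<circ> pull \<psi> (bmap \<psi> ` (bmap \<phi> ` V)) = pull (\<psi> \<odot> \<phi>) (bmap \<psi> ` (bmap \<phi> ` V))"
   using pre by (auto simp: fun_eq_iff)
  ultimately show "bij_betw (pull (\<psi> \<odot> \<phi>) (bmap (\<psi> \<odot> \<phi>) ` V)) (gsec L (bmap (\<psi> \<odot> \<phi>) ` V) k) (gsec M V k)"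
   unfolding im by simp
 qed
qed

lemma open_emb_iso:
 assumes "graded_sheaf M" "graded_sheaf N" "\<phi> \<in> mors M N" "\<psi> \<in> mors N M" "\<psi> \<odot> \<phi> = id_mor M" "\<phi> \<odot> \<psi> = id_mor N"
 shows "open_emb M N \<phi>"
proof -
 interpret M: gsheaf M by (simp add: gsheaf_def assms)
 interpret N: gsheaf N by (simp add: gsheaf_def assms)
 interpret p: morphism M N \<phi> by (rule morphismI[OF assms(3)])
 interpret q: morphism N M \<psi> by (rule morphismI[OF assms(4)])
 have qp: "bmap \<psi> (bmap \<phi> x) = x" if "x \<in> points M" for x
  using arg_cong[OF assms(5), of "\<lambda>f. bmap f x"] that by (simp add: comp_bmap id_mor_def)
 have pq: "bmap \<phi> (bmap \<psi> y) = y" if "y \<in> points N" for y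
  using arg_cong[OF assms(6), of "\<lambda>f. bmap f y"] that by (simp add: comp_bmap id_mor_def)
 have im: "bmap \<phi> ` V = preim \<psi> V" if "V \<subseteq> points M" for V
  using that qp pq p.bmap_closed q.bmap_closed unfolding q.preim_eq by (auto simp: image_iff) (metis subsetD)+
 show ?thesis unfolding open_emb_def
 proof (intro conjI allI impI)
  show "inj_on (bmap \<phi>) (points M)" by (rule inj_on_inverseI[where g = "bmap \<psi>"]) (rule qp)
  fix V assume V: "gopen M V"
  have VM: "V \<subseteq> points M" by (rule openin_subset[OF V])
  show o: "gopen N (bmap \<phi> ` V)" unfolding im[OF VM] by (rule q.preim_open[OF V])
  have pre: "preim \<phi> (bmap \<phi> ` V) = V"
   using VM qp unfolding p.preim_eq by (auto simp: image_iff) (metis subsetD)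
  fix k show "bij_betw (pull \<phi> (bmap \<phi> ` V)) (gsec N (bmap \<phi> ` V) k) (gsec M V k)"
  proof (rule bij_betwI[where g = "pull \<psi> V"])
   show "pull \<phi> (bmap \<phi> ` V) \<in> gsec N (bmap \<phi> ` V) k \<rightarrow> gsec M V k"
    using p.closed[OF o, of _ k] pre by auto
   show "pull \<psi> V \<in> gsec M V k \<rightarrow> gsec N (bmap \<phi> ` V) k"
    using q.closed[OF V, of _ k] im[OF VM] by auto
  next
   fix f assume f: "f \<in> gsec N (bmap \<phi> ` V) k"
   have "pull (\<phi> \<odot> \<psi>) (bmap \<phi> ` V) f = f" unfolding assms(6) using o f by (simp add: id_pull homogeneousI)
   then show "pull \<psi> V (pull \<phi> (bmap \<phi> ` V) f) = f" using pre by simp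
  next
   fix f assume f: "f \<in> gsec M V k"
   have "pull (\<psi> \<odot> \<phi>) V f = f" unfolding assms(5) using V f by (simp add: id_pull homogeneousI)
   then show "pull \<phi> (bmap \<phi> ` V) (pull \<psi> V f) = f" using im[OF VM] by simp
  qed
 qed (rule assms(3))
qed

locale open_embedding =
 fixes M :: "('p, 'a::real_vector) graded_space" and N :: "('q, 'b::real_vector) graded_space" and \<phi>
 assumes emb: "open_emb M N \<phi>" and sheaf_M: "graded_sheaf M" and sheaf_N: "graded_sheaf N"
begin

sublocale morphism M N \<phi> using emb by (simp add: open_emb_def morphism_def)
sublocale M: gsheaf M by (simp add: gsheaf_def sheaf_M)
sublocale N: gsheaf N by (simp add: gsheaf_def sheaf_N)

lemma inj: "inj_on (bmap \<phi>) (points M)" using emb by (simp add: open_emb_def)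
lemma open_image: "gopen M V ==> gopen N (bmap \<phi> ` V)" using emb by (simp add: open_emb_def)
lemma bij: "gopen M V ==> bij_betw (pull \<phi> (bmap \<phi> ` V)) (gsec N (bmap \<phi> ` V) k) (gsec M V k)"
 using emb by (simp add: open_emb_def)

lemma preim_image: "V \<subseteq> points M ==> preim \<phi> (bmap \<phi> ` V) = V"
 using inj unfolding preim_eq inj_on_def by blast

text \<open>Injectivity is given in each degree separately. Equal nonzero pullbacks force the
  degrees to agree, and a vanishing pullback forces the section to be \<open>0\<close> in its own
  degree.\<close>

lemma pull_inj:
 assumes V: "gopen M V" and f: "f \<in> homogeneous N (bmap \<phi> ` V)" "g \<in> homogeneous N (bmap \<phi> ` V)"
  and eq: "pull \<phi> (bmap \<phi> ` V) f = pull \<phi> (bmap \<phi> ` V) g"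
 shows "f = g"
proof -
 let ?p = "pull \<phi> (bmap \<phi> ` V)"
 note o = open_image[OF V]
 have pre: "preim \<phi> (bmap \<phi> ` V) = V" by (rule preim_image[OF openin_subset[OF V]])
 obtain j k where jk: "f \<in> gsec N (bmap \<phi> ` V) j" "g \<in> gsec N (bmap \<phi> ` V) k" using f by (auto simp: homogeneous_def)
 have i: "inj_on ?p (gsec N (bmap \<phi> ` V) l)" for l using bij[OF V, of l] by (simp add: bij_betw_def)
 have z: "x = 0" if "x \<in> gsec N (bmap \<phi> ` V) l" "?p x = 0" for x l
  using inj_onD[OF i, of x 0] that N.zero_sec[OF o] by simp
 show ?thesis
 proof (cases "?p f = 0")
  case True
  then show ?thesis using z jk eq by metis
 next
  case False
  have "j = k"
   by (rule gc_algebra.degree_unique[OF M.gca[OF V], of "?p f"])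
     (use closed[OF o jk(1)] closed[OF o jk(2)] pre eq False in auto)
  then show ?thesis using inj_onD[OF i eq] jk by auto
 qed
qed

text \<open>The inverse of the pullback on homogeneous sections of all degrees at once; the
  description is unique by \<open>pull_inj\<close>.\<close>

definition unpull :: "'p set => 'a => 'b" where
 "unpull V f = (THE g. g \<in> homogeneous N (bmap \<phi> ` V) \<and> pull \<phi> (bmap \<phi> ` V) g = f)"

lemma unpull_eqI:
 assumes "gopen M V" "g \<in> homogeneous N (bmap \<phi> ` V)" "pull \<phi> (bmap \<phi> ` V) g = f"
 shows "unpull V f = g"
 unfolding unpull_def by (rule the_equality) (use assms pull_inj[OF assms(1)] in auto)

lemma unpull:
 assumes V: "gopen M V" and f: "f \<in> gsec M V k"
 shows "unpull V f \<in> gsec N (bmap \<phi> ` V) k" "pull \<phi> (bmap \<phi> ` V) (unpull V f) = f"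
proof -
 obtain g where g: "g \<in> gsec N (bmap \<phi> ` V) k" "pull \<phi> (bmap \<phi> ` V) g = f"
  using bij[OF V, of k] f unfolding bij_betw_def by (metis imageE)
 then have "unpull V f = g" by (intro unpull_eqI[OF V homogeneousI])
 with g show "unpull V f \<in> gsec N (bmap \<phi> ` V) k" "pull \<phi> (bmap \<phi> ` V) (unpull V f) = f" by auto
qed

lemma unpull_homog:
 assumes "gopen M V" "f \<in> homogeneous M V"
 shows "unpull V f \<in> homogeneous N (bmap \<phi> ` V)" "pull \<phi> (bmap \<phi> ` V) (unpull V f) = f"
 using unpull[OF assms(1)] assms(2) unfolding homogeneous_def by blast+

lemma unpull_linear:
 assumes V: "gopen M V"
 shows "linear_map_on (gsec M V k) (unpull V)"
 unfolding linear_map_on_def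
proof (intro conjI ballI allI)
 fix x y assume xy: "x \<in> gsec M V k" "y \<in> gsec M V k"
 show "unpull V (x + y) = unpull V x + unpull V y"
  by (rule unpull_eqI[OF V homogeneousI[OF subspace_add[OF N.subspace[OF open_image[OF V]] unpull(1)[OF V xy(1)] unpull(1)[OF V xy(2)]]]])
    (use add[OF open_image[OF V] unpull(1)[OF V xy(1)] unpull(1)[OF V xy(2)]] unpull(2)[OF V] xy in simp)
next
 fix c x assume x: "x \<in> gsec M V k"
 show "unpull V (c *\<^sub>R x) = c *\<^sub>R unpull V x"
  by (rule unpull_eqI[OF V homogeneousI[OF subspace_scale[OF N.subspace[OF open_image[OF V]] unpull(1)[OF V x]]]])
    (use scale[OF open_image[OF V] unpull(1)[OF V x]] unpull(2)[OF V] x in simp)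
qed

lemma unpull_one: "gopen M V ==> unpull V (gone M V) = gone N (bmap \<phi> ` V)"
 using unpull_eqI[of V "gone N (bmap \<phi> ` V)"] one[OF open_image] preim_image[OF openin_subset]
  gc_algebra.one(1)[OF N.gca[OF open_image]] homogeneousI by metis

lemma unpull_mult:
 assumes V: "gopen M V" "f \<in> homogeneous M V" "g \<in> homogeneous M V"
 shows "unpull V (gmult M V f g) = gmult N (bmap \<phi> ` V) (unpull V f) (unpull V g)"
 by (rule unpull_eqI[OF V(1)])
   (use unpull_homog[OF V(1)] V N.mult_homogeneous[OF open_image[OF V(1)]] mult[OF open_image[OF V(1)]]
    preim_image[OF openin_subset[OF V(1)]] in auto)

lemma unpull_res:
 assumes V: "gopen M V" "gopen M W" "W \<subseteq> V" "f \<in> homogeneous M V"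
 shows "unpull W (gres M V W f) = gres N (bmap \<phi> ` V) (bmap \<phi> ` W) (unpull V f)"
 by (rule unpull_eqI[OF V(2) N.res_homogeneous[OF open_image[OF V(1)] open_image[OF V(2)] image_mono[OF V(3)] unpull_homog(1)[OF V(1,4)]]])
   (simp add: res[OF open_image[OF V(1)] open_image[OF V(2)] image_mono[OF V(3)] unpull_homog(1)[OF V(1,4)]]
    unpull_homog(2)[OF V(1,4)] preim_image[OF openin_subset[OF V(1)]] preim_image[OF openin_subset[OF V(2)]])

lemma image_preim: "bmap \<phi> ` preim \<phi> V = V \<inter> bmap \<phi> ` points M"
 by (auto simp: preim_eq)

lemma image_preim_open: "gopen N V ==> gopen N (V \<inter> bmap \<phi> ` points M)"
 using open_image[of "points M"] by auto

text \<open>The pullback sees only the part of \<open>V\<close> inside the image, so going back and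
  forth restricts to this part.\<close>

lemma unpull_pull:
 assumes V: "gopen N V" "f \<in> homogeneous N V"
 shows "unpull (preim \<phi> V) (pull \<phi> V f) = gres N V (V \<inter> bmap \<phi> ` points M) f"
proof (rule unpull_eqI[OF preim_open[OF V(1)]], unfold image_preim)
 let ?V = "V \<inter> bmap \<phi> ` points M"
 have pre: "preim \<phi> ?V = preim \<phi> V" by (auto simp: preim_eq)
 show "gres N V ?V f \<in> homogeneous N ?V"
  by (rule N.res_homogeneous[OF V(1) image_preim_open[OF V(1)] _ V(2)]) blast
 show "pull \<phi> ?V (gres N V ?V f) = pull \<phi> V f"
  using res[OF V(1) image_preim_open[OF V(1)] _ V(2)] M.res_id[OF preim_open[OF V(1)] homog[OF V]]
  by (simp add: pre)
qed

text \<open>A map into \<open>N\<close> whose body lands in the image of the embedding does not see the complement.\<close>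

lemma lift:
 assumes h: "h \<in> mors T N" and sub: "bmap h ` points T \<subseteq> bmap \<phi> ` points M" and sheaf_T: "graded_sheaf T"
 shows "\<exists>h'\<in>mors T M. \<phi> \<odot> h' = h"
proof -
 interpret T: gsheaf T by (simp add: gsheaf_def sheaf_T)
 interpret h: morphism T N h by (rule morphismI[OF h])
 define inv where "inv = inv_into (points M) (bmap \<phi>)"
 have inv: "inv (bmap h t) \<in> points M" "bmap \<phi> (inv (bmap h t)) = bmap h t" if "t \<in> points T" for t
  using sub that inv_into_into[of "bmap h t" "bmap \<phi>" "points M"] f_inv_into_f[of "bmap h t" "bmap \<phi>" "points M"]
  by (auto simp: inv_def)
 define h' where "h' = \<lparr>mdom = T, mcod = M, bmap = restrict (\<lambda>t. inv (bmap h t)) (points T),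
  pull = (\<lambda>V f. if gopen M V \<and> f \<in> homogeneous M V then pull h (bmap \<phi> ` V) (unpull V f) else 0)\<rparr>"
 have pre: "preim h' V = preim h (bmap \<phi> ` V)" if "V \<subseteq> points M" for V
 proof -
  have "inv (bmap h t) \<in> V \<longleftrightarrow> bmap h t \<in> bmap \<phi> ` V" if t: "t \<in> points T" for t
  proof
   assume "inv (bmap h t) \<in> V"
   then show "bmap h t \<in> bmap \<phi> ` V" using inv(2)[OF t] by (metis imageI)
  next
   assume "bmap h t \<in> bmap \<phi> ` V"
   then obtain v where v: "v \<in> V" "bmap \<phi> (inv (bmap h t)) = bmap \<phi> v"
    unfolding inv(2)[OF t] by blast
   then have "inv (bmap h t) = v" using inj_onD[OF inj v(2)] inv(1)[OF t] \<open>V \<subseteq> points M\<close> by blast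
   then show "inv (bmap h t) \<in> V" using v(1) by simp
  qed
  then show ?thesis by (auto simp: preim_def h'_def)
 qed
 have pull': "pull h' V f = pull h (bmap \<phi> ` V) (unpull V f)" if "gopen M V" "f \<in> homogeneous M V" for V f
  using that by (simp add: h'_def)
 have mor': "h' \<in> mors T M"
 proof (rule morsI)
  show "continuous_map (base T) (base M) (bmap h')"
   unfolding continuous_map_def
  proof (intro conjI allI impI Pi_I)
   fix t assume "t \<in> points T" then show "bmap h' t \<in> points M" using inv by (simp add: h'_def)
  next
   fix V assume V: "gopen M V"
   have "{x \<in> points T. bmap h' x \<in> V} = preim h (bmap \<phi> ` V)"
    using pre[OF openin_subset[OF V]] by (simp add: preim_def h'_def)
   then show "gopen T {x \<in> points T. bmap h' x \<in> V}" using h.preim_open[OF open_image[OF V]] by simp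
  qed
 next
  fix V k f assume V: "gopen M V" and f: "f \<in> gsec M V k"
  then show "pull h' V f \<in> gsec T (preim h' V) k"
   using h.closed[OF open_image[OF V] unpull(1)[OF V f]] by (simp add: pull' homogeneousI pre openin_subset)
 next
  fix V k assume V: "gopen M V"
  have hom: "f \<in> gsec M V k ==> f \<in> homogeneous M V" for f by (rule homogeneousI)
  show "linear_map_on (gsec M V k) (pull h' V)"
   unfolding linear_map_on_def
   using linear_map_on_add[OF unpull_linear[OF V, of k]] linear_map_on_scale[OF unpull_linear[OF V, of k]]
    subspace_add[OF M.subspace[OF V], of _ k] subspace_scale[OF M.subspace[OF V], of _ k] unpull(1)[OF V, of _ k]
   by (simp add: pull'[OF V hom] h.add[OF open_image[OF V] unpull(1)[OF V, of _ k] unpull(1)[OF V, of _ k]] h.scale[OF open_image[OF V] unpull(1)[OF V, of _ k]])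
 next
  fix V assume V: "gopen M V"
  show "pull h' V (gone M V) = gone T (preim h' V)"
   using pull'[OF V homogeneousI[OF gc_algebra.one(1)[OF M.gca[OF V]]]] h.one[OF open_image[OF V]]
   by (simp add: unpull_one[OF V] pre openin_subset[OF V])
 next
  fix V f g assume V: "gopen M V" "f \<in> homogeneous M V" "g \<in> homogeneous M V"
  then show "pull h' V (gmult M V f g) = gmult T (preim h' V) (pull h' V f) (pull h' V g)"
   by (simp add: pull' M.mult_homogeneous unpull_mult h.mult open_image unpull_homog pre openin_subset)
 next
  fix V W f assume V: "gopen M V" "gopen M W" "W \<subseteq> V" "f \<in> homogeneous M V"
  then show "pull h' W (gres M V W f) = gres T (preim h' V) (preim h' W) (pull h' V f)"
   by (simp add: pull' M.res_homogeneous unpull_res h.res open_image unpull_homog pre openin_subset image_mono)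
 qed (auto simp: h'_def)
 have "\<phi> \<odot> h' = h"
 proof (rule mors_eqI[OF comp_mors[OF mor' mor] h])
  fix t assume "t \<in> points T"
  then show "bmap (\<phi> \<odot> h') t = bmap h t" using inv by (simp add: comp_bmap h'_def)
 next
  fix V f k assume V: "gopen N V" and "f \<in> gsec N V k"
  then have f: "f \<in> homogeneous N V" by (auto intro: homogeneousI)
  let ?V = "V \<inter> bmap \<phi> ` points M"
  have pv: "preim h ?V = preim h V" using sub by (auto simp: h.preim_eq)
  show "pull (\<phi> \<odot> h') V f = pull h V f"
   using h.res[OF V image_preim_open[OF V] _ f] T.res_id[OF h.preim_open[OF V] h.homog[OF V f]]
   by (simp add: pull'[OF preim_open[OF V] homog[OF V f]] unpull_pull[OF V f] image_preim pv)
 qed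
 with mor' show ?thesis by blast
qed

lemma mono:
 assumes "a \<in> mors T M" "b \<in> mors T M" "\<phi> \<odot> a = \<phi> \<odot> b"
 shows "a = b"
proof (rule mors_eqI[OF assms(1,2)])
 interpret a: morphism T M a by (rule morphismI[OF assms(1)])
 interpret b: morphism T M b by (rule morphismI[OF assms(2)])
 fix x assume x: "x \<in> points T"
 have "bmap \<phi> (bmap a x) = bmap \<phi> (bmap b x)"
  using arg_cong[OF assms(3), of "\<lambda>h. bmap h x"] x by (simp add: comp_bmap)
 then show "bmap a x = bmap b x" using inj_onD[OF inj] a.bmap_closed[OF x] b.bmap_closed[OF x] by blast
next
 fix V f k assume V: "gopen M V" and f: "f \<in> gsec M V k"
 have "pull (\<phi> \<odot> a) (bmap \<phi> ` V) (unpull V f) = pull (\<phi> \<odot> b) (bmap \<phi> ` V) (unpull V f)" using assms(3) by simp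
 then show "pull a V f = pull b V f" by (simp add: preim_image[OF openin_subset[OF V]] unpull(2)[OF V f])
qed

text \<open>Tangent vectors to an open subspace are those of the whole space: \<open>D'\<close>
  applies \<open>D\<close> to the section of \<open>N\<close> over the image that corresponds to the
  given one.\<close>

lemma derivation_lift:
 assumes h: "h \<in> mors T M" and D: "D \<in> ders (\<phi> \<odot> h) k" and sheaf_T: "graded_sheaf T"
 shows "\<exists>D'\<in>ders h k. tangent \<phi> D' = D"
proof -
 interpret T: gsheaf T by (simp add: gsheaf_def sheaf_T)
 interpret h: morphism T M h by (rule morphismI[OF h])
 interpret d: derivation T N "\<phi> \<odot> h" k D by (rule derivationI[OF comp_mors[OF h mor] D])
 have pre: "preim (\<phi> \<odot> h) (bmap \<phi> ` V) = preim h V" if "V \<subseteq> points M" for V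
  by (simp add: preim_comp[OF h mor] preim_image[OF that])
 define D' where "D' V f = (if gopen M V \<and> f \<in> homogeneous M V then D (bmap \<phi> ` V) (unpull V f) else 0)" for V f
 have D': "D' V f = D (bmap \<phi> ` V) (unpull V f)" if "gopen M V" "f \<in> homogeneous M V" for V f
  using that by (simp add: D'_def)
 have pull': "pull (\<phi> \<odot> h) (bmap \<phi> ` V) (unpull V f) = pull h V f" if "gopen M V" "f \<in> homogeneous M V" for V f
  using that by (simp add: preim_image openin_subset unpull_homog)
 have der': "D' \<in> ders h k"
 proof (rule derivations_alongI[OF h])
  fix V f j assume V: "gopen M V" and f: "f \<in> gsec M V j"
  then show "D' V f \<in> gsec T (preim h V) (j + k)"
   using d.der_closed[OF open_image[OF V] unpull(1)[OF V f]] by (simp add: D' homogeneousI pre openin_subset)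
 next
  fix V j assume V: "gopen M V"
  have hom: "f \<in> gsec M V j ==> f \<in> homogeneous M V" for f by (rule homogeneousI)
  show "linear_map_on (gsec M V j) (D' V)"
   unfolding linear_map_on_def
   using linear_map_on_add[OF unpull_linear[OF V, of j]] linear_map_on_scale[OF unpull_linear[OF V, of j]]
    subspace_add[OF M.subspace[OF V], of _ j] subspace_scale[OF M.subspace[OF V], of _ j] unpull(1)[OF V, of _ j]
   by (simp add: D'[OF V hom] d.der_add[OF open_image[OF V] unpull(1)[OF V, of _ j] unpull(1)[OF V, of _ j]] d.der_scale[OF open_image[OF V] unpull(1)[OF V, of _ j]])
 next
  fix V f g j assume V: "gopen M V" and f: "f \<in> gsec M V j" and g: "g \<in> homogeneous M V"
  have fh: "f \<in> homogeneous M V" using f by (rule homogeneousI)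
  show "D' V (gmult M V f g) = gmult T (preim h V) (D' V f) (pull h V g)
       + ((-1) powi (k * j)) *\<^sub>R gmult T (preim h V) (pull h V f) (D' V g)"
   using d.leibniz[OF open_image[OF V] unpull(1)[OF V f] unpull_homog(1)[OF V g]]
   unfolding pull'[OF V fh] pull'[OF V g] pre[OF openin_subset[OF V]]
   by (simp add: D' V fh g M.mult_homogeneous unpull_mult)
 next
  fix V W f assume V: "gopen M V" "gopen M W" "W \<subseteq> V" "f \<in> homogeneous M V"
  then show "D' W (gres M V W f) = gres T (preim h V) (preim h W) (D' V f)"
   by (simp add: D' M.res_homogeneous unpull_res d.der_res open_image unpull_homog pre openin_subset image_mono)
 qed (auto simp: D'_def)
 have "tangent \<phi> D' = D"
 proof (rule derivations_eqI[OF comp_mors[OF h mor] tangent_derivation[OF h mor der'] D])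
  fix V f j assume V: "gopen N V" and "f \<in> gsec N V j"
  then have f: "f \<in> homogeneous N V" by (auto intro: homogeneousI)
  let ?V = "V \<inter> bmap \<phi> ` points M"
  have pv: "preim (\<phi> \<odot> h) ?V = preim (\<phi> \<odot> h) V"
   unfolding preim_comp[OF h mor] by (rule arg_cong[of _ _ "preim h"]) (auto simp: preim_eq)
  show "tangent \<phi> D' V f = D V f"
   using d.der_res[OF V image_preim_open[OF V] _ f] T.res_id[OF d.preim_open[OF V] d.der_homog[OF V f]]
   by (simp add: tangent_def D'[OF preim_open[OF V] homog[OF V f]] unpull_pull[OF V f] image_preim pv)
 qed
 with der' show ?thesis by blast
qed

lemma tangent_inj:
 assumes "h \<in> mors T M" "D \<in> ders h k" "D' \<in> ders h k'" "tangent \<phi> D = tangent \<phi> D'"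
 shows "D = D'"
proof (rule derivations_eqI[OF assms(1-3)])
 fix V f j assume V: "gopen M V" and f: "f \<in> gsec M V j"
 have "tangent \<phi> D (bmap \<phi> ` V) (unpull V f) = tangent \<phi> D' (bmap \<phi> ` V) (unpull V f)" using assms(4) by simp
 then show "D V f = D' V f" by (simp add: tangent_def preim_image[OF openin_subset[OF V]] unpull(2)[OF V f])
qed

end

section \<open>Calculus of tangent maps and precomposition\<close>

lemma tangent_comp:
 assumes "\<psi> \<in> mors N L" "\<omega> \<in> mors L K"
 shows "tangent (\<omega> \<odot> \<psi>) D = tangent \<omega> (tangent \<psi> D)"
 by (auto simp: tangent_def fun_eq_iff preim_comp[OF assms])

lemma precomp_comp:
 assumes "\<kappa> \<in> mors K M" "\<phi> \<in> mors M N"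
 shows "precomp (\<phi> \<odot> \<kappa>) (precomp \<phi> D \<kappa>) \<mu> = precomp \<phi> D (\<kappa> \<odot> \<mu>)"
 by (auto simp: precomp_def fun_eq_iff preim_comp[OF assms])

lemma precomp_tangent:
 assumes "\<phi> \<in> mors M N" "\<psi> \<in> mors N L"
 shows "precomp (\<psi> \<odot> \<phi>) (tangent \<psi> D) \<kappa> = tangent \<psi> (precomp \<phi> D \<kappa>)"
 by (auto simp: precomp_def tangent_def fun_eq_iff preim_comp[OF assms])

lemma tangent_0: "tangent \<psi> 0 = 0"
 by (auto simp: tangent_def fun_eq_iff)

lemma precomp_0:
 assumes "\<kappa> \<in> mors K M" shows "precomp \<phi> 0 \<kappa> = 0"
 using morphism.pull_0[OF morphismI[OF assms]] by (auto simp: precomp_def fun_eq_iff)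

section \<open>Gluing over covers by charts\<close>

locale open_cover =
 fixes K :: "('p, 'a::real_vector) graded_space" and I :: "'i set"
  and T :: "'i => ('q, 'b::real_vector) graded_space" and \<kappa>
 assumes emb: "\<And>i. i \<in> I ==> open_embedding (T i) K (\<kappa> i)"
  and sheaf_K: "graded_sheaf K"
  and covers: "points K \<subseteq> (\<Union>i\<in>I. bmap (\<kappa> i) ` points (T i))"
begin

sublocale K: gsheaf K by (simp add: gsheaf_def sheaf_K)

lemma chart_mors: "i \<in> I ==> \<kappa> i \<in> mors (T i) K"
 using emb unfolding open_embedding_def open_emb_def by blast

lemma sections_eqI:
 assumes V: "gopen K V" and xy: "x \<in> gsec K V k" "y \<in> gsec K V k"
  and eq: "\<And>i. i \<in> I ==> pull (\<kappa> i) V x = pull (\<kappa> i) V y"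
 shows "x = y"
proof -
 let ?U = "\<lambda>i. V \<inter> bmap (\<kappa> i) ` points (T i)"
 have un: "(\<Union>i\<in>I. ?U i) = V" using covers openin_subset[OF V] by blast
 show ?thesis
 proof (rule K.sections_eqI[of I ?U x k y], unfold un)
  fix i assume i: "i \<in> I"
  interpret open_embedding "T i" K "\<kappa> i" by (rule emb[OF i])
  show "gopen K (?U i)" by (rule image_preim_open[OF V])
  show "gres K V (?U i) x = gres K V (?U i) y"
   using unpull_pull[OF V homogeneousI[OF xy(1)]] unpull_pull[OF V homogeneousI[OF xy(2)]] eq[OF i] by simp
 qed (use xy in auto)
qed

text \<open>A chart in which the common pullback is nonzero determines the degree; if there is none,
  both sections vanish.\<close>

lemma homogeneous_eqI:
 assumes V: "gopen K V" and xy: "x \<in> homogeneous K V" "y \<in> homogeneous K V"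
  and eq: "\<And>i. i \<in> I ==> pull (\<kappa> i) V x = pull (\<kappa> i) V y"
 shows "x = y"
proof -
 obtain j k where jk: "x \<in> gsec K V j" "y \<in> gsec K V k" using xy by (auto simp: homogeneous_def)
 show ?thesis
 proof (cases "\<forall>i\<in>I. pull (\<kappa> i) V x = 0")
  case True
  have "pull (\<kappa> i) V 0 = 0" if "i \<in> I" for i
   using morphism.pull_0[OF morphismI[OF chart_mors[OF that]]] .
  then have "x = 0" "y = 0"
   using sections_eqI[OF V jk(1) K.zero_sec[OF V]] sections_eqI[OF V jk(2) K.zero_sec[OF V]] True eq by auto
  then show ?thesis by simp
 next
  case False
  then obtain i where i: "i \<in> I" "pull (\<kappa> i) V x \<noteq> 0" by blast
  interpret open_embedding "T i" K "\<kappa> i" by (rule emb[OF i(1)])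
  have "j = k"
   by (rule gc_algebra.degree_unique[OF M.gca[OF preim_open[OF V]], of "pull (\<kappa> i) V x"])
     (use closed[OF V jk(1)] closed[OF V jk(2)] eq[OF i(1)] i(2) in auto)
  with jk show ?thesis using sections_eqI[OF V _ _ eq] by auto
 qed
qed

lemma mors_cover_eqI:
 assumes "h \<in> mors K P" "h' \<in> mors K P" "\<And>i. i \<in> I ==> h \<odot> \<kappa> i = h' \<odot> \<kappa> i"
 shows "h = h'"
proof (rule mors_eqI[OF assms(1,2)])
 have bm: "bmap h x = bmap h' x" if x: "x \<in> points K" for x
 proof -
  obtain i t where i: "i \<in> I" "t \<in> points (T i)" "x = bmap (\<kappa> i) t" using covers x by blast
  then have "bmap (h \<odot> \<kappa> i) t = bmap (h' \<odot> \<kappa> i) t" using assms(3) by simp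
  then show ?thesis using i mors_simps[OF chart_mors[OF i(1)]] by (simp add: comp_bmap)
 qed
 then show "\<And>x. x \<in> points K ==> bmap h x = bmap h' x" .
 fix V f k assume V: "gopen P V" and f: "f \<in> gsec P V k"
 have pre: "preim h V = preim h' V"
  using bm mors_simps[OF assms(1)] mors_simps[OF assms(2)] by (auto simp: preim_def)
 show "pull h V f = pull h' V f"
 proof (rule sections_eqI)
  show "gopen K (preim h V)" by (rule morphism.preim_open[OF morphismI[OF assms(1)] V])
  show "pull h V f \<in> gsec K (preim h V) k" by (rule morphism.closed[OF morphismI[OF assms(1)] V f])
  show "pull h' V f \<in> gsec K (preim h V) k" unfolding pre by (rule morphism.closed[OF morphismI[OF assms(2)] V f])
  fix i assume "i \<in> I"
  then have "pull (h \<odot> \<kappa> i) V f = pull (h' \<odot> \<kappa> i) V f" using assms(3) by simp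
  then show "pull (\<kappa> i) (preim h V) (pull h V f) = pull (\<kappa> i) (preim h V) (pull h' V f)" using pre by simp
 qed
qed

lemma derivations_cover_eqI:
 assumes "h \<in> mors K P" "D \<in> ders h k" "D' \<in> ders h k"
  "\<And>i. i \<in> I ==> precomp h D (\<kappa> i) = precomp h D' (\<kappa> i)"
 shows "D = D'"
proof (rule derivations_eqI[OF assms(1-3)])
 fix V f j assume V: "gopen P V" and f: "f \<in> gsec P V j"
 show "D V f = D' V f"
 proof (rule sections_eqI)
  show "gopen K (preim h V)" by (rule morphism.preim_open[OF morphismI[OF assms(1)] V])
  show "D V f \<in> gsec K (preim h V) (j + k)" by (rule derivation.der_closed[OF derivationI[OF assms(1,2)] V f])
  show "D' V f \<in> gsec K (preim h V) (j + k)" by (rule derivation.der_closed[OF derivationI[OF assms(1,3)] V f])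
  fix i assume "i \<in> I"
  then have "precomp h D (\<kappa> i) V f = precomp h D' (\<kappa> i) V f" using assms(4) by simp
  then show "pull (\<kappa> i) (preim h V) (D V f) = pull (\<kappa> i) (preim h V) (D' V f)" by (simp add: precomp_def)
 qed
qed

text \<open>The charts are arbitrary open embeddings, so agreement on an overlap is stated through
  an open part of one chart with its inclusion and a map \<open>\<mu>\<close> into the other chart.
  The values on a fixed section are moved to the images of the charts and glued there.\<close>

lemma derivations_glue:
 assumes h: "h \<in> mors K P" and P: "graded_sheaf P" and D: "\<And>i. i \<in> I ==> D i \<in> ders (h \<odot> \<kappa> i) k"
  and compat: "\<And>i j W \<mu>. i \<in> I ==> j \<in> I ==> gopen (T i) W ==> \<mu> \<in> mors (open_subspace (T i) W) (T j) ==>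
   \<kappa> i \<odot> incl (T i) W = \<kappa> j \<odot> \<mu> ==>
   precomp (h \<odot> \<kappa> i) (D i) (incl (T i) W) = precomp (h \<odot> \<kappa> j) (D j) \<mu>"
 shows "\<exists>E\<in>ders h k. \<forall>i\<in>I. precomp h E (\<kappa> i) = D i"
proof -
 interpret h: morphism K P h by (rule morphismI[OF h])
 interpret P: gsheaf P by (simp add: gsheaf_def P)
 have pc: "preim (h \<odot> \<kappa> i) V = preim (\<kappa> i) (preim h V)" if "i \<in> I" for i V
  by (rule preim_comp[OF chart_mors[OF that] h])
 have hk: "h \<odot> \<kappa> i \<in> mors (T i) P" if "i \<in> I" for i by (rule comp_mors[OF chart_mors[OF that] h])
 have Di: "derivation (T i) P (h \<odot> \<kappa> i) k (D i)" if "i \<in> I" for i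
  by (rule derivationI[OF hk[OF that] D[OF that]])
 have ex: "\<exists>x. x \<in> gsec K (preim h V) (l + k) \<and> (\<forall>i\<in>I. pull (\<kappa> i) (preim h V) x = D i V f)"
  if V: "gopen P V" and f: "f \<in> gsec P V l" for V f l
 proof -
  have fh: "f \<in> homogeneous P V" by (rule homogeneousI[OF f])
  define V0 where "V0 = preim h V"
  have V0: "gopen K V0" unfolding V0_def by (rule h.preim_open[OF V])
  define U where "U i = V0 \<inter> bmap (\<kappa> i) ` points (T i)" for i
  define s where "s i = open_embedding.unpull K (\<kappa> i) (preim (\<kappa> i) V0) (D i V f)" for i
  have U: "gopen K (U i)" if "i \<in> I" for i
   unfolding U_def by (rule open_embedding.image_preim_open[OF emb[OF that] V0])
  have un: "(\<Union>i\<in>I. U i) = V0" using covers openin_subset[OF V0] unfolding U_def by blast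
  have DV: "D i V f \<in> gsec (T i) (preim (\<kappa> i) V0) (l + k)" if "i \<in> I" for i
   using derivation.der_closed[OF Di[OF that] V f] by (simp add: pc[OF that] V0_def)
  have im: "bmap (\<kappa> i) ` preim (\<kappa> i) V0 = U i" if "i \<in> I" for i
   unfolding U_def by (rule open_embedding.image_preim[OF emb[OF that]])
  have oT: "gopen (T i) (preim (\<kappa> i) A)" if "i \<in> I" "gopen K A" for i A
   using morphism.preim_open[OF morphismI[OF chart_mors[OF that(1)]] that(2)] .
  have s: "s i \<in> gsec K (U i) (l + k)" "pull (\<kappa> i) (U i) (s i) = D i V f" if "i \<in> I" for i
   using open_embedding.unpull[OF emb[OF that] oT[OF that V0] DV[OF that]] im[OF that] by (auto simp: s_def)
  have preU: "preim (\<kappa> i) (U i) = preim (\<kappa> i) V0" if "i \<in> I" for i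
   using mors_simps[OF chart_mors[OF that]] by (auto simp: preim_def U_def)
  have "\<exists>x. x \<in> gsec K (\<Union>i\<in>I. U i) (l + k) \<and> (\<forall>i\<in>I. gres K (\<Union>i\<in>I. U i) (U i) x = s i)"
  proof (rule K.glue_indexed[OF U s(1)])
   fix i j assume i: "i \<in> I" and j: "j \<in> I"
   interpret i: open_embedding "T i" K "\<kappa> i" by (rule emb[OF i])
   interpret j: open_embedding "T j" K "\<kappa> j" by (rule emb[OF j])
   let ?A = "U i \<inter> U j"
   have A: "gopen K ?A" using U[OF i] U[OF j] by blast
   \<comment> \<open>The part of chart \<open>i\<close> that lies over chart \<open>j\<close>. Its
     inclusion lifts to a map \<open>\<mu>\<close> into chart \<open>j\<close>, and
     \<open>compat\<close> applies to this pair.\<close>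
   let ?W = "preim (\<kappa> i) (bmap (\<kappa> j) ` points (T j))"
   have W: "gopen (T i) ?W" by (rule i.preim_open[OF j.open_image]) simp
   let ?\<iota> = "incl (T i) ?W"
   have \<iota>: "?\<iota> \<in> mors (open_subspace (T i) ?W) (T i)" by (rule incl_mors[OF i.sheaf_M W])
   have \<kappa>\<iota>: "\<kappa> i \<odot> ?\<iota> \<in> mors (open_subspace (T i) ?W) K" by (rule comp_mors[OF \<iota> i.mor])
   have pts: "points (open_subspace (T i) ?W) = ?W" using openin_subset[OF W] by auto
   have "bmap (\<kappa> i \<odot> ?\<iota>) ` points (open_subspace (T i) ?W) \<subseteq> bmap (\<kappa> j) ` points (T j)"
    unfolding pts by (auto simp: comp_mor_def incl_def i.preim_eq)
   from j.lift[OF \<kappa>\<iota> this graded_sheaf_open_subspace[OF i.sheaf_M W]]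
   obtain \<mu> where \<mu>: "\<mu> \<in> mors (open_subspace (T i) ?W) (T j)" "\<kappa> j \<odot> \<mu> = \<kappa> i \<odot> ?\<iota>" by blast
   have c: "precomp (h \<odot> \<kappa> i) (D i) ?\<iota> V f = precomp (h \<odot> \<kappa> j) (D j) \<mu> V f"
    using compat[OF i j W \<mu>(1) \<mu>(2)[symmetric]] by simp
   interpret m: morphism "open_subspace (T i) ?W" "T j" \<mu> by (rule morphismI[OF \<mu>(1)])
   have preA: "preim (\<kappa> i) ?A \<inter> ?W = preim (\<kappa> i) ?A" by (auto simp: i.preim_eq U_def)
   have res\<iota>: "pull ?\<iota> (preim (\<kappa> i) ?A) z = z" if "z \<in> homogeneous (T i) (preim (\<kappa> i) ?A)" for z
    using that i.preim_open[OF A] by (simp add: incl_pull preA i.M.res_id)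
   have sh: "s i \<in> homogeneous K (U i)" "s j \<in> homogeneous K (U j)" using s(1)[OF i] s(1)[OF j] by (auto intro: homogeneousI)
   have Dh: "D i V f \<in> homogeneous (T i) (preim (\<kappa> i) V0)" using DV[OF i] by (rule homogeneousI)
   have Djh: "D j V f \<in> homogeneous (T j) (preim (\<kappa> j) V0)" using DV[OF j] by (rule homogeneousI)
   have "pull (\<kappa> i) ?A (gres K (U i) ?A (s i)) = gres (T i) (preim (\<kappa> i) V0) (preim (\<kappa> i) ?A) (D i V f)"
    using i.res[OF U[OF i] A _ sh(1)] s(2)[OF i] preU[OF i] by simp
   moreover have "pull (\<kappa> i) ?A (gres K (U j) ?A (s j)) = gres (T i) (preim (\<kappa> i) V0) (preim (\<kappa> i) ?A) (D i V f)"
   proof -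
    let ?z = "gres K (U j) ?A (s j)"
    have z: "?z \<in> homogeneous K ?A" by (rule K.res_homogeneous[OF U[OF j] A _ sh(2)]) blast
    have "pull (\<kappa> i) ?A ?z = pull (\<kappa> i \<odot> ?\<iota>) ?A ?z" using res\<iota>[OF i.homog[OF A z]] by simp
    also have "\<dots> = pull \<mu> (preim (\<kappa> j) ?A) (pull (\<kappa> j) ?A ?z)" by (simp add: \<mu>(2)[symmetric])
    also have "pull (\<kappa> j) ?A ?z = gres (T j) (preim (\<kappa> j) V0) (preim (\<kappa> j) ?A) (D j V f)"
     using j.res[OF U[OF j] A _ sh(2)] s(2)[OF j] preU[OF j] by simp
    also have "pull \<mu> (preim (\<kappa> j) ?A) \<dots> = gres (T i) (preim \<mu> (preim (\<kappa> j) V0)) (preim \<mu> (preim (\<kappa> j) ?A)) (pull \<mu> (preim (\<kappa> j) V0) (D j V f))"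
     using m.res[OF j.preim_open[OF V0] j.preim_open[OF A] _ Djh] j.preim_mono[of ?A V0] by (auto simp: U_def)
    also have "pull \<mu> (preim (\<kappa> j) V0) (D j V f) = pull ?\<iota> (preim (\<kappa> i) V0) (D i V f)"
     using c by (simp add: precomp_def pc i j V0_def)
    also have "\<dots> = gres (T i) (preim (\<kappa> i) V0) (preim (\<kappa> i) V0 \<inter> ?W) (D i V f)"
     by (rule incl_pull[OF i.preim_open[OF V0] Dh])
    also have "preim \<mu> (preim (\<kappa> j) V0) = preim (\<kappa> i) V0 \<inter> ?W"
     unfolding preim_comp[OF \<mu>(1) j.mor, symmetric] \<mu>(2) preim_comp[OF \<iota> i.mor] preim_incl[OF W] ..
    also have "preim \<mu> (preim (\<kappa> j) ?A) = preim (\<kappa> i) ?A"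
     unfolding preim_comp[OF \<mu>(1) j.mor, symmetric] \<mu>(2) preim_comp[OF \<iota> i.mor] preim_incl[OF W] preA ..
    also have "gres (T i) (preim (\<kappa> i) V0 \<inter> ?W) (preim (\<kappa> i) ?A) (gres (T i) (preim (\<kappa> i) V0) (preim (\<kappa> i) V0 \<inter> ?W) (D i V f))
      = gres (T i) (preim (\<kappa> i) V0) (preim (\<kappa> i) ?A) (D i V f)"
     by (rule i.M.res_res) (use i.preim_open[OF V0] i.preim_open[OF A] W Dh in "auto simp: i.preim_eq U_def")
    finally show ?thesis .
   qed
   ultimately have eq: "pull (\<kappa> i) ?A (gres K (U i) ?A (s i)) = pull (\<kappa> i) ?A (gres K (U j) ?A (s j))" by simp
   have imA: "bmap (\<kappa> i) ` preim (\<kappa> i) ?A = ?A" unfolding i.image_preim by (auto simp: U_def)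
   show "gres K (U i) ?A (s i) = gres K (U j) ?A (s j)"
   proof (rule i.pull_inj[OF i.preim_open[OF A]], unfold imA)
    show "gres K (U i) ?A (s i) \<in> homogeneous K ?A" by (rule K.res_homogeneous[OF U[OF i] A _ sh(1)]) blast
    show "gres K (U j) ?A (s j) \<in> homogeneous K ?A" by (rule K.res_homogeneous[OF U[OF j] A _ sh(2)]) blast
   qed (rule eq)
  qed
  then obtain x where x: "x \<in> gsec K V0 (l + k)" "\<And>i. i \<in> I ==> gres K V0 (U i) x = s i" unfolding un by blast
  have "pull (\<kappa> i) V0 x = D i V f" if i: "i \<in> I" for i
  proof -
   interpret i: open_embedding "T i" K "\<kappa> i" by (rule emb[OF i])
   have "D i V f = pull (\<kappa> i) (U i) (gres K V0 (U i) x)" using s(2)[OF i] x(2)[OF i] by simp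
   also have "\<dots> = gres (T i) (preim (\<kappa> i) V0) (preim (\<kappa> i) V0) (pull (\<kappa> i) V0 x)"
    using i.res[OF V0 U[OF i] _ homogeneousI[OF x(1)]] preU[OF i] by (simp add: U_def)
   also have "\<dots> = pull (\<kappa> i) V0 x"
    by (rule i.M.res_id[OF i.preim_open[OF V0] i.homog[OF V0 homogeneousI[OF x(1)]]])
   finally show ?thesis by simp
  qed
  then show ?thesis using x(1) unfolding V0_def by blast
 qed
 \<comment> \<open>The description leaves the degree of the value open, so that it serves all
   degrees; \<open>homogeneous_eqI\<close> makes the value unique.\<close>
 define E where "E V f = (if gopen P V \<and> f \<in> homogeneous P V
   then (THE x. x \<in> homogeneous K (preim h V) \<and> (\<forall>i\<in>I. pull (\<kappa> i) (preim h V) x = D i V f)) else 0)" for V f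
 have E_eqI: "E V f = x" if "gopen P V" "f \<in> homogeneous P V" "x \<in> homogeneous K (preim h V)"
  "\<And>i. i \<in> I ==> pull (\<kappa> i) (preim h V) x = D i V f" for V f x
 proof -
  have "(THE x. x \<in> homogeneous K (preim h V) \<and> (\<forall>i\<in>I. pull (\<kappa> i) (preim h V) x = D i V f)) = x"
   by (rule the_equality) (use that homogeneous_eqI[OF h.preim_open[OF that(1)]] in auto)
  then show ?thesis using that(1,2) by (simp add: E_def)
 qed
 have E: "E V f \<in> gsec K (preim h V) (l + k)" "\<And>i. i \<in> I ==> pull (\<kappa> i) (preim h V) (E V f) = D i V f"
  if V: "gopen P V" and f: "f \<in> gsec P V l" for V f l
 proof -
  obtain x where x: "x \<in> gsec K (preim h V) (l + k)" "\<And>i. i \<in> I ==> pull (\<kappa> i) (preim h V) x = D i V f"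
   using ex[OF V f] by blast
  have "E V f = x" by (rule E_eqI[OF V homogeneousI[OF f] homogeneousI[OF x(1)] x(2)])
  then show "E V f \<in> gsec K (preim h V) (l + k)" "\<And>i. i \<in> I ==> pull (\<kappa> i) (preim h V) (E V f) = D i V f"
   using x by auto
 qed
 have der: "E \<in> ders h k"
 proof (rule derivations_alongI[OF h])
  fix V f assume "\<not> (gopen P V \<and> f \<in> homogeneous P V)"
  then show "E V f = 0" by (auto simp: E_def)
 next
  fix V f j assume "gopen P V" "f \<in> gsec P V j"
  then show "E V f \<in> gsec K (preim h V) (j + k)" by (rule E(1))
 next
  fix V j assume V: "gopen P V"
  note oV = h.preim_open[OF V]
  show "linear_map_on (gsec P V j) (E V)"
   unfolding linear_map_on_def
  proof (intro conjI ballI allI)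
   fix f g assume f: "f \<in> gsec P V j" and g: "g \<in> gsec P V j"
   show "E V (f + g) = E V f + E V g"
   proof (rule E_eqI[OF V homogeneousI[OF subspace_add[OF P.subspace[OF V] f g]]
      homogeneousI[OF subspace_add[OF K.subspace[OF oV] E(1)[OF V f] E(1)[OF V g]]]])
    fix i assume i: "i \<in> I"
    show "pull (\<kappa> i) (preim h V) (E V f + E V g) = D i V (f + g)"
     using morphism.add[OF morphismI[OF chart_mors[OF i]] oV E(1)[OF V f] E(1)[OF V g]] E(2)[OF V f i] E(2)[OF V g i]
      derivation.der_add[OF Di[OF i] V f g] by simp
   qed
  next
   fix c f assume f: "f \<in> gsec P V j"
   show "E V (c *\<^sub>R f) = c *\<^sub>R E V f"
   proof (rule E_eqI[OF V homogeneousI[OF subspace_scale[OF P.subspace[OF V] f]]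
      homogeneousI[OF subspace_scale[OF K.subspace[OF oV] E(1)[OF V f]]]])
    fix i assume i: "i \<in> I"
    show "pull (\<kappa> i) (preim h V) (c *\<^sub>R E V f) = D i V (c *\<^sub>R f)"
     using morphism.scale[OF morphismI[OF chart_mors[OF i]] oV E(1)[OF V f]] E(2)[OF V f i]
      derivation.der_scale[OF Di[OF i] V f] by simp
   qed
  qed
 next
  fix V f g j assume V: "gopen P V" and f: "f \<in> gsec P V j" and g: "g \<in> homogeneous P V"
  from g obtain l where gl: "g \<in> gsec P V l" by (rule homogeneousE)
  note oV = h.preim_open[OF V]
  interpret a: gc_algebra "gsec K (preim h V)" "gmult K (preim h V)" "gone K (preim h V)"
   by (rule K.gca[OF oV])
  have 1: "gmult K (preim h V) (E V f) (pull h V g) \<in> gsec K (preim h V) (j + k + l)"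
   by (intro a.closed E(1) h.closed V f gl)
  have 2: "gmult K (preim h V) (pull h V f) (E V g) \<in> gsec K (preim h V) (j + k + l)"
   using a.closed[OF h.closed[OF V f] E(1)[OF V gl]] by (simp add: ac_simps)
  let ?r = "gmult K (preim h V) (E V f) (pull h V g) + ((-1) powi (k * j)) *\<^sub>R gmult K (preim h V) (pull h V f) (E V g)"
  have r: "?r \<in> gsec K (preim h V) (j + k + l)" by (intro a.add a.scale 1 2)
  have pl: "pull (\<kappa> i) (preim h V) ?r = D i V (gmult P V f g)" if i: "i \<in> I" for i
  proof -
   interpret i: open_embedding "T i" K "\<kappa> i" by (rule emb[OF i])
   show ?thesis
    by (simp add: i.add[OF oV 1 a.scale[OF 2]] i.scale[OF oV 2] i.mult[OF oV] derivation.leibniz[OF Di[OF i] V f g]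
      homogeneousI[OF E(1)[OF V f]] homogeneousI[OF E(1)[OF V gl]] h.homog[OF V g] h.homog[OF V homogeneousI[OF f]]
      E(2)[OF V f i] E(2)[OF V gl i] pc[OF i])
  qed
  have "gmult P V f g \<in> homogeneous P V" using gc_algebra.closed[OF P.gca[OF V] f gl] by (rule homogeneousI)
  then show "E V (gmult P V f g) = ?r" by (rule E_eqI[OF V _ homogeneousI[OF r] pl])
 next
  fix V W f assume V: "gopen P V" and W: "gopen P W" "W \<subseteq> V" and "f \<in> homogeneous P V"
  then obtain l where f: "f \<in> gsec P V l" by (auto simp: homogeneous_def)
  note oV = h.preim_open[OF V] and oW = h.preim_open[OF W(1)] and WV = h.preim_mono[OF W(2)]
  have r: "gres K (preim h V) (preim h W) (E V f) \<in> gsec K (preim h W) (l + k)"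
   by (rule K.res_closed[OF oV oW WV E(1)[OF V f]])
  have pl: "pull (\<kappa> i) (preim h W) (gres K (preim h V) (preim h W) (E V f)) = D i W (gres P V W f)" if i: "i \<in> I" for i
  proof -
   interpret i: open_embedding "T i" K "\<kappa> i" by (rule emb[OF i])
   show ?thesis
    by (simp add: i.res[OF oV oW WV homogeneousI[OF E(1)[OF V f]]] E(2)[OF V f i]
      derivation.der_res[OF Di[OF i] V W homogeneousI[OF f]] pc[OF i])
  qed
  show "E W (gres P V W f) = gres K (preim h V) (preim h W) (E V f)"
   by (rule E_eqI[OF W(1) homogeneousI[OF P.res_closed[OF V W f]] homogeneousI[OF r] pl])
 qed
 have "precomp h E (\<kappa> i) = D i" if i: "i \<in> I" for i
 proof (rule derivations_eqI[OF hk[OF i] precomp_derivation[OF chart_mors[OF i] h der sheaf_K] D[OF i]])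
  fix V f j assume "gopen P V" "f \<in> gsec P V j"
  then show "precomp h E (\<kappa> i) V f = D i V f" using E(2) i by (simp add: precomp_def)
 qed
 with der show ?thesis by blast
qed

end

section \<open>The algebra of a graded domain\<close>

definition Sm :: "nat => (nat => real) set => ((nat => real) => real) set" where
 "Sm m V = {f. smooth m V f \<and> (\<forall>x. x \<notin> V --> f x = 0)}"

definition restr :: "(nat => real) set => ((nat => real) => real) => (nat => real) => real" where
 "restr V f = (\<lambda>x. if x \<in> V then f x else 0)"

lemma restr_Sm: "eopen m V ==> smooth m V f ==> restr V f \<in> Sm m V"
 unfolding Sm_def restr_def by (auto intro: smooth_cong[of m V f])

lemma restr_Sm_subset: "eopen m V ==> eopen m W ==> W \<subseteq> V ==> f \<in> Sm m V ==> restr W f \<in> Sm m W"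
 by (rule restr_Sm) (auto simp: Sm_def intro: smooth_subset)

lemma subspace_Sm:
 assumes V: "eopen m V" shows "subspace (Sm m V)"
proof (rule subspaceI)
 show "0 \<in> Sm m V" using smooth_const[OF V, of 0] by (simp add: Sm_def zero_fun_def)
 show "f + g \<in> Sm m V" if "f \<in> Sm m V" "g \<in> Sm m V" for f g
  using that smooth_add[OF V] by (simp add: Sm_def plus_fun_def)
 show "c *\<^sub>R f \<in> Sm m V" if "f \<in> Sm m V" for c f
  using that smooth_mult[OF V smooth_const[OF V, of c]] by (simp add: Sm_def scaleR_fun_def)
qed

lemma Sm_mult: "eopen m V ==> f \<in> Sm m V ==> g \<in> Sm m V ==> f * g \<in> Sm m V"
 using smooth_mult by (simp add: Sm_def times_fun_def)

lemma Sm_one: "eopen m V ==> restr V 1 \<in> Sm m V"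
 by (rule restr_Sm) (auto simp: one_fun_def intro: smooth_const)

definition sections :: "nat => nat list => (nat => real) set => int => model_section set" where
 "sections m w V k = {F. (\<forall>\<mu>. F \<mu> \<in> Sm m V) \<and> (\<forall>\<mu>. \<not> (\<mu> \<in> monomials w \<and> mdegree w \<mu> = k) --> F \<mu> = 0)}"

text \<open>The product of \<open>graded_domain\<close> with the exponents below
  \<open>\<nu>\<close> as an order interval and with subtraction of functions, which gives access to
  the library's facts on both.\<close>

definition gmul :: "nat list => model_section => model_section => model_section" where
 "gmul w F G = (\<lambda>\<nu> x. if \<nu> \<in> monomials w
         then \<Sum>\<mu>\<in>{..\<nu>}. koszul_sign w \<mu> (\<nu> - \<mu>) * F \<mu> x * G (\<nu> - \<mu>) x
         else 0)"

definition emb :: "(nat => real) set => ((nat => real) => real) => model_section" where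
 "emb V f = (\<lambda>\<mu> x. if (\<forall>j. \<mu> j = 0) \<and> x \<in> V then f x else 0)"

text \<open>The name stands for monomial: this is the monomial in the generators with exponent
  \<open>\<mu>\<close>, as a section over \<open>V\<close>.\<close>

definition mono :: "(nat => real) set => (nat => nat) => model_section" where
 "mono V \<mu> = (\<lambda>\<beta> x. if \<beta> = \<mu> \<and> x \<in> V then 1 else 0)"

definition unit_exp :: "nat => nat => nat" where
 "unit_exp j = (\<lambda>i. if i = j then 1 else 0)"

abbreviation gen :: "(nat => real) set => nat => model_section" where
 "gen V j \<equiv> mono V (unit_exp j)"

lemma atMost_fun: "{..\<nu>} = {\<mu>. \<forall>j. \<mu> j \<le> (\<nu> j :: nat)}"
 by (auto simp: le_fun_def)

lemma domain_simps [simp]: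
 "base (gdom m w U0) = subtopology (Euclidean_space m) U0"
 "gsec (gdom m w U0) = sections m w"
 "gmult (gdom m w U0) = (\<lambda>U. gmul w)"
 "gone (gdom m w U0) = (\<lambda>U. emb U 1)"
 "gres (gdom m w U0) U V F = (\<lambda>\<mu>. restr V (F \<mu>))"
 by (auto simp: graded_domain_def sections_def Sm_def gmul_def emb_def restr_def fun_eq_iff atMost_fun fun_diff_def)

section \<open>Exponents and Koszul signs\<close>

lemma finite_below:
 assumes "\<nu> \<in> monomials w" shows "finite {..\<nu>}"
proof (rule finite_subset)
 let ?B = "{..(\<Sum>j<length w. \<nu> j)}"
 show "finite {f::nat => nat. \<forall>x. (x \<in> {..<length w} --> f x \<in> ?B) \<and> (x \<notin> {..<length w} --> f x = 0)}"
  by (rule finite_set_of_finite_funs) auto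
 show "{..\<nu>} \<subseteq> {f. \<forall>x. (x \<in> {..<length w} --> f x \<in> ?B) \<and> (x \<notin> {..<length w} --> f x = 0)}"
 proof (intro subsetI CollectI allI conjI impI)
  fix f x assume f: "f \<in> {..\<nu>}"
  then have le: "f x \<le> \<nu> x" by (simp add: le_fun_def)
  { assume "x \<in> {..<length w}"
   then have "\<nu> x \<le> (\<Sum>j<length w. \<nu> j)" by (intro member_le_sum) auto
   with le show "f x \<in> ?B" by simp }
  { assume "x \<notin> {..<length w}"
   then show "f x = 0" using le assms by (auto simp: monomials_def) }
 qed
qed

lemma monomials_below: "\<nu> \<in> monomials w ==> \<mu> \<le> \<nu> ==> \<mu> \<in> monomials w"
 unfolding monomials_def le_fun_def by (auto intro: le_trans) (metis le_zero_eq)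

lemma monomials_diff: "\<nu> \<in> monomials w ==> \<nu> - \<mu> \<in> monomials w"
 by (rule monomials_below) (auto simp: le_fun_def)

lemma mdegree_add: "mdegree w (\<mu> + \<beta>) = mdegree w \<mu> + mdegree w \<beta>"
 by (simp add: mdegree_def sum.distrib algebra_simps)

lemma le_diff_add: "\<mu> \<le> \<nu> ==> \<mu> + (\<nu> - \<mu>) = (\<nu> :: nat => nat)"
 by (auto simp: le_fun_def fun_eq_iff)

lemma mdegree_diff: "\<mu> \<le> \<nu> ==> mdegree w \<mu> + mdegree w (\<nu> - \<mu>) = mdegree w \<nu>"
 using mdegree_add[of w \<mu> "\<nu> - \<mu>"] le_diff_add[of \<mu> \<nu>] by simp

text \<open>The exponent of the Koszul sign. It is biadditive, which makes the sign a cocycle and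
  thereby the product associative.\<close>

definition kex :: "nat list => (nat => nat) => (nat => nat) => nat" where
 "kex w \<mu> \<beta> = (\<Sum>i<length w. \<Sum>j<i. (\<mu> i * w ! i) * (\<beta> j * w ! j))"

lemma koszul_kex: "koszul_sign w \<mu> \<beta> = (-1) ^ kex w \<mu> \<beta>"
 by (simp add: koszul_sign_def kex_def)

lemma kex_add: "kex w (\<mu> + \<mu>') \<beta> = kex w \<mu> \<beta> + kex w \<mu>' \<beta>" "kex w \<mu> (\<beta> + \<beta>') = kex w \<mu> \<beta> + kex w \<mu> \<beta>'"
 by (simp_all add: kex_def sum.distrib algebra_simps)

lemma kex_0 [simp]: "kex w 0 \<beta> = 0" "kex w \<mu> 0 = 0"
 by (simp_all add: kex_def)

lemma koszul_cocycle: "koszul_sign w \<mu> \<beta> * koszul_sign w (\<mu> + \<beta>) \<kappa> = koszul_sign w \<mu> (\<beta> + \<kappa>) * koszul_sign w \<beta> \<kappa>"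
 by (simp add: koszul_kex kex_add power_add[symmetric] ac_simps)

lemma sign_cong: "even a = even b ==> (-1::real) ^ a = (-1) ^ b"
 by (cases "even a") auto

text \<open>The product of the two degrees is a sum over pairs of indices. The pairs off the
  diagonal give the exponents of the two signs; a diagonal term is even because an odd generator
  occurs at most once in \<open>\<mu> + \<beta>\<close>.\<close>

lemma koszul_swap:
 assumes "\<mu> + \<beta> \<in> monomials w"
 shows "koszul_sign w \<mu> \<beta> = ((-1) powi (mdegree w \<mu> * mdegree w \<beta>)) * koszul_sign w \<beta> \<mu>"
proof -
 let ?a = "\<lambda>i. \<mu> i * w ! i" and ?b = "\<lambda>i. \<beta> i * w ! i"
 have "(\<Sum>i<n. ?a i) * (\<Sum>i<n. ?b i) = (\<Sum>i<n. ?a i * ?b i) + (\<Sum>i<n. \<Sum>j<i. ?a i * ?b j) + (\<Sum>i<n. \<Sum>j<i. ?b i * ?a j)" for n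
  by (induction n) (simp_all add: algebra_simps sum_distrib_left sum_distrib_right)
 then have eq: "(\<Sum>i<length w. ?a i) * (\<Sum>i<length w. ?b i) = (\<Sum>i<length w. ?a i * ?b i) + kex w \<mu> \<beta> + kex w \<beta> \<mu>"
  by (simp add: kex_def)
 have "even (\<Sum>i<length w. ?a i * ?b i)"
 proof (rule dvd_sum)
  fix i assume "i \<in> {..<length w}"
  then have "odd (w ! i) ==> \<mu> i + \<beta> i \<le> 1" using assms by (auto simp: monomials_def)
  then have "odd (w ! i) ==> \<mu> i = 0 \<or> \<beta> i = 0" by linarith
  then show "even (?a i * ?b i)" by auto
 qed
 then have "even (kex w \<mu> \<beta>) \<longleftrightarrow> even ((\<Sum>i<length w. ?a i) * (\<Sum>i<length w. ?b i) + kex w \<beta> \<mu>)"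
  unfolding eq by presburger
 then have "(-1::real) ^ kex w \<mu> \<beta> = (-1) ^ ((\<Sum>i<length w. ?a i) * (\<Sum>i<length w. ?b i) + kex w \<beta> \<mu>)"
  by (rule sign_cong)
 moreover have "mdegree w \<mu> * mdegree w \<beta> = int ((\<Sum>i<length w. ?a i) * (\<Sum>i<length w. ?b i))"
  by (simp add: mdegree_def)
 ultimately show ?thesis by (simp add: koszul_kex power_add power_int_of_nat del: of_nat_mult of_nat_sum)
qed

text \<open>Both sides run over the decompositions of \<open>\<nu>\<close> into three summands; the
  left one singles out the sum of the first two, the right one the first.\<close>

lemma sum_below_triple:
 assumes "\<nu> \<in> monomials w"
 shows "(\<Sum>\<delta>\<in>{..\<nu>}. \<Sum>\<mu>\<in>{..\<delta>}. g \<mu> (\<delta> - \<mu>) (\<nu> - \<delta>)) = (\<Sum>\<mu>\<in>{..\<nu>}. \<Sum>\<beta>\<in>{..\<nu> - \<mu>}. g \<mu> \<beta> (\<nu> - \<mu> - \<beta>))"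
proof -
 have fin: "finite {..\<delta>}" if "\<delta> \<le> \<nu>" for \<delta>
  using finite_below[OF monomials_below[OF assms that]] .
 have fin': "finite {..\<nu> - \<mu>}" for \<mu> by (rule fin) (auto simp: le_fun_def)
 have "(\<Sum>\<delta>\<in>{..\<nu>}. \<Sum>\<mu>\<in>{..\<delta>}. g \<mu> (\<delta> - \<mu>) (\<nu> - \<delta>)) = (\<Sum>(\<delta>, \<mu>)\<in>Sigma {..\<nu>} (\<lambda>\<delta>. {..\<delta>}). g \<mu> (\<delta> - \<mu>) (\<nu> - \<delta>))"
  using fin finite_below[OF assms] by (subst sum.Sigma) auto
 also have "\<dots> = (\<Sum>(\<mu>, \<beta>)\<in>Sigma {..\<nu>} (\<lambda>\<mu>. {..\<nu> - \<mu>}). g \<mu> \<beta> (\<nu> - \<mu> - \<beta>))"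
 proof (rule sum.reindex_bij_witness[where i = "\<lambda>(\<mu>, \<beta>). (\<mu> + \<beta>, \<mu>)" and j = "\<lambda>(\<delta>, \<mu>). (\<mu>, \<delta> - \<mu>)"], goal_cases)
  case (1 a) then show ?case by (auto simp: le_diff_add)
 next
  case (2 a) then show ?case by (fastforce simp: le_fun_def intro: le_trans diff_le_mono)
 next
  case (3 b) then show ?case by (auto simp: fun_eq_iff)
 next
  case (4 b)
  then show ?case
   by (auto simp: le_fun_def) (metis le_diff_conv2 add.commute)
 next
  case (5 a)
  have "\<nu> - \<mu> - (\<delta> - \<mu>) = \<nu> - \<delta>" if "\<mu> \<le> \<delta>" for \<mu> \<delta>
   using that by (auto simp: fun_eq_iff le_fun_def)
  then show ?case using 5 by auto
 qed
 also have "\<dots> = (\<Sum>\<mu>\<in>{..\<nu>}. \<Sum>\<beta>\<in>{..\<nu> - \<mu>}. g \<mu> \<beta> (\<nu> - \<mu> - \<beta>))"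
  using fin' finite_below[OF assms] by (subst sum.Sigma) auto
 finally show ?thesis .
qed

section \<open>The graded commutative algebra of sections\<close>

lemma gmul_assoc: "gmul w (gmul w F G) H = gmul w F (gmul w G H)"
proof (intro ext)
 fix \<nu> x
 show "gmul w (gmul w F G) H \<nu> x = gmul w F (gmul w G H) \<nu> x"
 proof (cases "\<nu> \<in> monomials w")
  case True
  define g where "g \<mu> \<beta> \<kappa> = koszul_sign w \<mu> \<beta> * koszul_sign w (\<mu> + \<beta>) \<kappa> * F \<mu> x * G \<beta> x * H \<kappa> x" for \<mu> \<beta> \<kappa>
  have "gmul w (gmul w F G) H \<nu> x = (\<Sum>\<delta>\<in>{..\<nu>}. \<Sum>\<mu>\<in>{..\<delta>}. g \<mu> (\<delta> - \<mu>) (\<nu> - \<delta>))"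
   using True monomials_below[OF True]
   by (auto simp: gmul_def g_def sum_distrib_left sum_distrib_right le_diff_add intro!: sum.cong)
  also have "\<dots> = (\<Sum>\<mu>\<in>{..\<nu>}. \<Sum>\<beta>\<in>{..\<nu> - \<mu>}. g \<mu> \<beta> (\<nu> - \<mu> - \<beta>))" by (rule sum_below_triple[OF True])
  also have "\<dots> = gmul w F (gmul w G H) \<nu> x"
   using True monomials_diff[OF True]
   by (auto simp: gmul_def g_def koszul_cocycle sum_distrib_left sum_distrib_right le_diff_add intro!: sum.cong)
  finally show ?thesis .
 qed (simp add: gmul_def)
qed

lemma sectionsD: "F \<in> sections m w V k ==> F \<mu> \<in> Sm m V"
 "F \<in> sections m w V k ==> F \<mu> \<noteq> 0 ==> \<mu> \<in> monomials w \<and> mdegree w \<mu> = k"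
 "F \<in> sections m w V k ==> x \<notin> V ==> F \<mu> x = 0"
 by (auto simp: sections_def Sm_def)

lemma gmul_eq_sum: "\<nu> \<in> monomials w ==> gmul w F G \<nu> = (\<Sum>\<mu>\<in>{..\<nu>}. koszul_sign w \<mu> (\<nu> - \<mu>) *\<^sub>R (F \<mu> * G (\<nu> - \<mu>)))"
proof
 fix x
 have ap: "(\<Sum>a\<in>S. f a) x = (\<Sum>a\<in>S. f a x)" for S :: "(nat => nat) set" and f :: "_ => (nat => real) => real"
  by (induction S rule: infinite_finite_induct) auto
 assume "\<nu> \<in> monomials w"
 then show "gmul w F G \<nu> x = (\<Sum>\<mu>\<in>{..\<nu>}. koszul_sign w \<mu> (\<nu> - \<mu>) *\<^sub>R (F \<mu> * G (\<nu> - \<mu>))) x"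
  by (simp add: ap gmul_def scaleR_fun_def mult.assoc)
qed

lemma gmul_closed:
 assumes V: "eopen m V" and F: "F \<in> sections m w V j" and G: "G \<in> sections m w V k"
 shows "gmul w F G \<in> sections m w V (j + k)"
 unfolding sections_def
proof (intro CollectI conjI allI impI)
 note S = subspace_Sm[OF V]
 fix \<nu>
 show "gmul w F G \<nu> \<in> Sm m V"
 proof (cases "\<nu> \<in> monomials w")
  case True
  show ?thesis unfolding gmul_eq_sum[OF True]
   by (intro subspace_sum[OF S] subspace_scale[OF S] Sm_mult[OF V] sectionsD(1)[OF F] sectionsD(1)[OF G])
 next
  case False
  then have "gmul w F G \<nu> = 0" by (auto simp: gmul_def)
  then show ?thesis using subspace_0[OF S] by simp
 qed
 assume ng: "\<not> (\<nu> \<in> monomials w \<and> mdegree w \<nu> = j + k)"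
 show "gmul w F G \<nu> = 0"
 proof (cases "\<nu> \<in> monomials w")
  case True
  have "F \<mu> * G (\<nu> - \<mu>) = 0" if "\<mu> \<le> \<nu>" for \<mu>
  proof (rule ccontr)
   assume "F \<mu> * G (\<nu> - \<mu>) \<noteq> 0"
   then have "F \<mu> \<noteq> 0" "G (\<nu> - \<mu>) \<noteq> 0" by auto
   then have "mdegree w \<mu> = j" "mdegree w (\<nu> - \<mu>) = k" using sectionsD(2)[OF F] sectionsD(2)[OF G] by auto
   then show False using ng True mdegree_diff[OF that, of w] by simp
  qed
  then show ?thesis unfolding gmul_eq_sum[OF True] by simp
 qed (auto simp: gmul_def)
qed

lemma gmul_swap:
 assumes F: "F \<in> sections m w V j" and G: "G \<in> sections m w V k"
 shows "gmul w F G = ((-1) powi (j * k)) *\<^sub>R gmul w G F"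
proof (intro ext)
 fix \<nu> x
 show "gmul w F G \<nu> x = (((-1) powi (j * k)) *\<^sub>R gmul w G F) \<nu> x"
 proof (cases "\<nu> \<in> monomials w")
  case True
  have "gmul w F G \<nu> x = (\<Sum>\<mu>\<in>{..\<nu>}. koszul_sign w \<mu> (\<nu> - \<mu>) * F \<mu> x * G (\<nu> - \<mu>) x)"
   using True by (simp add: gmul_def)
  also have "\<dots> = (\<Sum>\<mu>\<in>{..\<nu>}. ((-1) powi (j * k)) * (koszul_sign w (\<nu> - \<mu>) \<mu> * G (\<nu> - \<mu>) x * F \<mu> x))"
  proof (rule sum.cong[OF refl])
   fix \<mu> assume a: "\<mu> \<in> {..\<nu>}"
   show "koszul_sign w \<mu> (\<nu> - \<mu>) * F \<mu> x * G (\<nu> - \<mu>) x = ((-1) powi (j * k)) * (koszul_sign w (\<nu> - \<mu>) \<mu> * G (\<nu> - \<mu>) x * F \<mu> x)"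
   proof (cases "F \<mu> = 0 \<or> G (\<nu> - \<mu>) = 0")
    case True then show ?thesis by auto
   next
    case False
    then have "mdegree w \<mu> = j" "mdegree w (\<nu> - \<mu>) = k" using sectionsD(2)[OF F] sectionsD(2)[OF G] by auto
    moreover have "\<mu> + (\<nu> - \<mu>) \<in> monomials w" using a True by (simp add: le_diff_add)
    ultimately show ?thesis using koszul_swap[of \<mu> "\<nu> - \<mu>" w] by simp
   qed
  qed
  also have "\<dots> = ((-1) powi (j * k)) * (\<Sum>\<mu>\<in>{..\<nu>}. koszul_sign w \<mu> (\<nu> - \<mu>) * G \<mu> x * F (\<nu> - \<mu>) x)"
   unfolding sum_distrib_left[symmetric]
  proof (rule arg_cong[of _ _ "(*) _"], rule sum.reindex_bij_witness[where i = "\<lambda>\<mu>. \<nu> - \<mu>" and j = "\<lambda>\<mu>. \<nu> - \<mu>"])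
   have dd: "\<nu> - (\<nu> - \<mu>) = \<mu>" if "\<mu> \<in> {..\<nu>}" for \<mu>
    using that by (auto simp: fun_eq_iff le_fun_def)
   then show "\<And>a. a \<in> {..\<nu>} ==> \<nu> - (\<nu> - a) = a" "\<And>a. a \<in> {..\<nu>} ==> \<nu> - (\<nu> - a) = a" by auto
   show "\<And>a. a \<in> {..\<nu>} ==> \<nu> - a \<in> {..\<nu>}" "\<And>a. a \<in> {..\<nu>} ==> \<nu> - a \<in> {..\<nu>}" by (auto simp: le_fun_def)
   show "\<And>a. a \<in> {..\<nu>} ==> koszul_sign w (\<nu> - a) (\<nu> - (\<nu> - a)) * G (\<nu> - a) x * F (\<nu> - (\<nu> - a)) x =
     koszul_sign w (\<nu> - a) a * G (\<nu> - a) x * F a x" using dd by simp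
  qed
  finally show ?thesis using True by (simp add: gmul_def scaleR_fun_def)
 qed (simp add: gmul_def scaleR_fun_def)
qed

lemma zero_monomial [simp]: "0 \<in> monomials w" "mdegree w 0 = 0"
 by (auto simp: monomials_def mdegree_def)

lemma emb_eq: "emb V f \<mu> = (if \<mu> = 0 then restr V f else 0)"
 by (auto simp: emb_def restr_def fun_eq_iff)

lemma mono_eq: "mono V \<mu> \<beta> = (if \<beta> = \<mu> then restr V 1 else 0)"
 by (auto simp: mono_def restr_def fun_eq_iff)

lemma restr_id: "f \<in> Sm m V ==> restr V f = f"
 by (auto simp: Sm_def restr_def)

lemma emb_sections: "eopen m V ==> smooth m V f ==> emb V f \<in> sections m w V 0"
 using restr_Sm[of m V f] subspace_0[OF subspace_Sm[of m V]] by (auto simp: sections_def emb_eq)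

lemma mono_sections: "eopen m V ==> \<mu> \<in> monomials w ==> mono V \<mu> \<in> sections m w V (mdegree w \<mu>)"
 using Sm_one[of m V] subspace_0[OF subspace_Sm[of m V]] by (auto simp: sections_def mono_eq)

lemma unit_exp_monomial: "j < length w ==> unit_exp j \<in> monomials w" "j < length w ==> mdegree w (unit_exp j) = int (w ! j)"
proof -
 assume j: "j < length w"
 show "unit_exp j \<in> monomials w" using j by (auto simp: monomials_def unit_exp_def)
 have "mdegree w (unit_exp j) = (\<Sum>i<length w. if i = j then int (w ! j) else 0)"
  unfolding mdegree_def by (rule sum.cong) (auto simp: unit_exp_def)
 then show "mdegree w (unit_exp j) = int (w ! j)" using j by simp
qed

lemma gen_sections: "eopen m V ==> j < length w ==> gen V j \<in> sections m w V (int (w ! j))"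
 using mono_sections[of m V "unit_exp j" w] unit_exp_monomial by simp

lemma gmul_emb_left:
 assumes "F \<in> sections m w V k"
 shows "gmul w (emb V f) F \<mu> x = f x * F \<mu> x"
proof (cases "\<mu> \<in> monomials w \<and> x \<in> V")
 case True
 have "gmul w (emb V f) F \<mu> x = (\<Sum>\<beta>\<in>{..\<mu>}. if \<beta> = 0 then f x * F \<mu> x else 0)"
  unfolding gmul_def using True by (auto simp: emb_eq koszul_kex restr_def intro!: sum.cong)
 then show ?thesis using True finite_below[of \<mu> w] by (simp add: le_fun_def)
next
 case False
 then have "F \<mu> x = 0" using sectionsD(2,3)[OF assms] by (metis zero_fun_apply)
 moreover have "gmul w (emb V f) F \<mu> x = 0" using False by (auto simp: gmul_def emb_def)
 ultimately show ?thesis by simp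
qed

lemma gmul_emb_right:
 assumes "F \<in> sections m w V k"
 shows "gmul w F (emb V f) \<mu> x = F \<mu> x * f x"
proof (cases "\<mu> \<in> monomials w \<and> x \<in> V")
 case True
 have z: "\<mu> - \<beta> = 0 \<longleftrightarrow> \<beta> = \<mu>" if "\<beta> \<in> {..\<mu>}" for \<beta>
  using that by (auto simp: fun_eq_iff le_fun_def intro: antisym)
 have "gmul w F (emb V f) \<mu> x = (\<Sum>\<beta>\<in>{..\<mu>}. if \<beta> = \<mu> then F \<mu> x * f x else 0)"
  unfolding gmul_def using True z by (auto simp: emb_eq koszul_kex restr_def intro!: sum.cong)
 then show ?thesis using True finite_below[of \<mu> w] by simp
next
 case False
 then have "F \<mu> x = 0" using sectionsD(2,3)[OF assms] by (metis zero_fun_apply)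
 moreover have "gmul w F (emb V f) \<mu> x = 0" using False by (auto simp: gmul_def emb_def)
 ultimately show ?thesis by simp
qed

lemma gmul_0: "gmul w F G 0 x = F 0 x * G 0 x"
proof -
 have "{..0::nat => nat} = {0}" by (auto simp: le_fun_def fun_eq_iff)
 then show ?thesis by (simp add: gmul_def koszul_kex)
qed

lemma gmul_mono:
 assumes "\<mu> + \<beta> \<in> monomials w"
 shows "gmul w (mono V \<mu>) (mono V \<beta>) = koszul_sign w \<mu> \<beta> *\<^sub>R mono V (\<mu> + \<beta>)"
proof (intro ext)
 fix \<nu> x
 show "gmul w (mono V \<mu>) (mono V \<beta>) \<nu> x = (koszul_sign w \<mu> \<beta> *\<^sub>R mono V (\<mu> + \<beta>)) \<nu> x"
 proof (cases "\<nu> \<in> monomials w")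
  case True
  have *: "\<mu>' = \<mu> \<and> \<nu> - \<mu>' = \<beta> \<longleftrightarrow> \<mu>' = \<mu> \<and> \<nu> = \<mu> + \<beta>" if "\<mu>' \<in> {..\<nu>}" for \<mu>'
   using that le_diff_add[of \<mu>' \<nu>] by (auto simp: fun_eq_iff)
  have "gmul w (mono V \<mu>) (mono V \<beta>) \<nu> x =
    (\<Sum>\<mu>'\<in>{..\<nu>}. if \<mu>' = \<mu> then (if \<nu> = \<mu> + \<beta> \<and> x \<in> V then koszul_sign w \<mu> \<beta> else 0) else 0)"
   unfolding gmul_def if_P[OF True]
  proof (rule sum.cong[OF refl])
   fix \<mu>' assume "\<mu>' \<in> {..\<nu>}"
   from *[OF this] show "koszul_sign w \<mu>' (\<nu> - \<mu>') * mono V \<mu> \<mu>' x * mono V \<beta> (\<nu> - \<mu>') x =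
     (if \<mu>' = \<mu> then (if \<nu> = \<mu> + \<beta> \<and> x \<in> V then koszul_sign w \<mu> \<beta> else 0) else 0)"
    unfolding mono_def by auto
  qed
  also have "\<dots> = (if \<nu> = \<mu> + \<beta> \<and> x \<in> V then koszul_sign w \<mu> \<beta> else 0)"
   using finite_below[OF True] by (auto simp: le_fun_def)
  finally show ?thesis by (simp add: mono_def scaleR_fun_def)
 next
  case False
  then show ?thesis using assms by (auto simp: gmul_def mono_def scaleR_fun_def)
 qed
qed

lemma subspace_sections:
 assumes V: "eopen m V" shows "subspace (sections m w V k)"
proof -
 note S = subspace_Sm[OF V]
 show ?thesis
  by (rule subspaceI) (auto simp: sections_def subspace_0[OF S] subspace_add[OF S] subspace_scale[OF S] scaleR_fun_def[of _ "_ :: model_section"])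
qed

lemma gmul_linear: "linear_map_on S (gmul w F)" "linear_map_on S (\<lambda>F. gmul w F G)"
 by (auto simp: linear_map_on_def gmul_def fun_eq_iff scaleR_fun_def algebra_simps sum.distrib sum_distrib_left)

lemma gca_domain:
 assumes V: "eopen m V"
 shows "graded_commutative_algebra (sections m w V) (gmul w) (emb V 1)"
 unfolding graded_commutative_algebra_def
proof (intro conjI allI impI ballI)
 fix j k :: int assume jk: "j \<noteq> k"
 show "sections m w V j \<inter> sections m w V k = {0}"
 proof (intro equalityI subsetI)
  fix F assume "F \<in> sections m w V j \<inter> sections m w V k"
  then have F: "F \<in> sections m w V j" "F \<in> sections m w V k" by auto
  have "F \<mu> = 0" for \<mu> using sectionsD(2)[OF F(1), of \<mu>] sectionsD(2)[OF F(2), of \<mu>] jk by auto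
  then show "F \<in> {0}" by (auto simp: fun_eq_iff)
 qed (use subspace_0[OF subspace_sections[OF V]] in auto)
next
 fix k F assume F: "F \<in> sections m w V k"
 show "gmul w (emb V 1) F = F" using gmul_emb_left[OF F, of 1] by (auto simp: fun_eq_iff)
 show "gmul w F (emb V 1) = F" using gmul_emb_right[OF F, of 1] by (auto simp: fun_eq_iff)
next
 show "emb V 1 \<in> sections m w V 0" by (rule emb_sections[OF V]) (auto simp: one_fun_def intro: smooth_const V)
next
 fix j k F G assume "F \<in> sections m w V j" "G \<in> sections m w V k"
 then show "gmul w F G = ((-1) powi (j * k)) *\<^sub>R gmul w G F" by (rule gmul_swap)
qed (auto simp: subspace_sections[OF V] gmul_closed[OF V] gmul_linear gmul_assoc)

section \<open>Decomposition of sections into monomials\<close>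

lemma sum_apply2: "(\<Sum>a\<in>S. f a) \<mu> x = (\<Sum>a\<in>S. (f a :: model_section) \<mu> x)"
 by (induction S rule: infinite_finite_induct) auto

lemma finite_monomials_degree:
 assumes "\<forall>d\<in>set w. 1 \<le> d"
 shows "finite {\<mu> \<in> monomials w. mdegree w \<mu> = k}"
proof (rule finite_subset)
 show "finite {f::nat => nat. \<forall>x. (x \<in> {..<length w} --> f x \<in> {..nat k}) \<and> (x \<notin> {..<length w} --> f x = 0)}"
  by (rule finite_set_of_finite_funs) auto
 show "{\<mu> \<in> monomials w. mdegree w \<mu> = k} \<subseteq> {f. \<forall>x. (x \<in> {..<length w} --> f x \<in> {..nat k}) \<and> (x \<notin> {..<length w} --> f x = 0)}"
 proof (intro subsetI CollectI allI conjI impI)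
  fix f x assume f: "f \<in> {\<mu> \<in> monomials w. mdegree w \<mu> = k}"
  { assume x: "x \<in> {..<length w}"
   have "int (f x * 1) \<le> int (f x * w ! x)" using assms x by (intro iffD2[OF of_nat_le_iff] mult_le_mono2) auto
   also have "int (f x * w ! x) \<le> (\<Sum>j<length w. int (f j * w ! j))"
    using x by (intro member_le_sum) auto
   also have "\<dots> = k" using f by (auto simp: mdegree_def)
   finally show "f x \<in> {..nat k}" by simp }
  { assume "x \<notin> {..<length w}" then show "f x = 0" using f by (auto simp: monomials_def) }
 qed
qed

lemma finite_support:
 assumes "\<forall>d\<in>set w. 1 \<le> d" "F \<in> sections m w V k"
 shows "finite {\<mu>. F \<mu> \<noteq> 0}"
 by (rule finite_subset[OF _ finite_monomials_degree[OF assms(1), of k]]) (use sectionsD(2)[OF assms(2)] in auto)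

lemma mdegree_pos:
 assumes "\<forall>d\<in>set w. 1 \<le> d" "\<mu> \<in> monomials w"
 shows "mdegree w \<mu> \<ge> 0" "mdegree w \<mu> = 0 ==> \<mu> = 0"
proof -
 show "mdegree w \<mu> \<ge> 0" by (auto simp: mdegree_def intro: sum_nonneg)
 assume "mdegree w \<mu> = 0"
 then have z: "\<forall>j\<in>{..<length w}. int (\<mu> j * w ! j) = 0" unfolding mdegree_def by (subst (asm) sum_nonneg_eq_0_iff) auto
 have "\<mu> j = 0" for j
 proof (cases "j < length w")
  case True
  then have "1 \<le> w ! j" using assms(1) by auto
  then show ?thesis using z True by auto
 next
  case False
  then show ?thesis using assms(2) by (auto simp: monomials_def)
 qed
 then show "\<mu> = 0" by (auto simp: fun_eq_iff)
qed

lemma sections_degree_0: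
 assumes "\<forall>d\<in>set w. 1 \<le> d" "F \<in> sections m w V 0"
 shows "F = emb V (F 0)" "F 0 \<in> Sm m V"
proof -
 show *: "F 0 \<in> Sm m V" using sectionsD(1)[OF assms(2)] .
 have "F \<mu> = 0" if "\<mu> \<noteq> 0" for \<mu>
  using that sectionsD(2)[OF assms(2), of \<mu>] mdegree_pos(2)[OF assms(1), of \<mu>] by auto
 then have "F \<mu> = emb V (F 0) \<mu>" for \<mu> using restr_id[OF *] by (simp add: emb_eq)
 then show "F = emb V (F 0)" by blast
qed

lemma sections_positive_degree:
 assumes "\<forall>d\<in>set w. 1 \<le> d" "F \<in> sections m w V k" "k \<noteq> 0"
 shows "F 0 = 0"
 using sectionsD(2)[OF assms(2), of 0] assms(3) by auto

text \<open>A generator is split off a monomial on the left, the one with the least index, so that no sign appears.\<close>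

lemma section_induct:
 assumes pos: "\<forall>d\<in>set w. 1 \<le> d" and V: "eopen m V" and F: "F \<in> sections m w V k"
  and supp: "\<And>\<mu> j. F \<mu> \<noteq> 0 ==> \<mu> j \<noteq> 0 ==> j \<in> J"
  and emb: "\<And>f. f \<in> Sm m V ==> P 0 (emb V f)"
  and gen: "\<And>j. j < length w ==> j \<in> J ==> P (int (w ! j)) (gen V j)"
  and mult: "\<And>F G a b. F \<in> sections m w V a ==> G \<in> sections m w V b ==> P a F ==> P b G ==> P (a + b) (gmul w F G)"
  and add: "\<And>F G a. F \<in> sections m w V a ==> G \<in> sections m w V a ==> P a F ==> P a G ==> P a (F + G)"
  and zero: "\<And>a. P a 0"
 shows "P k F"
proof -
 have one: "P 0 (mono V 0)"
 proof -
  have "mono V 0 = emb V (restr V 1)" by (auto simp: mono_eq emb_eq restr_def fun_eq_iff)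
  then show ?thesis using emb[OF Sm_one[OF V]] by simp
 qed
 have mon: "P (mdegree w \<mu>) (mono V \<mu>)" if "\<mu> \<in> monomials w" "\<And>j. \<mu> j \<noteq> 0 ==> j \<in> J" for \<mu>
  using that
 proof (induction "\<Sum>j<length w. \<mu> j" arbitrary: \<mu> rule: less_induct)
  case less
  show ?case
  proof (cases "\<mu> = 0")
   case True then show ?thesis using one by simp
  next
   case False
   then obtain j0 where "\<mu> j0 \<noteq> 0" by (auto simp: fun_eq_iff)
   define j where "j = (LEAST j. \<mu> j \<noteq> 0)"
   have j: "\<mu> j \<noteq> 0" unfolding j_def by (rule LeastI[of _ j0]) fact
   have jmin: "\<mu> i = 0" if "i < j" for i using not_less_Least[of i "\<lambda>j. \<mu> j \<noteq> 0"] that by (auto simp: j_def)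
   have jl: "j < length w" using j less.prems(1) by (auto simp: monomials_def intro: ccontr)
   define \<beta> where "\<beta> = \<mu> - unit_exp j"
   have ab: "unit_exp j + \<beta> = \<mu>" using j by (auto simp: \<beta>_def unit_exp_def fun_eq_iff)
   have \<beta>m: "\<beta> \<in> monomials w" unfolding \<beta>_def by (rule monomials_diff[OF less.prems(1)])
   have "(\<Sum>i<length w. \<mu> i) = (\<Sum>i<length w. unit_exp j i) + (\<Sum>i<length w. \<beta> i)"
    using ab by (auto simp: sum.distrib[symmetric] fun_eq_iff)
   moreover have "(\<Sum>i<length w. unit_exp j i) = 1" using jl by (simp add: unit_exp_def)
   ultimately have lt: "(\<Sum>i<length w. \<beta> i) < (\<Sum>i<length w. \<mu> i)" by simp
   have \<beta>J: "i \<in> J" if "\<beta> i \<noteq> 0" for i using less.prems(2)[of i] that by (auto simp: \<beta>_def)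
   have "kex w (unit_exp j) \<beta> = 0"
    unfolding kex_def by (auto simp: unit_exp_def \<beta>_def jmin)
   then have "gmul w (gen V j) (mono V \<beta>) = mono V \<mu>"
    using gmul_mono[of "unit_exp j" \<beta> w V] less.prems(1) by (simp add: ab koszul_kex)
   moreover have "P (int (w ! j) + mdegree w \<beta>) (gmul w (gen V j) (mono V \<beta>))"
    by (rule mult[OF gen_sections[OF V jl] mono_sections[OF V \<beta>m] gen[OF jl less.prems(2)[OF j]] less.hyps[OF lt \<beta>m \<beta>J]])
   moreover have "int (w ! j) + mdegree w \<beta> = mdegree w \<mu>"
    using mdegree_add[of w "unit_exp j" \<beta>] ab unit_exp_monomial(2)[OF jl] by simp
   ultimately show ?thesis by simp
  qed
 qed
 \<comment> \<open>The section is the sum of its coefficient functions times monomials. The sum is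
   finite because all generators have positive degree.\<close>
 define S where "S = {\<mu>. F \<mu> \<noteq> 0}"
 have S: "finite S" unfolding S_def by (rule finite_support[OF pos F])
 have summand: "gmul w (emb V (F \<mu>)) (mono V \<mu>) \<in> sections m w V k \<and> P k (gmul w (emb V (F \<mu>)) (mono V \<mu>))" if "\<mu> \<in> S" for \<mu>
 proof -
  have a: "\<mu> \<in> monomials w" "mdegree w \<mu> = k" using sectionsD(2)[OF F] that by (auto simp: S_def)
  have e: "emb V (F \<mu>) \<in> sections m w V 0" using sectionsD(1)[OF F, of \<mu>] by (intro emb_sections[OF V]) (auto simp: Sm_def)
  have m: "mono V \<mu> \<in> sections m w V k" using mono_sections[OF V a(1)] a(2) by simp
  have "P k (mono V \<mu>)" using mon[OF a(1) supp[of \<mu>]] that a(2) by (auto simp: S_def)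
  then show ?thesis using gmul_closed[OF V e m] mult[OF e m emb[OF sectionsD(1)[OF F]]] by simp
 qed
 have "(\<Sum>\<mu>\<in>S'. gmul w (emb V (F \<mu>)) (mono V \<mu>)) \<in> sections m w V k \<and> P k (\<Sum>\<mu>\<in>S'. gmul w (emb V (F \<mu>)) (mono V \<mu>))"
  if "finite S'" "S' \<subseteq> S" for S'
  using that
 proof (induction S' rule: finite_induct)
  case empty show ?case unfolding sum.empty using zero subspace_0[OF subspace_sections[OF V]] by blast
 next
  case (insert a S')
  then have "a \<in> S" "(\<Sum>\<mu>\<in>S'. gmul w (emb V (F \<mu>)) (mono V \<mu>)) \<in> sections m w V k \<and> P k (\<Sum>\<mu>\<in>S'. gmul w (emb V (F \<mu>)) (mono V \<mu>))"
   by auto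
  with summand[of a] show ?case unfolding sum.insert[OF insert.hyps(1,2)]
   using add subspace_add[OF subspace_sections[OF V]] by blast
 qed
 from this[OF S order_refl] have "P k (\<Sum>\<mu>\<in>S. gmul w (emb V (F \<mu>)) (mono V \<mu>))" by simp
 moreover have "(\<Sum>\<mu>\<in>S. gmul w (emb V (F \<mu>)) (mono V \<mu>)) = F"
 proof (intro ext)
  fix \<beta> x
  have "(\<Sum>\<mu>\<in>S. gmul w (emb V (F \<mu>)) (mono V \<mu>)) \<beta> x = (\<Sum>\<mu>\<in>S. gmul w (emb V (F \<mu>)) (mono V \<mu>) \<beta> x)"
   by (rule sum_apply2)
  also have "\<dots> = (\<Sum>\<mu>\<in>S. if \<mu> = \<beta> then F \<beta> x else 0)"
  proof (rule sum.cong[OF refl])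
   fix \<mu> assume "\<mu> \<in> S"
   then have "\<mu> \<in> monomials w" using sectionsD(2)[OF F] by (auto simp: S_def)
   from gmul_emb_left[OF mono_sections[OF V this]]
   show "gmul w (emb V (F \<mu>)) (mono V \<mu>) \<beta> x = (if \<mu> = \<beta> then F \<beta> x else 0)"
    using sectionsD(3)[OF F, of x \<beta>] by (auto simp: mono_def)
  qed
  also have "\<dots> = F \<beta> x" using S by (auto simp: S_def)
  finally show "(\<Sum>\<mu>\<in>S. gmul w (emb V (F \<mu>)) (mono V \<mu>)) \<beta> x = F \<beta> x" .
 qed
 ultimately show ?thesis by simp
qed

section \<open>Homomorphisms out of the algebra of sections\<close>

context gc_algebra
begin

primrec pw :: "'a => nat => 'a" where
 "pw x 0 = e"
| "pw x (Suc k) = m (pw x k) x"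

text \<open>The product of powers of the \<open>\<eta> j\<close> in the order of the indices: the
  image which the monomial with exponent \<open>\<mu>\<close> must have under a homomorphism sending
  generators to the \<open>\<eta> j\<close>.\<close>

primrec mon :: "(nat => 'a) => nat => (nat => nat) => 'a" where
 "mon \<eta> 0 \<mu> = e"
| "mon \<eta> (Suc n) \<mu> = m (mon \<eta> n \<mu>) (pw (\<eta> n) (\<mu> n))"

lemma pw_closed: "x \<in> A d ==> pw x k \<in> A (int k * d)"
 by (induction k) (auto simp: one algebra_simps dest: closed[of _ _ x d])

lemma pw_add: "x \<in> A d ==> pw x (a + b) = m (pw x a) (pw x b)"
proof (induction b)
 case 0 then show ?case using one(3)[OF pw_closed[OF 0]] by simp
next
 case (Suc b) then show ?case by (simp add: assoc[OF pw_closed[OF Suc.prems] pw_closed[OF Suc.prems] Suc.prems])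
qed

lemma odd_square: "x \<in> A d ==> odd d ==> m x x = 0"
proof -
 assume x: "x \<in> A d" "odd d"
 then have "m x x = (-1) *\<^sub>R m x x" using comm[OF x(1) x(1)] by (simp add: power_int_minus_left)
 then have "m x x = - m x x" by simp
 then have "m x x + m x x = 0" by (metis add.right_inverse)
 then have "2 *\<^sub>R m x x = 0" by (simp only: scaleR_2)
 then show ?thesis by simp
qed

lemma pw_odd: "x \<in> A d ==> odd d ==> 2 \<le> k ==> pw x k = 0"
proof -
 assume x: "x \<in> A d" "odd d" "2 \<le> k"
 then obtain l where k: "k = Suc (Suc l)" by (metis add_2_eq_Suc le_Suc_ex)
 have "pw x k = m (pw x l) (m x x)" unfolding k by (simp add: assoc[OF pw_closed[OF x(1)] x(1) x(1)])
 then show ?thesis using odd_square[OF x(1,2)] mult_0(1)[OF pw_closed[OF x(1)]] by simp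
qed

lemma mon_closed: "(\<And>j. j < n ==> \<eta> j \<in> A (d j)) ==> mon \<eta> n \<mu> \<in> A (\<Sum>j<n. int (\<mu> j) * d j)"
 by (induction n) (auto simp: one intro!: closed pw_closed)

text \<open>Induction on the number of generators: the last power of the first monomial is moved
  past the rest of the second one. This costs the sign \<open>?s\<close>, which contributes the
  terms with \<open>i = n\<close> to the exponent.\<close>

lemma mon_mult:
 "(\<And>j. j < n ==> \<eta> j \<in> A (d j)) ==>
  m (mon \<eta> n \<mu>) (mon \<eta> n \<beta>) = ((-1) powi (\<Sum>i<n. \<Sum>j<i. (int (\<mu> i) * d i) * (int (\<beta> j) * d j))) *\<^sub>R mon \<eta> n (\<mu> + \<beta>)"
proof (induction n)
 case 0 then show ?case using one by simp
next
 case (Suc n)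
 let ?p = "\<Sum>j<n. int (\<mu> j) * d j" and ?q = "\<Sum>j<n. int (\<beta> j) * d j"
 have P: "mon \<eta> n \<mu> \<in> A ?p" and Q: "mon \<eta> n \<beta> \<in> A ?q" and PQ: "mon \<eta> n (\<mu> + \<beta>) \<in> A (\<Sum>j<n. int ((\<mu> + \<beta>) j) * d j)"
  by (rule mon_closed, rule Suc.prems, simp)+
 have a: "pw (\<eta> n) (\<mu> n) \<in> A (int (\<mu> n) * d n)" and b: "pw (\<eta> n) (\<beta> n) \<in> A (int (\<beta> n) * d n)" and c: "pw (\<eta> n) (\<mu> n + \<beta> n) \<in> A (int (\<mu> n + \<beta> n) * d n)"
  using Suc.prems by (auto intro!: pw_closed simp del: of_nat_add)
 let ?s = "(-1::real) powi ((int (\<mu> n) * d n) * ?q)"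
 let ?r = "(-1::real) powi (\<Sum>i<n. \<Sum>j<i. (int (\<mu> i) * d i) * (int (\<beta> j) * d j))"
 have "m (mon \<eta> (Suc n) \<mu>) (mon \<eta> (Suc n) \<beta>) = m (mon \<eta> n \<mu>) (m (m (pw (\<eta> n) (\<mu> n)) (mon \<eta> n \<beta>)) (pw (\<eta> n) (\<beta> n)))"
  by (simp add: assoc[OF P a closed[OF Q b]] assoc[OF a Q b])
 also have "\<dots> = m (mon \<eta> n \<mu>) (?s *\<^sub>R m (m (mon \<eta> n \<beta>) (pw (\<eta> n) (\<mu> n))) (pw (\<eta> n) (\<beta> n)))"
  by (simp add: comm[OF a Q] scale_left[OF closed[OF Q a] b])
 also have "\<dots> = ?s *\<^sub>R m (mon \<eta> n \<mu>) (m (mon \<eta> n \<beta>) (m (pw (\<eta> n) (\<mu> n)) (pw (\<eta> n) (\<beta> n))))"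
  by (simp add: assoc[OF Q a b] scale_right[OF P closed[OF Q closed[OF a b]]])
 also have "\<dots> = ?s *\<^sub>R m (m (mon \<eta> n \<mu>) (mon \<eta> n \<beta>)) (pw (\<eta> n) (\<mu> n + \<beta> n))"
  using Suc.prems by (simp add: assoc[OF P Q closed[OF a b]] pw_add[of _ "d n"])
 also have "m (mon \<eta> n \<mu>) (mon \<eta> n \<beta>) = ?r *\<^sub>R mon \<eta> n (\<mu> + \<beta>)"
  by (rule Suc.IH) (simp add: Suc.prems)
 also have "m (?r *\<^sub>R mon \<eta> n (\<mu> + \<beta>)) (pw (\<eta> n) (\<mu> n + \<beta> n)) = ?r *\<^sub>R mon \<eta> (Suc n) (\<mu> + \<beta>)"
  by (simp only: scale_left[OF PQ c] mon.simps plus_fun_apply)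
 also have "?s *\<^sub>R ?r *\<^sub>R mon \<eta> (Suc n) (\<mu> + \<beta>) = (?r * ?s) *\<^sub>R mon \<eta> (Suc n) (\<mu> + \<beta>)" by simp
 also have "?r * ?s = (-1) powi (\<Sum>i<Suc n. \<Sum>j<i. (int (\<mu> i) * d i) * (int (\<beta> j) * d j))"
  by (simp add: power_int_add sum_distrib_left)
 finally show ?case .
qed

text \<open>Odd elements square to \<open>0\<close>. This matches \<open>gmul\<close>, where the
  products whose exponent leaves \<open>monomials\<close> are dropped.\<close>

lemma mon_vanishes: "(\<And>j. j < n ==> \<eta> j \<in> A (d j)) ==> i < n ==> odd (d i) ==> 2 \<le> \<nu> i ==> mon \<eta> n \<nu> = 0"
proof (induction n)
 case (Suc n)
 show ?case
 proof (cases "i = n")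
  case True
  then show ?thesis using Suc.prems pw_odd[of "\<eta> n" "d n" "\<nu> n"] mult_0(1)[OF mon_closed[of n \<eta> d]] by simp
 next
  case False
  then have "mon \<eta> n \<nu> = 0" using Suc by auto
  then show ?thesis using mult_0(2)[OF pw_closed[of "\<eta> n" "d n"]] Suc.prems by simp
 qed
qed simp

lemma mon_zero: "mon \<eta> n 0 = e"
 by (induction n) (simp_all add: one(2)[OF one(1)])

lemma mon_unit: "(\<And>j. j < n ==> \<eta> j \<in> A (d j)) ==> j < n ==> mon \<eta> n (unit_exp j) = \<eta> j"
proof (induction n)
 case (Suc n)
 show ?case
 proof (cases "j = n")
  case True
  have "mon \<eta> n (unit_exp j) = mon \<eta> n 0" if "n \<le> j" for n
   using that by (induction n) (auto simp: unit_exp_def)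
  then show ?thesis using True mon_zero one(2)[of "\<eta> n" "d n"] Suc.prems by (simp add: unit_exp_def)
 next
  case False
  then have "j < n" using Suc.prems by simp
  then show ?thesis using Suc False one(3)[of "\<eta> j" "d j"] by (simp add: unit_exp_def)
 qed
qed simp

text \<open>The algebra of sections is free over the smooth functions as a graded commutative
  algebra: a homomorphism on functions and arbitrary images of the generators of the right degrees
  extend by mapping each coefficient with \<open>\<theta>\<close> and each monomial with
  \<open>mon\<close>.\<close>

lemma hom_exists:
 assumes pos: "\<forall>d\<in>set w. 1 \<le> d" and V: "eopen dm V"
  and \<theta>: "\<And>f. f \<in> Sm dm V ==> \<theta> f \<in> A 0" "linear_map_on (Sm dm V) \<theta>" "\<theta> (restr V 1) = e"
   "\<And>f g. f \<in> Sm dm V ==> g \<in> Sm dm V ==> \<theta> (f * g) = m (\<theta> f) (\<theta> g)"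
  and \<eta>: "\<And>j. j < length w ==> \<eta> j \<in> A (int (w ! j))"
 shows "\<exists>\<Phi>. (\<forall>k. \<forall>F\<in>sections dm w V k. \<Phi> F \<in> A k) \<and> (\<forall>k. linear_map_on (sections dm w V k) \<Phi>) \<and>
   (\<forall>j k. \<forall>F\<in>sections dm w V j. \<forall>G\<in>sections dm w V k. \<Phi> (gmul w F G) = m (\<Phi> F) (\<Phi> G)) \<and>
   (\<forall>f\<in>Sm dm V. \<Phi> (emb V f) = \<theta> f) \<and> (\<forall>j<length w. \<Phi> (gen V j) = \<eta> j)"
proof -
 note SS = subspace_Sm[OF V]
 have \<theta>0: "\<theta> 0 = 0" by (rule linear_map_on_0[OF \<theta>(2) SS])
 define M where "M = mon \<eta> (length w)"
 have M: "M \<mu> \<in> A (mdegree w \<mu>)" for \<mu>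
  using mon_closed[of "length w" \<eta> "\<lambda>j. int (w ! j)" \<mu>, OF \<eta>] by (simp add: M_def mdegree_def)
 define T where "T F \<mu> = m (\<theta> (F \<mu>)) (M \<mu>)" for F :: model_section and \<mu>
 \<comment> \<open>Summing over the support makes the definition independent of the degree. For a
   section of degree \<open>k\<close> the sum may be taken over the finite set \<open>Mk k\<close>
   instead, which is the same for all such sections.\<close>
 define \<Phi> where "\<Phi> F = (\<Sum>\<mu> | F \<mu> \<noteq> 0. T F \<mu>)" for F :: model_section
 have T0: "T F \<mu> = 0" if "F \<mu> = 0" for F \<mu> using that by (simp add: T_def \<theta>0 mult_0(2)[OF M])
 define Mk where "Mk k = {\<mu> \<in> monomials w. mdegree w \<mu> = k}" for k
 have fin: "finite (Mk k)" for k unfolding Mk_def by (rule finite_monomials_degree[OF pos])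
 have \<Phi>: "\<Phi> F = (\<Sum>\<mu>\<in>Mk k. T F \<mu>)" if F: "F \<in> sections dm w V k" for F k
  unfolding \<Phi>_def by (rule sum.mono_neutral_left[OF fin]) (use sectionsD(2)[OF F] T0 in "auto simp: Mk_def")
 have TA: "T F \<mu> \<in> A k" if "F \<in> sections dm w V k" "\<mu> \<in> Mk k" for F \<mu> k
  using closed[OF \<theta>(1)[OF sectionsD(1)[OF that(1)]] M, of \<mu> \<mu>] that(2) by (simp add: T_def Mk_def)
 have cl: "\<Phi> F \<in> A k" if "F \<in> sections dm w V k" for F k
  unfolding \<Phi>[OF that] by (rule sum) (rule TA[OF that])
 have lin: "linear_map_on (sections dm w V k) \<Phi>" for k
  unfolding linear_map_on_def
 proof (intro conjI ballI allI)
  fix F G assume F: "F \<in> sections dm w V k" and G: "G \<in> sections dm w V k"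
  have "T (F + G) \<mu> = T F \<mu> + T G \<mu>" for \<mu>
   using linear_map_on_add[OF \<theta>(2) sectionsD(1)[OF F, of \<mu>] sectionsD(1)[OF G, of \<mu>]]
    add_left[OF \<theta>(1)[OF sectionsD(1)[OF F]] \<theta>(1)[OF sectionsD(1)[OF G]] M] by (simp add: T_def)
  then show "\<Phi> (F + G) = \<Phi> F + \<Phi> G"
   using \<Phi>[OF F] \<Phi>[OF G] \<Phi>[OF subspace_add[OF subspace_sections[OF V] F G]] by (simp add: sum.distrib)
 next
  fix c F assume F: "F \<in> sections dm w V k"
  have "T (c *\<^sub>R F) \<mu> = c *\<^sub>R T F \<mu>" for \<mu>
   using linear_map_on_scale[OF \<theta>(2) sectionsD(1)[OF F, of \<mu>], of c]
    scale_left[OF \<theta>(1)[OF sectionsD(1)[OF F]] M] by (simp add: T_def scaleR_fun_def[of c F])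
  then show "\<Phi> (c *\<^sub>R F) = c *\<^sub>R \<Phi> F"
   using \<Phi>[OF F] \<Phi>[OF subspace_scale[OF subspace_sections[OF V] F]] by (simp add: scaleR_sum_right)
 qed
 have mult: "\<Phi> (gmul w F G) = m (\<Phi> F) (\<Phi> G)" if F: "F \<in> sections dm w V j" and G: "G \<in> sections dm w V k" for F G j k
 proof -
  define h where "h \<mu> \<beta> = koszul_sign w \<mu> \<beta> *\<^sub>R m (m (\<theta> (F \<mu>)) (\<theta> (G \<beta>))) (M (\<mu> + \<beta>))" for \<mu> \<beta>
  have \<theta>F: "\<theta> (F \<mu>) \<in> A 0" and \<theta>G: "\<theta> (G \<mu>) \<in> A 0" for \<mu>
   using \<theta>(1) sectionsD(1)[OF F] sectionsD(1)[OF G] by auto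
  have \<theta>FG: "m (\<theta> (F \<mu>)) (\<theta> (G \<beta>)) \<in> A 0" for \<mu> \<beta> using closed[OF \<theta>F \<theta>G] by simp
  have FG: "F \<mu> * G \<beta> \<in> Sm dm V" for \<mu> \<beta> using Sm_mult[OF V] sectionsD(1)[OF F] sectionsD(1)[OF G] by auto
  have "\<Phi> (gmul w F G) = (\<Sum>\<nu>\<in>Mk (j + k). \<Sum>\<mu>\<in>{..\<nu>}. h \<mu> (\<nu> - \<mu>))"
   unfolding \<Phi>[OF gmul_closed[OF V F G]]
  proof (rule sum.cong[OF refl])
   fix \<nu> assume "\<nu> \<in> Mk (j + k)"
   then have g: "\<nu> \<in> monomials w" by (simp add: Mk_def)
   have "\<theta> (gmul w F G \<nu>) = (\<Sum>\<mu>\<in>{..\<nu>}. koszul_sign w \<mu> (\<nu> - \<mu>) *\<^sub>R m (\<theta> (F \<mu>)) (\<theta> (G (\<nu> - \<mu>))))"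
    unfolding gmul_eq_sum[OF g]
    by (subst linear_map_on_sum[OF \<theta>(2) SS])
      (auto intro!: subspace_scale[OF SS] FG simp: linear_map_on_scale[OF \<theta>(2) FG] \<theta>(4)[OF sectionsD(1)[OF F] sectionsD(1)[OF G]])
   then have "T (gmul w F G) \<nu> = (\<Sum>\<mu>\<in>{..\<nu>}. m (koszul_sign w \<mu> (\<nu> - \<mu>) *\<^sub>R m (\<theta> (F \<mu>)) (\<theta> (G (\<nu> - \<mu>)))) (M \<nu>))"
    unfolding T_def by (simp add: sum_left[OF M scale[OF \<theta>FG]])
   also have "\<dots> = (\<Sum>\<mu>\<in>{..\<nu>}. h \<mu> (\<nu> - \<mu>))"
    by (rule sum.cong[OF refl]) (simp add: h_def scale_left[OF \<theta>FG M] le_diff_add)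
   finally show "T (gmul w F G) \<nu> = (\<Sum>\<mu>\<in>{..\<nu>}. h \<mu> (\<nu> - \<mu>))" .
  qed
  also have "\<dots> = (\<Sum>(\<nu>, \<mu>)\<in>Sigma (Mk (j + k)) (\<lambda>\<nu>. {..\<nu>}). h \<mu> (\<nu> - \<mu>))"
   using fin finite_below by (subst sum.Sigma) (auto simp: Mk_def)
  \<comment> \<open>Splittings of exponents of degree \<open>j + k\<close> correspond to pairs of
    exponents of degrees \<open>j\<close> and \<open>k\<close>, up to two exceptions that contribute
    \<open>0\<close>: splittings into other degrees, where a coefficient vanishes, and pairs whose
    sum is no admissible exponent, where \<open>mon_vanishes\<close> applies.\<close>
  also have "\<dots> = (\<Sum>(\<mu>, \<beta>)\<in>Mk j \<times> Mk k. h \<mu> \<beta>)"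
  proof (rule sum.reindex_bij_witness_not_neutral[where
     S' = "{(\<nu>, \<mu>) \<in> Sigma (Mk (j + k)) (\<lambda>\<nu>. {..\<nu>}). \<not> (\<mu> \<in> Mk j \<and> \<nu> - \<mu> \<in> Mk k)}" and
     T' = "{(\<mu>, \<beta>) \<in> Mk j \<times> Mk k. \<mu> + \<beta> \<notin> monomials w}" and
     i = "\<lambda>(\<mu>, \<beta>). (\<mu> + \<beta>, \<mu>)" and j = "\<lambda>(\<nu>, \<mu>). (\<mu>, \<nu> - \<mu>)"], goal_cases)
   case 1 show ?case
    by (rule finite_subset[OF _ finite_SigmaI[OF fin[of "j + k"], of "\<lambda>\<nu>. {..\<nu>}"]]) (use finite_below in "auto simp: Mk_def")
  next
   case 2 show ?case by (rule finite_subset[OF _ finite_cartesian_product[OF fin[of j] fin[of k]]]) auto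
  next
   case (3 a) then show ?case by (auto simp: le_diff_add)
  next
   case (4 a) then show ?case by (auto simp: le_diff_add Mk_def)
  next
   case (5 b) then show ?case by (auto simp: fun_eq_iff)
  next
   case (6 b)
   then obtain \<mu> \<beta> where b: "b = (\<mu>, \<beta>)" "\<mu> \<in> Mk j" "\<beta> \<in> Mk k" "\<mu> + \<beta> \<in> monomials w" by auto
   have "\<mu> + \<beta> - \<mu> = \<beta>" by (auto simp: fun_eq_iff)
   moreover have "\<mu> \<le> \<mu> + \<beta>" by (auto simp: le_fun_def)
   ultimately show ?case using b by (auto simp: Mk_def mdegree_add)
  next
   case (7 a)
   then obtain \<nu> \<mu> where a: "a = (\<nu>, \<mu>)" "\<nu> \<in> monomials w" "\<mu> \<le> \<nu>" "\<not> (\<mu> \<in> Mk j \<and> \<nu> - \<mu> \<in> Mk k)" by (auto simp: Mk_def)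
   then have "F \<mu> = 0 \<or> G (\<nu> - \<mu>) = 0" using sectionsD(2)[OF F, of \<mu>] sectionsD(2)[OF G, of "\<nu> - \<mu>"] by (auto simp: Mk_def)
   then show ?case using a \<theta>0 mult_0[OF \<theta>F] mult_0[OF \<theta>G] mult_0(2)[OF M] by (auto simp: h_def)
  next
   case (8 b)
   then obtain \<mu> \<beta> where b: "b = (\<mu>, \<beta>)" "\<mu> \<in> monomials w" "\<beta> \<in> monomials w" "\<mu> + \<beta> \<notin> monomials w" by (auto simp: Mk_def)
   then obtain i where "i < length w" "odd (w ! i)" "2 \<le> (\<mu> + \<beta>) i" by (auto simp: monomials_def)
   then have "M (\<mu> + \<beta>) = 0" unfolding M_def by (intro mon_vanishes[where d = "\<lambda>j. int (w ! j)"] \<eta>) auto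
   then show ?case using b mult_0(1)[OF \<theta>FG] by (simp add: h_def)
  next
   case (9 a) then show ?case by auto
  qed
  also have "\<dots> = (\<Sum>\<mu>\<in>Mk j. \<Sum>\<beta>\<in>Mk k. h \<mu> \<beta>)" by (simp add: sum.cartesian_product)
  also have "\<dots> = (\<Sum>\<mu>\<in>Mk j. \<Sum>\<beta>\<in>Mk k. m (T F \<mu>) (T G \<beta>))"
  proof (intro sum.cong refl)
   fix \<mu> \<beta> assume "\<mu> \<in> Mk j" "\<beta> \<in> Mk k"
   have sw: "m (M \<mu>) (\<theta> (G \<beta>)) = m (\<theta> (G \<beta>)) (M \<mu>)" using comm[OF M \<theta>G] by simp
   have ex: "(-1::real) powi (\<Sum>i<length w. \<Sum>j<i. (int (\<mu> i) * int (w ! i)) * (int (\<beta> j) * int (w ! j))) = koszul_sign w \<mu> \<beta>"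
    unfolding koszul_sign_def power_int_of_nat[symmetric] by simp
   have "m (T F \<mu>) (T G \<beta>) = m (\<theta> (F \<mu>)) (m (m (M \<mu>) (\<theta> (G \<beta>))) (M \<beta>))"
    unfolding T_def by (simp add: assoc[OF \<theta>F M closed[OF \<theta>G M]] assoc[OF M \<theta>G M])
   also have "\<dots> = m (m (\<theta> (F \<mu>)) (\<theta> (G \<beta>))) (m (M \<mu>) (M \<beta>))"
    unfolding sw by (simp add: assoc[OF \<theta>G M M] assoc[OF \<theta>F \<theta>G closed[OF M M]])
   also have "\<dots> = h \<mu> \<beta>"
    unfolding h_def using mon_mult[of "length w" \<eta> "\<lambda>j. int (w ! j)" \<mu> \<beta>, OF \<eta>]
    by (simp add: M_def[symmetric] ex scale_right[OF \<theta>FG M])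
   finally show "h \<mu> \<beta> = m (T F \<mu>) (T G \<beta>)" by simp
  qed
  also have "\<dots> = m (\<Phi> F) (\<Phi> G)"
   unfolding \<Phi>[OF F] \<Phi>[OF G]
   by (simp add: sum_left[OF sum[of "Mk k" "T G" k, OF TA[OF G]] TA[OF F]] sum_right[OF TA[OF F] TA[OF G]])
  finally show ?thesis .
 qed
 have semb: "\<Phi> (emb V f) = \<theta> f" if f: "f \<in> Sm dm V" for f
 proof -
  have "\<Phi> (emb V f) = (\<Sum>\<mu>\<in>{0}. T (emb V f) \<mu>)"
   unfolding \<Phi>_def by (rule sum.mono_neutral_left) (auto simp: emb_eq T0)
  then show ?thesis using one(3)[OF \<theta>(1)[OF f]] by (simp add: T_def emb_eq restr_id[OF f] M_def mon_zero)
 qed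
 have sgen: "\<Phi> (gen V j) = \<eta> j" if j: "j < length w" for j
 proof -
  have "\<Phi> (gen V j) = (\<Sum>\<mu>\<in>{unit_exp j}. T (gen V j) \<mu>)"
   unfolding \<Phi>_def by (rule sum.mono_neutral_left) (auto simp: mono_eq T0)
  then show ?thesis using one(2)[OF \<eta>[OF j]] mon_unit[of "length w" \<eta> "\<lambda>j. int (w ! j)", OF \<eta> j]
   by (simp add: T_def mono_eq \<theta>(3) M_def)
 qed
 show ?thesis using cl lin mult semb sgen by (intro exI[of _ \<Phi>]) auto
qed

end

section \<open>Graded domains and their morphisms\<close>

lemma pd_cong:
 assumes "eopen m V" "x \<in> V" "i < m" "\<And>y. y \<in> V ==> f y = g y"
 shows "pd i f x = pd i g x"
 unfolding pd_def
 by (rule deriv_cong_ev[OF eventually_mono[OF openin_Euclidean_space_fun_upd[OF assms(1-3)]]]) (use assms(4) in auto)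

text \<open>One list for both kinds of coordinates, the functions first and the generators after
  them. Morphisms and derivations into a domain are given by their values on this list.\<close>

definition crd :: "nat => (nat => real) set => nat => model_section" where
 "crd m U a = (if a < m then emb U (restr U (\<lambda>x. x a)) else gen U (a - m))"

definition cdeg :: "nat => nat list => nat => int" where
 "cdeg m w a = (if a < m then 0 else int (w ! (a - m)))"

lemma second_countable_euclidean: "second_countable (euclidean :: 'a::second_countable_topology topology)"
proof -
 obtain B :: "'a set set" where B: "countable B" "topological_basis B" using ex_countable_basis by blast
 have "\<exists>V\<in>B. x \<in> V \<and> V \<subseteq> U" if "openin euclidean U" "x \<in> U" for U x
  using that by (metis topological_basisE[OF B(2)] open_openin)
 then show ?thesis unfolding second_countable_def
  using B by (intro exI[of _ B]) (simp add: topological_basis_open)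
qed

lemma restr_apply: "restr V f x = (if x \<in> V then f x else 0)"
 by (simp add: restr_def)

lemma restr_scale_add: "restr V (f + g) = restr V f + restr V g" "restr V (c *\<^sub>R f) = c *\<^sub>R restr V f"
 by (auto simp: restr_def fun_eq_iff scaleR_fun_def)

locale gdomain =
 fixes m :: nat and w :: "nat list" and U0 :: "(nat => real) set"
 assumes pos: "\<forall>d\<in>set w. 1 \<le> d" and open_U0: "eopen m U0"
begin

abbreviation N where "N \<equiv> gdom m w U0"

lemma openin_iff: "gopen N V \<longleftrightarrow> eopen m V \<and> V \<subseteq> U0"
 using openin_open_subtopology[OF open_U0] by simp

lemma points_eq: "points N = U0"
 using openin_subset[OF open_U0] by auto

lemma open_UU: "gopen N U0" unfolding openin_iff using open_U0 by blast

lemma open_subspace_eq: "W \<subseteq> U0 ==> open_subspace N W = gdom m w W"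
 by (simp add: open_subspace_def graded_domain_def subtopology_subtopology Int_absorb1)

lemma crd_sections: "a < m + length w ==> crd m U0 a \<in> sections m w U0 (cdeg m w a)"
proof -
 assume a: "a < m + length w"
 have "smooth m U0 (restr U0 (\<lambda>x. x a))" using restr_Sm[OF open_U0 smooth_coordinate[OF open_U0]] by (simp add: Sm_def)
 then show ?thesis using a gen_sections[OF open_U0, of "a - m" w] emb_sections[OF open_U0] by (auto simp: crd_def cdeg_def)
qed

text \<open>Restriction cuts off by \<open>0\<close>, so gluing is pointwise: at \<open>x\<close>
  the value of any section of the family whose set contains \<open>x\<close> is taken.\<close>

lemma sheaf: "graded_sheaf N"
proof -
 have sm: "restr V (F \<mu>) \<in> Sm m V" if "eopen m U" "eopen m V" "V \<subseteq> U" "F \<in> sections m w U k" for U V F k \<mu>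
  using restr_Sm_subset[OF that(1-3) sectionsD(1)[OF that(4)]] .
 have cl: "(\<lambda>\<mu>. restr V (F \<mu>)) \<in> sections m w V k"
  if "eopen m U" "eopen m V" "V \<subseteq> U" "F \<in> sections m w U k" for U V F k
  using sm[OF that] sectionsD(2)[OF that(4)] by (auto simp: sections_def restr_def fun_eq_iff)
 have hom: "homogeneous N V = (\<Union>k. sections m w V k)" for V by (simp add: homogeneous_def)
 show ?thesis
  unfolding graded_sheaf_def openin_iff hom
 proof (intro conjI, goal_cases)
  case 1 then show ?case by (auto intro: gca_domain)
 next
  case 2
  have "linear_map_on (sections m w U k) (\<lambda>F \<mu>. restr V (F \<mu>))" for U V k
   by (auto simp: linear_map_on_def restr_scale_add scaleR_fun_def[of _ "_ :: model_section"] fun_eq_iff)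
  moreover have "(\<lambda>\<mu>. restr V (emb U 1 \<mu>)) = emb V 1" if "V \<subseteq> U" for U V
   using that by (auto simp: emb_eq restr_def fun_eq_iff)
  moreover have "(\<lambda>\<mu>. restr V (gmul w F G \<mu>)) = gmul w (\<lambda>\<mu>. restr V (F \<mu>)) (\<lambda>\<mu>. restr V (G \<mu>))" for F G V
   by (auto simp: gmul_def restr_def fun_eq_iff)
  moreover have "gres N U V = (\<lambda>F \<mu>. restr V (F \<mu>))" for U V by auto
  ultimately show ?case using cl by (auto simp del: domain_simps(5))
 next
  case 3
  have "(\<lambda>\<mu>. restr U (F \<mu>)) = F" if "F \<in> sections m w U k" for F U k using restr_id[OF sectionsD(1)[OF that]] by simp
  then show ?case by auto
 next
  case 4
  have "restr W (restr V f) = restr W f" if "W \<subseteq> V" for W V f using that by (auto simp: restr_def fun_eq_iff)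
  then show ?case by auto
 next
  case 5
  show ?case
  proof (intro allI impI, elim conjE)
   fix \<U> s k assume s: "\<forall>V\<in>\<U>. (eopen m V \<and> V \<subseteq> U0) \<and> s V \<in> gsec N V k"
    and ag: "\<forall>V\<in>\<U>. \<forall>W\<in>\<U>. gres N V (V \<inter> W) (s V) = gres N W (V \<inter> W) (s W)"
   have s': "eopen m V" "s V \<in> sections m w V k" if "V \<in> \<U>" for V using s that by auto
   have ag': "s V \<mu> x = s W \<mu> x" if "V \<in> \<U>" "W \<in> \<U>" "x \<in> V" "x \<in> W" for V W \<mu> x
   proof -
    have "(\<lambda>\<mu>. restr (V \<inter> W) (s V \<mu>)) = (\<lambda>\<mu>. restr (V \<inter> W) (s W \<mu>))"
     using ag that(1,2) unfolding domain_simps by blast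
    from fun_cong[OF fun_cong[OF this, of \<mu>], of x] show ?thesis using that by (simp add: restr_def)
   qed
   have oU: "eopen m (\<Union>\<U>)" using s' by blast
   define z where "z \<mu> x = (if x \<in> \<Union>\<U> then s (SOME V. V \<in> \<U> \<and> x \<in> V) \<mu> x else 0)" for \<mu> x
   have z: "z \<mu> x = s V \<mu> x" if "V \<in> \<U>" "x \<in> V" for V \<mu> x
   proof -
    define W where "W = (SOME V. V \<in> \<U> \<and> x \<in> V)"
    have "W \<in> \<U> \<and> x \<in> W" unfolding W_def by (rule someI[of _ V]) (use that in blast)
    moreover have "z \<mu> x = s W \<mu> x" using that by (auto simp: z_def W_def)
    ultimately show ?thesis using ag'[of W V x \<mu>] that by simp
   qed
   have zs: "z \<in> sections m w (\<Union>\<U>) k"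
    unfolding sections_def Sm_def
   proof (intro CollectI conjI allI impI)
    fix \<mu> show "smooth m (\<Union>\<U>) (z \<mu>)"
    proof (rule smooth_local[OF oU])
     fix x assume "x \<in> \<Union>\<U>"
     then obtain V where V: "V \<in> \<U>" "x \<in> V" by blast
     have "smooth m V (s V \<mu>)" using sectionsD(1)[OF s'(2)[OF V(1)]] by (simp add: Sm_def)
     then have "smooth m V (z \<mu>)" by (rule smooth_cong[OF s'(1)[OF V(1)], rotated]) (simp add: z[OF V(1)])
     then show "\<exists>V. eopen m V \<and> x \<in> V \<and> V \<subseteq> \<Union>\<U> \<and> smooth m V (z \<mu>)"
      using V s' by blast
    qed
   next
    fix \<mu> assume a: "\<not> (\<mu> \<in> monomials w \<and> mdegree w \<mu> = k)"
    show "z \<mu> = 0"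
    proof
     fix x show "z \<mu> x = 0 x"
     proof (cases "x \<in> \<Union>\<U>")
      case True
      then obtain V where V: "V \<in> \<U>" "x \<in> V" by blast
      have "s V \<mu> = 0" using sectionsD(2)[OF s'(2)[OF V(1)], of \<mu>] a by blast
      then show ?thesis using z[OF V] by simp
     qed (simp add: z_def)
    qed
   qed (auto simp: z_def)
   show "\<exists>!x. x \<in> gsec N (\<Union>\<U>) k \<and> (\<forall>V\<in>\<U>. gres N (\<Union>\<U>) V x = s V)"
   proof (rule ex1I[of _ z])
    have "(\<lambda>\<mu>. restr V (z \<mu>)) = s V" if "V \<in> \<U>" for V
    proof (intro ext)
     fix \<mu> x show "restr V (z \<mu>) x = s V \<mu> x"
      using z[OF that] sectionsD(3)[OF s'(2)[OF that], of x \<mu>] by (cases "x \<in> V") (auto simp: restr_def)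
    qed
    then show "z \<in> gsec N (\<Union>\<U>) k \<and> (\<forall>V\<in>\<U>. gres N (\<Union>\<U>) V z = s V)" using zs by simp
   next
    fix y assume y: "y \<in> gsec N (\<Union>\<U>) k \<and> (\<forall>V\<in>\<U>. gres N (\<Union>\<U>) V y = s V)"
    show "y = z"
    proof (intro ext)
     fix \<mu> x show "y \<mu> x = z \<mu> x"
     proof (cases "x \<in> \<Union>\<U>")
      case True
      then obtain V where V: "V \<in> \<U>" "x \<in> V" by blast
      have "(\<lambda>\<mu>. restr V (y \<mu>)) = s V" using y V(1) by simp
      from fun_cong[OF fun_cong[OF this, of \<mu>], of x] show ?thesis using z[OF V] V(2) by (simp add: restr_def)
     next
      case False
      then show ?thesis using sectionsD(3)[of y m w "\<Union>\<U>" k x \<mu>] y by (simp add: z_def)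
     qed
    qed
   qed
  qed
 qed
qed

sublocale gsheaf N by (simp add: gsheaf_def sheaf)

text \<open>A graded domain is covered by a single chart. This makes it an admissible test object
  for fibre products when its degrees are at most \<open>n\<close>.\<close>

lemma n_manifold_domain: "\<forall>d\<in>set w. d \<le> n ==> n_manifold n N"
 unfolding n_manifold_def
proof (intro conjI)
 assume n: "\<forall>d\<in>set w. d \<le> n"
 show "Hausdorff_space (base N)" by (simp add: Euclidean_space_top_of_set Hausdorff_space_subtopology)
 show "second_countable (base N)"
  by (simp add: Euclidean_space_top_of_set second_countable_subtopology second_countable_euclidean)
 show "graded_sheaf N" by (rule sheaf)
 have "isomorphic (open_subspace N U0) N"
  unfolding open_subspace_eq[OF order_refl] isomorphic_def
  by (intro bexI[of _ "id_mor N"] conjI id_mors[OF sheaf] id_comp[OF id_mors[OF sheaf]])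
 then show "\<exists>m' w'. (\<forall>d\<in>set w'. 1 \<le> d \<and> d \<le> n) \<and>
    (\<forall>p\<in>points N. \<exists>U U\<^sub>0. gopen N U \<and> p \<in> U \<and> eopen m' U\<^sub>0 \<and>
      isomorphic (open_subspace N U) (gdom m' w' U\<^sub>0))"
  using pos n open_UU open_U0 points_eq by (intro exI[of _ m] exI[of _ w]) blast
qed

lemma res_emb: "W \<subseteq> V ==> gres N V W (emb V f) = emb W (restr W f)"
 by (auto simp: emb_eq restr_def fun_eq_iff)

lemma res_gen: "W \<subseteq> V ==> gres N V W (gen V j) = gen W j"
 by (auto simp: mono_eq restr_def fun_eq_iff)

end

lemma emb_restr [simp]: "emb V (restr V f) = emb V f"
 by (auto simp: emb_eq restr_def fun_eq_iff)

lemma emb_apply: "emb V f \<mu> x = (if \<mu> = 0 \<and> x \<in> V then f x else 0)"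
 by (auto simp: emb_eq restr_def)

section \<open>Morphisms between graded domains\<close>

locale domain_morphism = T: gdomain mT wT T0 + N: gdomain m w U0
 for mT wT T0 m w U0 +
 fixes h
 assumes h: "h \<in> mors (gdom mT wT T0) (gdom m w U0)"
begin

sublocale morphism "gdom mT wT T0" "gdom m w U0" h by (rule morphismI[OF h])

lemma body_closed: "t \<in> T0 ==> bmap h t \<in> U0"
 using bmap_closed[of t] unfolding T.points_eq N.points_eq .

lemma preim_iff: "t \<in> preim h V \<longleftrightarrow> t \<in> T0 \<and> bmap h t \<in> V"
 unfolding preim_eq T.points_eq by auto

lemma preim_open': "eopen m V ==> V \<subseteq> U0 ==> eopen mT (preim h V) \<and> preim h V \<subseteq> T0"
 using preim_open[of V] unfolding N.openin_iff T.openin_iff by blast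

lemma preim_UU: "preim h U0 = T0"
 using body_closed by (auto simp: preim_iff)

text \<open>If \<open>h\<^sup>* f\<close> took a value \<open>c \<noteq> f(h(t))\<close> at \<open>t\<close>, then \<open>f - c\<close> would be invertible near \<open>h(t)\<close>, but \<open>h\<^sup>* f - c\<close> is not near \<open>t\<close>.\<close>

lemma locality:
 assumes V: "eopen m V" "V \<subseteq> U0" and f: "f \<in> Sm m V"
 shows "pull h V (emb V f) = emb (preim h V) (\<lambda>t. f (bmap h t))"
proof -
 have oV: "gopen N.N V" using V N.openin_iff by blast
 have fs: "smooth m V f" using f by (simp add: Sm_def)
 define F where "F = pull h V (emb V f)"
 have e: "emb V f \<in> sections m w V 0" by (rule emb_sections[OF V(1) fs])
 have F: "F \<in> sections mT wT (preim h V) 0" unfolding F_def using closed[OF oV, of _ 0] e by simp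
 have val: "F 0 t = f (bmap h t)" if t: "t \<in> preim h V" for t
 proof (rule ccontr)
  define c where "c = F 0 t"
  assume "F 0 t \<noteq> f (bmap h t)"
  define V' where "V' = V \<inter> f -` (- {c})"
  have "openin (top_of_set V) V'" unfolding V'_def
   by (rule continuous_openin_preimage_gen[OF smooth_continuous_on[OF V(1) fs]]) (simp add: open_Compl)
  then have V': "eopen m V'" using V(1) unfolding Euclidean_space_top_of_set by (rule openin_trans)
  have V'V: "V' \<subseteq> V" by (auto simp: V'_def)
  have oV': "gopen N.N V'" using V' V'V V(2) N.openin_iff by blast
  have t': "t \<in> preim h V'" using t \<open>F 0 t \<noteq> f (bmap h t)\<close> by (auto simp: preim_iff V'_def c_def)
  define d where "d = - c"
  define g where "g x = f x + d" for x
  define u where "u x = inverse (g x)" for x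
  have gs: "smooth m V' g" unfolding g_def
   by (intro smooth_add smooth_const V' smooth_subset[OF V(1) V' V'V fs])
  have us: "smooth m V' u" unfolding u_def
   by (rule smooth_inverse[OF V' gs]) (auto simp: g_def V'_def d_def)
  have Gs: "emb V' g \<in> sections m w V' 0" and Us: "emb V' u \<in> sections m w V' 0"
   by (rule emb_sections[OF V' gs], rule emb_sections[OF V' us])
  have "gmul w (emb V' g) (emb V' u) = emb V' 1"
  proof (intro ext)
   fix \<mu> x show "gmul w (emb V' g) (emb V' u) \<mu> x = emb V' 1 \<mu> x"
    unfolding gmul_emb_left[OF Us] by (auto simp: emb_apply u_def g_def V'_def d_def)
  qed
  then have "gmul wT (pull h V' (emb V' g)) (pull h V' (emb V' u)) = emb (preim h V') 1"
   using mult[OF oV', of "emb V' g" "emb V' u"] one[OF oV'] Gs Us by (simp add: homogeneousI)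
  then have "pull h V' (emb V' g) 0 t * pull h V' (emb V' u) 0 t = 1"
   using t' by (metis (no_types, lifting) gmul_0 emb_apply one_fun_apply)
  moreover have "pull h V' (emb V' g) 0 t = 0"
  proof -
   have one': "emb V 1 \<in> sections m w V 0" using emb_sections[OF V(1), of 1] smooth_const[OF V(1), of 1] by (simp add: one_fun_def)
   have eg: "emb V' g = gres N.N V V' (emb V f + d *\<^sub>R emb V 1)"
    using V'V by (auto simp: emb_eq restr_def fun_eq_iff g_def scaleR_fun_def)
   have "pull h V' (emb V' g) = gres T.N (preim h V) (preim h V') (pull h V (emb V f + d *\<^sub>R emb V 1))"
    unfolding eg using res[OF oV oV' V'V, of "emb V f + d *\<^sub>R emb V 1"]
     subspace_add[OF subspace_sections[OF V(1)] e subspace_scale[OF subspace_sections[OF V(1)] one']] by (simp add: homogeneousI[of _ _ _ 0] del: domain_simps(5))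
   also have "pull h V (emb V f + d *\<^sub>R emb V 1) = F + d *\<^sub>R emb (preim h V) 1"
    using add[OF oV, of "emb V f" 0 "d *\<^sub>R emb V 1"] scale[OF oV, of "emb V 1" 0 d] e one' one[OF oV]
     subspace_scale[OF subspace_sections[OF V(1)] one'] by (simp add: F_def)
   finally show ?thesis using t t' by (simp add: restr_def emb_apply[of _ 1] c_def d_def scaleR_fun_def)
  qed
  ultimately show False by simp
 qed
 \<comment> \<open>All generators have positive degree, so a section of degree \<open>0\<close> is
   its coefficient at the exponent \<open>0\<close>.\<close>
 have "F = emb (preim h V) (F 0)" by (rule sections_degree_0(1)[OF T.pos F])
 also have "\<dots> = emb (preim h V) (\<lambda>t. f (bmap h t))" using val by (auto simp: emb_eq restr_def fun_eq_iff)
 finally show ?thesis by (simp add: F_def)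
qed

lemma pull_gen:
 assumes V: "eopen m V" "V \<subseteq> U0" and j: "j < length w"
 shows "pull h V (gen V j) = gres T.N T0 (preim h V) (pull h U0 (crd m U0 (m + j)))"
proof -
 have "gen V j = gres N.N U0 V (crd m U0 (m + j))" unfolding N.res_gen[OF V(2), symmetric] by (simp add: crd_def)
 then show ?thesis
  using res[OF N.open_UU _ V(2), of "crd m U0 (m + j)"] N.openin_iff V homogeneousI[of "crd m U0 (m + j)" N.N U0 "cdeg m w (m + j)"] N.crd_sections[of "m + j"] j
  by (simp add: preim_UU)
qed

lemma body_coordinate:
 assumes "t \<in> T0" shows "bmap h t i = (if i < m then pull h U0 (crd m U0 i) 0 t else 0)"
proof (cases "i < m")
 case True
 have "restr U0 (\<lambda>x. x i) \<in> Sm m U0" by (rule restr_Sm[OF N.open_U0 smooth_coordinate[OF N.open_U0]])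
 from locality[OF N.open_U0 order_refl this] show ?thesis
  using True assms body_closed by (simp add: crd_def preim_UU emb_apply restr_def)
next
 case False
 then show ?thesis using openin_Euclidean_space_support[OF N.open_U0 body_closed[OF assms]] by simp
qed

end

lemmas domain_morphism_defs = domain_morphism_def domain_morphism_axioms_def

text \<open>The coordinate functions determine the map of bodies; by locality the latter determines
  the pullbacks of all smooth functions. Together with the generators these determine everything by
  \<open>section_induct\<close>.\<close>

theorem domain_morphism_eqI:
 assumes "gdomain mT wT T0" "gdomain m w U0"
  and h: "h \<in> mors (gdom mT wT T0) (gdom m w U0)" "h' \<in> mors (gdom mT wT T0) (gdom m w U0)"
  and eq: "\<And>a. a < m + length w ==> pull h U0 (crd m U0 a) = pull h' U0 (crd m U0 a)"
 shows "h = h'"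
proof -
 interpret h: domain_morphism mT wT T0 m w U0 h using assms by (simp add: domain_morphism_defs)
 interpret h': domain_morphism mT wT T0 m w U0 h' using assms by (simp add: domain_morphism_defs)
 have bm: "bmap h t = bmap h' t" if "t \<in> T0" for t
  using h.body_coordinate[OF that] h'.body_coordinate[OF that] eq by (auto simp: fun_eq_iff)
 show ?thesis
 proof (rule mors_eqI[OF h])
  show "bmap h t = bmap h' t" if "t \<in> points (gdom mT wT T0)" for t
   using bm that unfolding h.T.points_eq .
  fix V F k assume oV: "gopen (gdom m w U0) V" and F: "F \<in> gsec (gdom m w U0) V k"
  then have V: "eopen m V" "V \<subseteq> U0" using h.N.openin_iff by auto
  have pre: "preim h V = preim h' V" using bm by (auto simp: h.preim_iff h'.preim_iff)
  from F have F: "F \<in> sections m w V k" by simp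
  show "pull h V F = pull h' V F"
  proof (rule section_induct[OF h.N.pos V(1) F, where J = UNIV and P = "\<lambda>k F. pull h V F = pull h' V F"])
   fix f assume f: "f \<in> Sm m V"
   show "pull h V (emb V f) = pull h' V (emb V f)"
    unfolding h.locality[OF V f] h'.locality[OF V f] pre
   proof -
    have "f (bmap h t) = f (bmap h' t)" if "t \<in> preim h' V" for t using bm[of t] that by (simp add: h'.preim_iff)
    then show "emb (preim h' V) (\<lambda>t. f (bmap h t)) = emb (preim h' V) (\<lambda>t. f (bmap h' t))"
     by (auto simp: emb_eq restr_def fun_eq_iff)
   qed
  next
   fix j assume "j < length w"
   then show "pull h V (gen V j) = pull h' V (gen V j)"
    using eq[of "m + j"] h.pull_gen[OF V] h'.pull_gen[OF V] pre by simp
  next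
   fix F G a b assume "F \<in> sections m w V a" "G \<in> sections m w V b" "pull h V F = pull h' V F" "pull h V G = pull h' V G"
   then show "pull h V (gmul w F G) = pull h' V (gmul w F G)"
    using h.mult[OF oV, of F G] h'.mult[OF oV, of F G] by (simp add: homogeneousI)
  next
   fix F G a assume "F \<in> sections m w V a" "G \<in> sections m w V a" "pull h V F = pull h' V F" "pull h V G = pull h' V G"
   then show "pull h V (F + G) = pull h' V (F + G)"
    using h.add[OF oV, of F a G] h'.add[OF oV, of F a G] by simp
  qed auto
 qed
qed

section \<open>Derivations between graded domains\<close>

locale domain_derivation = domain_morphism +
 fixes k D
 assumes D: "D \<in> ders h k"
begin

sublocale derivation "gdom mT wT T0" "gdom m w U0" h k D by (rule derivationI[OF h D])

lemma der_gen:
 assumes V: "eopen m V" "V \<subseteq> U0" and j: "j < length w"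
 shows "D V (gen V j) = gres T.N T0 (preim h V) (D U0 (crd m U0 (m + j)))"
proof -
 have "gen V j = gres N.N U0 V (crd m U0 (m + j))" unfolding N.res_gen[OF V(2), symmetric] by (simp add: crd_def)
 then show ?thesis
  using der_res[OF N.open_UU _ V(2), of "crd m U0 (m + j)"] N.openin_iff V homogeneousI[of "crd m U0 (m + j)" N.N U0 "cdeg m w (m + j)"] N.crd_sections[of "m + j"] j
  by (simp add: preim_UU)
qed

lemma der_one:
 assumes V: "eopen m V" "V \<subseteq> U0" shows "D V (emb V 1) = 0"
proof -
 have oV: "gopen N.N V" using V N.openin_iff by blast
 have o: "emb V 1 \<in> sections m w V 0" using emb_sections[OF V(1), of 1] smooth_const[OF V(1), of 1] by (simp add: one_fun_def)
 interpret a: gc_algebra "sections m w V" "gmul w" "emb V 1" by (simp add: gc_algebra_def gca_domain[OF V(1)])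
 interpret b: gc_algebra "sections mT wT (preim h V)" "gmul wT" "emb (preim h V) 1"
  using preim_open'[OF V] by (simp add: gc_algebra_def gca_domain)
 have Dc: "D V (emb V 1) \<in> sections mT wT (preim h V) (0 + k)" using der_closed[OF oV, of _ 0] o by simp
 have "D V (emb V 1) = D V (emb V 1) + D V (emb V 1)"
  using leibniz[OF oV, of "emb V 1" 0 "emb V 1"] o one[OF oV] b.one(2,3)[OF Dc] a.one(2)[OF o] by (simp add: homogeneousI)
 then show ?thesis by simp
qed

text \<open>The remainder in Hadamard's lemma vanishes at the point.\<close>

lemma der_function:
 assumes V: "eopen m V" "V \<subseteq> U0" and f: "f \<in> Sm m V" and t: "t \<in> preim h V"
 shows "D V (emb V f) \<mu> t = (\<Sum>i<m. pd i f (bmap h t) * D U0 (crd m U0 i) \<mu> t)"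
proof -
 have oV: "gopen N.N V" using V N.openin_iff by blast
 define q where "q = bmap h t"
 have q: "q \<in> V" using t by (simp add: q_def preim_iff)
 have fs: "smooth m V f" using f by (simp add: Sm_def)
 obtain B H where B: "eopen m B" "q \<in> B" "B \<subseteq> V"
  "\<forall>i<m. smooth m B (H i)" "\<forall>x\<in>B. f x = f q + (\<Sum>i<m. (x i - q i) * H i x)"
  "\<forall>i<m. H i q = pd i f q" by (rule Hadamard[OF V(1) fs q])
 have BU: "B \<subseteq> U0" using B V by blast
 have oB: "gopen N.N B" using B BU N.openin_iff by blast
 have tB: "t \<in> preim h B" using t B(2) by (simp add: q_def preim_iff)
 have preB: "eopen mT (preim h B)" using preim_open'[OF B(1) BU] by simp
 define X where "X i = restr B (\<lambda>x. x i + - q i)" for i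
 have Xs: "X i \<in> Sm m B" for i unfolding X_def
  by (intro restr_Sm B smooth_add smooth_const smooth_coordinate)
 define HB where "HB i = restr B (H i)" for i
 have Hs: "HB i \<in> Sm m B" if "i < m" for i unfolding HB_def by (rule restr_Sm[OF B(1)]) (use B(4) that in simp)
 have eX: "emb B (X i) \<in> sections m w B 0" for i using Xs by (intro emb_sections[OF B(1)]) (auto simp: Sm_def)
 have eH: "emb B (HB i) \<in> sections m w B 0" if "i < m" for i using Hs[OF that] by (intro emb_sections[OF B(1)]) (auto simp: Sm_def)
 have o: "emb B 1 \<in> sections m w B 0" using emb_sections[OF B(1), of 1] smooth_const[OF B(1), of 1] by (simp add: one_fun_def)
 have ef: "emb V f \<in> sections m w V 0" by (rule emb_sections[OF V(1) fs])
 note SB = subspace_sections[OF B(1), of w 0]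
 let ?P = "\<lambda>i. gmul w (emb B (X i)) (emb B (HB i))"
 have P: "?P i \<in> sections m w B 0" if "i < m" for i using gmul_closed[OF B(1) eX eH[OF that]] by simp
 have dec: "gres N.N V B (emb V f) = f q *\<^sub>R emb B 1 + (\<Sum>i<m. ?P i)"
 proof (intro ext)
  fix \<beta> x
  have "(\<Sum>i<m. ?P i) \<beta> x = (\<Sum>i<m. X i x * emb B (HB i) \<beta> x)"
   unfolding sum_apply2 by (rule sum.cong) (auto simp: gmul_emb_left[OF eH])
  then show "gres N.N V B (emb V f) \<beta> x = (f q *\<^sub>R emb B 1 + (\<Sum>i<m. ?P i)) \<beta> x"
   using B(3) B(5) by (auto simp: restr_def emb_apply scaleR_fun_def X_def HB_def)
 qed
 \<comment> \<open>\<open>X i\<close> differs from the coordinate function by a constant, which a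
   derivation annihilates.\<close>
 have DX: "D B (emb B (X i)) \<mu> t = D U0 (crd m U0 i) \<mu> t" if i: "i < m" for i
 proof -
  have ci: "crd m U0 i \<in> sections m w U0 0" using N.crd_sections[of i] i by (simp add: cdeg_def)
  have rc: "gres N.N U0 B (crd m U0 i) \<in> sections m w B 0"
   using N.res_closed[OF N.open_UU oB BU] ci by simp
  define d where "d = - q i"
  have eq: "emb B (X i) = gres N.N U0 B (crd m U0 i) + d *\<^sub>R emb B 1"
   using BU i by (auto simp: crd_def emb_eq restr_def fun_eq_iff X_def scaleR_fun_def d_def)
  have "D B (emb B (X i)) = D B (gres N.N U0 B (crd m U0 i)) + d *\<^sub>R D B (emb B 1)"
   unfolding eq using der_add[OF oB, of _ 0 "d *\<^sub>R emb B 1"] der_scale[OF oB, of "emb B 1" 0 d] rc o subspace_scale[OF SB o]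
   by (simp del: domain_simps(5))
  also have "\<dots> = gres T.N T0 (preim h B) (D U0 (crd m U0 i))"
   using der_one[OF B(1) BU] der_res[OF N.open_UU oB BU, of "crd m U0 i"] ci by (simp add: homogeneousI[of _ _ _ 0] preim_UU del: domain_simps(5))
  finally show ?thesis using tB by (simp add: restr_def)
 qed
 have DP: "D B (?P i) \<mu> t = H i q * D U0 (crd m U0 i) \<mu> t" if i: "i < m" for i
 proof -
  have DeX: "D B (emb B (X i)) \<in> sections mT wT (preim h B) (0 + k)" using der_closed[OF oB, of _ 0] eX by simp
  have DeH: "D B (emb B (HB i)) \<in> sections mT wT (preim h B) (0 + k)" using der_closed[OF oB, of _ 0] eH[OF i] by simp
  have "D B (?P i) = gmul wT (D B (emb B (X i))) (pull h B (emb B (HB i))) + gmul wT (pull h B (emb B (X i))) (D B (emb B (HB i)))"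
   using leibniz[OF oB, of "emb B (X i)" 0 "emb B (HB i)"] eX eH[OF i] by (simp add: homogeneousI[of _ _ _ 0] del: emb_restr)
  moreover have "X i (bmap h t) = 0" "HB i (bmap h t) = H i q"
   using B(2) by (simp_all add: X_def HB_def restr_def q_def)
  ultimately show ?thesis
   using DX[OF i]
   unfolding locality[OF B(1) BU Xs] locality[OF B(1) BU Hs[OF i]]
   by (simp add: gmul_emb_left[OF DeH] gmul_emb_right[OF DeX])
 qed
 have "gres T.N (preim h V) (preim h B) (D V (emb V f)) = D B (gres N.N V B (emb V f))"
  using der_res[OF oV oB B(3), of "emb V f"] ef by (simp add: homogeneousI[of _ _ _ 0] del: domain_simps(5))
 also have "\<dots> = f q *\<^sub>R D B (emb B 1) + (\<Sum>i<m. D B (?P i))"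
 proof -
  have "(\<Sum>i<m. ?P i) \<in> sections m w B 0" using P by (intro subspace_sum[OF SB]) auto
  moreover have "D B (\<Sum>i<m. ?P i) = (\<Sum>i<m. D B (?P i))"
   using der_linear[OF oB, of 0] P by (intro linear_map_on_sum[OF _ SB]) auto
  ultimately show ?thesis
   unfolding dec using der_add[OF oB, of "f q *\<^sub>R emb B 1" 0] der_scale[OF oB, of "emb B 1" 0 "f q"] o subspace_scale[OF SB o] by simp
 qed
 finally have "gres T.N (preim h V) (preim h B) (D V (emb V f)) \<mu> t = (\<Sum>i<m. D B (?P i)) \<mu> t"
  using der_one[OF B(1) BU] by simp
 then have "D V (emb V f) \<mu> t = (\<Sum>i<m. D B (?P i) \<mu> t)" using tB unfolding sum_apply2 by (simp add: restr_def)
 then show ?thesis using DP B(6) by (simp add: q_def)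
qed

end

lemmas domain_derivation_defs = domain_morphism_defs domain_derivation_def domain_derivation_axioms_def

text \<open>\<open>der_function\<close> reduces values on smooth functions to values on the
  coordinates; the Leibniz rule takes care of products with generators.\<close>

theorem domain_derivation_eqI:
 assumes "gdomain mT wT T0" "gdomain m w U0"
  and h: "h \<in> mors (gdom mT wT T0) (gdom m w U0)"
  and D: "D \<in> ders h k" "D' \<in> ders h k"
  and eq: "\<And>a. a < m + length w ==> D U0 (crd m U0 a) = D' U0 (crd m U0 a)"
 shows "D = D'"
proof -
 interpret d: domain_derivation mT wT T0 m w U0 h k D
  using assms by (simp add: domain_derivation_defs)
 interpret d': domain_derivation mT wT T0 m w U0 h k D'
  using assms by (simp add: domain_derivation_defs)
 show ?thesis
 proof (rule derivations_eqI[OF h D])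
  fix V F j assume oV: "gopen (gdom m w U0) V" and "F \<in> gsec (gdom m w U0) V j"
  then have V: "eopen m V" "V \<subseteq> U0" and F: "F \<in> sections m w V j" using d.N.openin_iff by auto
  show "D V F = D' V F"
  proof (rule section_induct[OF d.N.pos V(1) F, where J = UNIV and P = "\<lambda>j F. D V F = D' V F"])
   fix f assume f: "f \<in> Sm m V"
   then have e: "emb V f \<in> sections m w V 0" by (intro emb_sections[OF V(1)]) (auto simp: Sm_def)
   show "D V (emb V f) = D' V (emb V f)"
   proof (intro ext)
    fix \<mu> t show "D V (emb V f) \<mu> t = D' V (emb V f) \<mu> t"
    proof (cases "t \<in> preim h V")
     case True
     then show ?thesis using d.der_function[OF V f True] d'.der_function[OF V f True] eq by simp
    next
     case False
     then show ?thesis using sectionsD(3)[OF _ False] d.der_closed[OF oV, of _ 0] d'.der_closed[OF oV, of _ 0] e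
      by (metis (no_types, lifting) domain_simps(2))
    qed
   qed
  next
   fix j assume "j < length w"
   then show "D V (gen V j) = D' V (gen V j)"
    using eq[of "m + j"] d.der_gen[OF V] d'.der_gen[OF V] by simp
  next
   fix F G a b assume "F \<in> sections m w V a" "G \<in> sections m w V b" "D V F = D' V F" "D V G = D' V G"
   then show "D V (gmul w F G) = D' V (gmul w F G)"
    using d.leibniz[OF oV, of F a G] d'.leibniz[OF oV, of F a G] by (simp add: homogeneousI[of _ _ _ b])
  next
   fix F G a assume "F \<in> sections m w V a" "G \<in> sections m w V a" "D V F = D' V F" "D V G = D' V G"
   then show "D V (F + G) = D' V (F + G)"
    using d.der_add[OF oV, of F a G] d'.der_add[OF oV, of F a G] by simp
  qed auto
 qed
qed

lemma restr_restr: "restr W (restr V f) = restr (W \<inter> V) f"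
 by (auto simp: restr_def fun_eq_iff)

text \<open>Morphisms and derivations out of a graded domain are constructed from homomorphisms
 of the algebras over all open sets, which are determined by the values on functions and generators.\<close>

theorem domain_morphism_exists:
 assumes T: "gdomain mT wT T0" and N: "gdomain m w U0"
  and y: "\<And>a. a < m + length w ==> y a \<in> sections mT wT T0 (cdeg m w a)"
  and body: "\<And>t. t \<in> T0 ==> (\<lambda>i. if i < m then y i 0 t else 0) \<in> U0"
 shows "\<exists>h\<in>mors (gdom mT wT T0) (gdom m w U0). (\<forall>a<m + length w. pull h U0 (crd m U0 a) = y a) \<and>
  (\<forall>t\<in>T0. bmap h t = (\<lambda>i. if i < m then y i 0 t else 0))"
proof -
 interpret T: gdomain mT wT T0 by (rule T)
 interpret N: gdomain m w U0 by (rule N)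
 define b where "b t = (\<lambda>i. if i < m then y i 0 t else 0)" for t
 have b: "b t \<in> U0" if "t \<in> T0" for t using body[OF that] by (simp add: b_def)
 have y0: "y i 0 \<in> Sm mT T0" if "i < m" for i using sectionsD(1)[OF y[of i]] that by simp
 have bs: "smooth mT T0 (\<lambda>t. b t i)" for i
  using y0[of i] smooth_const[OF T.open_U0, of 0] by (cases "i < m") (auto simp: b_def Sm_def)
 have bc: "continuous_on T0 b"
  by (rule continuous_on_into_Euclidean[where k = m, OF smooth_continuous_on[OF T.open_U0 bs]]) (simp add: b_def)
 define pre where "pre V = {t \<in> T0. b t \<in> V}" for V
 have pre: "eopen mT (pre V)" if V: "eopen m V" "V \<subseteq> U0" for V
 proof -
  obtain S where S: "open S" "V = {x. \<forall>i\<ge>m. x i = 0} \<inter> S"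
   using V(1) unfolding Euclidean_space_top_of_set openin_open by blast
  have eq: "pre V = T0 \<inter> b -` S" unfolding pre_def S(2) by (auto simp: b_def)
  have "openin (top_of_set T0) (T0 \<inter> b -` S)" by (rule continuous_openin_preimage_gen[OF bc S(1)])
  then show ?thesis unfolding eq using T.open_U0 unfolding Euclidean_space_top_of_set by (rule openin_trans)
 qed
 have preT: "pre V \<subseteq> T0" for V by (auto simp: pre_def)
 have preU: "pre U0 = T0" using b by (auto simp: pre_def)
 have comp: "smooth mT (pre V) (\<lambda>t. f (b t))" if V: "eopen m V" "V \<subseteq> U0" and f: "f \<in> Sm m V" for V f
  by (rule smooth_compose[OF pre[OF V] V(1)])
    (use f smooth_subset[OF T.open_U0 pre[OF V] preT bs] in "auto simp: Sm_def pre_def")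
 define \<theta> where "\<theta> V f = emb (pre V) (\<lambda>t. f (b t))" for V f
 define \<eta> where "\<eta> V j = gres T.N T0 (pre V) (y (m + j))" for V j
 \<comment> \<open>The requirements on the homomorphism over \<open>V\<close>, collected so that one
   can be chosen for each \<open>V\<close>. The choices are independent; their compatibility with
   restriction is shown afterwards as \<open>\<Phi>res\<close>.\<close>
 define good where "good V \<Phi> \<longleftrightarrow> (\<forall>k. \<forall>F\<in>sections m w V k. \<Phi> F \<in> sections mT wT (pre V) k) \<and> (\<forall>k. linear_map_on (sections m w V k) \<Phi>) \<and>
   (\<forall>j k. \<forall>F\<in>sections m w V j. \<forall>G\<in>sections m w V k. \<Phi> (gmul w F G) = gmul wT (\<Phi> F) (\<Phi> G)) \<and>
   (\<forall>f\<in>Sm m V. \<Phi> (emb V f) = \<theta> V f) \<and> (\<forall>j<length w. \<Phi> (gen V j) = \<eta> V j)" for V \<Phi>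
 have ex: "\<exists>\<Phi>. good V \<Phi>" if V: "eopen m V" "V \<subseteq> U0" for V
 proof -
  interpret a: gc_algebra "sections mT wT (pre V)" "gmul wT" "emb (pre V) 1"
   using pre[OF V] by (simp add: gc_algebra_def gca_domain)
  have th: "\<theta> V f \<in> sections mT wT (pre V) 0" if "f \<in> Sm m V" for f
   unfolding \<theta>_def by (rule emb_sections[OF pre[OF V] comp[OF V that]])
  show ?thesis
   unfolding good_def
  proof (rule a.hom_exists[OF N.pos V(1) th])
   show "linear_map_on (Sm m V) (\<theta> V)"
    by (auto simp: linear_map_on_def \<theta>_def emb_apply fun_eq_iff scaleR_fun_def)
   show "\<theta> V (restr V 1) = emb (pre V) 1"
    by (auto simp: \<theta>_def emb_apply fun_eq_iff restr_def pre_def)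
   show "\<theta> V (f * g) = gmul wT (\<theta> V f) (\<theta> V g)" if "f \<in> Sm m V" "g \<in> Sm m V" for f g
   proof (intro ext)
    fix \<mu> t show "\<theta> V (f * g) \<mu> t = gmul wT (\<theta> V f) (\<theta> V g) \<mu> t"
     using gmul_emb_left[OF th[OF that(2)], where f = "\<lambda>t. f (b t)" and \<mu> = \<mu> and x = t]
     by (simp add: \<theta>_def emb_apply)
   qed
   show "\<eta> V j \<in> sections mT wT (pre V) (int (w ! j))" if "j < length w" for j
    using T.res_closed[OF T.open_UU _ preT, of V "y (m + j)" "int (w ! j)"] y[of "m + j"] that pre[OF V] preT
    unfolding T.openin_iff \<eta>_def by (simp add: cdeg_def)
  qed
 qed
 define \<Phi> where "\<Phi> V = (SOME \<Phi>. good V \<Phi>)" for V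
 have good: "good V (\<Phi> V)" if "eopen m V" "V \<subseteq> U0" for V
  unfolding \<Phi>_def by (rule someI_ex[OF ex[OF that]])
 have \<Phi>: "F \<in> sections m w V k ==> \<Phi> V F \<in> sections mT wT (pre V) k" "linear_map_on (sections m w V k) (\<Phi> V)"
   "F \<in> sections m w V k ==> G \<in> sections m w V l ==> \<Phi> V (gmul w F G) = gmul wT (\<Phi> V F) (\<Phi> V G)"
   "f \<in> Sm m V ==> \<Phi> V (emb V f) = \<theta> V f" "j < length w ==> \<Phi> V (gen V j) = \<eta> V j"
   if "eopen m V" "V \<subseteq> U0" for V F G k l f j
  using good[OF that, unfolded good_def, THEN conjunct1]
   good[OF that, unfolded good_def, THEN conjunct2, THEN conjunct1]
   good[OF that, unfolded good_def, THEN conjunct2, THEN conjunct2, THEN conjunct1]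
   good[OF that, unfolded good_def, THEN conjunct2, THEN conjunct2, THEN conjunct2]
  by simp_all
 have \<Phi>0: "\<Phi> V 0 = 0" if "eopen m V" "V \<subseteq> U0" for V
  by (rule linear_map_on_0[OF \<Phi>(2)[OF that] subspace_sections[OF that(1)]])
 have \<Phi>res: "\<Phi> W (gres N.N V W F) = gres T.N (pre V) (pre W) (\<Phi> V F)"
  if V: "eopen m V" "V \<subseteq> U0" and W: "eopen m W" "W \<subseteq> V" and F: "F \<in> sections m w V k" for V W F k
 proof (rule section_induct[OF N.pos V(1) F, where J = UNIV and P = "\<lambda>k F. \<Phi> W (gres N.N V W F) = gres T.N (pre V) (pre W) (\<Phi> V F)"])
  have WU: "W \<subseteq> U0" using V W by blast
  have oV: "gopen N.N V" "gopen N.N W" "gopen T.N (pre V)" "gopen T.N (pre W)"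
   using N.openin_iff T.openin_iff V W WU pre preT by auto
  have pWV: "pre W \<subseteq> pre V" using W by (auto simp: pre_def)
  { fix f assume f: "f \<in> Sm m V"
   show "\<Phi> W (gres N.N V W (emb V f)) = gres T.N (pre V) (pre W) (\<Phi> V (emb V f))"
    unfolding N.res_emb[OF W(2)] \<Phi>(4)[OF W(1) WU restr_Sm_subset[OF V(1) W f]] \<Phi>(4)[OF V f]
    using pWV by (auto simp: \<theta>_def emb_apply fun_eq_iff restr_def pre_def) }
  { fix j assume j: "j < length w"
   show "\<Phi> W (gres N.N V W (gen V j)) = gres T.N (pre V) (pre W) (\<Phi> V (gen V j))"
    unfolding N.res_gen[OF W(2)] \<Phi>(5)[OF W(1) WU j] \<Phi>(5)[OF V j]
    using pWV by (simp add: \<eta>_def restr_restr Int_absorb2) }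
  { fix F G a b assume F: "F \<in> sections m w V a" and G: "G \<in> sections m w V b"
    and IH: "\<Phi> W (gres N.N V W F) = gres T.N (pre V) (pre W) (\<Phi> V F)" "\<Phi> W (gres N.N V W G) = gres T.N (pre V) (pre W) (\<Phi> V G)"
   have r: "gres N.N V W F \<in> sections m w W a" "gres N.N V W G \<in> sections m w W b"
    using N.res_closed[OF oV(1,2) W(2)] F G by auto
   have "gres N.N V W (gmul w F G) = gmul w (gres N.N V W F) (gres N.N V W G)"
    using N.res_mult[OF oV(1,2) W(2), of F G] F G by (simp add: homogeneousI[of F _ _ a] homogeneousI[of G _ _ b] del: domain_simps(5))
   moreover have "gres T.N (pre V) (pre W) (gmul wT (\<Phi> V F) (\<Phi> V G)) = gmul wT (gres T.N (pre V) (pre W) (\<Phi> V F)) (gres T.N (pre V) (pre W) (\<Phi> V G))"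
    using T.res_mult[OF oV(3,4) pWV, of "\<Phi> V F" "\<Phi> V G"] \<Phi>(1)[OF V F] \<Phi>(1)[OF V G]
    by (simp add: homogeneousI[of "\<Phi> V F" _ _ a] homogeneousI[of "\<Phi> V G" _ _ b] del: domain_simps(5))
   ultimately show "\<Phi> W (gres N.N V W (gmul w F G)) = gres T.N (pre V) (pre W) (\<Phi> V (gmul w F G))"
    using \<Phi>(3)[OF W(1) WU r] \<Phi>(3)[OF V F G] IH by (simp del: domain_simps(5)) }
  { fix F G a assume F: "F \<in> sections m w V a" and G: "G \<in> sections m w V a"
    and IH: "\<Phi> W (gres N.N V W F) = gres T.N (pre V) (pre W) (\<Phi> V F)" "\<Phi> W (gres N.N V W G) = gres T.N (pre V) (pre W) (\<Phi> V G)"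
   have r: "gres N.N V W F \<in> sections m w W a" "gres N.N V W G \<in> sections m w W a"
    using N.res_closed[OF oV(1,2) W(2)] F G by auto
   have "gres N.N V W (F + G) = gres N.N V W F + gres N.N V W G" for F G by (auto simp: restr_def fun_eq_iff)
   moreover have "gres T.N (pre V) (pre W) (F + G) = gres T.N (pre V) (pre W) F + gres T.N (pre V) (pre W) G" for F G by (auto simp: restr_def fun_eq_iff)
   ultimately show "\<Phi> W (gres N.N V W (F + G)) = gres T.N (pre V) (pre W) (\<Phi> V (F + G))"
    using linear_map_on_add[OF \<Phi>(2)[OF W(1) WU] r] linear_map_on_add[OF \<Phi>(2)[OF V] F G] IH by (simp del: domain_simps(5)) }
  have "gres N.N V W 0 = 0" "gres T.N (pre V) (pre W) 0 = 0" by (auto simp: restr_def fun_eq_iff)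
  then show "\<Phi> W (gres N.N V W 0) = gres T.N (pre V) (pre W) (\<Phi> V 0)"
   using \<Phi>0[OF V] \<Phi>0[OF W(1) WU] by (simp del: domain_simps(5))
 qed simp
 define h where "h = \<lparr>mdom = T.N, mcod = N.N, bmap = restrict b T0,
  pull = (\<lambda>V F. if gopen N.N V \<and> F \<in> homogeneous N.N V then \<Phi> V F else 0)\<rparr>"
 have preh: "preim h V = pre V" for V unfolding preim_def h_def graded_map.simps T.points_eq by (auto simp: pre_def)
 have pullh: "pull h V F = \<Phi> V F" if "eopen m V" "V \<subseteq> U0" "F \<in> sections m w V k" for V F k
  using that N.openin_iff homogeneousI[of F N.N V k] by (simp add: h_def)
 have hm: "h \<in> mors T.N N.N"
 proof (rule morsI)
  show "bmap h \<in> extensional (points T.N)" unfolding T.points_eq by (simp add: h_def)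
  have "continuous_map (base T.N) (base N.N) b"
  proof -
   have "base T.N = top_of_set T0" "base N.N = top_of_set U0"
    using openin_subset[OF T.open_U0] openin_subset[OF N.open_U0]
    by (auto simp: Euclidean_space_top_of_set subtopology_subtopology Int_absorb1)
   then show ?thesis using bc b by (simp add: continuous_map_in_subtopology image_subset_iff Pi_iff)
  qed
  then show "continuous_map (base T.N) (base N.N) (bmap h)"
   by (rule continuous_map_eq) (simp only: T.points_eq, simp add: h_def)
 next
  fix V F k assume "gopen N.N V" "F \<in> gsec N.N V k"
  then show "pull h V F \<in> gsec T.N (preim h V) k" using pullh \<Phi>(1) unfolding N.openin_iff preh by auto
 next
  fix V k assume oV: "gopen N.N V"
  then have V: "eopen m V" "V \<subseteq> U0" using N.openin_iff by auto
  show "linear_map_on (gsec N.N V k) (pull h V)"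
   using \<Phi>(2)[OF V, of k] subspace_add[OF subspace_sections[OF V(1), of w k]] subspace_scale[OF subspace_sections[OF V(1), of w k]]
   unfolding linear_map_on_def by (simp add: pullh[OF V, of _ k])
 next
  fix V assume oV: "gopen N.N V"
  then have V: "eopen m V" "V \<subseteq> U0" using N.openin_iff by auto
  have o: "emb V (restr V 1) \<in> sections m w V 0" using Sm_one[OF V(1)] by (intro emb_sections[OF V(1)]) (simp add: Sm_def)
  have "pull h V (emb V (restr V 1)) = emb (pre V) 1"
   unfolding pullh[OF V o] \<Phi>(4)[OF V Sm_one[OF V(1)]] by (auto simp: \<theta>_def emb_apply fun_eq_iff restr_def pre_def)
  then show "pull h V (gone N.N V) = gone T.N (preim h V)" by (simp add: preh)
 next
  fix V F G assume oV: "gopen N.N V" and "F \<in> homogeneous N.N V" "G \<in> homogeneous N.N V"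
  then obtain a b where V: "eopen m V" "V \<subseteq> U0" and F: "F \<in> sections m w V a" and G: "G \<in> sections m w V b"
   using N.openin_iff by (auto simp: homogeneous_def)
  show "pull h V (gmult N.N V F G) = gmult T.N (preim h V) (pull h V F) (pull h V G)"
   using pullh[OF V gmul_closed[OF V(1) F G]] pullh[OF V F] pullh[OF V G] \<Phi>(3)[OF V F G] by simp
 next
  fix V W F assume oV: "gopen N.N V" and oW: "gopen N.N W" and WV: "W \<subseteq> V" and "F \<in> homogeneous N.N V"
  then obtain a where V: "eopen m V" "V \<subseteq> U0" and W: "eopen m W" "W \<subseteq> U0" and F: "F \<in> sections m w V a"
   using N.openin_iff by (auto simp: homogeneous_def)
  have "gres N.N V W F \<in> sections m w W a" using N.res_closed[OF oV oW WV] F by simp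
  from pullh[OF W this] show "pull h W (gres N.N V W F) = gres T.N (preim h V) (preim h W) (pull h V F)"
   using \<Phi>res[OF V W(1) WV F] pullh[OF V F] by (simp add: preh del: domain_simps(5))
 qed (auto simp: h_def)
 have "pull h U0 (crd m U0 a) = y a" if a: "a < m + length w" for a
 proof (cases "a < m")
  case True
  have s: "restr U0 (\<lambda>x. x a) \<in> Sm m U0" by (rule restr_Sm[OF N.open_U0 smooth_coordinate[OF N.open_U0]])
  have ya: "y a \<in> sections mT wT T0 0" using y[OF a] True by (simp add: cdeg_def)
  have "pull h U0 (crd m U0 a) = \<theta> U0 (restr U0 (\<lambda>x. x a))"
   using pullh[OF N.open_U0 order_refl N.crd_sections[OF a]] \<Phi>(4)[OF N.open_U0 order_refl s] True by (simp add: crd_def)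
  also have "\<dots> = emb T0 (y a 0)" using b True by (auto simp: \<theta>_def preU emb_apply fun_eq_iff restr_def b_def)
  finally show ?thesis using sections_degree_0(1)[OF T.pos ya] by simp
 next
  case False
  then have j: "a - m < length w" using a by simp
  have "pull h U0 (crd m U0 a) = \<eta> U0 (a - m)"
   using pullh[OF N.open_U0 order_refl N.crd_sections[OF a]] \<Phi>(5)[OF N.open_U0 order_refl j] False by (simp add: crd_def)
  then show ?thesis using False restr_id[OF sectionsD(1)[OF y[OF a]]] by (simp add: \<eta>_def preU)
 qed
 then show ?thesis using hm by (intro bexI[of _ h]) (auto simp: h_def b_def)
qed

context gc_algebra
begin

text \<open>Derivations of degree \<open>k\<close> are the second components of homomorphisms into the algebra of dual
 numbers \<open>a + \<epsilon> a'\<close> with \<open>\<epsilon>\<close> of degree \<open>-k\<close> and \<open>\<epsilon>\<^sup>2 = 0\<close>, for which \<open>(a, a')\<close> stands.\<close>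

definition dual_sec :: "int => int => ('a \<times> 'a) set" where
 "dual_sec k j = A j \<times> A (j + k)"

text \<open>The sign depends on the degree of \<open>x\<close>, which is recovered by choice. The
  degree is ambiguous only for \<open>x = 0\<close>, and then the product that carries the sign
  vanishes.\<close>

definition dual_sign :: "int => 'a => real" where
 "dual_sign k x = (-1) powi (k * (SOME j. x \<in> A j))"

definition dual_mult :: "int => 'a \<times> 'a => 'a \<times> 'a => 'a \<times> 'a" where
 "dual_mult k = (\<lambda>(x, x') (y, y'). (m x y, m x' y + dual_sign k x *\<^sub>R m x y'))"

lemma dual_sign: "x \<in> A j ==> y \<in> A l ==> dual_sign k x *\<^sub>R m x y = ((-1) powi (k * j)) *\<^sub>R m x y"
proof (cases "x = 0")
 case False
 assume "x \<in> A j"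
 then have "(SOME j. x \<in> A j) = j" using degree_unique[of x _ j] False by (metis someI)
 then show ?thesis by (simp add: dual_sign_def)
qed (simp add: mult_0(2)[of y l])

lemma dual_mult: "x \<in> A j ==> y' \<in> A l ==> dual_mult k (x, x') (y, y') = (m x y, m x' y + ((-1) powi (k * j)) *\<^sub>R m x y')"
 by (simp add: dual_mult_def dual_sign)

lemma dual_gca: "gc_algebra (dual_sec k) (dual_mult k) (e, 0)"
 unfolding gc_algebra_def graded_commutative_algebra_def
proof (intro conjI allI impI ballI, goal_cases)
 case (1 j)
 show ?case unfolding dual_sec_def by (rule subspace_Times[OF sub sub])
next
 case (2 i j)
 then have "A i \<inter> A j = {0}" "A (i + k) \<inter> A (j + k) = {0}"
  using gca_conjuncts[THEN conjunct2, THEN conjunct1] by auto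
 then show ?case by (auto simp: dual_sec_def zero_prod_def)
next
 case (3 i j x y)
 then obtain x1 x2 y1 y2 where x: "x = (x1, x2)" "x1 \<in> A i" "x2 \<in> A (i + k)" and y: "y = (y1, y2)" "y1 \<in> A j" "y2 \<in> A (j + k)"
  by (auto simp: dual_sec_def)
 have "m x2 y1 \<in> A (i + j + k)" "m x1 y2 \<in> A (i + j + k)" using closed[OF x(3) y(2)] closed[OF x(2) y(3)] by (simp_all add: ac_simps)
 then show ?case unfolding x(1) y(1) dual_mult[OF x(2) y(3)] using closed[OF x(2) y(2)] by (simp add: dual_sec_def add scale)
next
 case (4 i j x)
 then obtain x1 x2 where x: "x = (x1, x2)" "x1 \<in> A i" "x2 \<in> A (i + k)" by (auto simp: dual_sec_def)
 show ?case unfolding linear_map_on_def x(1)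
  by (auto simp: dual_sec_def dual_mult_def add_right[OF x(2)] add_right[OF x(3)] scale_right[OF x(2)] scale_right[OF x(3)] algebra_simps)
next
 case (5 i j y)
 then obtain y1 y2 where y: "y = (y1, y2)" "y1 \<in> A j" "y2 \<in> A (j + k)" by (auto simp: dual_sec_def)
 show ?case unfolding linear_map_on_def y(1)
  by (auto simp: dual_sec_def dual_mult[OF _ y(3)] dual_mult[OF add y(3)] dual_mult[OF scale y(3)] add_left[OF _ _ y(2)] add_left[OF _ _ y(3)] scale_left[OF _ y(2)] scale_left[OF _ y(3)] algebra_simps)
next
 case (6 i j l x y z)
 then obtain x1 x2 y1 y2 z1 z2 where x: "x = (x1, x2)" "x1 \<in> A i" "x2 \<in> A (i + k)" and y: "y = (y1, y2)" "y1 \<in> A j" "y2 \<in> A (j + k)"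
  and z: "z = (z1, z2)" "z1 \<in> A l" "z2 \<in> A (l + k)" by (auto simp: dual_sec_def)
 define s where "s j = (-1::real) powi (k * j)" for j
 have ss: "s (i + j) = s i * s j" by (simp add: s_def distrib_left power_int_add)
 note dual_mult = dual_mult[of _ _ _ _ k, folded s_def]
 have a: "m x2 y1 \<in> A (i + j + k)" "m x1 y2 \<in> A (i + j + k)" using closed[OF x(3) y(2)] closed[OF x(2) y(3)] by (simp_all add: ac_simps)
 have b: "m y2 z1 \<in> A (j + l + k)" "m y1 z2 \<in> A (j + l + k)" using closed[OF y(3) z(2)] closed[OF y(2) z(3)] by (simp_all add: ac_simps)
 have "dual_mult k (dual_mult k x y) z = (m (m x1 y1) z1, m (m x2 y1 + s i *\<^sub>R m x1 y2) z1 + s (i + j) *\<^sub>R m (m x1 y1) z2)"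
  unfolding x(1) y(1) z(1) dual_mult[OF x(2) y(3)] dual_mult[OF closed[OF x(2) y(2)] z(3)] ..
 also have "\<dots> = (m x1 (m y1 z1), m x2 (m y1 z1) + s i *\<^sub>R m x1 (m y2 z1 + s j *\<^sub>R m y1 z2))"
  using x y z a b
  by (simp add: add_left[OF a(1) scale[OF a(2)] z(2)] scale_left[OF a(2) z(2)] add_right[OF x(2) b(1) scale[OF b(2)]] scale_right[OF x(2) b(2)]
    assoc[OF x(2) y(2) z(2)] assoc[OF x(3) y(2) z(2)] assoc[OF x(2) y(3) z(2)] assoc[OF x(2) y(2) z(3)] ss algebra_simps)
 also have "\<dots> = dual_mult k x (dual_mult k y z)"
  unfolding x(1) y(1) z(1) dual_mult[OF y(2) z(3)] dual_mult[OF x(2) add[OF b(1) scale[OF b(2)]]] ..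
 finally show ?case .
next
 case 7 show ?case by (simp add: dual_sec_def one)
next
 case (8 j x)
 then obtain x1 x2 where x: "x = (x1, x2)" "x1 \<in> A j" "x2 \<in> A (j + k)" by (auto simp: dual_sec_def)
 show ?case unfolding x(1) dual_mult[OF one(1) x(3)] by (simp add: one(2)[OF x(2)] one(2)[OF x(3)] mult_0(2)[OF x(2)])
next
 case (9 j x)
 then obtain x1 x2 where x: "x = (x1, x2)" "x1 \<in> A j" "x2 \<in> A (j + k)" by (auto simp: dual_sec_def)
 show ?case unfolding x(1) dual_mult[OF x(2) zero] by (simp add: one(3)[OF x(2)] one(3)[OF x(3)] mult_0(1)[OF x(2)])
next
 case (10 i j x y)
 then obtain x1 x2 y1 y2 where x: "x = (x1, x2)" "x1 \<in> A i" "x2 \<in> A (i + k)" and y: "y = (y1, y2)" "y1 \<in> A j" "y2 \<in> A (j + k)"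
  by (auto simp: dual_sec_def)
 have e: "(-1::real) powi (k * i) * (-1) powi (i * (j + k)) = (-1) powi (i * j)"
  "(-1::real) powi ((i + k) * j) = (-1) powi (i * j) * (-1) powi (k * j)"
  by (simp_all add: power_int_add[symmetric] distrib_left distrib_right power_int_minus_left mult.commute)
 show ?case
  unfolding x(1) y(1) dual_mult[OF x(2) y(3)] dual_mult[OF y(2) x(3)]
  using comm[OF x(2) y(2)] comm[OF x(3) y(2)] comm[OF x(2) y(3)] e by (simp add: scaleR_add_right add.commute)
qed

end

theorem domain_derivation_exists:
 assumes T: "gdomain mT wT T0" and N: "gdomain m w U0"
  and h: "h \<in> mors (gdom mT wT T0) (gdom m w U0)"
  and c: "\<And>a. a < m + length w ==> c a \<in> sections mT wT T0 (cdeg m w a + k)"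
 shows "\<exists>D\<in>ders h k. \<forall>a<m + length w. D U0 (crd m U0 a) = c a"
proof -
 interpret h: domain_morphism mT wT T0 m w U0 h using assms by (simp add: domain_morphism_defs)
 define b where "b = bmap h"
 define pre where "pre V = preim h V" for V
 have pre: "eopen mT (pre V)" "pre V \<subseteq> T0" if V: "eopen m V" "V \<subseteq> U0" for V
  using h.preim_open'[OF that] unfolding pre_def by auto
 have b: "b t \<in> V" if "t \<in> pre V" for t V using that by (simp add: pre_def b_def h.preim_iff)
 have bs: "smooth mT T0 (\<lambda>t. b t i)" for i
 proof (cases "i < m")
  case True
  have "smooth mT T0 (pull h U0 (crd m U0 i) 0)"
   using sectionsD(1)[of _ mT wT T0 "cdeg m w i" 0] h.closed[OF h.N.open_UU, of "crd m U0 i" "cdeg m w i"] h.N.crd_sections[of i] True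
   by (simp add: h.preim_UU Sm_def)
  then show ?thesis by (rule smooth_cong[OF h.T.open_U0, rotated]) (use h.body_coordinate True in "simp add: b_def")
 next
  case False
  show ?thesis by (rule smooth_cong[OF h.T.open_U0 _ smooth_const[OF h.T.open_U0, of 0]])
    (use h.body_coordinate False in "simp add: b_def")
 qed
 have comp: "smooth mT (pre V) (\<lambda>t. f (b t))" if V: "eopen m V" "V \<subseteq> U0" and f: "smooth m V f" for V f
  by (rule smooth_compose[OF pre(1)[OF V] V(1) b])
    (use f smooth_subset[OF h.T.open_U0 pre[OF V] bs] in auto)
 \<comment> \<open>The second component is the chain rule, the only value allowed by
   \<open>der_function\<close> once the coordinates are sent to the \<open>c i\<close>.\<close>
 define \<theta> where "\<theta> V f = (emb (pre V) (\<lambda>t. f (b t)), (\<lambda>\<mu>. restr (pre V) (\<lambda>t. \<Sum>i<m. pd i f (b t) * c i \<mu> t)))" for V f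
 define \<eta> where "\<eta> V j = (pull h V (gen V j), gres h.T.N T0 (pre V) (c (m + j)))" for V j
 define dsec where "dsec V = gc_algebra.dual_sec (sections mT wT (pre V)) k" for V
 define dmul where "dmul V = gc_algebra.dual_mult (sections mT wT (pre V)) (gmul wT) k" for V
 define good where "good V \<Phi> \<longleftrightarrow> (\<forall>j. \<forall>F\<in>sections m w V j. \<Phi> F \<in> dsec V j) \<and> (\<forall>j. linear_map_on (sections m w V j) \<Phi>) \<and>
   (\<forall>i j. \<forall>F\<in>sections m w V i. \<forall>G\<in>sections m w V j. \<Phi> (gmul w F G) = dmul V (\<Phi> F) (\<Phi> G)) \<and>
   (\<forall>f\<in>Sm m V. \<Phi> (emb V f) = \<theta> V f) \<and> (\<forall>j<length w. \<Phi> (gen V j) = \<eta> V j)" for V \<Phi>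
 have alg: "gc_algebra (sections mT wT (pre V)) (gmul wT) (emb (pre V) 1)" if "eopen m V" "V \<subseteq> U0" for V
  using pre[OF that] by (simp add: gc_algebra_def gca_domain)
 have ex: "\<exists>\<Phi>. good V \<Phi>" if V: "eopen m V" "V \<subseteq> U0" for V
 proof -
  have oV: "gopen h.N.N V" using V h.N.openin_iff by blast
  interpret a: gc_algebra "sections mT wT (pre V)" "gmul wT" "emb (pre V) 1" by (rule alg[OF V])
  interpret d: gc_algebra "dsec V" "dmul V" "(emb (pre V) 1, 0)" unfolding dsec_def dmul_def by (rule a.dual_gca)
  have sm: "smooth m V f" if "f \<in> Sm m V" for f using that by (simp add: Sm_def)
  have th1: "emb (pre V) (\<lambda>t. f (b t)) \<in> sections mT wT (pre V) 0" if "f \<in> Sm m V" for f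
   by (rule emb_sections[OF pre(1)[OF V] comp[OF V sm[OF that]]])
  have th2: "(\<lambda>\<mu>. restr (pre V) (\<lambda>t. \<Sum>i<m. pd i f (b t) * c i \<mu> t)) \<in> sections mT wT (pre V) k" if f: "f \<in> Sm m V" for f
   unfolding sections_def
  proof (intro CollectI conjI allI impI)
   fix \<mu>
   have "smooth mT (pre V) (c i \<mu>)" if "i < m" for i
    using sectionsD(1)[OF c[of i], of \<mu>] that smooth_subset[OF h.T.open_U0 pre[OF V]] by (auto simp: Sm_def)
   then show "restr (pre V) (\<lambda>t. \<Sum>i<m. pd i f (b t) * c i \<mu> t) \<in> Sm mT (pre V)"
    by (intro restr_Sm smooth_sum smooth_mult pre(1)[OF V] comp[OF V] smooth_pd(1)[OF V(1) sm[OF f]]) auto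
  next
   fix \<mu> assume "\<not> (\<mu> \<in> monomials wT \<and> mdegree wT \<mu> = k)"
   then have "c i \<mu> = 0" if "i < m" for i using sectionsD(2)[OF c[of i], of \<mu>] that by (auto simp: cdeg_def)
   then show "restr (pre V) (\<lambda>t. \<Sum>i<m. pd i f (b t) * c i \<mu> t) = 0" by (auto simp: restr_def fun_eq_iff)
  qed
  have th: "\<theta> V f \<in> dsec V 0" if "f \<in> Sm m V" for f
   using th1[OF that] th2[OF that] by (simp add: \<theta>_def dsec_def a.dual_sec_def)
  have pdd: "((\<lambda>y. f (x(i := y))) has_real_derivative pd i f x) (at (x i))" if "f \<in> Sm m V" "i < m" "x \<in> V" for f i x
   by (rule smooth_pd(2)[OF V(1) sm[OF that(1)] that(2,3)])
  have pdadd: "pd i (f + g) x = pd i f x + pd i g x" if "f \<in> Sm m V" "g \<in> Sm m V" "i < m" "x \<in> V" for f g i x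
   by (rule pd_eqI) (use DERIV_add[OF pdd[OF that(1,3,4)] pdd[OF that(2,3,4)]] in simp)
  have pdmul: "pd i (f * g) x = pd i f x * g x + pd i g x * f x" if "f \<in> Sm m V" "g \<in> Sm m V" "i < m" "x \<in> V" for f g i x
   by (rule pd_eqI) (use DERIV_mult[OF pdd[OF that(1,3,4)] pdd[OF that(2,3,4)]] in simp)
  have pdsc: "pd i (r *\<^sub>R f) x = r * pd i f x" if "f \<in> Sm m V" "i < m" "x \<in> V" for r f i x
   by (rule pd_eqI) (use DERIV_cmult[OF pdd[OF that], of r] in "simp add: scaleR_fun_def")
  have pdone: "pd i (restr V 1) x = 0" if "i < m" "x \<in> V" for i x
   using pd_cong[OF V(1) that(2,1), of "restr V 1" "\<lambda>_. 1"] pd_eqI[of "\<lambda>_. 1" x i 0] by (simp add: restr_def)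
  show ?thesis
   unfolding good_def
  proof (rule d.hom_exists[OF h.N.pos V(1) th])
   show "linear_map_on (Sm m V) (\<theta> V)"
    using pdadd pdsc b
    by (auto simp: linear_map_on_def \<theta>_def emb_apply fun_eq_iff scaleR_fun_def restr_def sum.distrib[symmetric] sum_distrib_left algebra_simps intro!: sum.cong)
   show "\<theta> V (restr V 1) = (emb (pre V) 1, 0)"
    using b pdone by (auto simp: \<theta>_def emb_apply fun_eq_iff restr_apply intro!: sum.neutral)
   show "\<theta> V (f * g) = dmul V (\<theta> V f) (\<theta> V g)" if f: "f \<in> Sm m V" and g: "g \<in> Sm m V" for f g
   proof -
    have "dmul V (\<theta> V f) (\<theta> V g) = (gmul wT (fst (\<theta> V f)) (fst (\<theta> V g)), gmul wT (snd (\<theta> V f)) (fst (\<theta> V g)) + gmul wT (fst (\<theta> V f)) (snd (\<theta> V g)))"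
     unfolding dmul_def \<theta>_def by (simp add: a.dual_mult[OF th1[OF f] th2[OF g]])
    moreover have "gmul wT (fst (\<theta> V f)) (fst (\<theta> V g)) = fst (\<theta> V (f * g))"
     using gmul_emb_left[OF th1[OF g], where f = "\<lambda>t. f (b t)"] by (auto simp: \<theta>_def emb_apply fun_eq_iff)
    moreover have "gmul wT (snd (\<theta> V f)) (fst (\<theta> V g)) + gmul wT (fst (\<theta> V f)) (snd (\<theta> V g)) = snd (\<theta> V (f * g))"
    proof (intro ext)
     fix \<mu> t
     have "(gmul wT (snd (\<theta> V f)) (fst (\<theta> V g)) + gmul wT (fst (\<theta> V f)) (snd (\<theta> V g))) \<mu> t =
       snd (\<theta> V f) \<mu> t * g (b t) + f (b t) * snd (\<theta> V g) \<mu> t"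
      unfolding \<theta>_def fst_conv snd_conv plus_fun_apply gmul_emb_left[OF th2[OF g]] gmul_emb_right[OF th2[OF f]] ..
     then show "(gmul wT (snd (\<theta> V f)) (fst (\<theta> V g)) + gmul wT (fst (\<theta> V f)) (snd (\<theta> V g))) \<mu> t = snd (\<theta> V (f * g)) \<mu> t"
      using b[of t V] pdmul[OF f g]
      by (auto simp: \<theta>_def restr_apply sum.distrib[symmetric] sum_distrib_left sum_distrib_right algebra_simps intro!: sum.cong)
    qed
    ultimately show ?thesis by (simp add: prod_eq_iff)
   qed
   show "\<eta> V j \<in> dsec V (int (w ! j))" if j: "j < length w" for j
   proof -
    have "pull h V (gen V j) \<in> sections mT wT (pre V) (int (w ! j))"
     using h.closed[OF oV, of "gen V j"] gen_sections[OF V(1) j] by (simp add: pre_def)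
    moreover have "gres h.T.N T0 (pre V) (c (m + j)) \<in> sections mT wT (pre V) (int (w ! j) + k)"
     using h.T.res_closed[OF h.T.open_UU _ pre(2)[OF V], of "c (m + j)" "int (w ! j) + k"] c[of "m + j"] j pre[OF V]
     unfolding h.T.openin_iff by (simp add: cdeg_def)
    ultimately show ?thesis by (simp add: \<eta>_def dsec_def a.dual_sec_def)
   qed
  qed
 qed
 define \<Phi> where "\<Phi> V = (SOME \<Phi>. good V \<Phi>)" for V
 have good: "good V (\<Phi> V)" if "eopen m V" "V \<subseteq> U0" for V
  unfolding \<Phi>_def by (rule someI_ex[OF ex[OF that]])
 have \<Phi>: "F \<in> sections m w V j ==> \<Phi> V F \<in> dsec V j" "linear_map_on (sections m w V j) (\<Phi> V)"
   "F \<in> sections m w V j ==> G \<in> sections m w V l ==> \<Phi> V (gmul w F G) = dmul V (\<Phi> V F) (\<Phi> V G)"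
   "f \<in> Sm m V ==> \<Phi> V (emb V f) = \<theta> V f" "i < length w ==> \<Phi> V (gen V i) = \<eta> V i"
   if "eopen m V" "V \<subseteq> U0" for V F G j l f i
  using good[OF that, unfolded good_def, THEN conjunct1]
   good[OF that, unfolded good_def, THEN conjunct2, THEN conjunct1]
   good[OF that, unfolded good_def, THEN conjunct2, THEN conjunct2, THEN conjunct1]
   good[OF that, unfolded good_def, THEN conjunct2, THEN conjunct2, THEN conjunct2]
  by simp_all
 have \<Phi>0: "\<Phi> V 0 = 0" if "eopen m V" "V \<subseteq> U0" for V
  by (rule linear_map_on_0[OF \<Phi>(2)[OF that] subspace_sections[OF that(1)]])
 have mem: "fst (\<Phi> V F) \<in> sections mT wT (pre V) j" "snd (\<Phi> V F) \<in> sections mT wT (pre V) (j + k)"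
  if V: "eopen m V" "V \<subseteq> U0" and F: "F \<in> sections m w V j" for V F j
  using \<Phi>(1)[OF V F, unfolded dsec_def gc_algebra.dual_sec_def[OF alg[OF V]]] by (simp_all add: mem_Times_iff)
 have mul: "fst (\<Phi> V (gmul w F G)) = gmul wT (fst (\<Phi> V F)) (fst (\<Phi> V G))"
  "snd (\<Phi> V (gmul w F G)) = gmul wT (snd (\<Phi> V F)) (fst (\<Phi> V G)) + ((-1) powi (k * j)) *\<^sub>R gmul wT (fst (\<Phi> V F)) (snd (\<Phi> V G))"
  if V: "eopen m V" "V \<subseteq> U0" and F: "F \<in> sections m w V j" and G: "G \<in> sections m w V l" for V F G j l
  using \<Phi>(3)[OF V F G] gc_algebra.dual_mult[OF alg[OF V] mem(1)[OF V F] mem(2)[OF V G], of k "snd (\<Phi> V F)" "fst (\<Phi> V G)"]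
  unfolding dmul_def by auto
 \<comment> \<open>Multiplicativity in the dual numbers is a Leibniz rule over the first component;
   identifying the latter with the pullback makes the second one a derivation along
   \<open>h\<close>.\<close>
 have fstp: "fst (\<Phi> V F) = pull h V F" if V: "eopen m V" "V \<subseteq> U0" and F: "F \<in> sections m w V j" for V F j
 proof (rule section_induct[OF h.N.pos V(1) F, where J = UNIV and P = "\<lambda>j F. fst (\<Phi> V F) = pull h V F"])
  have oV: "gopen h.N.N V" using V h.N.openin_iff by blast
  { fix f assume f: "f \<in> Sm m V"
   show "fst (\<Phi> V (emb V f)) = pull h V (emb V f)"
    unfolding \<Phi>(4)[OF V f] h.locality[OF V f] by (simp add: \<theta>_def pre_def b_def) }
  { fix j assume j: "j < length w" show "fst (\<Phi> V (gen V j)) = pull h V (gen V j)" unfolding \<Phi>(5)[OF V j] by (simp add: \<eta>_def) }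
  { fix F G a b assume F: "F \<in> sections m w V a" and G: "G \<in> sections m w V b" and "fst (\<Phi> V F) = pull h V F" "fst (\<Phi> V G) = pull h V G"
   then show "fst (\<Phi> V (gmul w F G)) = pull h V (gmul w F G)"
    using mul(1)[OF V F G] h.mult[OF oV, of F G] by (simp add: homogeneousI[of F _ _ a] homogeneousI[of G _ _ b]) }
  { fix F G a assume F: "F \<in> sections m w V a" and G: "G \<in> sections m w V a" and "fst (\<Phi> V F) = pull h V F" "fst (\<Phi> V G) = pull h V G"
   then show "fst (\<Phi> V (F + G)) = pull h V (F + G)"
    using linear_map_on_add[OF \<Phi>(2)[OF V] F G] h.add[OF oV, of F a G] by simp }
  show "fst (\<Phi> V 0) = pull h V 0" using \<Phi>0[OF V] by simp
 qed simp
 have \<Phi>res: "snd (\<Phi> W (gres h.N.N V W F)) = gres h.T.N (pre V) (pre W) (snd (\<Phi> V F))"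
  if V: "eopen m V" "V \<subseteq> U0" and W: "eopen m W" "W \<subseteq> V" and F: "F \<in> sections m w V j" for V W F j
 proof (rule section_induct[OF h.N.pos V(1) F, where J = UNIV and P = "\<lambda>j F. snd (\<Phi> W (gres h.N.N V W F)) = gres h.T.N (pre V) (pre W) (snd (\<Phi> V F))"])
  have WU: "W \<subseteq> U0" using V W by blast
  have oV: "gopen h.N.N V" "gopen h.N.N W" "gopen h.T.N (pre V)" "gopen h.T.N (pre W)"
   using h.N.openin_iff h.T.openin_iff V W WU pre by auto
  have pWV: "pre W \<subseteq> pre V" using W unfolding pre_def by (intro h.preim_mono)
  have add_res: "gres h.N.N V W (F + G) = gres h.N.N V W F + gres h.N.N V W G"
   "gres h.T.N (pre V) (pre W) (F + G) = gres h.T.N (pre V) (pre W) F + gres h.T.N (pre V) (pre W) G"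
   "gres h.T.N (pre V) (pre W) (r *\<^sub>R F) = r *\<^sub>R gres h.T.N (pre V) (pre W) F" for F G :: model_section and r
   by (auto simp: restr_def fun_eq_iff scaleR_fun_def)
  { fix f assume f: "f \<in> Sm m V"
   have "pd i (restr W f) (b t) = pd i f (b t)" if "i < m" "t \<in> pre W" for i t
    by (rule pd_cong[OF W(1) b[OF that(2)] that(1)]) (simp add: restr_def)
   then show "snd (\<Phi> W (gres h.N.N V W (emb V f))) = gres h.T.N (pre V) (pre W) (snd (\<Phi> V (emb V f)))"
    unfolding h.N.res_emb[OF W(2)] \<Phi>(4)[OF W(1) WU restr_Sm_subset[OF V(1) W f]] \<Phi>(4)[OF V f]
    using pWV by (auto simp: \<theta>_def fun_eq_iff restr_apply) }
  { fix j assume j: "j < length w"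
   show "snd (\<Phi> W (gres h.N.N V W (gen V j))) = gres h.T.N (pre V) (pre W) (snd (\<Phi> V (gen V j)))"
    unfolding h.N.res_gen[OF W(2)] \<Phi>(5)[OF W(1) WU j] \<Phi>(5)[OF V j]
    using pWV by (simp add: \<eta>_def restr_restr Int_absorb2) }
  { fix F G a b assume F: "F \<in> sections m w V a" and G: "G \<in> sections m w V b"
    and IH: "snd (\<Phi> W (gres h.N.N V W F)) = gres h.T.N (pre V) (pre W) (snd (\<Phi> V F))" "snd (\<Phi> W (gres h.N.N V W G)) = gres h.T.N (pre V) (pre W) (snd (\<Phi> V G))"
   have r: "gres h.N.N V W F \<in> sections m w W a" "gres h.N.N V W G \<in> sections m w W b"
    using h.N.res_closed[OF oV(1,2) W(2)] F G by auto
   have 1: "gres h.N.N V W (gmul w F G) = gmul w (gres h.N.N V W F) (gres h.N.N V W G)"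
    using h.N.res_mult[OF oV(1,2) W(2), of F G] F G by (simp add: homogeneousI[of F _ _ a] homogeneousI[of G _ _ b] del: domain_simps(5))
   have 2: "gres h.T.N (pre V) (pre W) (gmul wT X Y) = gmul wT (gres h.T.N (pre V) (pre W) X) (gres h.T.N (pre V) (pre W) Y)"
    if "X \<in> sections mT wT (pre V) x" "Y \<in> sections mT wT (pre V) y" for X Y x y
    using h.T.res_mult[OF oV(3,4) pWV, of X Y] that
    by (simp add: homogeneousI[of X _ _ x] homogeneousI[of Y _ _ y] del: domain_simps(5))
   have 3: "fst (\<Phi> W (gres h.N.N V W X)) = gres h.T.N (pre V) (pre W) (fst (\<Phi> V X))" if X: "X \<in> sections m w V x" for X x
   proof -
    have "gres h.N.N V W X \<in> sections m w W x" using h.N.res_closed[OF oV(1,2) W(2)] X by auto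
    from fstp[OF W(1) WU this] show ?thesis
     using fstp[OF V X] h.res[OF oV(1,2) W(2), of X] X by (simp add: homogeneousI[of X _ _ x] pre_def del: domain_simps(5))
   qed
   show "snd (\<Phi> W (gres h.N.N V W (gmul w F G))) = gres h.T.N (pre V) (pre W) (snd (\<Phi> V (gmul w F G)))"
    unfolding 1 mul(2)[OF W(1) WU r] mul(2)[OF V F G] add_res 2[OF mem(2)[OF V F] mem(1)[OF V G]] 2[OF mem(1)[OF V F] mem(2)[OF V G]] IH 3[OF F] 3[OF G] .. }
  { fix F G a assume F: "F \<in> sections m w V a" and G: "G \<in> sections m w V a"
    and IH: "snd (\<Phi> W (gres h.N.N V W F)) = gres h.T.N (pre V) (pre W) (snd (\<Phi> V F))" "snd (\<Phi> W (gres h.N.N V W G)) = gres h.T.N (pre V) (pre W) (snd (\<Phi> V G))"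
   have r: "gres h.N.N V W F \<in> sections m w W a" "gres h.N.N V W G \<in> sections m w W a"
    using h.N.res_closed[OF oV(1,2) W(2)] F G by auto
   show "snd (\<Phi> W (gres h.N.N V W (F + G))) = gres h.T.N (pre V) (pre W) (snd (\<Phi> V (F + G)))"
    unfolding add_res linear_map_on_add[OF \<Phi>(2)[OF W(1) WU] r] linear_map_on_add[OF \<Phi>(2)[OF V] F G] snd_add IH .. }
  have "gres h.N.N V W 0 = 0" "gres h.T.N (pre V) (pre W) 0 = 0" by (auto simp: restr_def fun_eq_iff)
  then show "snd (\<Phi> W (gres h.N.N V W 0)) = gres h.T.N (pre V) (pre W) (snd (\<Phi> V 0))"
   using \<Phi>0[OF V] \<Phi>0[OF W(1) WU] by (simp del: domain_simps(5))
 qed simp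
 define D where "D V F = (if gopen h.N.N V \<and> F \<in> homogeneous h.N.N V then snd (\<Phi> V F) else 0)" for V F
 have DV: "D V F = snd (\<Phi> V F)" if "eopen m V" "V \<subseteq> U0" "F \<in> sections m w V j" for V F j
  using that h.N.openin_iff homogeneousI[of F h.N.N V j] by (simp add: D_def)
 have "D \<in> ders h k"
 proof (rule derivations_alongI[OF h])
  fix V F assume "\<not> (gopen h.N.N V \<and> F \<in> homogeneous h.N.N V)"
  then show "D V F = 0" unfolding D_def by (rule if_not_P)
 next
  fix V F j assume "gopen h.N.N V" "F \<in> gsec h.N.N V j"
  then show "D V F \<in> gsec h.T.N (preim h V) (j + k)" using DV mem(2) h.N.openin_iff by (auto simp: pre_def)
 next
  fix V j assume "gopen h.N.N V"
  then have V: "eopen m V" "V \<subseteq> U0" using h.N.openin_iff by auto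
  show "linear_map_on (gsec h.N.N V j) (D V)"
   using \<Phi>(2)[OF V, of j] subspace_add[OF subspace_sections[OF V(1), of w j]] subspace_scale[OF subspace_sections[OF V(1), of w j]]
   unfolding linear_map_on_def by (simp add: DV[OF V, of _ j])
 next
  fix V F G j assume "gopen h.N.N V" "F \<in> gsec h.N.N V j" "G \<in> homogeneous h.N.N V"
  then obtain l where V: "eopen m V" "V \<subseteq> U0" and F: "F \<in> sections m w V j" and G: "G \<in> sections m w V l"
   using h.N.openin_iff by (auto simp: homogeneous_def)
  show "D V (gmult h.N.N V F G) = gmult h.T.N (preim h V) (D V F) (pull h V G) + ((-1) powi (k * j)) *\<^sub>R gmult h.T.N (preim h V) (pull h V F) (D V G)"
   using DV[OF V gmul_closed[OF V(1) F G]] DV[OF V F] DV[OF V G] mul(2)[OF V F G] fstp[OF V F] fstp[OF V G] by simp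
 next
  fix V W F assume oV: "gopen h.N.N V" and oW: "gopen h.N.N W" and WV: "W \<subseteq> V" and "F \<in> homogeneous h.N.N V"
  then obtain a where V: "eopen m V" "V \<subseteq> U0" and W: "eopen m W" "W \<subseteq> U0" and F: "F \<in> sections m w V a"
   using h.N.openin_iff by (auto simp: homogeneous_def)
  have "gres h.N.N V W F \<in> sections m w W a" using h.N.res_closed[OF oV oW WV] F by simp
  from DV[OF W this] show "D W (gres h.N.N V W F) = gres h.T.N (preim h V) (preim h W) (D V F)"
   using \<Phi>res[OF V W(1) WV F] DV[OF V F] by (simp add: pre_def del: domain_simps(5))
 qed
 moreover have "D U0 (crd m U0 a) = c a" if a: "a < m + length w" for a
 proof (cases "a < m")
  case True
  have s: "restr U0 (\<lambda>x. x a) \<in> Sm m U0" by (rule restr_Sm[OF h.N.open_U0 smooth_coordinate[OF h.N.open_U0]])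
  have p: "pd i (restr U0 (\<lambda>x. x a)) x = (if i = a then 1 else 0)" if "i < m" "x \<in> U0" for i x
   using pd_cong[OF h.N.open_U0 that(2,1), of "restr U0 (\<lambda>x. x a)" "\<lambda>x. x a"] pd_eqI[of "\<lambda>x. x a" x i "if i = a then 1 else 0"]
   by (auto simp: restr_def)
  have preU: "pre U0 = T0" by (simp add: pre_def h.preim_UU)
  have "D U0 (crd m U0 a) = snd (\<theta> U0 (restr U0 (\<lambda>x. x a)))"
   using DV[OF h.N.open_U0 order_refl h.N.crd_sections[OF a]] \<Phi>(4)[OF h.N.open_U0 order_refl s] True by (simp add: crd_def)
  also have "\<dots> = c a"
  proof (intro ext)
   fix \<mu> t
   have "(\<Sum>i<m. pd i (restr U0 (\<lambda>x. x a)) (b t) * c i \<mu> t) = (\<Sum>i<m. if i = a then c a \<mu> t else 0)" if "t \<in> T0"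
    using p b[of t U0] that preU by (intro sum.cong) auto
   then show "snd (\<theta> U0 (restr U0 (\<lambda>x. x a))) \<mu> t = c a \<mu> t"
    using True sectionsD(3)[OF c[OF a], of t \<mu>] by (auto simp: \<theta>_def preU restr_apply)
  qed
  finally show ?thesis .
 next
  case False
  then have j: "a - m < length w" using a by simp
  have "D U0 (crd m U0 a) = snd (\<eta> U0 (a - m))"
   using DV[OF h.N.open_U0 order_refl h.N.crd_sections[OF a]] \<Phi>(5)[OF h.N.open_U0 order_refl j] False by (simp add: crd_def)
  then show ?thesis using False restr_id[OF sectionsD(1)[OF c[OF a]]] by (simp add: \<eta>_def pre_def h.preim_UU)
 qed
 ultimately show ?thesis by blast
qed

section \<open>Retractions onto zero sets\<close>

context gdomain
begin

lemma sub: "eopen m W ==> gdomain m w W"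
 using pos by (simp add: gdomain_def)

lemma incl_domain:
 assumes "eopen m W" "W \<subseteq> U0"
 shows "incl N W \<in> mors (gdom m w W) N" "open_embedding (gdom m w W) N (incl N W)"
  "preim (incl N W) U0 = W" "bmap (incl N W) x = (if x \<in> W then x else undefined)"
  "F \<in> sections m w U0 k ==> pull (incl N W) U0 F = gres N U0 W F"
proof -
 have oW: "gopen N W" unfolding openin_iff using assms by blast
 show "incl N W \<in> mors (gdom m w W) N" using incl_mors[OF sheaf oW] open_subspace_eq[OF assms(2)] by simp
 have "open_emb (gdom m w W) N (incl N W)" using open_emb_incl[OF sheaf oW] open_subspace_eq[OF assms(2)] by simp
 then show "open_embedding (gdom m w W) N (incl N W)"
  using sheaf gdomain.sheaf[OF sub[OF assms(1)]] by (simp add: open_embedding_def)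
 show "preim (incl N W) U0 = W" unfolding preim_incl[OF oW] using assms(2) by blast
 show "bmap (incl N W) x = (if x \<in> W then x else undefined)" by (simp add: incl_def)
 assume "F \<in> sections m w U0 k"
 then have "F \<in> homogeneous N U0" by (auto intro: homogeneousI)
 from incl_pull[OF open_UU this, of W] show "pull (incl N W) U0 F = gres N U0 W F" using assms(2) by (simp add: Int_absorb1)
qed

lemma res_crd: "W \<subseteq> U0 ==> gres N U0 W (crd m U0 a) = crd m W a"
 by (auto simp: crd_def emb_eq mono_eq restr_def fun_eq_iff)

lemma incl_incl:
 assumes "eopen m W" "W \<subseteq> U0" "eopen m W'" "W' \<subseteq> W"
 shows "incl N W \<odot> incl (gdom m w W) W' = incl N W'"
proof -
 interpret W: gdomain m w W by (rule sub[OF assms(1)])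
 have W'U: "W' \<subseteq> U0" using assms by blast
 show ?thesis
 proof (rule domain_morphism_eqI[OF sub[OF assms(3)] gdomain_axioms])
  show "incl N W \<odot> incl W.N W' \<in> mors (gdom m w W') N"
   by (rule comp_mors[OF W.incl_domain(1)[OF assms(3,4)] incl_domain(1)[OF assms(1,2)]])
  show "incl N W' \<in> mors (gdom m w W') N" by (rule incl_domain(1)[OF assms(3) W'U])
  fix a assume a: "a < m + length w"
  show "pull (incl N W \<odot> incl W.N W') U0 (crd m U0 a) = pull (incl N W') U0 (crd m U0 a)"
   using incl_domain(5)[OF assms(1,2) crd_sections[OF a]] incl_domain(5)[OF assms(3) W'U crd_sections[OF a]]
    W.incl_domain(5)[OF assms(3,4) W.crd_sections[OF a]]
   by (simp add: incl_domain(3)[OF assms(1,2)] res_crd[OF assms(2)] res_crd[OF W'U] W.res_crd[OF assms(4)] del: domain_simps(5))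
 qed
qed

end

text \<open>The zero set of the \<open>F i\<close> need not be a graded domain, so it enters only
  through test maps: \<open>\<rho>\<close> maps into it, and it fixes the morphisms \<open>a\<close>
  into it and the derivations tangent to it. Fixing means agreement with the inclusion, as
  \<open>\<rho>\<close> is defined on \<open>W\<close> only but takes values in
  \<open>U0\<close>.\<close>

definition retracts :: "nat => nat list => (nat => real) set => (nat => real) set => 'i set => ('i => model_section) =>
  (nat => real, model_section, nat => real, model_section) graded_map => bool" where
 "retracts m w U0 W I F \<rho> \<longleftrightarrow> \<rho> \<in> mors (gdom m w W) (gdom m w U0) \<and> (\<forall>i\<in>I. pull \<rho> U0 (F i) = 0) \<and>
  (\<forall>mT wT T0 a. gdomain mT wT T0 --> a \<in> mors (gdom mT wT T0) (gdom m w W) -->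
    (\<forall>i\<in>I. pull (incl (gdom m w U0) W \<odot> a) U0 (F i) = 0) -->
    \<rho> \<odot> a = incl (gdom m w U0) W \<odot> a \<and>
    (\<forall>k. \<forall>D\<in>ders a k. (\<forall>i\<in>I. tangent (incl (gdom m w U0) W) D U0 (F i) = 0) -->
     tangent \<rho> D = tangent (incl (gdom m w U0) W) D))"

lemma retractsD:
 assumes "retracts m w U0 W I F \<rho>"
 shows "\<rho> \<in> mors (gdom m w W) (gdom m w U0)" "i \<in> I ==> pull \<rho> U0 (F i) = 0"
  "gdomain mT wT T0 ==> a \<in> mors (gdom mT wT T0) (gdom m w W) ==>
    (\<And>i. i \<in> I ==> pull (incl (gdom m w U0) W \<odot> a) U0 (F i) = 0) ==> \<rho> \<odot> a = incl (gdom m w U0) W \<odot> a"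
  "gdomain mT wT T0 ==> a \<in> mors (gdom mT wT T0) (gdom m w W) ==>
    (\<And>i. i \<in> I ==> pull (incl (gdom m w U0) W \<odot> a) U0 (F i) = 0) ==> D \<in> ders a k ==>
    (\<And>i. i \<in> I ==> tangent (incl (gdom m w U0) W) D U0 (F i) = 0) ==>
    tangent \<rho> D = tangent (incl (gdom m w U0) W) D"
 using assms unfolding retracts_def by (simp, simp, (elim conjE, metis)+)

context gdomain
begin

text \<open>Morphisms and derivations into a domain are compared on coordinates. So it suffices that
  the new coordinates \<open>y b\<close> and the old ones agree under every morphism that
  annihilates \<open>F\<close> and every derivation along it that does.\<close>

lemma retracts_singleI:
 assumes W: "eopen m W" "W \<subseteq> U0" and F: "F \<in> sections m w U0 e"
  and \<rho>: "\<rho> \<in> mors (gdom m w W) N" "\<And>b. b < m + length w ==> pull \<rho> U0 (crd m U0 b) = y b" "pull \<rho> U0 F = 0"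
  and eq: "\<And>mT wT T0 a b. gdomain mT wT T0 ==> a \<in> mors (gdom mT wT T0) (gdom m w W) ==> pull a W (gres N U0 W F) = 0 ==>
    b < m + length w ==> pull a W (y b) = pull a W (crd m W b)"
  and deq: "\<And>mT wT T0 a b D k. gdomain mT wT T0 ==> a \<in> mors (gdom mT wT T0) (gdom m w W) ==> pull a W (gres N U0 W F) = 0 ==>
    D \<in> ders a k ==> D W (gres N U0 W F) = 0 ==>
    b < m + length w ==> D W (y b) = D W (crd m W b)"
 shows "retracts m w U0 W {i} (\<lambda>_. F) \<rho>"
 unfolding retracts_def
proof (intro conjI allI impI ballI)
 interpret W: gdomain m w W by (rule sub[OF W(1)])
 note inc = incl_domain[OF W]
 have pre\<rho>: "preim \<rho> U0 = W"
  using domain_morphism.preim_UU[of m w W m w U0 \<rho>] \<rho>(1) gdomain_axioms W.gdomain_axioms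
  by (simp add: domain_morphism_defs)
 show "\<rho> \<in> mors (gdom m w W) N" "pull \<rho> U0 F = 0" by (rule \<rho>)+
 fix mT wT T0 a
 assume T: "gdomain mT wT T0" and a: "a \<in> mors (gdom mT wT T0) (gdom m w W)"
  and z: "\<forall>i\<in>{i}. pull (incl N W \<odot> a) U0 F = 0"
 then have z': "pull a W (gres N U0 W F) = 0" by (simp add: inc(3) inc(5)[OF F] del: domain_simps(5))
 have crdW: "pull (incl N W) U0 (crd m U0 b) = crd m W b" if "b < m + length w" for b
  using inc(5)[OF crd_sections[OF that]] res_crd[OF W(2)] by simp
 show *: "\<rho> \<odot> a = incl N W \<odot> a"
 proof (rule domain_morphism_eqI[OF T gdomain_axioms comp_mors[OF a \<rho>(1)] comp_mors[OF a inc(1)]])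
  fix b assume b: "b < m + length w"
  show "pull (\<rho> \<odot> a) U0 (crd m U0 b) = pull (incl N W \<odot> a) U0 (crd m U0 b)"
   using eq[OF T a z' b] by (simp add: pre\<rho> inc(3) \<rho>(2)[OF b] crdW[OF b])
 qed
 fix k D assume D: "D \<in> ders a k" and dz: "\<forall>i\<in>{i}. tangent (incl N W) D U0 F = 0"
 then have dz': "D W (gres N U0 W F) = 0" by (simp add: tangent_def inc(3) inc(5)[OF F] del: domain_simps(5))
 show "tangent \<rho> D = tangent (incl N W) D"
 proof (rule domain_derivation_eqI[OF T gdomain_axioms comp_mors[OF a inc(1)]])
  show "tangent \<rho> D \<in> ders (incl N W \<odot> a) k" using tangent_derivation[OF a \<rho>(1) D] * by simp
  show "tangent (incl N W) D \<in> ders (incl N W \<odot> a) k" by (rule tangent_derivation[OF a inc(1) D])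
  fix b assume b: "b < m + length w"
  show "tangent \<rho> D U0 (crd m U0 b) = tangent (incl N W) D U0 (crd m U0 b)"
   using deq[OF T a z' D dz' b] by (simp add: tangent_def pre\<rho> inc(3) \<rho>(2)[OF b] crdW[OF b])
 qed
qed

end

section \<open>The one-point domain and the elimination of one equation\<close>

lemma gdomain_point: "gdomain 0 [] (topspace (Euclidean_space 0))"
 by (simp add: gdomain_def)

lemma monomials_Nil: "monomials [] = {0}"
 by (auto simp: monomials_def fun_eq_iff)

lemma sections_point:
 assumes "F \<in> sections 0 [] V k"
 shows "F = emb V (F 0)" "k \<noteq> 0 ==> F = 0"
proof -
 have z: "F \<mu> = 0" if "\<mu> \<noteq> 0 \<or> k \<noteq> 0" for \<mu>
  using sectionsD(2)[OF assms, of \<mu>] that by (cases "F \<mu> = 0") (auto simp: monomials_Nil)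
 have "F \<mu> = emb V (F 0) \<mu>" for \<mu>
  using restr_id[OF sectionsD(1)[OF assms, of 0]] z[of \<mu>] by (cases "\<mu> = 0") (simp_all add: emb_eq)
 then show "F = emb V (F 0)" by blast
 show "k \<noteq> 0 ==> F = 0" using z by (auto simp: fun_eq_iff)
qed

lemma topspace_Euclidean_0: "topspace (Euclidean_space 0) = {\<lambda>_. 0}"
 by (auto simp: topspace_Euclidean_space fun_eq_iff)

context gdomain
begin

text \<open>A tangent vector with \<open>v U0 F \<noteq> 0\<close> yields a nonzero partial
  derivative of the body function at the point. The implicit function theorem solves for this
  coordinate, which \<open>\<rho>\<close> replaces by the solution; all others, including the
  generators, are kept.\<close>

lemma retract_degree_0:
 assumes F: "F \<in> sections m w U0 0" and \<pi>: "\<pi> \<in> mors one_point N" "pull \<pi> U0 F = 0"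
  and v: "v \<in> ders \<pi> 0" "v U0 F \<noteq> 0"
 shows "\<exists>W \<rho>. eopen m W \<and> bmap \<pi> (\<lambda>_. 0) \<in> W \<and> W \<subseteq> U0 \<and> retracts m w U0 W {i} (\<lambda>_. F) \<rho>"
proof -
 let ?P0 = "topspace (Euclidean_space 0)"
 let ?o = "\<lambda>_::nat. 0::real"
 have o: "?o \<in> ?P0" by (simp add: topspace_Euclidean_0)
 interpret d: domain_derivation 0 "[]" ?P0 m w U0 \<pi> 0 v
  using gdomain_point gdomain_axioms \<pi>(1) v(1)
  by (simp add: domain_derivation_defs one_point_def)
 define f where "f = F 0"
 have Fe: "F = emb U0 f" and f: "f \<in> Sm m U0" unfolding f_def by (rule sections_degree_0[OF pos F])+
 define p where "p = bmap \<pi> ?o"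
 have p: "p \<in> U0" unfolding p_def by (rule d.body_closed[OF o])
 have fs: "smooth m U0 f" using f by (simp add: Sm_def)
 have fp: "f p = 0"
 proof -
  have "emb ?P0 (\<lambda>t. f (bmap \<pi> t)) = 0" using \<pi>(2) d.locality[OF open_U0 order_refl f] unfolding Fe d.preim_UU by simp
  from fun_cong[OF fun_cong[OF this, of 0], of ?o] show ?thesis using o by (simp add: emb_apply p_def)
 qed
 have vs: "v U0 F \<in> sections 0 [] ?P0 0"
  using d.der_closed[OF open_UU, of F 0] F by (simp add: d.preim_UU)
 have "v U0 F 0 ?o \<noteq> 0"
 proof
  assume a: "v U0 F 0 ?o = 0"
  have "v U0 F 0 = (\<lambda>_. 0)"
  proof
   fix t show "v U0 F 0 t = 0" using a sectionsD(3)[OF vs, of t 0] by (cases "t \<in> ?P0") (auto simp: topspace_Euclidean_0)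
  qed
  then have "emb ?P0 (v U0 F 0) = 0" by (auto simp: emb_apply fun_eq_iff)
  then have "v U0 F = 0" using sections_point(1)[OF vs] by metis
  then show False using v(2) by simp
 qed
 then have "(\<Sum>i<m. pd i f p * v U0 (crd m U0 i) 0 ?o) \<noteq> 0"
  using d.der_function[OF open_U0 order_refl f, of ?o 0] o unfolding Fe d.preim_UU p_def by simp
 then obtain i' where i: "i' < m" "pd i' f p \<noteq> 0" by (metis (no_types, lifting) lessThan_iff mult_eq_0_iff sum.neutral)
 obtain W g where W: "eopen m W" "p \<in> W" "W \<subseteq> U0" "smooth m W g"
  "\<forall>x\<in>W. x(i' := g x) \<in> U0 \<and> f (x(i' := g x)) = 0 \<and> pd i' f (x(i' := g x)) \<noteq> 0"
  "\<forall>x\<in>W. f x = 0 --> g x = x i'" "\<forall>x\<in>W. pd i' g x = 0"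
  "\<forall>x\<in>W. \<forall>k<m. k \<noteq> i' --> pd k g x = - pd k f (x(i' := g x)) / pd i' f (x(i' := g x))"
  by (rule implicit_function[OF open_U0 fs p fp i])
 interpret W: gdomain m w W by (rule sub[OF W(1)])
 define g' where "g' = restr W g"
 have g': "g' \<in> Sm m W" unfolding g'_def by (rule restr_Sm[OF W(1,4)])
 define y where "y b = (if b = i' then emb W g' else crd m W b)" for b
 have ys: "y b \<in> sections m w W (cdeg m w b)" if "b < m + length w" for b
  using W.crd_sections[OF that] emb_sections[OF W(1), of g' w] g' i(1) by (auto simp: y_def cdeg_def Sm_def)
 have yb: "(\<lambda>i. if i < m then y i 0 x else 0) = x(i' := g x)" if "x \<in> W" for x
  using that openin_Euclidean_space_support[OF W(1) that] i(1)
  by (auto simp: y_def crd_def emb_apply restr_apply g'_def fun_eq_iff)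
 obtain \<rho> where \<rho>: "\<rho> \<in> mors W.N N" "\<forall>a<m + length w. pull \<rho> U0 (crd m U0 a) = y a" "\<forall>t\<in>W. bmap \<rho> t = (\<lambda>i. if i < m then y i 0 t else 0)"
  using domain_morphism_exists[OF W.gdomain_axioms gdomain_axioms ys] yb W(5) by auto
 interpret r: domain_morphism m w W m w U0 \<rho> using \<rho>(1) by unfold_locales
 have fW: "restr W f \<in> Sm m W" by (rule restr_Sm_subset[OF open_U0 W(1,3) f])
 have rF: "gres N U0 W F = emb W (restr W f)" unfolding Fe by (rule res_emb[OF W(3)])
 have pdW: "pd k (restr W f) x = pd k f x" if "x \<in> W" "k < m" for k x
  by (rule pd_cong[OF W(1) that]) (simp add: restr_def)
 have pdg: "pd k g' x = pd k g x" if "x \<in> W" "k < m" for k x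
  by (rule pd_cong[OF W(1) that]) (simp add: restr_def g'_def)
 have "retracts m w U0 W {i} (\<lambda>_. F) \<rho>"
 proof (rule retracts_singleI[OF W(1,3) F \<rho>(1)])
  show "pull \<rho> U0 (crd m U0 b) = y b" if "b < m + length w" for b using \<rho>(2) that by blast
  show "pull \<rho> U0 F = 0" unfolding Fe r.locality[OF open_U0 order_refl f] r.preim_UU
  proof (intro ext)
   fix \<mu> x
   have "f (bmap \<rho> x) = 0" if "x \<in> W" using \<rho>(3) yb[OF that] W(5) that by (simp del: fun_upd_apply)
   then show "emb W (\<lambda>t. f (bmap \<rho> t)) \<mu> x = 0 \<mu> x" by (simp add: emb_apply)
  qed
 next
  fix mT wT T0 a b assume T: "gdomain mT wT T0" and a: "a \<in> mors (gdom mT wT T0) W.N" and z: "pull a W (gres N U0 W F) = 0"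
  interpret a: domain_morphism mT wT T0 m w W a using T W.gdomain_axioms a by (simp add: domain_morphism_defs)
  have gq: "f (bmap a t) = 0" "g (bmap a t) = bmap a t i'" if t: "t \<in> T0" for t
  proof -
   have "emb T0 (\<lambda>t. restr W f (bmap a t)) = 0" using z unfolding rF a.locality[OF W(1) order_refl fW] a.preim_UU .
   from fun_cong[OF fun_cong[OF this, of 0], of t] show "f (bmap a t) = 0"
    using t a.body_closed[OF t] by (simp add: emb_apply restr_apply)
   then show "g (bmap a t) = bmap a t i'" using W(6) a.body_closed[OF t] by blast
  qed
  { assume b: "b < m + length w"
   show "pull a W (y b) = pull a W (crd m W b)"
   proof (cases "b = i'")
    case True
    have x: "restr W (\<lambda>x. x i') \<in> Sm m W" by (rule restr_Sm[OF W(1) smooth_coordinate[OF W(1)]])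
    show ?thesis
     using True i(1) a.locality[OF W(1) order_refl g'] a.locality[OF W(1) order_refl x] gq(2) a.body_closed
     by (auto simp: y_def crd_def a.preim_UU emb_apply restr_apply g'_def fun_eq_iff)
   qed (simp add: y_def) }
  fix D k assume D: "D \<in> ders a k" and dz: "D W (gres N U0 W F) = 0"
  assume b: "b < m + length w"
  interpret D: domain_derivation mT wT T0 m w W a k D by unfold_locales (rule D)
  show "D W (y b) = D W (crd m W b)"
  proof (cases "b = i'")
   case True
   show ?thesis
   proof (intro ext)
    fix \<mu> t
    show "D W (y b) \<mu> t = D W (crd m W b) \<mu> t"
    proof (cases "t \<in> T0")
     case False
     have "y b \<in> gsec W.N W (cdeg m w b)" "crd m W b \<in> gsec W.N W (cdeg m w b)"
      using ys[OF b] W.crd_sections[OF b] by simp_all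
     from this[THEN D.der_closed[OF W.open_UU]] have "D W (y b) \<in> sections mT wT T0 (cdeg m w b + k)" "D W (crd m W b) \<in> sections mT wT T0 (cdeg m w b + k)"
      by (simp_all add: a.preim_UU)
     then show ?thesis using sectionsD(3) False by metis
    next
     case t: True
     let ?q = "bmap a t"
     let ?d = "\<lambda>k. D W (crd m W k) \<mu> t"
     have q: "?q \<in> W" by (rule a.body_closed[OF t])
     have upd: "?q(i' := g ?q) = ?q" using gq(2)[OF t] by auto
     have tp: "t \<in> preim a W" using t by (simp add: a.preim_UU)
     \<comment> \<open>The linearized equation expresses \<open>?d i'\<close> through the other
       \<open>?d k\<close>, with exactly the coefficients that the implicit function theorem gives
       for the partial derivatives of \<open>g\<close>.\<close>
     have "(\<Sum>k<m. pd k f ?q * ?d k) = 0"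
      using D.der_function[OF W(1) order_refl fW tp, of \<mu>] dz pdW[OF q] unfolding rF by simp
     then have s: "pd i' f ?q * ?d i' + (\<Sum>k\<in>{..<m} - {i'}. pd k f ?q * ?d k) = 0"
      using i(1) by (simp add: sum.remove[of "{..<m}" i'])
     have nz: "pd i' f ?q \<noteq> 0" using W(5) q upd by metis
     have "D W (y b) \<mu> t = (\<Sum>k<m. pd k g ?q * ?d k)"
      using D.der_function[OF W(1) order_refl g' tp, of \<mu>] pdg[OF q] True by (simp add: y_def)
     also have "\<dots> = (\<Sum>k\<in>{..<m} - {i'}. pd k g ?q * ?d k)"
      using i(1) W(7) q by (simp add: sum.remove[of "{..<m}" i'])
     also have "\<dots> = (\<Sum>k\<in>{..<m} - {i'}. - (pd k f ?q * ?d k) / pd i' f ?q)"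
      using W(8) q upd by (intro sum.cong) auto
     also have "\<dots> = - (\<Sum>k\<in>{..<m} - {i'}. pd k f ?q * ?d k) / pd i' f ?q"
      by (simp add: sum_negf sum_divide_distrib)
     also have "\<dots> = ?d i'" using s nz by (simp add: field_simps)
     finally show ?thesis using True by simp
    qed
   qed
  qed (simp add: y_def)
 qed
 then show ?thesis using W(1-3) unfolding p_def by blast
qed

lemma below_unit: "{..unit_exp j} = {0, unit_exp j}"
proof (intro equalityI subsetI)
 fix \<mu> assume "\<mu> \<in> {..unit_exp j}"
 then have *: "\<mu> i \<le> (if i = j then 1 else 0)" for i by (auto simp: le_fun_def unit_exp_def)
 show "\<mu> \<in> {0, unit_exp j}"
 proof (cases "\<mu> j = 0")
  case True
  have "\<mu> i = 0" for i using *[of i] True by (cases "i = j") auto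
  then show ?thesis by (auto simp: fun_eq_iff)
 next
  case False
  have "\<mu> i = unit_exp j i" for i using *[of i] False by (cases "i = j") (auto simp: unit_exp_def)
  then show ?thesis by (auto simp: fun_eq_iff)
 qed
qed (auto simp: le_fun_def)

text \<open>A unit exponent splits only into \<open>0\<close> and itself. So the coefficient of a
  single generator satisfies a Leibniz rule over the body.\<close>

lemma gmul_unit:
 assumes "j < length w"
 shows "gmul w F G (unit_exp j) x = F 0 x * G (unit_exp j) x + F (unit_exp j) x * G 0 x"
proof -
 have n: "0 \<noteq> unit_exp j" by (auto simp: unit_exp_def fun_eq_iff intro!: exI[of _ j])
 have "unit_exp j - 0 = unit_exp j" "unit_exp j - unit_exp j = 0" by (auto simp: fun_eq_iff)
 then show ?thesis using unit_exp_monomial(1)[OF assms] n by (simp add: gmul_def below_unit koszul_kex)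
qed

text \<open>At a point all sections of nonzero degree pull back to \<open>0\<close>, so a tangent
  vector annihilates products of two of them and sees only the coefficients of single generators.
  The condition \<open>d = e\<close> stands inside the conclusion because the induction also passes
  through factors of other degrees.\<close>

lemma point_derivation:
 assumes \<pi>: "\<pi> \<in> mors one_point N" and v: "v \<in> ders \<pi> (- e)" and e: "e \<noteq> 0" and F: "F \<in> sections m w U0 d"
 shows "d = e --> v U0 F = (\<Sum>j | j < length w \<and> int (w ! j) = e. F (unit_exp j) (bmap \<pi> (\<lambda>_. 0)) *\<^sub>R v U0 (gen U0 j))"
proof -
 let ?P0 = "topspace (Euclidean_space 0)"
 interpret d: domain_derivation 0 "[]" ?P0 m w U0 \<pi> "- e" v
  using gdomain_point gdomain_axioms \<pi> v
  by (simp add: domain_derivation_defs one_point_def)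
 define p where "p = bmap \<pi> (\<lambda>_. 0)"
 have p: "p \<in> U0" unfolding p_def by (rule d.body_closed) (simp add: topspace_Euclidean_0)
 let ?J = "{j. j < length w \<and> int (w ! j) = e}"
 let ?S = "\<lambda>F. \<Sum>j\<in>?J. F (unit_exp j) p *\<^sub>R v U0 (gen U0 j)"
 have fin: "finite ?J" by simp
 have pullF: "pull \<pi> U0 F = emb ?P0 (\<lambda>_. F 0 p)" if F: "F \<in> sections m w U0 a" for F a
 proof (cases "a = 0")
  case True
  note F0 = sections_degree_0[OF pos F[unfolded True]]
  show ?thesis
   by (subst F0(1), subst d.locality[OF open_U0 order_refl F0(2)])
     (intro ext, simp add: d.preim_UU emb_apply topspace_Euclidean_0 p_def)
 next
  case False
  have "pull \<pi> U0 F \<in> sections 0 [] ?P0 a" using d.closed[OF open_UU, of F a] F by (simp add: d.preim_UU)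
  then show ?thesis using sections_point(2) sections_positive_degree[OF pos F] False by (auto simp: emb_apply fun_eq_iff)
 qed
 have "d = e --> v U0 F = ?S F"
 proof (rule section_induct[OF pos open_U0 F, where J = UNIV and P = "\<lambda>d F. d = e --> v U0 F = ?S F"])
  fix j assume j: "j < length w"
  show "int (w ! j) = e --> v U0 (gen U0 j) = ?S (gen U0 j)"
  proof
   assume we: "int (w ! j) = e"
   have "unit_exp i = unit_exp j \<longleftrightarrow> i = j" for i by (metis unit_exp_def zero_neq_one)
   then have "?S (gen U0 j) = (\<Sum>i\<in>?J. if i = j then v U0 (gen U0 j) else 0)"
    using p by (intro sum.cong) (auto simp: mono_def)
   then show "v U0 (gen U0 j) = ?S (gen U0 j)" using j we by (simp add: fin)
  qed
 next
  fix F G a b assume F: "F \<in> sections m w U0 a" and G: "G \<in> sections m w U0 b" and IH: "a = e --> v U0 F = ?S F" "b = e --> v U0 G = ?S G"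
  show "a + b = e --> v U0 (gmul w F G) = ?S (gmul w F G)"
  proof
   assume ab: "a + b = e"
   have vF: "v U0 F \<in> sections 0 [] ?P0 (a + - e)" and vG: "v U0 G \<in> sections 0 [] ?P0 (b + - e)"
    using d.der_closed[OF open_UU, of F a] d.der_closed[OF open_UU, of G b] F G by (simp_all add: d.preim_UU)
   have "v U0 (gmul w F G) = gmul [] (v U0 F) (pull \<pi> U0 G) + ((-1) powi (- e * a)) *\<^sub>R gmul [] (pull \<pi> U0 F) (v U0 G)"
    using d.leibniz[OF open_UU, of F a G] F G by (simp add: homogeneousI[of G _ _ b])
   also have "gmul [] (v U0 F) (pull \<pi> U0 G) = G 0 p *\<^sub>R v U0 F"
    unfolding pullF[OF G] by (intro ext) (simp add: gmul_emb_right[OF vF] scaleR_fun_def mult.commute)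
   also have "gmul [] (pull \<pi> U0 F) (v U0 G) = F 0 p *\<^sub>R v U0 G"
    unfolding pullF[OF F] by (intro ext) (simp add: gmul_emb_left[OF vG] scaleR_fun_def)
   also have "((-1) powi (- e * a)) *\<^sub>R F 0 p *\<^sub>R v U0 G = F 0 p *\<^sub>R v U0 G"
    using sections_positive_degree[OF pos F] by (cases "a = 0") auto
   also have "F 0 p *\<^sub>R v U0 G = F 0 p *\<^sub>R ?S G"
    using sections_positive_degree[OF pos F] IH(2) ab by (cases "a = 0") auto
   also have "G 0 p *\<^sub>R v U0 F = G 0 p *\<^sub>R ?S F"
    using sections_positive_degree[OF pos G] IH(1) ab by (cases "b = 0") auto
   also have "G 0 p *\<^sub>R ?S F + F 0 p *\<^sub>R ?S G = ?S (gmul w F G)"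
    unfolding scaleR_sum_right sum.distrib[symmetric]
    by (rule sum.cong) (auto simp: gmul_unit scaleR_add_left mult.commute)
   finally show "v U0 (gmul w F G) = ?S (gmul w F G)" .
  qed
 next
  fix F G a assume F: "F \<in> sections m w U0 a" and G: "G \<in> sections m w U0 a" and IH: "a = e --> v U0 F = ?S F" "a = e --> v U0 G = ?S G"
  show "a = e --> v U0 (F + G) = ?S (F + G)"
   using IH d.der_add[OF open_UU, of F a G] F G by (simp add: scaleR_add_left sum.distrib)
 qed (use e in auto)
 then show ?thesis by (simp add: p_def)
qed

text \<open>By \<open>point_derivation\<close> some generator of degree \<open>e\<close> has a
  coefficient \<open>c\<close> in \<open>F\<close> that is nonzero at the point. For reasons of
  degree \<open>F\<close> is \<open>c\<close> times this generator plus a part \<open>F'\<close>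
  free of it, so subtracting \<open>F / c\<close> from the generator solves the equation
  exactly.\<close>

lemma retract_positive_degree:
 assumes e: "e \<noteq> 0" and F: "F \<in> sections m w U0 e" and \<pi>: "\<pi> \<in> mors one_point N"
  and v: "v \<in> ders \<pi> (- e)" "v U0 F \<noteq> 0"
 shows "\<exists>W \<rho>. eopen m W \<and> bmap \<pi> (\<lambda>_. 0) \<in> W \<and> W \<subseteq> U0 \<and> retracts m w U0 W {i} (\<lambda>_. F) \<rho>"
proof -
 interpret pi: domain_morphism 0 "[]" "topspace (Euclidean_space 0)" m w U0 \<pi>
  using gdomain_point gdomain_axioms \<pi> by (simp add: domain_morphism_defs one_point_def)
 define p where "p = bmap \<pi> (\<lambda>_. 0)"
 have p: "p \<in> U0" unfolding p_def by (rule pi.body_closed) (simp add: topspace_Euclidean_0)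
 have "(\<Sum>j | j < length w \<and> int (w ! j) = e. F (unit_exp j) p *\<^sub>R v U0 (gen U0 j)) \<noteq> 0"
  using point_derivation[OF \<pi> v(1) e F] v(2) by (simp add: p_def)
 then obtain j where j: "j < length w" "int (w ! j) = e" "F (unit_exp j) p \<noteq> 0"
  by (metis (mono_tags, lifting) mem_Collect_eq scaleR_zero_left sum.neutral)
 define c where "c = F (unit_exp j)"
 have c: "c \<in> Sm m U0" unfolding c_def by (rule sectionsD(1)[OF F])
 have cs: "smooth m U0 c" using c by (simp add: Sm_def)
 define W where "W = U0 \<inter> c -` (- {0})"
 have "openin (top_of_set U0) W" unfolding W_def
  by (rule continuous_openin_preimage_gen[OF smooth_continuous_on[OF open_U0 cs]]) (simp add: open_Compl)
 then have W: "eopen m W" using open_U0 unfolding Euclidean_space_top_of_set by (rule openin_trans)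
 have WU: "W \<subseteq> U0" by (auto simp: W_def)
 have cW: "c x \<noteq> 0" if "x \<in> W" for x using that by (simp add: W_def)
 have pW: "p \<in> W" using p j(3) by (simp add: W_def c_def)
 interpret W: gdomain m w W by (rule sub[OF W])
 have oW: "gopen N W" unfolding openin_iff using W WU by blast
 have ics: "smooth m W (\<lambda>x. inverse (c x))" by (rule smooth_inverse[OF W smooth_subset[OF open_U0 W WU cs] cW])
 let ?i = "emb W (\<lambda>x. inverse (c x))"
 have ie: "?i \<in> sections m w W 0" by (rule emb_sections[OF W ics])
 have rF: "gres N U0 W F \<in> sections m w W e" using res_closed[OF open_UU oW WU] F by simp
 have iF: "gmul w ?i (gres N U0 W F) \<in> sections m w W e" using gmul_closed[OF W ie rF] by simp
 have gW: "gen W j \<in> sections m w W e" using gen_sections[OF W j(1)] j(2) by simp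
 note SW = subspace_sections[OF W, of w e]
 \<comment> \<open>The generator \<open>j\<close> is replaced by itself minus \<open>F / c\<close>;
   the other coordinates stay as they are.\<close>
 define y where "y b = (if b = m + j then gen W j - gmul w ?i (gres N U0 W F) else crd m W b)" for b
 have crdj: "crd m W (m + j) = gen W j" by (simp add: crd_def)
 have ys: "y b \<in> sections m w W (cdeg m w b)" if "b < m + length w" for b
  using W.crd_sections[OF that] subspace_diff[OF SW gW iF] j by (auto simp: y_def cdeg_def)
 have yb: "(\<lambda>i. if i < m then y i 0 x else 0) = x" if "x \<in> W" for x
  using that openin_Euclidean_space_support[OF W that] by (auto simp: y_def crd_def emb_apply restr_apply fun_eq_iff)
 obtain \<rho> where \<rho>: "\<rho> \<in> mors W.N N" "\<forall>a<m + length w. pull \<rho> U0 (crd m U0 a) = y a" "\<forall>t\<in>W. bmap \<rho> t = (\<lambda>i. if i < m then y i 0 t else 0)"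
  using domain_morphism_exists[OF W.gdomain_axioms gdomain_axioms ys] yb WU by auto
 interpret r: domain_morphism m w W m w U0 \<rho> using \<rho>(1) by unfold_locales
 have rbody: "bmap \<rho> x = x" if "x \<in> W" for x using \<rho>(3) yb that by simp
 define F' where "F' \<mu> = (if \<mu> = unit_exp j then 0 else F \<mu>)" for \<mu>
 have F's: "F' \<in> sections m w U0 e"
  using F subspace_0[OF subspace_Sm[OF open_U0]] by (auto simp: sections_def F'_def)
 \<comment> \<open>An exponent of degree \<open>e\<close> that contains the generator
   \<open>j\<close>, itself of degree \<open>e\<close>, leaves degree \<open>0\<close> for the rest
   and hence is the unit exponent, whose coefficient was removed.\<close>
 have F'J: "i \<in> - {j}" if "F' \<mu> \<noteq> 0" "\<mu> i \<noteq> 0" for \<mu> i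
 proof
  assume "i \<in> {j}"
  have a: "\<mu> \<noteq> unit_exp j" "F \<mu> \<noteq> 0" using that(1) by (auto simp: F'_def split: if_splits)
  then have am: "\<mu> \<in> monomials w" "mdegree w \<mu> = e" using sectionsD(2)[OF F] by auto
  have le: "unit_exp j \<le> \<mu>" using that(2) \<open>i \<in> {j}\<close> by (auto simp: le_fun_def unit_exp_def)
  then have "mdegree w (\<mu> - unit_exp j) = 0" using mdegree_diff[OF le, of w] am(2) unit_exp_monomial(2)[OF j(1)] j(2) by simp
  then have "\<mu> - unit_exp j = 0" using mdegree_pos(2)[OF pos monomials_diff[OF am(1)]] by blast
  then show False using le_diff_add[OF le] a(1) by simp
 qed
 \<comment> \<open>\<open>\<rho>\<close> changes only the generator \<open>j\<close>, so sections
   free of it are merely restricted; this is where \<open>section_induct\<close> is applied with a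
   proper set of generators.\<close>
 have rF': "pull \<rho> U0 F' = gres N U0 W F'"
 proof (rule section_induct[OF pos open_U0 F's F'J, where P = "\<lambda>k G. pull \<rho> U0 G = gres N U0 W G"])
  fix f assume f: "f \<in> Sm m U0"
  show "pull \<rho> U0 (emb U0 f) = gres N U0 W (emb U0 f)"
   unfolding r.locality[OF open_U0 order_refl f] r.preim_UU res_emb[OF WU] by (intro ext) (simp add: emb_apply restr_apply rbody)
 next
  fix i assume i: "i < length w" "i \<in> - {j}"
  have "pull \<rho> U0 (gen U0 i) = y (m + i)" using \<rho>(2)[rule_format, of "m + i"] i(1) by (simp add: crd_def)
  also have "\<dots> = gen W i" using i(2) by (simp add: y_def crd_def)
  finally show "pull \<rho> U0 (gen U0 i) = gres N U0 W (gen U0 i)" unfolding res_gen[OF WU] .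
 next
  fix G H a b assume G: "G \<in> sections m w U0 a" and H: "H \<in> sections m w U0 b"
   and IH: "pull \<rho> U0 G = gres N U0 W G" "pull \<rho> U0 H = gres N U0 W H"
  have "pull \<rho> U0 (gmul w G H) = gmul w (pull \<rho> U0 G) (pull \<rho> U0 H)"
   using r.mult[OF open_UU, of G H] G H by (simp add: homogeneousI[of G _ _ a] homogeneousI[of H _ _ b])
  moreover have "gres N U0 W (gmul w G H) = gmul w (gres N U0 W G) (gres N U0 W H)"
   using res_mult[OF open_UU oW WU, of G H] G H by (simp add: homogeneousI[of G _ _ a] homogeneousI[of H _ _ b] del: domain_simps(5))
  ultimately show "pull \<rho> U0 (gmul w G H) = gres N U0 W (gmul w G H)" using IH by simp
 next
  fix G H a assume G: "G \<in> sections m w U0 a" and H: "H \<in> sections m w U0 a"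
   and IH: "pull \<rho> U0 G = gres N U0 W G" "pull \<rho> U0 H = gres N U0 W H"
  have "gres N U0 W (G + H) = gres N U0 W G + gres N U0 W H" by (auto simp: restr_def fun_eq_iff)
  then show "pull \<rho> U0 (G + H) = gres N U0 W (G + H)"
   using r.add[OF open_UU, of G a H] G H IH by simp
 next
  have "gres N U0 W 0 = 0" by (auto simp: restr_def fun_eq_iff)
  then show "pull \<rho> U0 0 = gres N U0 W 0" by simp
 qed
 have gU: "gen U0 j \<in> sections m w U0 e" using gen_sections[OF open_U0 j(1)] j(2) by simp
 have ce: "emb U0 c \<in> sections m w U0 0" by (rule emb_sections[OF open_U0 cs])
 have cg: "gmul w (emb U0 c) (gen U0 j) \<in> sections m w U0 e" using gmul_closed[OF open_U0 ce gU] by simp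
 have dec: "F = gmul w (emb U0 c) (gen U0 j) + F'"
 proof (intro ext)
  fix \<mu> x show "F \<mu> x = (gmul w (emb U0 c) (gen U0 j) + F') \<mu> x"
   unfolding plus_fun_apply gmul_emb_left[OF gU] using sectionsD(3)[OF F, of x \<mu>]
   by (cases "\<mu> = unit_exp j") (auto simp: F'_def mono_def c_def)
 qed
 have \<rho>F: "pull \<rho> U0 F = 0"
 proof (intro ext)
  fix \<mu> x
  have ys': "gen W j - gmul w ?i (gres N U0 W F) \<in> sections m w W e" by (rule subspace_diff[OF SW gW iF])
  have "pull \<rho> U0 F = gmul w (pull \<rho> U0 (emb U0 c)) (pull \<rho> U0 (gen U0 j)) + pull \<rho> U0 F'"
   using r.add[OF open_UU, of "gmul w (emb U0 c) (gen U0 j)" e F'] cg F's r.mult[OF open_UU, of "emb U0 c" "gen U0 j"] ce gU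
   by (subst dec) (simp add: homogeneousI[of "emb U0 c" _ _ 0] homogeneousI[of "gen U0 j" _ _ e])
  also have "pull \<rho> U0 (emb U0 c) = emb W c"
   unfolding r.locality[OF open_U0 order_refl c] r.preim_UU by (intro ext) (simp add: emb_apply rbody)
  also have "pull \<rho> U0 (gen U0 j) = gen W j - gmul w ?i (gres N U0 W F)"
   using \<rho>(2)[rule_format, of "m + j"] j(1) by (simp add: crd_def y_def)
  finally have E: "pull \<rho> U0 F = gmul w (emb W c) (gen W j - gmul w ?i (gres N U0 W F)) + gres N U0 W F'" unfolding rF' .
  have "pull \<rho> U0 F \<mu> x = c x * (gen W j \<mu> x - inverse (c x) * gres N U0 W F \<mu> x) + gres N U0 W F' \<mu> x"
   unfolding E plus_fun_apply gmul_emb_left[OF ys'] minus_apply gmul_emb_left[OF rF] ..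
  then show "pull \<rho> U0 F \<mu> x = 0 \<mu> x"
   using cW[of x] by (cases "x \<in> W"; cases "\<mu> = unit_exp j") (simp_all add: restr_def mono_def F'_def c_def field_simps)
 qed
 have "retracts m w U0 W {i} (\<lambda>_. F) \<rho>"
 proof (rule retracts_singleI[OF W WU F \<rho>(1) _ \<rho>F])
  show "pull \<rho> U0 (crd m U0 b) = y b" if "b < m + length w" for b using \<rho>(2) that by blast
 next
  fix mT wT T0 a b assume T: "gdomain mT wT T0" and a: "a \<in> mors (gdom mT wT T0) W.N" and z: "pull a W (gres N U0 W F) = 0"
  interpret a: domain_morphism mT wT T0 m w W a using T W.gdomain_axioms a by (simp add: domain_morphism_defs)
  interpret A: gc_algebra "sections mT wT T0" "gmul wT" "emb T0 1" by (simp add: gc_algebra_def gca_domain[OF a.T.open_U0])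
  have la: "linear_map_on (sections m w W e) (pull a W)" using a.linear[OF W.open_UU, of e] by simp
  have pi: "pull a W ?i \<in> sections mT wT T0 0" using a.closed[OF W.open_UU, of ?i 0] ie by (simp add: a.preim_UU)
  have pm: "pull a W (gmul w ?i (gres N U0 W F)) = 0"
   using a.mult[OF W.open_UU, of ?i "gres N U0 W F"] ie rF z A.mult_0(1)[OF pi]
   by (simp add: homogeneousI[of ?i _ _ 0] homogeneousI[of "gres N U0 W F" _ _ e] a.preim_UU del: domain_simps(5))
  { assume b: "b < m + length w"
   show "pull a W (y b) = pull a W (crd m W b)"
    using linear_map_on_diff[OF la SW gW iF] pm by (simp add: y_def crdj del: domain_simps(5)) }
  fix D k assume D: "D \<in> ders a k" and dz: "D W (gres N U0 W F) = 0" and b: "b < m + length w"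
  interpret D: domain_derivation mT wT T0 m w W a k D by unfold_locales (rule D)
  have Di: "D W ?i \<in> sections mT wT T0 (0 + k)" using D.der_closed[OF W.open_UU, of ?i 0] ie by (simp add: a.preim_UU)
  have Dm: "D W (gmul w ?i (gres N U0 W F)) = 0"
   using D.leibniz[OF W.open_UU, of ?i 0 "gres N U0 W F"] ie rF z dz A.mult_0(1)[OF pi] A.mult_0(1)[OF Di]
   by (simp add: homogeneousI[of "gres N U0 W F" _ _ e] a.preim_UU del: domain_simps(5))
  have lD: "linear_map_on (sections m w W e) (D W)" using D.der_linear[OF W.open_UU, of e] by simp
  show "D W (y b) = D W (crd m W b)"
   using linear_map_on_diff[OF lD SW gW iF] Dm by (simp add: y_def crdj del: domain_simps(5))
 qed
 then show ?thesis using W pW WU unfolding p_def by blast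
qed

end

text \<open>Equations are solved one at a time.  The vectors \<open>v i\<close>, dual to the differentials of the remaining equations,
 are tangent to the zero set of the first one, hence fixed by the retraction onto it.\<close>

theorem retraction_exists:
 assumes "finite I" and "gdomain m w U0"
  and "\<And>i. i \<in> I ==> F i \<in> sections m w U0 (e i)"
  and "\<pi> \<in> mors one_point (gdom m w U0)" "\<And>i. i \<in> I ==> pull \<pi> U0 (F i) = 0"
  and "\<And>i. i \<in> I ==> v i \<in> ders \<pi> (- e i)" "\<And>i. i \<in> I ==> v i U0 (F i) \<noteq> 0"
  and "\<And>i j. i \<in> I ==> j \<in> I ==> i \<noteq> j ==> v i U0 (F j) = 0"
 shows "\<exists>W \<rho>. eopen m W \<and> bmap \<pi> (\<lambda>_. 0) \<in> W \<and> W \<subseteq> U0 \<and> retracts m w U0 W I F \<rho>"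
 using assms
proof (induction I arbitrary: U0 F \<pi> v rule: finite_induct)
 case empty
 interpret gdomain m w U0 by (rule empty.prems(1))
 interpret pi: domain_morphism 0 "[]" "topspace (Euclidean_space 0)" m w U0 \<pi>
  using gdomain_point gdomain_axioms empty.prems(3) by (simp add: domain_morphism_defs one_point_def)
 have "bmap \<pi> (\<lambda>_. 0) \<in> U0" by (rule pi.body_closed) (simp add: topspace_Euclidean_0)
 moreover have "retracts m w U0 U0 {} F (incl N U0)"
  unfolding retracts_def using incl_domain(1)[OF open_U0 order_refl] by simp
 ultimately show ?case using open_U0 by blast
next
 case (insert i0 I)
 interpret gdomain m w U0 by (rule insert.prems(1))
 have "\<exists>W \<rho>. eopen m W \<and> bmap \<pi> (\<lambda>_. 0) \<in> W \<and> W \<subseteq> U0 \<and> retracts m w U0 W {i0} (\<lambda>_. F i0) \<rho>"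
 proof (cases "e i0 = 0")
  case True
  have 1: "F i0 \<in> sections m w U0 0" using insert.prems(2)[of i0] True by simp
  have 2: "pull \<pi> U0 (F i0) = 0" using insert.prems(4) by blast
  have 3: "v i0 \<in> ders \<pi> 0" using insert.prems(5)[of i0] True by simp
  have 4: "v i0 U0 (F i0) \<noteq> 0" using insert.prems(6) by blast
  show ?thesis by (rule retract_degree_0[where F = "F i0" and v = "v i0" and i = i0, OF 1 insert.prems(3) 2 3 4])
 next
  case False
  have 1: "F i0 \<in> sections m w U0 (e i0)" using insert.prems(2) by blast
  have 2: "v i0 \<in> ders \<pi> (- e i0)" using insert.prems(5) by blast
  have 3: "v i0 U0 (F i0) \<noteq> 0" using insert.prems(6) by blast
  show ?thesis by (rule retract_positive_degree[where F = "F i0" and v = "v i0" and i = i0, OF False 1 insert.prems(3) 2 3])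
 qed
 then obtain W1 \<rho>1 where W1: "eopen m W1" "bmap \<pi> (\<lambda>_. 0) \<in> W1" "W1 \<subseteq> U0"
  and r1: "retracts m w U0 W1 {i0} (\<lambda>_. F i0) \<rho>1" by blast
 interpret W1: gdomain m w W1 by (rule sub[OF W1(1)])
 note inc = incl_domain[OF W1(1,3)]
 interpret inc: open_embedding W1.N N "incl N W1" by (rule inc(2))
 note \<rho>1 = retractsD(1)[OF r1]
 interpret r1: domain_morphism m w W1 m w U0 \<rho>1 using \<rho>1 by unfold_locales
 have pt: "points one_point = {\<lambda>_. 0}"
  by (simp only: one_point_def gdomain.points_eq[OF gdomain_point]) (rule topspace_Euclidean_0)
 have ptsheaf: "graded_sheaf one_point" unfolding one_point_def by (rule gdomain.sheaf[OF gdomain_point])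
 have "bmap \<pi> ` points one_point \<subseteq> bmap (incl N W1) ` points W1.N"
  unfolding pt W1.points_eq using W1(2) inc(4) by (auto simp: image_iff)
 from inc.lift[OF insert.prems(3) this ptsheaf]
 obtain \<pi>1 where \<pi>1: "\<pi>1 \<in> mors one_point W1.N" "incl N W1 \<odot> \<pi>1 = \<pi>" by blast
 have "\<exists>u. u \<in> ders \<pi>1 (- e i) \<and> tangent (incl N W1) u = v i" if "i \<in> I" for i
  using inc.derivation_lift[OF \<pi>1(1) _ ptsheaf, of "v i" "- e i"] insert.prems(5)[of i] that \<pi>1(2) by auto
 then obtain u where u: "\<And>i. i \<in> I ==> u i \<in> ders \<pi>1 (- e i)" "\<And>i. i \<in> I ==> tangent (incl N W1) (u i) = v i"
  by metis
 have z0: "pull (incl N W1 \<odot> \<pi>1) U0 (F i0) = 0" unfolding \<pi>1(2) using insert.prems(4) by blast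
 have \<rho>\<pi>: "\<rho>1 \<odot> \<pi>1 = \<pi>"
  using retractsD(3)[OF r1 gdomain_point \<pi>1(1)[unfolded one_point_def]] z0 \<pi>1(2) by simp
 have \<rho>u: "tangent \<rho>1 (u i) = v i" if i: "i \<in> I" for i
 proof -
  have "v i U0 (F i0) = 0" using insert.prems(7) i insert.hyps(2) by blast
  then show ?thesis
   using retractsD(4)[OF r1 gdomain_point \<pi>1(1)[unfolded one_point_def] _ u(1)[OF i]] z0 u(2)[OF i] by simp
 qed
 \<comment> \<open>The other equations are pulled back along the first retraction. By
   \<open>\<rho>u\<close> the lifted vectors \<open>u i\<close> remain dual to them, as the
   induction hypothesis demands.\<close>
 define F' where "F' k = pull \<rho>1 U0 (F k)" for k
 have pre1: "preim \<rho>1 U0 = W1" by (rule r1.preim_UU)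
 have vF: "u i W1 (F' k) = v i U0 (F k)" if "i \<in> I" for i k
  using fun_cong[OF fun_cong[OF \<rho>u[OF that], of U0], of "F k"] by (simp add: tangent_def pre1 F'_def)
 have "\<exists>W \<rho>. eopen m W \<and> bmap \<pi>1 (\<lambda>_. 0) \<in> W \<and> W \<subseteq> W1 \<and> retracts m w W1 W I F' \<rho>"
 proof (rule insert.IH[where v = u, OF W1.gdomain_axioms _ \<pi>1(1) _ u(1)])
  show "F' i \<in> sections m w W1 (e i)" if "i \<in> I" for i
   using r1.closed[OF open_UU, of "F i" "e i"] insert.prems(2)[of i] that by (simp add: F'_def pre1)
  show "pull \<pi>1 W1 (F' i) = 0" if "i \<in> I" for i
  proof -
   have "pull \<pi>1 W1 (F' i) = pull (\<rho>1 \<odot> \<pi>1) U0 (F i)" by (simp add: F'_def pre1)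
   also have "\<dots> = 0" unfolding \<rho>\<pi> using insert.prems(4) that by blast
   finally show ?thesis .
  qed
  show "u i W1 (F' i) \<noteq> 0" if "i \<in> I" for i unfolding vF[OF that] using insert.prems(6) that by blast
  show "u i W1 (F' j) = 0" if "i \<in> I" "j \<in> I" "i \<noteq> j" for i j unfolding vF[OF that(1)] using insert.prems(7) that by blast
 qed auto
 then obtain W2 \<rho>2 where W2: "eopen m W2" "bmap \<pi>1 (\<lambda>_. 0) \<in> W2" "W2 \<subseteq> W1"
  and r2: "retracts m w W1 W2 I F' \<rho>2" by blast
 interpret W2: gdomain m w W2 by (rule sub[OF W2(1)])
 note inc2 = W1.incl_domain[OF W2(1,3)]
 note \<rho>2 = retractsD(1)[OF r2]
 interpret r2: domain_morphism m w W2 m w W1 \<rho>2 using \<rho>2 by unfold_locales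
 have ii: "incl N W1 \<odot> incl W1.N W2 = incl N W2" by (rule incl_incl[OF W1(1,3) W2(1,3)])
 have "retracts m w U0 W2 (insert i0 I) F (\<rho>1 \<odot> \<rho>2)"
  unfolding retracts_def
 proof (intro conjI allI impI ballI)
  show "\<rho>1 \<odot> \<rho>2 \<in> mors W2.N N" by (rule comp_mors[OF \<rho>2 \<rho>1])
  show "pull (\<rho>1 \<odot> \<rho>2) U0 (F i) = 0" if "i \<in> insert i0 I" for i
   using that retractsD(2)[OF r1, of i0] retractsD(2)[OF r2, of i] by (auto simp: pre1 F'_def)
  fix mT wT T0 a
  assume T: "gdomain mT wT T0" and a: "a \<in> mors (gdom mT wT T0) W2.N"
   and z: "\<forall>i\<in>insert i0 I. pull (incl N W2 \<odot> a) U0 (F i) = 0"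
  define a1 where "a1 = incl W1.N W2 \<odot> a"
  have a1: "a1 \<in> mors (gdom mT wT T0) W1.N" unfolding a1_def by (rule comp_mors[OF a inc2(1)])
  have ia: "incl N W1 \<odot> a1 = incl N W2 \<odot> a" unfolding a1_def ii[symmetric] by (rule comp_assoc[OF a inc2(1) inc(1), symmetric])
  have za: "pull (incl N W1 \<odot> a1) U0 (F i0) = 0" unfolding ia using z by simp
  have \<rho>a1: "\<rho>1 \<odot> a1 = incl N W1 \<odot> a1" by (rule retractsD(3)[OF r1 T a1 za])
  have za2: "pull (incl W1.N W2 \<odot> a) W1 (F' i) = 0" if "i \<in> I" for i
   using arg_cong[OF \<rho>a1, of "\<lambda>h. pull h U0 (F i)"] z that unfolding ia a1_def[symmetric] by (simp add: pre1 F'_def)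
  have \<rho>a2: "\<rho>2 \<odot> a = a1" unfolding a1_def by (rule retractsD(3)[OF r2 T a za2])
  show "(\<rho>1 \<odot> \<rho>2) \<odot> a = incl N W2 \<odot> a" unfolding comp_assoc[OF a \<rho>2 \<rho>1] \<rho>a2 \<rho>a1 ia ..
  fix k D assume D: "D \<in> ders a k" and dz: "\<forall>i\<in>insert i0 I. tangent (incl N W2) D U0 (F i) = 0"
  define D1 where "D1 = tangent (incl W1.N W2) D"
  have D1: "D1 \<in> ders a1 k" unfolding D1_def a1_def by (rule tangent_derivation[OF a inc2(1) D])
  have iD: "tangent (incl N W1) D1 = tangent (incl N W2) D" unfolding D1_def ii[symmetric] by (rule tangent_comp[OF inc2(1) inc(1), symmetric])
  have d1: "tangent \<rho>1 D1 = tangent (incl N W1) D1"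
   by (rule retractsD(4)[OF r1 T a1 za D1]) (use dz iD in auto)
  have d2: "tangent (incl W1.N W2) D W1 (F' i) = 0" if "i \<in> I" for i
   using fun_cong[OF fun_cong[OF d1, of U0], of "F i"] dz that unfolding iD D1_def[symmetric] by (simp add: tangent_def[of \<rho>1] pre1 F'_def)
  have "tangent \<rho>2 D = D1" unfolding D1_def by (rule retractsD(4)[OF r2 T a za2 D d2])
  then show "tangent (\<rho>1 \<odot> \<rho>2) D = tangent (incl N W2) D" unfolding tangent_comp[OF \<rho>2 \<rho>1] using d1 iD by simp
 qed
 moreover have "bmap \<pi> (\<lambda>_. 0) \<in> W2"
 proof -
  have "bmap \<pi> (\<lambda>_. 0) = bmap (incl N W1) (bmap \<pi>1 (\<lambda>_. 0))"
   unfolding \<pi>1(2)[symmetric] by (rule comp_bmap) (simp add: mors_simps[OF \<pi>1(1)] pt)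
  then show ?thesis using W2(2,3) inc(4) by auto
 qed
 ultimately show ?case using W2(1,3) W1(3) by blast
qed

section \<open>Charts, points and products of graded domains\<close>

text \<open>Source and target are fields of a morphism. With them the category laws become
  conditional rewrite rules whose side conditions are equations between \<open>mdom\<close> and
  \<open>mcod\<close>, which the simplifier can discharge.\<close>

definition morphic :: "('p, 'a::real_vector, 'q, 'b::real_vector) graded_map => bool" where
 "morphic \<phi> \<longleftrightarrow> \<phi> \<in> mors (mdom \<phi>) (mcod \<phi>)"

lemma morsD: "\<phi> \<in> mors M N ==> morphic \<phi> \<and> mdom \<phi> = M \<and> mcod \<phi> = N"
 using mors_simps[of \<phi> M N] by (simp add: morphic_def)

lemma mors_iff: "\<phi> \<in> mors M N \<longleftrightarrow> morphic \<phi> \<and> mdom \<phi> = M \<and> mcod \<phi> = N"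
 using morsD by (auto simp: morphic_def)

lemma morphic_comp [simp]: "morphic \<phi> ==> morphic \<psi> ==> mcod \<phi> = mdom \<psi> ==> morphic (\<psi> \<odot> \<phi>)"
 using comp_mors[of \<phi> "mdom \<phi>" "mcod \<phi>" \<psi> "mcod \<psi>"] by (simp add: morphic_def)

lemma morphic_assoc [simp]:
 "morphic \<phi> ==> morphic \<psi> ==> morphic \<omega> ==> mcod \<phi> = mdom \<psi> ==> mcod \<psi> = mdom \<omega> ==> (\<omega> \<odot> \<psi>) \<odot> \<phi> = \<omega> \<odot> (\<psi> \<odot> \<phi>)"
 using comp_assoc[of \<phi> "mdom \<phi>" "mcod \<phi>" \<psi> "mcod \<psi>" \<omega> "mcod \<omega>"] by (simp add: morphic_def)

lemma morphic_tangent [simp]: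
 "morphic \<psi> ==> morphic \<omega> ==> mcod \<psi> = mdom \<omega> ==> tangent (\<omega> \<odot> \<psi>) D = tangent \<omega> (tangent \<psi> D)"
 using tangent_comp[of \<psi> "mdom \<psi>" "mcod \<psi>" \<omega> "mcod \<omega>"] by (simp add: morphic_def)

lemma morphic_tangent_der:
 "D \<in> ders \<phi> k ==> morphic \<phi> ==> morphic \<psi> ==> mcod \<phi> = mdom \<psi> ==> tangent \<psi> D \<in> ders (\<psi> \<odot> \<phi>) k"
 using tangent_derivation[of \<phi> "mdom \<phi>" "mcod \<phi>" \<psi> "mcod \<psi>"] by (simp add: morphic_def)

lemma morphic_id [simp]: "morphic \<phi> ==> mcod \<phi> = M ==> id_mor M \<odot> \<phi> = \<phi>"
 using id_comp[of \<phi> "mdom \<phi>" "mcod \<phi>"] by (auto simp: morphic_def)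

text \<open>Identities between composites, as rewrite rules for terms associated to the right.\<close>

lemma comp_rw:
 assumes "\<psi> \<odot> \<phi> = \<chi>'" "morphic \<phi>" "morphic \<psi>" "mcod \<phi> = mdom \<psi>"
 shows "morphic r ==> mcod r = mdom \<phi> ==> \<psi> \<odot> (\<phi> \<odot> r) = \<chi>' \<odot> r" "tangent \<psi> (tangent \<phi> D) = tangent \<chi>' D"
 using assms by auto

section \<open>Points of a graded domain\<close>

lemma (in gdomain) point_exists:
 assumes "t \<in> U0" shows "\<exists>\<pi>\<in>mors one_point N. bmap \<pi> (\<lambda>_. 0) = t"
proof -
 let ?P = "topspace (Euclidean_space 0)"
 have oP: "eopen 0 ?P" by simp
 define y where "y a = (if a < m then emb ?P (\<lambda>_. t a) else 0)" for a
 have "(\<lambda>i. if i < m then t i else 0) = t"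
  using openin_Euclidean_space_support[OF open_U0 assms] by auto
 then have b: "(\<lambda>i. if i < m then y i 0 s else 0) = t" if "s \<in> ?P" for s
  using that openin_Euclidean_space_support[OF open_U0 assms] by (auto simp: y_def emb_apply fun_eq_iff)
 have "\<exists>h\<in>mors (gdom 0 [] ?P) N. (\<forall>a<m + length w. pull h U0 (crd m U0 a) = y a) \<and>
  (\<forall>t\<in>?P. bmap h t = (\<lambda>i. if i < m then y i 0 t else 0))"
 proof (rule domain_morphism_exists[OF gdomain_point gdomain_axioms])
  show "y a \<in> sections 0 [] ?P (cdeg m w a)" for a
   using emb_sections[OF oP smooth_const[OF oP]] subspace_0[OF subspace_sections[OF oP]] by (auto simp: y_def cdeg_def)
  show "(\<lambda>i. if i < m then y i 0 s else 0) \<in> U0" if "s \<in> ?P" for s unfolding b[OF that] by (rule assms)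
 qed
 then show ?thesis using b[of "\<lambda>_. 0"] by (auto simp: one_point_def topspace_Euclidean_0)
qed

text \<open>The one-point domain has no nonzero sections of nonzero degree, so generators pull back
  to \<open>0\<close> and only the body is left.\<close>

lemma (in gdomain) point_eqI:
 assumes "\<pi> \<in> mors one_point N" "\<pi>' \<in> mors one_point N" "bmap \<pi> (\<lambda>_. 0) = bmap \<pi>' (\<lambda>_. 0)"
 shows "\<pi> = \<pi>'"
proof -
 let ?P = "topspace (Euclidean_space 0)"
 have dm: "domain_morphism 0 [] ?P m w U0 \<phi>" if "\<phi> \<in> mors one_point N" for \<phi>
  using gdomain_point gdomain_axioms that by (simp add: domain_morphism_defs one_point_def)
 interpret p: domain_morphism 0 "[]" ?P m w U0 \<pi> by (rule dm[OF assms(1)])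
 interpret q: domain_morphism 0 "[]" ?P m w U0 \<pi>' by (rule dm[OF assms(2)])
 show ?thesis
 proof (rule domain_morphism_eqI[OF gdomain_point gdomain_axioms p.h q.h])
  fix a assume a: "a < m + length w"
  have s: "pull \<pi> U0 (crd m U0 a) \<in> sections 0 [] ?P (cdeg m w a)" "pull \<pi>' U0 (crd m U0 a) \<in> sections 0 [] ?P (cdeg m w a)"
   using p.closed[OF open_UU] q.closed[OF open_UU] crd_sections[OF a] by (simp_all add: p.preim_UU q.preim_UU)
  show "pull \<pi> U0 (crd m U0 a) = pull \<pi>' U0 (crd m U0 a)"
  proof (cases "a < m")
   case True
   have "pull \<pi> U0 (crd m U0 a) 0 x = pull \<pi>' U0 (crd m U0 a) 0 x" if "x \<in> ?P" for x
    using p.body_coordinate[OF that, of a] q.body_coordinate[OF that, of a] True assms(3) that by (simp add: topspace_Euclidean_0)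
   then show ?thesis
    by (subst sections_point(1)[OF s(1)], subst sections_point(1)[OF s(2)]) (auto simp: emb_apply fun_eq_iff)
  next
   case False
   then have "w ! (a - m) \<in> set w" using a by simp
   then have "cdeg m w a \<noteq> 0" using pos False by (force simp: cdeg_def)
   then show ?thesis using sections_point(2)[OF s(1)] sections_point(2)[OF s(2)] by simp
  qed
 qed
qed

section \<open>Charts of n-manifolds\<close>

lemma n_manifold_sheaf: "n_manifold n M ==> graded_sheaf M"
 by (simp add: n_manifold_def)

text \<open>A given chart is restricted to the preimage of \<open>V\<close>. The bound on the
  degrees is kept, because with it the domain of the chart can be tested against the universal
  property.\<close>

lemma small_chart:
 assumes M: "n_manifold n M" and V: "gopen M V" "p \<in> V"
 shows "\<exists>m w U0 \<phi>. gdomain m w U0 \<and> (\<forall>d\<in>set w. d \<le> n) \<and> open_embedding (gdom m w U0) M \<phi> \<and>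
  p \<in> bmap \<phi> ` U0 \<and> bmap \<phi> ` U0 \<subseteq> V"
proof -
 have sh: "graded_sheaf M" by (rule n_manifold_sheaf[OF M])
 have "p \<in> points M" using V openin_subset by blast
 then obtain m w U U0 where w: "\<forall>d\<in>set w. 1 \<le> d \<and> d \<le> n" and U: "gopen M U" "p \<in> U" and U0: "eopen m U0"
  and iso: "isomorphic (open_subspace M U) (gdom m w U0)" using M unfolding n_manifold_def by blast
 interpret D: gdomain m w U0 using w U0 by (simp add: gdomain_def)
 obtain \<phi> \<psi> where \<phi>: "\<phi> \<in> mors (open_subspace M U) D.N" and \<psi>: "\<psi> \<in> mors D.N (open_subspace M U)"
  and inv: "\<psi> \<odot> \<phi> = id_mor (open_subspace M U)" "\<phi> \<odot> \<psi> = id_mor D.N" using iso unfolding isomorphic_def by blast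
 note shU = graded_sheaf_open_subspace[OF sh U(1)]
 have e\<psi>: "open_emb D.N (open_subspace M U) \<psi>" by (rule open_emb_iso[OF D.sheaf shU \<psi> \<phi> inv(2,1)])
 define \<chi>' where "\<chi>' = incl M U \<odot> \<psi>"
 have e\<chi>: "open_emb D.N M \<chi>'" unfolding \<chi>'_def by (rule open_emb_comp[OF e\<psi> open_emb_incl[OF sh U(1)]])
 interpret c: open_embedding D.N M \<chi>' using e\<chi> D.sheaf sh by (simp add: open_embedding_def)
 have ptsU: "points (open_subspace M U) = U" using openin_subset[OF U(1)] by auto
 interpret f: morphism "open_subspace M U" D.N \<phi> by (rule morphismI[OF \<phi>])
 interpret g: morphism D.N "open_subspace M U" \<psi> by (rule morphismI[OF \<psi>])
 define t where "t = bmap \<phi> p"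
 have t: "t \<in> U0" using f.bmap_closed[of p] U(2) unfolding ptsU D.points_eq t_def by blast
 have "bmap (\<psi> \<odot> \<phi>) p = p" unfolding inv(1) id_mor_def using U(2) ptsU by simp
 then have "bmap \<psi> t = p" using U(2) ptsU by (simp add: comp_bmap f.dom t_def del: open_subspace_simps)
 then have \<chi>t: "bmap \<chi>' t = p" using t U(2) D.points_eq by (simp add: \<chi>'_def comp_bmap g.dom incl_def del: domain_simps)
 define U1 where "U1 = preim \<chi>' V"
 have U1: "eopen m U1" "U1 \<subseteq> U0" using c.preim_open[OF V(1)] unfolding D.openin_iff U1_def by auto
 note in1 = D.incl_domain[OF U1]
 interpret i1: open_embedding "gdom m w U1" D.N "incl D.N U1" by (rule in1(2))
 interpret D1: gdomain m w U1 by (rule D.sub[OF U1(1)])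
 have e2: "open_emb D1.N M (\<chi>' \<odot> incl D.N U1)" by (rule open_emb_comp[OF i1.emb e\<chi>])
 have b: "bmap (\<chi>' \<odot> incl D.N U1) x = bmap \<chi>' x" if "x \<in> U1" for x
  using that D1.points_eq by (simp add: comp_bmap i1.dom in1(4) del: domain_simps)
 have "t \<in> U1" using t \<chi>t V(2) unfolding U1_def c.preim_eq D.points_eq by blast
 then have "p \<in> bmap (\<chi>' \<odot> incl D.N U1) ` U1" using b \<chi>t by force
 moreover have "bmap (\<chi>' \<odot> incl D.N U1) ` U1 \<subseteq> V" using b by (auto simp: U1_def c.preim_eq)
 moreover have "open_embedding D1.N M (\<chi>' \<odot> incl D.N U1)" using e2 D1.sheaf sh by (simp add: open_embedding_def)
 ultimately show ?thesis using D1.gdomain_axioms w by blast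
qed

section \<open>Products of two graded domains\<close>

locale domain_product = W: gdomain m w W0 + X: gdomain mX wX X0 + Y: gdomain mY wY Y0
 for m w W0 mX wX X0 mY wY Y0 +
 fixes prX prY
 assumes prX: "prX \<in> mors (gdom m w W0) (gdom mX wX X0)"
  and prY: "prY \<in> mors (gdom m w W0) (gdom mY wY Y0)"
  and pair: "gdomain mT wT T0 ==> a \<in> mors (gdom mT wT T0) (gdom mX wX X0) ==>
   b \<in> mors (gdom mT wT T0) (gdom mY wY Y0) ==>
   \<exists>h\<in>mors (gdom mT wT T0) (gdom m w W0). prX \<odot> h = a \<and> prY \<odot> h = b"
  and pair_eqI: "gdomain mT wT T0 ==> h \<in> mors (gdom mT wT T0) (gdom m w W0) ==>
   h' \<in> mors (gdom mT wT T0) (gdom m w W0) ==> prX \<odot> h = prX \<odot> h' ==> prY \<odot> h = prY \<odot> h' ==> h = h'"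
  and der_pair: "gdomain mT wT T0 ==> h \<in> mors (gdom mT wT T0) (gdom m w W0) ==>
   A \<in> ders (prX \<odot> h) k ==> B \<in> ders (prY \<odot> h) k ==>
   \<exists>D\<in>ders h k. tangent prX D = A \<and> tangent prY D = B"
  and der_pair_eqI: "gdomain mT wT T0 ==> h \<in> mors (gdom mT wT T0) (gdom m w W0) ==>
   D \<in> ders h k ==> D' \<in> ders h k ==> tangent prX D = tangent prX D' ==> tangent prY D = tangent prY D' ==> D = D'"

text \<open>Morphisms and derivations into a domain are arbitrary assignments of sections to
  coordinates, subject only to degrees and, for morphisms, to the condition on bodies. So the
  coordinates of both factors together serve for the product.\<close>

lemma domain_product_exists:
 assumes "gdomain mX wX X0" "gdomain mY wY Y0"
 shows "\<exists>m W0 prX prY. domain_product m (wX @ wY) W0 mX wX X0 mY wY Y0 prX prY"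
proof -
 interpret X: gdomain mX wX X0 by (rule assms)
 interpret Y: gdomain mY wY Y0 by (rule assms)
 define m where "m = mX + mY"
 define w where "w = wX @ wY"
 define W0 where "W0 = {z \<in> topspace (Euclidean_space m). (\<lambda>i. if i < mX then z i else 0) \<in> X0} \<inter>
  {z \<in> topspace (Euclidean_space m). (\<lambda>i. if i < mY then z (mX + i) else 0) \<in> Y0}"
 have cc: "continuous_map (Euclidean_space m) euclideanreal (\<lambda>z. z i)" for i
  unfolding continuous_map_Euclidean_space_iff by (rule continuous_on_subset[OF continuous_on_product_coordinates]) simp
 have oW: "eopen m W0" unfolding W0_def
  by (intro openin_Int openin_continuous_map_preimage[OF _ X.open_U0] openin_continuous_map_preimage[OF _ Y.open_U0])
    (simp_all add: continuous_map_componentwise_Euclidean_space cc)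
 interpret W: gdomain m w W0 using oW X.pos Y.pos by (auto simp: gdomain_def w_def)
 \<comment> \<open>\<open>crd\<close> lists functions before generators, so the order is: functions
   of the first factor, functions of the second, generators of the first, generators of the second.
   \<open>iX\<close> and \<open>iY\<close> embed the coordinates of the factors, and
   \<open>comb\<close> merges two assignments.\<close>
 define iX where "iX a = (if a < mX then a else a + mY)" for a
 define iY where "iY b = (if b < mY then mX + b else mX + length wX + b)" for b
 define comb :: "(nat => model_section) => (nat => model_section) => nat => model_section" where
  "comb p q c = (if c < mX then p c else if c < m then q (c - mX) else if c < m + length wX then p (c - mY) else q (c - mX - length wX))" for p q c
 have ind: "iX a < m + length w" "cdeg m w (iX a) = cdeg mX wX a" "comb p q (iX a) = p a" if "a < mX + length wX" for a p q
 proof -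
  have "wX ! (a - mX) = (wX @ wY) ! (a + mY - (mX + mY))" if "\<not> a < mX" using that \<open>a < mX + length wX\<close> by (subst nth_append) auto
  then show "iX a < m + length w" "cdeg m w (iX a) = cdeg mX wX a" "comb p q (iX a) = p a"
   using that by (auto simp: iX_def comb_def m_def w_def cdeg_def)
 qed
 have indY: "iY b < m + length w" "cdeg m w (iY b) = cdeg mY wY b" "comb p q (iY b) = q b" if "b < mY + length wY" for b p q
 proof -
  have "wY ! (b - mY) = (wX @ wY) ! (mX + length wX + b - (mX + mY))" if "\<not> b < mY" using that by (subst nth_append) auto
  then show "iY b < m + length w" "cdeg m w (iY b) = cdeg mY wY b" "comb p q (iY b) = q b"
   using that by (auto simp: iY_def comb_def m_def w_def cdeg_def)
 qed
 have cover: "(\<exists>a<mX + length wX. c = iX a) \<or> (\<exists>b<mY + length wY. c = iY b)" if "c < m + length w" for c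
 proof -
  consider "c < mX" | "mX \<le> c" "c < m" | "m \<le> c" "c < m + length wX" | "m + length wX \<le> c" by linarith
  then show ?thesis
  proof cases
   case 1 then have "c < mX + length wX" "c = iX c" by (auto simp: iX_def) then show ?thesis by blast
  next
   case 2 then have "c - mX < mY + length wY" "c = iY (c - mX)" by (auto simp: iY_def m_def) then show ?thesis by blast
  next
   case 3 then have "c - mY < mX + length wX" "c = iX (c - mY)" by (auto simp: iX_def m_def) then show ?thesis by blast
  next
   case 4 then have "c - mX - length wX < mY + length wY" "c = iY (c - mX - length wX)"
    using that by (auto simp: iY_def m_def w_def)
   then show ?thesis by blast
  qed
 qed
 have comb_sec: "comb p q c \<in> sections mT wT T0 (cdeg m w c + k)"
  if c: "c < m + length w" and p: "\<And>a. a < mX + length wX ==> p a \<in> sections mT wT T0 (cdeg mX wX a + k)"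
   and q: "\<And>b. b < mY + length wY ==> q b \<in> sections mT wT T0 (cdeg mY wY b + k)" for p q c mT wT T0 k
  using cover[OF c] p q ind(2,3) indY(2,3) by metis
 have bodyX: "(\<lambda>i. if i < mX then crd m W0 (iX i) 0 t else 0) \<in> X0" if "t \<in> W0" for t
 proof -
  have "(\<lambda>i. if i < mX then crd m W0 (iX i) 0 t else 0) = (\<lambda>i. if i < mX then t i else 0)"
   using that by (auto simp: crd_def emb_apply restr_def iX_def m_def)
  then show ?thesis using that by (simp add: W0_def)
 qed
 have bodyY: "(\<lambda>i. if i < mY then crd m W0 (iY i) 0 t else 0) \<in> Y0" if "t \<in> W0" for t
 proof -
  have "(\<lambda>i. if i < mY then crd m W0 (iY i) 0 t else 0) = (\<lambda>i. if i < mY then t (mX + i) else 0)"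
   using that by (auto simp: crd_def emb_apply restr_def iY_def m_def)
  then show ?thesis using that by (simp add: W0_def)
 qed
 have secX: "crd m W0 (iX a) \<in> sections m w W0 (cdeg mX wX a)" if "a < mX + length wX" for a
  using W.crd_sections[OF ind(1)[OF that]] unfolding ind(2)[OF that] .
 obtain prX where prX: "prX \<in> mors W.N X.N" "\<And>a. a < mX + length wX ==> pull prX X0 (crd mX X0 a) = crd m W0 (iX a)"
  using domain_morphism_exists[OF W.gdomain_axioms X.gdomain_axioms secX bodyX] by blast
 have secY: "crd m W0 (iY a) \<in> sections m w W0 (cdeg mY wY a)" if "a < mY + length wY" for a
  using W.crd_sections[OF indY(1)[OF that]] unfolding indY(2)[OF that] .
 obtain prY where prY: "prY \<in> mors W.N Y.N" "\<And>b. b < mY + length wY ==> pull prY Y0 (crd mY Y0 b) = crd m W0 (iY b)"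
  using domain_morphism_exists[OF W.gdomain_axioms Y.gdomain_axioms secY bodyY] by blast
 interpret prX: domain_morphism m w W0 mX wX X0 prX using prX(1) by unfold_locales
 interpret prY: domain_morphism m w W0 mY wY Y0 prY using prY(1) by unfold_locales
 have "domain_product m w W0 mX wX X0 mY wY Y0 prX prY"
 proof (unfold_locales)
  fix mT wT T0 a b assume T: "gdomain mT wT T0" and a: "a \<in> mors (gdom mT wT T0) X.N" and b: "b \<in> mors (gdom mT wT T0) Y.N"
  interpret T: gdomain mT wT T0 by (rule T)
  interpret a: domain_morphism mT wT T0 mX wX X0 a using a by unfold_locales
  interpret b: domain_morphism mT wT T0 mY wY Y0 b using b by unfold_locales
  define p where "p c = pull a X0 (crd mX X0 c)" for c
  define q where "q c = pull b Y0 (crd mY Y0 c)" for c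
  have p: "p c \<in> sections mT wT T0 (cdeg mX wX c)" if "c < mX + length wX" for c
   using a.closed[OF X.open_UU] X.crd_sections[OF that] by (simp add: p_def a.preim_UU)
  have q: "q c \<in> sections mT wT T0 (cdeg mY wY c)" if "c < mY + length wY" for c
   using b.closed[OF Y.open_UU] Y.crd_sections[OF that] by (simp add: q_def b.preim_UU)
  have "\<exists>h\<in>mors T.N W.N. (\<forall>c<m + length w. pull h W0 (crd m W0 c) = comb p q c) \<and>
   (\<forall>t\<in>T0. bmap h t = (\<lambda>i. if i < m then comb p q i 0 t else 0))"
  proof (rule domain_morphism_exists[OF T W.gdomain_axioms])
   show "comb p q c \<in> sections mT wT T0 (cdeg m w c)" if "c < m + length w" for c
    using comb_sec[OF that, of p mT wT T0 0 q] p q by simp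
   fix t assume t: "t \<in> T0"
   have "(\<lambda>i. if i < mX then if i < m then comb p q i 0 t else 0 else 0) = bmap a t"
    using a.body_coordinate[OF t] by (auto simp: comb_def p_def m_def fun_eq_iff)
   moreover have "(\<lambda>i. if i < mY then if mX + i < m then comb p q (mX + i) 0 t else 0 else 0) = bmap b t"
    using b.body_coordinate[OF t] by (auto simp: comb_def q_def m_def fun_eq_iff)
   ultimately show "(\<lambda>i. if i < m then comb p q i 0 t else 0) \<in> W0"
    using a.body_closed[OF t] b.body_closed[OF t] by (simp add: W0_def topspace_Euclidean_space)
  qed
  then obtain h where h: "h \<in> mors T.N W.N" "\<And>c. c < m + length w ==> pull h W0 (crd m W0 c) = comb p q c" by blast
  have "prX \<odot> h = a"
   by (rule domain_morphism_eqI[OF T X.gdomain_axioms comp_mors[OF h(1) prX(1)] a]) (simp add: prX.preim_UU prX(2) h(2) ind p_def)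
  moreover have "prY \<odot> h = b"
   by (rule domain_morphism_eqI[OF T Y.gdomain_axioms comp_mors[OF h(1) prY(1)] b]) (simp add: prY.preim_UU prY(2) h(2) indY q_def)
  ultimately show "\<exists>h\<in>mors T.N W.N. prX \<odot> h = a \<and> prY \<odot> h = b" using h(1) by blast
 next
  fix mT wT T0 h h' assume T: "gdomain mT wT T0" and h: "h \<in> mors (gdom mT wT T0) W.N" "h' \<in> mors (gdom mT wT T0) W.N"
   and eq: "prX \<odot> h = prX \<odot> h'" "prY \<odot> h = prY \<odot> h'"
  show "h = h'"
  proof (rule domain_morphism_eqI[OF T W.gdomain_axioms h])
   fix c assume "c < m + length w"
   from cover[OF this] show "pull h W0 (crd m W0 c) = pull h' W0 (crd m W0 c)"
   proof (elim disjE exE conjE)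
    fix a assume "a < mX + length wX" "c = iX a" then show ?thesis
     using arg_cong[OF eq(1), of "\<lambda>g. pull g X0 (crd mX X0 a)"] by (simp add: prX.preim_UU prX(2))
   next
    fix a assume "a < mY + length wY" "c = iY a" then show ?thesis
     using arg_cong[OF eq(2), of "\<lambda>g. pull g Y0 (crd mY Y0 a)"] by (simp add: prY.preim_UU prY(2))
   qed
  qed
 next
  fix mT wT T0 h A B k assume T: "gdomain mT wT T0" and h: "h \<in> mors (gdom mT wT T0) W.N"
   and A: "A \<in> ders (prX \<odot> h) k" and B: "B \<in> ders (prY \<odot> h) k"
  interpret T: gdomain mT wT T0 by (rule T)
  interpret h: domain_morphism mT wT T0 m w W0 h using h by unfold_locales
  note hX = comp_mors[OF h prX(1)] and hY = comp_mors[OF h prY(1)]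
  interpret A: domain_derivation mT wT T0 mX wX X0 "prX \<odot> h" k A using hX A by unfold_locales
  interpret B: domain_derivation mT wT T0 mY wY Y0 "prY \<odot> h" k B using hY B by unfold_locales
  define p where "p c = A X0 (crd mX X0 c)" for c
  define q where "q c = B Y0 (crd mY Y0 c)" for c
  have p: "p c \<in> sections mT wT T0 (cdeg mX wX c + k)" if "c < mX + length wX" for c
   using A.der_closed[OF X.open_UU] X.crd_sections[OF that] by (simp add: p_def A.preim_UU)
  have q: "q c \<in> sections mT wT T0 (cdeg mY wY c + k)" if "c < mY + length wY" for c
   using B.der_closed[OF Y.open_UU] Y.crd_sections[OF that] by (simp add: q_def B.preim_UU)
  obtain D where D: "D \<in> ders h k" "\<And>c. c < m + length w ==> D W0 (crd m W0 c) = comb p q c"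
   using domain_derivation_exists[OF T W.gdomain_axioms h comb_sec[OF _ p q]] by blast
  have "tangent prX D = A"
   by (rule domain_derivation_eqI[OF T X.gdomain_axioms hX tangent_derivation[OF h prX(1) D(1)] A])
     (simp add: tangent_def prX.preim_UU prX(2) D(2) ind p_def)
  moreover have "tangent prY D = B"
   by (rule domain_derivation_eqI[OF T Y.gdomain_axioms hY tangent_derivation[OF h prY(1) D(1)] B])
     (simp add: tangent_def prY.preim_UU prY(2) D(2) indY q_def)
  ultimately show "\<exists>D\<in>ders h k. tangent prX D = A \<and> tangent prY D = B" using D(1) by blast
 next
  fix mT wT T0 h D D' k assume T: "gdomain mT wT T0" and h: "h \<in> mors (gdom mT wT T0) W.N"
   and D: "D \<in> ders h k" "D' \<in> ders h k"
   and eq: "tangent prX D = tangent prX D'" "tangent prY D = tangent prY D'"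
  show "D = D'"
  proof (rule domain_derivation_eqI[OF T W.gdomain_axioms h D])
   fix c assume "c < m + length w"
   from cover[OF this] show "D W0 (crd m W0 c) = D' W0 (crd m W0 c)"
   proof (elim disjE exE conjE)
    fix a assume "a < mX + length wX" "c = iX a" then show ?thesis
     using fun_cong[OF fun_cong[OF eq(1), of X0], of "crd mX X0 a"] by (simp add: tangent_def prX.preim_UU prX(2))
   next
    fix a assume "a < mY + length wY" "c = iY a" then show ?thesis
     using fun_cong[OF fun_cong[OF eq(2), of Y0], of "crd mY Y0 a"] by (simp add: tangent_def prY.preim_UU prY(2))
   qed
  qed
 qed (rule prX prY)+
 then show ?thesis unfolding w_def by blast
qed

section \<open>Fibre products\<close>

lemma (in morphism) pull_diff: "gopen N V ==> f \<in> gsec N V k ==> g \<in> gsec N V k ==> graded_sheaf N ==>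
 pull \<phi> V (f - g) = pull \<phi> V f - pull \<phi> V g"
 using add[of V f k "- g"] scale[of V g k "-1"] subspace_neg[OF gsheaf.subspace[of N V k], of g] by (simp add: gsheaf_def)

lemma (in derivation) der_diff: "gopen N V ==> f \<in> gsec N V j ==> g \<in> gsec N V j ==> graded_sheaf N ==>
 D V (f - g) = D V f - D V g"
 using der_add[of V f j "- g"] der_scale[of V g j "-1"] subspace_neg[OF gsheaf.subspace[of N V j], of g] by (simp add: gsheaf_def)

text \<open>The hypothesis on the \<open>v i\<close> is transversality of \<open>\<alpha>\<close> and \<open>\<beta>\<close> at the point \<open>\<pi>\<close>.\<close>

lemma equalizer_retraction:
 assumes W: "gdomain m w W0" and Z: "gdomain mZ wZ Z0"
  and \<alpha>: "\<alpha> \<in> mors (gdom m w W0) (gdom mZ wZ Z0)" and \<beta>: "\<beta> \<in> mors (gdom m w W0) (gdom mZ wZ Z0)"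
  and \<pi>: "\<pi> \<in> mors one_point (gdom m w W0)" "\<alpha> \<odot> \<pi> = \<beta> \<odot> \<pi>"
  and v: "\<forall>i<mZ + length wZ. v i \<in> ders \<pi> (- cdeg mZ wZ i) \<and> tangent \<alpha> (v i) = 0 \<and>
   (\<forall>j<mZ + length wZ. tangent \<beta> (v i) Z0 (crd mZ Z0 j) = (if j = i then emb (topspace (Euclidean_space 0)) 1 else 0))"
 shows "\<exists>W1 \<rho>. eopen m W1 \<and> bmap \<pi> (\<lambda>_. 0) \<in> W1 \<and> W1 \<subseteq> W0 \<and>
  \<rho> \<in> mors (gdom m w W1) (gdom m w W0) \<and> \<alpha> \<odot> \<rho> = \<beta> \<odot> \<rho> \<and>
  (\<forall>mT wT T0 a. gdomain mT wT T0 --> a \<in> mors (gdom mT wT T0) (gdom m w W1) -->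
    \<alpha> \<odot> (incl (gdom m w W0) W1 \<odot> a) = \<beta> \<odot> (incl (gdom m w W0) W1 \<odot> a) -->
    \<rho> \<odot> a = incl (gdom m w W0) W1 \<odot> a \<and>
    (\<forall>k. \<forall>D\<in>ders a k. tangent \<alpha> (tangent (incl (gdom m w W0) W1) D) = tangent \<beta> (tangent (incl (gdom m w W0) W1) D) -->
     tangent \<rho> D = tangent (incl (gdom m w W0) W1) D))"
proof -
 interpret W: gdomain m w W0 by (rule W)
 interpret Z: gdomain mZ wZ Z0 by (rule Z)
 interpret \<alpha>: domain_morphism m w W0 mZ wZ Z0 \<alpha> using \<alpha> by unfold_locales
 interpret \<beta>: domain_morphism m w W0 mZ wZ Z0 \<beta> using \<beta> by unfold_locales
 let ?I = "{..<mZ + length wZ}"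
 \<comment> \<open>The two morphisms agree after composition with a test map exactly when these
   differences of coordinates pull back to \<open>0\<close>, and likewise for derivations.\<close>
 define F where "F i = pull \<alpha> Z0 (crd mZ Z0 i) - pull \<beta> Z0 (crd mZ Z0 i)" for i
 have sec: "pull \<alpha> Z0 (crd mZ Z0 i) \<in> gsec W.N W0 (cdeg mZ wZ i)" "pull \<beta> Z0 (crd mZ Z0 i) \<in> gsec W.N W0 (cdeg mZ wZ i)"
  if "i \<in> ?I" for i
  using \<alpha>.closed[OF Z.open_UU] \<beta>.closed[OF Z.open_UU] Z.crd_sections[of i] that by (simp_all add: \<alpha>.preim_UU \<beta>.preim_UU)
 have pF: "pull a W0 (F i) = pull (\<alpha> \<odot> a) Z0 (crd mZ Z0 i) - pull (\<beta> \<odot> a) Z0 (crd mZ Z0 i)"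
  if "a \<in> mors T W.N" "i \<in> ?I" for T :: univ_space and a i
  using morphism.pull_diff[OF morphismI[OF that(1)] W.open_UU sec[OF that(2)] W.sheaf] by (simp add: F_def \<alpha>.preim_UU \<beta>.preim_UU)
 have dF: "D W0 (F i) = tangent \<alpha> D Z0 (crd mZ Z0 i) - tangent \<beta> D Z0 (crd mZ Z0 i)"
  if "a \<in> mors T W.N" "D \<in> ders a k" "i \<in> ?I" for T :: univ_space and a D k i
  using derivation.der_diff[OF derivationI[OF that(1,2)] W.open_UU sec[OF that(3)] W.sheaf]
  by (simp add: F_def tangent_def \<alpha>.preim_UU \<beta>.preim_UU)
 have vF: "v i W0 (F j) = (if j = i then - emb (topspace (Euclidean_space 0)) 1 else 0)" if "i \<in> ?I" "j \<in> ?I" for i j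
  using dF[OF \<pi>(1) _ that(2), of "v i"] v that by (auto simp: fun_eq_iff)
 have "emb (topspace (Euclidean_space 0)) 1 0 (\<lambda>_. 0) = 1" by (simp add: emb_apply topspace_Euclidean_0)
 then have ne: "emb (topspace (Euclidean_space 0)) 1 \<noteq> 0" by (metis zero_fun_apply zero_neq_one)
 have "\<exists>W1 \<rho>. eopen m W1 \<and> bmap \<pi> (\<lambda>_. 0) \<in> W1 \<and> W1 \<subseteq> W0 \<and> retracts m w W0 W1 ?I F \<rho>"
 proof (rule retraction_exists[where e = "cdeg mZ wZ" and v = v, OF _ W _ \<pi>(1)])
  show "v i \<in> ders \<pi> (- cdeg mZ wZ i)" if "i \<in> ?I" for i using v that by simp
  show "F i \<in> sections m w W0 (cdeg mZ wZ i)" if "i \<in> ?I" for i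
   unfolding F_def using subspace_diff[OF subspace_sections[OF W.open_U0]] sec[OF that] by simp
  show "pull \<pi> W0 (F i) = 0" if "i \<in> ?I" for i unfolding pF[OF \<pi>(1) that] \<pi>(2) by (rule diff_self)
  show "v i W0 (F i) \<noteq> 0" if "i \<in> ?I" for i unfolding vF[OF that that] using ne by (metis neg_0_equal_iff_equal)
  show "v i W0 (F j) = 0" if "i \<in> ?I" "j \<in> ?I" "i \<noteq> j" for i j unfolding vF[OF that(1,2)] using that(3) by (metis (full_types))
 qed auto
 then obtain W1 \<rho> where W1: "eopen m W1" "bmap \<pi> (\<lambda>_. 0) \<in> W1" "W1 \<subseteq> W0" and r: "retracts m w W0 W1 ?I F \<rho>" by blast
 note \<rho> = retractsD(1)[OF r]
 interpret W1: gdomain m w W1 by (rule W.sub[OF W1(1)])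
 have "\<alpha> \<odot> \<rho> = \<beta> \<odot> \<rho>"
 proof (rule domain_morphism_eqI[OF W1.gdomain_axioms Z comp_mors[OF \<rho> \<alpha>] comp_mors[OF \<rho> \<beta>]])
  fix i assume "i < mZ + length wZ"
  then have i: "i \<in> ?I" by simp
  show "pull (\<alpha> \<odot> \<rho>) Z0 (crd mZ Z0 i) = pull (\<beta> \<odot> \<rho>) Z0 (crd mZ Z0 i)"
   using trans[OF pF[OF \<rho> i, symmetric] retractsD(2)[OF r i]] by (metis eq_iff_diff_eq_0)
 qed
 moreover have "\<rho> \<odot> a = incl W.N W1 \<odot> a \<and> (\<forall>k. \<forall>D\<in>ders a k. tangent \<alpha> (tangent (incl W.N W1) D) = tangent \<beta> (tangent (incl W.N W1) D) -->
     tangent \<rho> D = tangent (incl W.N W1) D)"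
  if T: "gdomain mT wT T0" and a: "a \<in> mors (gdom mT wT T0) W1.N" and eq: "\<alpha> \<odot> (incl W.N W1 \<odot> a) = \<beta> \<odot> (incl W.N W1 \<odot> a)" for mT wT T0 a
 proof -
  note ia = comp_mors[OF a W.incl_domain(1)[OF W1(1,3)]]
  have z: "pull (incl W.N W1 \<odot> a) W0 (F i) = 0" if "i \<in> ?I" for i
   unfolding pF[OF ia that] eq by (rule diff_self)
  have "tangent \<rho> D = tangent (incl W.N W1) D"
   if D: "D \<in> ders a k" "tangent \<alpha> (tangent (incl W.N W1) D) = tangent \<beta> (tangent (incl W.N W1) D)" for k D
  proof (rule retractsD(4)[OF r T a z D(1)])
   show "tangent (incl W.N W1) D W0 (F i) = 0" if "i \<in> ?I" for i
    unfolding dF[OF ia tangent_derivation[OF a W.incl_domain(1)[OF W1(1,3)] D(1)] that] D(2) by (rule diff_self)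
  qed
  then show ?thesis using retractsD(3)[OF r T a z] by blast
 qed
 ultimately show ?thesis using W1 \<rho> by blast
qed

text \<open>The tangent bundle of the fibre product is the fibre product of the tangent bundles,
  read along \<open>h\<close>: derivations along \<open>h\<close> correspond to compatible pairs of
  derivations along its components.\<close>

definition lifts_derivations where
 "lifts_derivations f g p1 p2 h \<longleftrightarrow>
  (\<forall>k D D'. D \<in> ders h k --> D' \<in> ders h k -->
   tangent p1 D = tangent p1 D' --> tangent p2 D = tangent p2 D' --> D = D') \<and>
  (\<forall>k A B. A \<in> ders (p1 \<odot> h) k --> B \<in> ders (p2 \<odot> h) k --> tangent f A = tangent g B -->
   (\<exists>D\<in>ders h k. tangent p1 D = A \<and> tangent p2 D = B))"

text \<open>Two local objects meet: a chart \<open>\<phi>\<close> of \<open>P\<close>, and the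
  domain \<open>W1\<close> of the retraction with its morphism \<open>c\<close> to \<open>P\<close>,
  which need not be a chart. The components of \<open>\<phi>\<close> give a map \<open>j\<close>
  from the chart to \<open>W1\<close> with \<open>c \<odot> j = \<phi>\<close>. A compatible pair is
  lifted to \<open>W1\<close> and pushed forward by \<open>c\<close>; conversely the components of a
  derivation determine its image under \<open>j\<close>, hence the derivation.\<close>

theorem fibre_chart:
 fixes X :: "('p, 'a::real_vector) graded_space" and Y :: "('r, 'c::real_vector) graded_space" and Z :: "('q, 'b::real_vector) graded_space"
  and P :: "('s, 'd::real_vector) graded_space"
 assumes X: "n_manifold n X" and Y: "n_manifold n Y" and Z: "n_manifold n Z" and f: "f \<in> mors X Z" and g: "g \<in> mors Y Z"
  and sub: "submersion g" and fib: "is_fibre_product n f g P p1 p2" and q: "q \<in> points P"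
 shows "\<exists>m w U0 \<phi>. gdomain m w U0 \<and> open_embedding (gdom m w U0) P \<phi> \<and> q \<in> bmap \<phi> ` U0 \<and>
  (\<forall>mT wT T0 h. gdomain mT wT T0 --> h \<in> mors (gdom mT wT T0) (gdom m w U0) --> lifts_derivations f g p1 p2 (\<phi> \<odot> h))"
proof -
 note fg = f g
 have dom: "mdom f = X" "mdom g = Y" using fg by (simp_all add: mors_iff)
 have P: "n_manifold n P" and p1: "p1 \<in> mors P X" and p2: "p2 \<in> mors P Y" and fp: "f \<odot> p1 = g \<odot> p2"
  using fib by (simp_all add: is_fibre_product_def dom)
 have univ: "\<exists>!h. h \<in> mors T P \<and> p1 \<odot> h = a \<and> p2 \<odot> h = b"
  if "n_manifold n T" "a \<in> mors T X" "b \<in> mors T Y" "f \<odot> a = g \<odot> b" for T :: univ_space and a b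
  using fib that unfolding is_fibre_product_def dom by blast
 interpret f: morphism X Z f by (rule morphismI[OF f])
 interpret g: morphism Y Z g by (rule morphismI[OF g])
 interpret p1: morphism P X p1 by (rule morphismI[OF p1])
 interpret p2: morphism P Y p2 by (rule morphismI[OF p2])
 define x y z where "x = bmap p1 q" and "y = bmap p2 q" and "z = bmap f x"
 have x: "x \<in> points X" and y: "y \<in> points Y" using p1.bmap_closed p2.bmap_closed q by (auto simp: x_def y_def)
 have z: "z \<in> points Z" "z = bmap g y"
  using f.bmap_closed[OF x] arg_cong[OF fp, of "\<lambda>h. bmap h q"] q by (auto simp: z_def x_def y_def comp_bmap p1.dom p2.dom)
 obtain mZ wZ Z0 \<phi>Z where cZ: "gdomain mZ wZ Z0" "open_embedding (gdom mZ wZ Z0) Z \<phi>Z" "z \<in> bmap \<phi>Z ` Z0"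
  using small_chart[OF Z openin_topspace z(1)] by blast
 interpret Z0: gdomain mZ wZ Z0 by (rule cZ(1))
 interpret \<phi>Z: open_embedding Z0.N Z \<phi>Z by (rule cZ(2))
 have oZ: "gopen Z (bmap \<phi>Z ` Z0)" by (rule \<phi>Z.open_image[OF Z0.open_UU])
 have "x \<in> preim f (bmap \<phi>Z ` Z0)" "y \<in> preim g (bmap \<phi>Z ` Z0)"
  using cZ(3) x y z(2) by (auto simp: f.preim_eq g.preim_eq z_def)
 from small_chart[OF X f.preim_open[OF oZ] this(1)] small_chart[OF Y g.preim_open[OF oZ] this(2)]
 obtain mX wX X0 \<phi>X mY wY Y0 \<phi>Y where
  cX: "gdomain mX wX X0" "\<forall>d\<in>set wX. d \<le> n" "open_embedding (gdom mX wX X0) X \<phi>X" "x \<in> bmap \<phi>X ` X0" "bmap \<phi>X ` X0 \<subseteq> preim f (bmap \<phi>Z ` Z0)"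
  and cY: "gdomain mY wY Y0" "\<forall>d\<in>set wY. d \<le> n" "open_embedding (gdom mY wY Y0) Y \<phi>Y" "y \<in> bmap \<phi>Y ` Y0" "bmap \<phi>Y ` Y0 \<subseteq> preim g (bmap \<phi>Z ` Z0)"
  by (elim exE conjE) metis
 interpret X0: gdomain mX wX X0 by (rule cX(1))
 interpret Y0: gdomain mY wY Y0 by (rule cY(1))
 interpret \<phi>X: open_embedding X0.N X \<phi>X by (rule cX(3))
 interpret \<phi>Y: open_embedding Y0.N Y \<phi>Y by (rule cY(3))
 note \<phi> = \<phi>X.mor \<phi>Y.mor \<phi>Z.mor
 have "bmap (f \<odot> \<phi>X) ` points X0.N \<subseteq> bmap \<phi>Z ` points Z0.N" "bmap (g \<odot> \<phi>Y) ` points Y0.N \<subseteq> bmap \<phi>Z ` points Z0.N"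
  using cX(5) cY(5) by (auto simp: X0.points_eq Y0.points_eq Z0.points_eq comp_bmap \<phi>X.dom \<phi>Y.dom f.preim_eq g.preim_eq simp del: domain_simps)
 from \<phi>Z.lift[OF comp_mors[OF \<phi>(1) f] this(1) X0.sheaf] \<phi>Z.lift[OF comp_mors[OF \<phi>(2) g] this(2) Y0.sheaf]
 obtain fX gY where fX: "fX \<in> mors X0.N Z0.N" "\<phi>Z \<odot> fX = f \<odot> \<phi>X" and gY: "gY \<in> mors Y0.N Z0.N" "\<phi>Z \<odot> gY = g \<odot> \<phi>Y" by blast
 obtain m W0 prX prY where W: "domain_product m (wX @ wY) W0 mX wX X0 mY wY Y0 prX prY"
  using domain_product_exists[OF cX(1) cY(1)] by blast
 define w where "w = wX @ wY"
 interpret W: domain_product m w W0 mX wX X0 mY wY Y0 prX prY unfolding w_def by (rule W)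
 obtain x0 y0 where x0: "x0 \<in> X0" "bmap \<phi>X x0 = x" and y0: "y0 \<in> Y0" "bmap \<phi>Y y0 = y" using cX(4) cY(4) by blast
 obtain \<pi>X \<pi>Y where \<pi>X: "\<pi>X \<in> mors one_point X0.N" "bmap \<pi>X (\<lambda>_. 0) = x0" and \<pi>Y: "\<pi>Y \<in> mors one_point Y0.N" "bmap \<pi>Y (\<lambda>_. 0) = y0"
  using X0.point_exists[OF x0(1)] Y0.point_exists[OF y0(1)] by blast
 obtain \<pi> where \<pi>: "\<pi> \<in> mors one_point W.W.N" "prX \<odot> \<pi> = \<pi>X" "prY \<odot> \<pi> = \<pi>Y"
  using W.pair[OF gdomain_point] \<pi>X(1) \<pi>Y(1) unfolding one_point_def by blast
 note ms = f g p1 p2 \<phi> fX(1) gY(1) W.prX W.prY \<pi>X(1) \<pi>Y(1) \<pi>(1)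
 note ms1 = ms[THEN morsD]
 have pt0: "(\<lambda>_. 0) \<in> points one_point" unfolding one_point_def gdomain.points_eq[OF gdomain_point] by (simp add: topspace_Euclidean_0)
 have "bmap \<phi>Z (bmap fX x0) = z" "bmap \<phi>Z (bmap gY y0) = z"
  using arg_cong[OF fX(2), of "\<lambda>h. bmap h x0"] arg_cong[OF gY(2), of "\<lambda>h. bmap h y0"] x0 y0 z(2) ms1
  by (simp_all add: comp_bmap X0.points_eq Y0.points_eq z_def del: domain_simps)
 then have b0: "bmap fX x0 = bmap gY y0"
  using inj_onD[OF \<phi>Z.inj] morphism.bmap_closed[OF morphismI[OF fX(1)]] morphism.bmap_closed[OF morphismI[OF gY(1)]] x0(1) y0(1)
  unfolding X0.points_eq Y0.points_eq by metis
 have "fX \<odot> \<pi>X = gY \<odot> \<pi>Y"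
  by (rule Z0.point_eqI[OF comp_mors[OF \<pi>X(1) fX(1)] comp_mors[OF \<pi>Y(1) gY(1)]])
    (use b0 pt0 \<pi>X(2) \<pi>Y(2) ms1 in "simp add: comp_bmap")
 define \<alpha> \<beta> where "\<alpha> = fX \<odot> prX" and "\<beta> = gY \<odot> prY"
 have \<alpha>: "\<alpha> \<in> mors W.W.N Z0.N" and \<beta>: "\<beta> \<in> mors W.W.N Z0.N"
  unfolding \<alpha>_def \<beta>_def by (rule comp_mors[OF W.prX fX(1)], rule comp_mors[OF W.prY gY(1)])
 have \<alpha>\<beta>\<pi>: "\<alpha> \<odot> \<pi> = \<beta> \<odot> \<pi>" using \<open>fX \<odot> \<pi>X = gY \<odot> \<pi>Y\<close> \<pi>(2,3) ms1 by (simp add: \<alpha>_def \<beta>_def)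
 let ?P = "topspace (Euclidean_space 0)"
 have pt_sheaf: "graded_sheaf one_point" unfolding one_point_def by (rule gdomain.sheaf[OF gdomain_point])
 \<comment> \<open>The transversal vectors move the second factor only: the submersion
   \<open>g\<close> lifts the coordinate vector number \<open>i\<close> of the base to a vector
   \<open>u'\<close> on the second factor, and it is paired with \<open>0\<close> on the
   first.\<close>
 have "\<exists>v\<in>ders \<pi> (- cdeg mZ wZ i). tangent \<alpha> v = 0 \<and>
   (\<forall>j<mZ + length wZ. tangent \<beta> v Z0 (crd mZ Z0 j) = (if j = i then emb ?P 1 else 0))" if i: "i < mZ + length wZ" for i
 proof -
  let ?k = "- cdeg mZ wZ i"
  have oP: "eopen 0 ?P" by simp
  have "emb ?P 1 \<in> sections 0 [] ?P 0" using emb_sections[OF oP smooth_const[OF oP, of 1]] by (simp add: one_fun_def)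
  then have "(if j = i then emb ?P 1 else 0) \<in> sections 0 [] ?P (cdeg mZ wZ j + ?k)" for j
   using subspace_0[OF subspace_sections[OF oP]] by auto
  from domain_derivation_exists[OF gdomain_point Z0.gdomain_axioms comp_mors[OF \<pi>Y(1) gY(1), unfolded one_point_def] this]
  obtain d where d: "d \<in> ders (gY \<odot> \<pi>Y) ?k" "\<And>j. j < mZ + length wZ ==> d Z0 (crd mZ Z0 j) = (if j = i then emb ?P 1 else 0)"
   by blast
  have "tangent \<phi>Z d \<in> ders (g \<odot> (\<phi>Y \<odot> \<pi>Y)) ?k"
   using morphic_tangent_der[OF d(1), of \<phi>Z] ms1 by (simp add: comp_rw[OF gY(2)])
  moreover have "ders (g \<odot> (\<phi>Y \<odot> \<pi>Y)) ?k \<subseteq> tangent g ` ders (\<phi>Y \<odot> \<pi>Y) ?k"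
   using sub comp_mors[OF \<pi>Y(1) \<phi>(2)] unfolding submersion_def dom by simp
  ultimately have "tangent \<phi>Z d \<in> tangent g ` ders (\<phi>Y \<odot> \<pi>Y) ?k" by (rule subsetD[rotated])
  then have "\<exists>u\<in>ders (\<phi>Y \<odot> \<pi>Y) ?k. tangent \<phi>Z d = tangent g u" unfolding image_iff .
  then obtain u where u: "u \<in> ders (\<phi>Y \<odot> \<pi>Y) ?k" "tangent \<phi>Z d = tangent g u" ..
  obtain u' where u': "u' \<in> ders \<pi>Y ?k" "tangent \<phi>Y u' = u"
   using \<phi>Y.derivation_lift[OF \<pi>Y(1) u(1) pt_sheaf] by blast
  have "tangent gY u' = d"
   by (rule \<phi>Z.tangent_inj[OF comp_mors[OF \<pi>Y(1) gY(1)] tangent_derivation[OF \<pi>Y(1) gY(1) u'(1)] d(1)])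
     (use u' u(2)[symmetric] ms1 in "simp add: comp_rw[OF gY(2)]")
  moreover have "0 \<in> ders (prX \<odot> \<pi>) ?k" by (rule zero_derivation[OF pt_sheaf comp_mors[OF \<pi>(1) W.prX]])
  moreover have "u' \<in> ders (prY \<odot> \<pi>) ?k" using u'(1) \<pi>(3) by simp
  ultimately obtain v where v: "v \<in> ders \<pi> ?k" "tangent prX v = 0" "tangent prY v = u'"
   using W.der_pair[OF gdomain_point \<pi>(1)[unfolded one_point_def]] by blast
  have "tangent \<alpha> v = 0" using v(2) ms1 by (simp add: \<alpha>_def tangent_0 del: zero_fun_def)
  moreover have "tangent \<beta> v = d" using v(3) ms1 \<open>tangent gY u' = d\<close> by (simp add: \<beta>_def)
  ultimately show ?thesis using v(1) d(2) by blast
 qed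
 then obtain v where v: "\<forall>i<mZ + length wZ. v i \<in> ders \<pi> (- cdeg mZ wZ i) \<and> tangent \<alpha> (v i) = 0 \<and>
   (\<forall>j<mZ + length wZ. tangent \<beta> (v i) Z0 (crd mZ Z0 j) = (if j = i then emb ?P 1 else 0))"
  by metis
 from equalizer_retraction[OF W.W.gdomain_axioms Z0.gdomain_axioms \<alpha> \<beta> \<pi>(1) \<alpha>\<beta>\<pi> v]
 obtain W1 \<rho> where E: "eopen m W1 \<and> bmap \<pi> (\<lambda>_. 0) \<in> W1 \<and> W1 \<subseteq> W0 \<and>
  \<rho> \<in> mors (gdom m w W1) W.W.N \<and> \<alpha> \<odot> \<rho> = \<beta> \<odot> \<rho> \<and>
  (\<forall>mT wT T0 a. gdomain mT wT T0 --> a \<in> mors (gdom mT wT T0) (gdom m w W1) -->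
    \<alpha> \<odot> (incl W.W.N W1 \<odot> a) = \<beta> \<odot> (incl W.W.N W1 \<odot> a) --> \<rho> \<odot> a = incl W.W.N W1 \<odot> a \<and>
    (\<forall>k. \<forall>D\<in>ders a k. tangent \<alpha> (tangent (incl W.W.N W1) D) = tangent \<beta> (tangent (incl W.W.N W1) D) -->
     tangent \<rho> D = tangent (incl W.W.N W1) D))" (is "?W1 \<and> ?W2 \<and> ?W3 \<and> ?R1 \<and> ?R2 \<and> ?R3")
  by (elim exE) (rule that)
 then have W1: ?W1 ?W2 ?W3 and \<rho>: ?R1 ?R2 by simp_all
 note ret = conjunct2[OF conjunct2[OF conjunct2[OF conjunct2[OF conjunct2[OF E]]]], rule_format]
 interpret W1: gdomain m w W1 by (rule W.W.sub[OF W1(1)])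
 define iW where "iW = incl W.W.N W1"
 note iW = W.W.incl_domain(1,2)[OF W1(1,3), folded iW_def]
 interpret iW: open_embedding W1.N W.W.N iW by (rule iW(2))
 note ret = ret[folded iW_def]
 \<comment> \<open>The bounds on the degrees of the two charts enter here: the universal property
   may be tested on n-manifolds only.\<close>
 have nW1: "n_manifold n W1.N" by (rule W1.n_manifold_domain) (use cX(2) cY(2) in "auto simp: w_def")
 note ms2 = ms1 \<rho>(1)[THEN morsD] iW(1)[THEN morsD]
 have "f \<odot> (\<phi>X \<odot> (prX \<odot> \<rho>)) = g \<odot> (\<phi>Y \<odot> (prY \<odot> \<rho>))"
  using arg_cong[OF \<rho>(2), of "\<lambda>h. \<phi>Z \<odot> h"] ms2 by (simp add: \<alpha>_def \<beta>_def comp_rw[OF gY(2)] comp_rw[OF fX(2)])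
 then obtain c where c: "c \<in> mors W1.N P" "p1 \<odot> c = \<phi>X \<odot> (prX \<odot> \<rho>)" "p2 \<odot> c = \<phi>Y \<odot> (prY \<odot> \<rho>)"
  using univ[OF nW1, of "\<phi>X \<odot> (prX \<odot> \<rho>)" "\<phi>Y \<odot> (prY \<odot> \<rho>)"] ms2 by (auto simp: mors_iff)
 \<comment> \<open>A chart of \<open>P\<close> inside this set has both projections landing in the
   chosen charts, so that they lift to a map into the product.\<close>
 define V where "V = preim p1 (bmap \<phi>X ` X0) \<inter> preim p2 (bmap \<phi>Y ` Y0)"
 have V: "gopen P V" "q \<in> V"
  using p1.preim_open[OF \<phi>X.open_image[OF X0.open_UU]] p2.preim_open[OF \<phi>Y.open_image[OF Y0.open_UU]] q cX(4) cY(4)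
  by (auto simp: V_def p1.preim_eq p2.preim_eq x_def y_def)
 obtain mN wN N0 \<phi>0 where cN: "gdomain mN wN N0" "\<forall>d\<in>set wN. d \<le> n" "open_embedding (gdom mN wN N0) P \<phi>0" "q \<in> bmap \<phi>0 ` N0" "bmap \<phi>0 ` N0 \<subseteq> V"
  using small_chart[OF P V] by blast
 interpret N0: gdomain mN wN N0 by (rule cN(1))
 interpret \<phi>0: open_embedding N0.N P \<phi>0 by (rule cN(3))
 have "bmap (p1 \<odot> \<phi>0) ` points N0.N \<subseteq> bmap \<phi>X ` points X0.N" "bmap (p2 \<odot> \<phi>0) ` points N0.N \<subseteq> bmap \<phi>Y ` points Y0.N"
  using cN(5) by (auto simp: X0.points_eq Y0.points_eq N0.points_eq comp_bmap \<phi>0.dom V_def p1.preim_eq p2.preim_eq simp del: domain_simps)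
 from \<phi>X.lift[OF comp_mors[OF \<phi>0.mor p1] this(1) N0.sheaf] \<phi>Y.lift[OF comp_mors[OF \<phi>0.mor p2] this(2) N0.sheaf]
 obtain a0 b0 where a0: "a0 \<in> mors N0.N X0.N" "\<phi>X \<odot> a0 = p1 \<odot> \<phi>0" and b0: "b0 \<in> mors N0.N Y0.N" "\<phi>Y \<odot> b0 = p2 \<odot> \<phi>0" by blast
 obtain j0 where j0: "j0 \<in> mors N0.N W.W.N" "prX \<odot> j0 = a0" "prY \<odot> j0 = b0" using W.pair[OF cN(1) a0(1) b0(1)] by blast
 interpret j0: domain_morphism mN wN N0 m w W0 j0 using j0(1) by unfold_locales
 obtain t0 where t0: "t0 \<in> N0" "bmap \<phi>0 t0 = q" using cN(4) by blast
 obtain \<tau> where \<tau>: "\<tau> \<in> mors one_point N0.N" "bmap \<tau> (\<lambda>_. 0) = t0" using N0.point_exists[OF t0(1)] by blast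
 note ms3 = ms2 c(1)[THEN morsD] \<phi>0.mor[THEN morsD] a0(1)[THEN morsD] b0(1)[THEN morsD] j0(1)[THEN morsD] \<tau>(1)[THEN morsD]
 have "bmap \<phi>X (bmap a0 t0) = x" "bmap \<phi>Y (bmap b0 t0) = y"
  using arg_cong[OF a0(2), of "\<lambda>h. bmap h t0"] arg_cong[OF b0(2), of "\<lambda>h. bmap h t0"] t0 ms3
  by (simp_all add: comp_bmap N0.points_eq x_def y_def del: domain_simps)
 then have ab0: "bmap a0 t0 = x0" "bmap b0 t0 = y0"
  using inj_onD[OF \<phi>X.inj] inj_onD[OF \<phi>Y.inj] morphism.bmap_closed[OF morphismI[OF a0(1)]] morphism.bmap_closed[OF morphismI[OF b0(1)]] t0(1) x0 y0
  unfolding X0.points_eq Y0.points_eq N0.points_eq by metis+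
 \<comment> \<open>The base points of the chart of \<open>P\<close> and of the product agree, also
   as points in the graded sense. Hence \<open>j0\<close> sends \<open>t0\<close> into
   \<open>W1\<close>, and the chart can be shrunk to the preimage of \<open>W1\<close>.\<close>
 have "a0 \<odot> \<tau> = \<pi>X"
  by (rule X0.point_eqI[OF comp_mors[OF \<tau>(1) a0(1)] \<pi>X(1)]) (use ab0 pt0 \<tau>(2) \<pi>X(2) ms3 in "simp add: comp_bmap")
 moreover have "b0 \<odot> \<tau> = \<pi>Y"
  by (rule Y0.point_eqI[OF comp_mors[OF \<tau>(1) b0(1)] \<pi>Y(1)]) (use ab0 pt0 \<tau>(2) \<pi>Y(2) ms3 in "simp add: comp_bmap")
 ultimately have "j0 \<odot> \<tau> = \<pi>"
  by (intro W.pair_eqI[OF gdomain_point comp_mors[OF \<tau>(1) j0(1), unfolded one_point_def] \<pi>(1)[unfolded one_point_def]])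
    (use ms3 \<pi>(2,3) in "simp_all add: comp_rw[OF j0(2)] comp_rw[OF j0(3)]")
 then have "bmap j0 t0 \<in> W1" using W1(2) comp_bmap[of "\<lambda>_. 0" \<tau> j0] pt0 \<tau>(2) ms3 by simp
 define N1 where "N1 = preim j0 W1"
 have N1: "eopen mN N1" "N1 \<subseteq> N0" using j0.preim_open'[OF W1(1,3)] by (auto simp: N1_def)
 have t01: "t0 \<in> N1" using \<open>bmap j0 t0 \<in> W1\<close> t0(1) unfolding N1_def j0.preim_iff by blast
 interpret N1: gdomain mN wN N1 by (rule N0.sub[OF N1(1)])
 define iN where "iN = incl N0.N N1"
 note iN = N0.incl_domain(1,2,4)[OF N1, folded iN_def]
 interpret iN: open_embedding N1.N N0.N iN by (rule iN(2))
 have "bmap (j0 \<odot> iN) ` points N1.N \<subseteq> bmap iW ` points W1.N"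
 proof
  fix s assume "s \<in> bmap (j0 \<odot> iN) ` points N1.N"
  then obtain t where t: "t \<in> N1" "s = bmap j0 t" unfolding N1.points_eq using iN(3) by (auto simp: comp_bmap iN.dom N1.points_eq simp del: domain_simps)
  then have "s \<in> W1" unfolding N1_def j0.preim_iff by blast
  then show "s \<in> bmap iW ` points W1.N" unfolding W1.points_eq iW_def by (force simp: W.W.incl_domain(4)[OF W1(1,3)])
 qed
 from iW.lift[OF comp_mors[OF iN(1) j0(1)] this N1.sheaf]
 obtain j where j: "j \<in> mors N1.N W1.N" "iW \<odot> j = j0 \<odot> iN" by blast
 define \<phi> where "\<phi> = \<phi>0 \<odot> iN"
 have \<phi>e: "open_embedding N1.N P \<phi>" unfolding \<phi>_def open_embedding_def using open_emb_comp[OF iN.emb \<phi>0.emb] N1.sheaf \<phi>0.sheaf_N by simp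
 interpret \<phi>: open_embedding N1.N P \<phi> by (rule \<phi>e)
 note ms4 = ms3 iN(1)[THEN morsD] j(1)[THEN morsD]
 note rws = comp_rw[OF gY(2)] comp_rw[OF fX(2)] comp_rw[OF a0(2)] comp_rw[OF b0(2)] comp_rw[OF j0(2)] comp_rw[OF j0(3)] comp_rw[OF j(2)]
  comp_rw[OF c(2)] comp_rw[OF c(3)] comp_rw[OF fp]
 have \<alpha>\<beta>j: "\<alpha> \<odot> (iW \<odot> j) = \<beta> \<odot> (iW \<odot> j)"
  by (rule \<phi>Z.mono[OF comp_mors[OF comp_mors[OF j(1) iW(1)] \<alpha>] comp_mors[OF comp_mors[OF j(1) iW(1)] \<beta>]])
    (use ms4 in "simp add: \<alpha>_def \<beta>_def rws j(2)")
 have \<rho>j: "\<rho> \<odot> j = j0 \<odot> iN" using ret[OF N1.gdomain_axioms j(1) \<alpha>\<beta>j] j(2) by simp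
 have nN1: "n_manifold n N1.N" by (rule N1.n_manifold_domain[OF cN(2)])
 \<comment> \<open>The map \<open>j\<close> solves the equations, so \<open>\<rho>\<close> fixes it
   and \<open>c \<odot> j\<close> has the same two components as \<open>\<phi>\<close>.\<close>
 have "\<exists>!h. h \<in> mors N1.N P \<and> p1 \<odot> h = p1 \<odot> \<phi> \<and> p2 \<odot> h = p2 \<odot> \<phi>"
  by (rule univ[OF nN1 comp_mors[OF \<phi>.mor p1] comp_mors[OF \<phi>.mor p2]]) (use ms4 in "simp add: \<phi>_def rws")
 moreover have "p1 \<odot> (c \<odot> j) = p1 \<odot> \<phi>" "p2 \<odot> (c \<odot> j) = p2 \<odot> \<phi>" using ms4 by (simp_all add: \<phi>_def rws \<rho>j)
 ultimately have cj: "c \<odot> j = \<phi>" using comp_mors[OF j(1) c(1)] \<phi>.mor by blast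
 have "lifts_derivations f g p1 p2 (\<phi> \<odot> h)" if T: "gdomain mT wT T0" and h: "h \<in> mors (gdom mT wT T0) N1.N" for mT wT T0 h
  unfolding lifts_derivations_def
 proof (intro conjI allI impI)
  interpret T: gdomain mT wT T0 by (rule T)
  note ms5 = ms4 h[THEN morsD]
  have hj: "j \<odot> h \<in> mors (gdom mT wT T0) W1.N" and h0: "j0 \<odot> (iN \<odot> h) \<in> mors (gdom mT wT T0) W.W.N"
   using ms5 by (simp_all add: mors_iff)
  fix k
  have d0: "tangent j0 (tangent iN E) \<in> ders (j0 \<odot> (iN \<odot> h)) k" if "E \<in> ders h k" for E
   using that ms5 by (simp add: morphic_tangent_der)
  have dX: "tangent prX (tangent j0 (tangent iN E)) \<in> ders (prX \<odot> (j0 \<odot> (iN \<odot> h))) k"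
   "tangent prY (tangent j0 (tangent iN E)) \<in> ders (prY \<odot> (j0 \<odot> (iN \<odot> h))) k" if "E \<in> ders h k" for E
   using d0[OF that] ms5 by (auto intro!: morphic_tangent_der)
  fix E E' assume E: "E \<in> ders (\<phi> \<odot> h) k" "E' \<in> ders (\<phi> \<odot> h) k" and e: "tangent p1 E = tangent p1 E'" "tangent p2 E = tangent p2 E'"
  obtain D D' where D: "D \<in> ders h k" "D' \<in> ders h k" and DE: "tangent \<phi> D = E" "tangent \<phi> D' = E'"
   using \<phi>.derivation_lift[OF h E(1) T.sheaf] \<phi>.derivation_lift[OF h E(2) T.sheaf] by blast
  note e = e[folded DE]
  have "tangent j0 (tangent iN D) = tangent j0 (tangent iN D')"
  proof (rule W.der_pair_eqI[OF T h0 d0[OF D(1)] d0[OF D(2)]])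
   show "tangent prX (tangent j0 (tangent iN D)) = tangent prX (tangent j0 (tangent iN D'))"
    by (rule \<phi>X.tangent_inj[OF comp_mors[OF h0 W.prX] dX(1)[OF D(1)] dX(1)[OF D(2)]]) (use e(1) ms5 in "simp add: \<phi>_def rws")
   show "tangent prY (tangent j0 (tangent iN D)) = tangent prY (tangent j0 (tangent iN D'))"
    by (rule \<phi>Y.tangent_inj[OF comp_mors[OF h0 W.prY] dX(2)[OF D(1)] dX(2)[OF D(2)]]) (use e(2) ms5 in "simp add: \<phi>_def rws")
  qed
  then have "tangent iW (tangent j D) = tangent iW (tangent j D')" using ms5 by (simp add: rws)
  then have "tangent j D = tangent j D'"
   by (rule iW.tangent_inj[OF hj tangent_derivation[OF h j(1) D(1)] tangent_derivation[OF h j(1) D(2)]])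
  then show "E = E'" unfolding DE[symmetric] cj[symmetric] using ms5 by simp
 next
  fix k A B assume A: "A \<in> ders (p1 \<odot> (\<phi> \<odot> h)) k" and B: "B \<in> ders (p2 \<odot> (\<phi> \<odot> h)) k" and e: "tangent f A = tangent g B"
  interpret T: gdomain mT wT T0 by (rule T)
  note ms5 = ms4 h[THEN morsD]
  have hj: "j \<odot> h \<in> mors T.N W1.N" and h0: "j0 \<odot> (iN \<odot> h) \<in> mors T.N W.W.N" using ms5 by (simp_all add: mors_iff)
  have eX: "p1 \<odot> (\<phi> \<odot> h) = \<phi>X \<odot> (prX \<odot> (j0 \<odot> (iN \<odot> h)))" and eY: "p2 \<odot> (\<phi> \<odot> h) = \<phi>Y \<odot> (prY \<odot> (j0 \<odot> (iN \<odot> h)))"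
   using ms5 by (simp_all add: \<phi>_def rws)
  obtain A' where A': "A' \<in> ders (prX \<odot> (j0 \<odot> (iN \<odot> h))) k" "tangent \<phi>X A' = A"
   using \<phi>X.derivation_lift[OF comp_mors[OF h0 W.prX] A[unfolded eX] T.sheaf] by blast
  obtain B' where B': "B' \<in> ders (prY \<odot> (j0 \<odot> (iN \<odot> h))) k" "tangent \<phi>Y B' = B"
   using \<phi>Y.derivation_lift[OF comp_mors[OF h0 W.prY] B[unfolded eY] T.sheaf] by blast
  obtain D0 where D0: "D0 \<in> ders (j0 \<odot> (iN \<odot> h)) k" "tangent prX D0 = A'" "tangent prY D0 = B'"
   using W.der_pair[OF T h0 A'(1) B'(1)] by blast
  have hj0: "iW \<odot> (j \<odot> h) = j0 \<odot> (iN \<odot> h)" using ms5 by (simp add: rws)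
  obtain D1 where D1: "D1 \<in> ders (j \<odot> h) k" "tangent iW D1 = D0"
   using iW.derivation_lift[OF hj D0(1)[folded hj0] T.sheaf] by blast
  have \<alpha>\<beta>h: "\<alpha> \<odot> (iW \<odot> (j \<odot> h)) = \<beta> \<odot> (iW \<odot> (j \<odot> h))"
   using arg_cong[OF \<alpha>\<beta>j, of "\<lambda>a. a \<odot> h"] ms5 \<alpha>[THEN morsD] \<beta>[THEN morsD] by simp
  have "tangent \<alpha> D0 = tangent \<beta> D0"
  proof (rule \<phi>Z.tangent_inj[OF comp_mors[OF h0 \<alpha>] tangent_derivation[OF h0 \<alpha> D0(1)]])
   show "tangent \<beta> D0 \<in> ders (\<alpha> \<odot> (j0 \<odot> (iN \<odot> h))) k"
    using tangent_derivation[OF h0 \<beta> D0(1)] \<alpha>\<beta>h unfolding hj0 by simp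
   show "tangent \<phi>Z (tangent \<alpha> D0) = tangent \<phi>Z (tangent \<beta> D0)"
    using e D0(2,3) A'(2) B'(2) ms5 by (simp add: \<alpha>_def \<beta>_def rws)
  qed
  then have "tangent \<rho> D1 = D0" using ret[OF T hj \<alpha>\<beta>h] D1 by blast
  moreover have "tangent c D1 \<in> ders (\<phi> \<odot> h) k"
   using tangent_derivation[OF hj c(1) D1(1)] arg_cong[OF cj, of "\<lambda>a. a \<odot> h"] ms5 by simp
  ultimately show "\<exists>D\<in>ders (\<phi> \<odot> h) k. tangent p1 D = A \<and> tangent p2 D = B"
   using D0 A'(2) B'(2) ms5 by (intro bexI[of _ "tangent c D1"]) (simp_all add: rws)
 qed
 moreover have "q \<in> bmap \<phi> ` N1"
  using t01 t0(2) by (force simp: \<phi>_def comp_bmap iN.dom N1.points_eq iN(3) simp del: domain_simps)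
 ultimately show ?thesis using N1.gdomain_axioms \<phi>e by blast
qed

section \<open>Derivations into a fibre product, globally\<close>

locale fibre_product =
 fixes n :: nat and X :: "('p, 'a::real_vector) graded_space" and Y :: "('r, 'c::real_vector) graded_space"
  and Z :: "('q, 'b::real_vector) graded_space" and P :: "('s, 'd::real_vector) graded_space" and f g p1 p2
 assumes X: "n_manifold n X" and Y: "n_manifold n Y" and Z: "n_manifold n Z" and f: "f \<in> mors X Z" and g: "g \<in> mors Y Z"
  and sub: "submersion g" and fib: "is_fibre_product n f g P p1 p2"
begin

lemma fib_simps: "n_manifold n P" "p1 \<in> mors P X" "p2 \<in> mors P Y" "f \<odot> p1 = g \<odot> p2"
 using fib f g by (simp_all add: is_fibre_product_def mors_iff)

lemma chart_cover:
 assumes K: "n_manifold n K" and h: "\<forall>x\<in>points K. gopen K (V x) \<and> x \<in> V x"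
 shows "\<exists>m w U \<kappa>. open_cover K (points K) (\<lambda>x. gdom (m x) (w x) (U x)) \<kappa> \<and>
  (\<forall>x\<in>points K. gdomain (m x) (w x) (U x) \<and> (\<forall>d\<in>set (w x). d \<le> n) \<and> bmap (\<kappa> x) ` U x \<subseteq> V x)"
proof -
 have "\<forall>x\<in>points K. \<exists>c. case c of (m, w, U0, \<phi>) => gdomain m w U0 \<and> (\<forall>d\<in>set w. d \<le> n) \<and> open_embedding (gdom m w U0) K \<phi> \<and>
   x \<in> bmap \<phi> ` U0 \<and> bmap \<phi> ` U0 \<subseteq> V x"
  using small_chart[OF K] h by (simp add: split_paired_Ex)
 from bchoice[OF this] obtain c where c: "\<forall>x\<in>points K. case c x of (m, w, U0, \<phi>) => gdomain m w U0 \<and> (\<forall>d\<in>set w. d \<le> n) \<and>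
   open_embedding (gdom m w U0) K \<phi> \<and> x \<in> bmap \<phi> ` U0 \<and> bmap \<phi> ` U0 \<subseteq> V x" by blast
 define m w U \<kappa> where "m x = fst (c x)" and "w x = fst (snd (c x))" and "U x = fst (snd (snd (c x)))" and "\<kappa> x = snd (snd (snd (c x)))" for x
 have c': "gdomain (m x) (w x) (U x) \<and> (\<forall>d\<in>set (w x). d \<le> n) \<and> open_embedding (gdom (m x) (w x) (U x)) K (\<kappa> x) \<and>
   x \<in> bmap (\<kappa> x) ` U x \<and> bmap (\<kappa> x) ` U x \<subseteq> V x" if "x \<in> points K" for x
  using c that by (auto simp: m_def w_def U_def \<kappa>_def split_beta)
 have emb: "open_embedding (gdom (m x) (w x) (U x)) K (\<kappa> x)" if "x \<in> points K" for x using c'[OF that] by (elim conjE)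
 have pt: "x \<in> bmap (\<kappa> x) ` points (gdom (m x) (w x) (U x))" if "x \<in> points K" for x
 proof -
  have "gdomain (m x) (w x) (U x)" using c'[OF that] by blast
  then show ?thesis unfolding gdomain.points_eq[OF \<open>gdomain (m x) (w x) (U x)\<close>] using c'[OF that] by blast
 qed
 have "open_cover K (points K) (\<lambda>x. gdom (m x) (w x) (U x)) \<kappa>"
  by (rule open_cover.intro[OF emb n_manifold_sheaf[OF K]]) (assumption, use pt in blast)
 then show ?thesis using c' by blast
qed

text \<open>The universal property quantifies over \<open>univ_space\<close> only, while
  \<open>K\<close> may have any types. Its charts have graded domains as sources, and these are of
  the right type.\<close>

lemma eqI:
 assumes K: "n_manifold n K" and h: "h \<in> mors K P" "h' \<in> mors K P" "p1 \<odot> h = p1 \<odot> h'" "p2 \<odot> h = p2 \<odot> h'"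
 shows "h = h'"
proof -
 have "\<forall>x\<in>points K. gopen K (points K) \<and> x \<in> points K" by simp
 from chart_cover[OF K this] obtain m w U \<kappa> where cov: "open_cover K (points K) (\<lambda>x. gdom (m x) (w x) (U x)) \<kappa>"
  and c: "\<forall>x\<in>points K. gdomain (m x) (w x) (U x) \<and> (\<forall>d\<in>set (w x). d \<le> n)" by blast
 show ?thesis
 proof (rule open_cover.mors_cover_eqI[OF cov h(1,2)])
  fix x assume x: "x \<in> points K"
  let ?T = "gdom (m x) (w x) (U x)"
  note \<kappa> = open_cover.chart_mors[OF cov x]
  have nT: "n_manifold n ?T" using c x gdomain.n_manifold_domain by blast
  note ms = fib_simps(2,3)[THEN morsD] f[THEN morsD] g[THEN morsD] h(1,2)[THEN morsD] \<kappa>[THEN morsD]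
  have "\<exists>!g'. g' \<in> mors ?T P \<and> p1 \<odot> g' = p1 \<odot> (h \<odot> \<kappa> x) \<and> p2 \<odot> g' = p2 \<odot> (h \<odot> \<kappa> x)"
   using fib nT ms unfolding is_fibre_product_def by (simp add: mors_iff comp_rw[OF fib_simps(4)])
  moreover have "p1 \<odot> (h \<odot> \<kappa> x) = p1 \<odot> (h' \<odot> \<kappa> x)" "p2 \<odot> (h \<odot> \<kappa> x) = p2 \<odot> (h' \<odot> \<kappa> x)"
   using ms by (simp_all add: comp_rw[OF h(3)] comp_rw[OF h(4)])
  ultimately show "h \<odot> \<kappa> x = h' \<odot> \<kappa> x" using comp_mors[OF \<kappa> h(1)] comp_mors[OF \<kappa> h(2)] by metis
 qed
qed

text \<open>The charts of \<open>K\<close> are taken so small that \<open>h\<close> sends each of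
  them into one of the charts of \<open>P\<close> found in \<open>fibre_chart\<close>.\<close>

lemma local_charts:
 assumes K: "n_manifold n K" and h: "h \<in> mors K P"
 obtains m w U \<kappa> where "open_cover K (points K) (\<lambda>x. gdom (m x) (w x) (U x)) \<kappa>"
  "\<forall>x\<in>points K. gdomain (m x) (w x) (U x) \<and> (\<forall>d\<in>set (w x). d \<le> n) \<and> lifts_derivations f g p1 p2 (h \<odot> \<kappa> x)"
proof -
 interpret h: morphism K P h by (rule morphismI[OF h])
 have "\<forall>q\<in>points P. \<exists>V. gopen P V \<and> q \<in> V \<and>
  (\<forall>mT wT T0. \<forall>h'\<in>mors (gdom mT wT T0) P. gdomain mT wT T0 --> bmap h' ` T0 \<subseteq> V --> lifts_derivations f g p1 p2 h')"
 proof
  fix q assume q: "q \<in> points P"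
  obtain m w U0 \<phi> where c: "gdomain m w U0" "open_embedding (gdom m w U0) P \<phi>" "q \<in> bmap \<phi> ` U0"
   and L: "\<forall>mT wT T0 h. gdomain mT wT T0 --> h \<in> mors (gdom mT wT T0) (gdom m w U0) --> lifts_derivations f g p1 p2 (\<phi> \<odot> h)"
   using fibre_chart[OF X Y Z f g sub fib q] by (elim exE conjE) (rule that)
  interpret U: gdomain m w U0 by (rule c(1))
  interpret \<phi>: open_embedding "gdom m w U0" P \<phi> by (rule c(2))
  have "lifts_derivations f g p1 p2 h'" if T: "gdomain mT wT T0" and h': "h' \<in> mors (gdom mT wT T0) P" "bmap h' ` T0 \<subseteq> bmap \<phi> ` U0" for mT wT T0 h'
  proof -
   interpret T: gdomain mT wT T0 by (rule T)
   obtain l where l: "l \<in> mors T.N U.N" "\<phi> \<odot> l = h'"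
    using \<phi>.lift[OF h'(1) _ T.sheaf] h'(2) unfolding T.points_eq U.points_eq by blast
   show ?thesis using L[rule_format, OF T l(1)] unfolding l(2) .
  qed
  then show "\<exists>V. gopen P V \<and> q \<in> V \<and>
   (\<forall>mT wT T0. \<forall>h'\<in>mors (gdom mT wT T0) P. gdomain mT wT T0 --> bmap h' ` T0 \<subseteq> V --> lifts_derivations f g p1 p2 h')"
   using \<phi>.open_image[OF U.open_UU] c(3) by (intro exI[of _ "bmap \<phi> ` U0"]) simp
 qed
 from bchoice[OF this] obtain V where V: "\<forall>q\<in>points P. gopen P (V q) \<and> q \<in> V q \<and>
  (\<forall>mT wT T0. \<forall>h'\<in>mors (gdom mT wT T0) P. gdomain mT wT T0 --> bmap h' ` T0 \<subseteq> V q --> lifts_derivations f g p1 p2 h')"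
  by (elim exE) (rule that)
 have "\<forall>x\<in>points K. gopen K (preim h (V (bmap h x))) \<and> x \<in> preim h (V (bmap h x))"
 proof
  fix x assume x: "x \<in> points K"
  have "gopen P (V (bmap h x))" "bmap h x \<in> V (bmap h x)" using bspec[OF V h.bmap_closed[OF x]] by blast+
  then show "gopen K (preim h (V (bmap h x))) \<and> x \<in> preim h (V (bmap h x))"
   using h.preim_open x unfolding h.preim_eq by blast
 qed
 from chart_cover[OF K this] obtain m w U \<kappa> where cov: "open_cover K (points K) (\<lambda>x. gdom (m x) (w x) (U x)) \<kappa>"
  and c: "\<forall>x\<in>points K. gdomain (m x) (w x) (U x) \<and> (\<forall>d\<in>set (w x). d \<le> n) \<and> bmap (\<kappa> x) ` U x \<subseteq> preim h (V (bmap h x))"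
  by (elim exE conjE) (rule that)
 have "lifts_derivations f g p1 p2 (h \<odot> \<kappa> x)" if x: "x \<in> points K" for x
 proof -
  note \<kappa> = open_cover.chart_mors[OF cov x]
  have g: "gdomain (m x) (w x) (U x)" using c x by blast
  have "bmap (h \<odot> \<kappa> x) ` U x \<subseteq> V (bmap h x)"
   using c x \<kappa>[THEN morsD] gdomain.points_eq[OF g] by (auto simp: comp_bmap h.preim_eq simp del: domain_simps)
  then show ?thesis
   by (rule mp[OF mp[OF bspec[OF spec[OF spec[OF spec[OF conjunct2[OF conjunct2[OF bspec[OF V h.bmap_closed[OF x]]]]]]] comp_mors[OF \<kappa> h]] g]])
 qed
 then show thesis using that[OF cov] c by blast
qed

lemma derivations_eqI:
 assumes K: "n_manifold n K" and h: "h \<in> mors K P" and D: "D \<in> ders h k" "D' \<in> ders h k"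
  and eq: "tangent p1 D = tangent p1 D'" "tangent p2 D = tangent p2 D'"
 shows "D = D'"
proof -
 note shK = n_manifold_sheaf[OF K]
 obtain m w U \<kappa> where cov: "open_cover K (points K) (\<lambda>x. gdom (m x) (w x) (U x)) \<kappa>"
  and c: "\<forall>x\<in>points K. lifts_derivations f g p1 p2 (h \<odot> \<kappa> x)"
  by (rule local_charts[OF K h]) (rule that, assumption, blast)
 show ?thesis
 proof (rule open_cover.derivations_cover_eqI[OF cov h D])
  fix x assume x: "x \<in> points K"
  note \<kappa> = open_cover.chart_mors[OF cov x]
  have "tangent p1 (precomp h D (\<kappa> x)) = tangent p1 (precomp h D' (\<kappa> x))" "tangent p2 (precomp h D (\<kappa> x)) = tangent p2 (precomp h D' (\<kappa> x))"
   unfolding precomp_tangent[OF h fib_simps(2), symmetric] precomp_tangent[OF h fib_simps(3), symmetric] eq by simp_all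
  then show "precomp h D (\<kappa> x) = precomp h D' (\<kappa> x)"
   using c[rule_format, OF x, unfolded lifts_derivations_def, THEN conjunct1, rule_format, OF precomp_derivation[OF \<kappa> h D(1) shK] precomp_derivation[OF \<kappa> h D(2) shK]] by blast
 qed
qed

text \<open>Lifts exist over the charts. On overlaps they have the same components, so they agree by
  uniqueness and glue.\<close>

theorem derivation_exists:
 assumes K: "n_manifold n K" and h: "h \<in> mors K P"
  and A: "A \<in> ders (p1 \<odot> h) k" and B: "B \<in> ders (p2 \<odot> h) k" and AB: "tangent f A = tangent g B"
 shows "\<exists>D\<in>ders h k. tangent p1 D = A \<and> tangent p2 D = B"
proof -
 note shK = n_manifold_sheaf[OF K]
 note p1 = fib_simps(2) and p2 = fib_simps(3)
 note hp1 = comp_mors[OF h p1] and hp2 = comp_mors[OF h p2]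
 obtain m w U \<kappa> where cov: "open_cover K (points K) (\<lambda>x. gdom (m x) (w x) (U x)) \<kappa>"
  and c: "\<forall>x\<in>points K. gdomain (m x) (w x) (U x) \<and> (\<forall>d\<in>set (w x). d \<le> n) \<and> lifts_derivations f g p1 p2 (h \<odot> \<kappa> x)"
  by (rule local_charts[OF K h]) (rule that, assumption, blast)
 let ?T = "\<lambda>x. gdom (m x) (w x) (U x)"
 have \<kappa>: "\<kappa> x \<in> mors (?T x) K" if "x \<in> points K" for x using open_cover.chart_mors[OF cov that] .
 have ga: "p1 \<odot> (h \<odot> \<kappa> x) = (p1 \<odot> h) \<odot> \<kappa> x" "p2 \<odot> (h \<odot> \<kappa> x) = (p2 \<odot> h) \<odot> \<kappa> x" if "x \<in> points K" for x
  using comp_assoc[OF \<kappa>[OF that] h p1] comp_assoc[OF \<kappa>[OF that] h p2] by simp_all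
 have "\<exists>D\<in>ders (h \<odot> \<kappa> x) k. tangent p1 D = precomp (p1 \<odot> h) A (\<kappa> x) \<and> tangent p2 D = precomp (p2 \<odot> h) B (\<kappa> x)"
  if x: "x \<in> points K" for x
 proof -
  have "tangent f (precomp (p1 \<odot> h) A (\<kappa> x)) = precomp (f \<odot> (p1 \<odot> h)) (tangent f A) (\<kappa> x)" by (rule precomp_tangent[OF hp1 f, symmetric])
  also have "f \<odot> (p1 \<odot> h) = g \<odot> (p2 \<odot> h)"
   using fib_simps(4) comp_assoc[OF h p1 f] comp_assoc[OF h p2 g] by simp
  also have "precomp (g \<odot> (p2 \<odot> h)) (tangent f A) (\<kappa> x) = tangent g (precomp (p2 \<odot> h) B (\<kappa> x))" unfolding AB by (rule precomp_tangent[OF hp2 g])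
  finally have e: "tangent f (precomp (p1 \<odot> h) A (\<kappa> x)) = tangent g (precomp (p2 \<odot> h) B (\<kappa> x))" .
  have "lifts_derivations f g p1 p2 (h \<odot> \<kappa> x)" using c x by blast
  from this[unfolded lifts_derivations_def ga[OF x], THEN conjunct2, rule_format, OF precomp_derivation[OF \<kappa>[OF x] hp1 A shK] precomp_derivation[OF \<kappa>[OF x] hp2 B shK] e]
  show ?thesis .
 qed
 then obtain D where D: "\<And>x. x \<in> points K ==> D x \<in> ders (h \<odot> \<kappa> x) k"
  "\<And>x. x \<in> points K ==> tangent p1 (D x) = precomp (p1 \<odot> h) A (\<kappa> x)" "\<And>x. x \<in> points K ==> tangent p2 (D x) = precomp (p2 \<odot> h) B (\<kappa> x)" by metis
 have "\<exists>E\<in>ders h k. \<forall>i\<in>points K. precomp h E (\<kappa> i) = D i"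
 proof (rule open_cover.derivations_glue[OF cov h n_manifold_sheaf[OF fib_simps(1)] D(1)])
  fix i j W \<mu> assume i: "i \<in> points K" and j: "j \<in> points K" and W: "gopen (?T i) W" and \<mu>: "\<mu> \<in> mors (open_subspace (?T i) W) (?T j)"
   and e: "\<kappa> i \<odot> incl (?T i) W = \<kappa> j \<odot> \<mu>"
  interpret Ti: gdomain "m i" "w i" "U i" using c i by blast
  interpret Tj: gdomain "m j" "w j" "U j" using c j by blast
  have Wo: "eopen (m i) W" "W \<subseteq> U i" using W unfolding Ti.openin_iff by auto
  interpret W: gdomain "m i" "w i" W by (rule Ti.sub[OF Wo(1)])
  note \<iota> = Ti.incl_domain(1)[OF Wo]
  have \<mu>': "\<mu> \<in> mors W.N (?T j)" using \<mu> unfolding Ti.open_subspace_eq[OF Wo(2)] .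
  have nW: "n_manifold n W.N" using c i W.n_manifold_domain by blast
  note hi = comp_mors[OF \<kappa>[OF i] h] and hj = comp_mors[OF \<kappa>[OF j] h]
  have hh: "(h \<odot> \<kappa> i) \<odot> incl (?T i) W = (h \<odot> \<kappa> j) \<odot> \<mu>"
   using comp_assoc[OF \<iota> \<kappa>[OF i] h] comp_assoc[OF \<mu>' \<kappa>[OF j] h] e by simp
  have p: "tangent p (precomp (h \<odot> \<kappa> x) (D x) \<nu>) = precomp (p \<odot> h) C (\<kappa> x \<odot> \<nu>)"
   if x: "x \<in> points K" and p: "p \<in> mors P Q" and d: "tangent p (D x) = precomp (p \<odot> h) C (\<kappa> x)" for x p C \<nu> and Q :: "('x, 'y::real_vector) graded_space"
  proof -
   have "tangent p (precomp (h \<odot> \<kappa> x) (D x) \<nu>) = precomp (p \<odot> (h \<odot> \<kappa> x)) (tangent p (D x)) \<nu>"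
    by (rule precomp_tangent[OF comp_mors[OF \<kappa>[OF x] h] p, symmetric])
   also have "\<dots> = precomp (p \<odot> h) C (\<kappa> x \<odot> \<nu>)"
    unfolding d comp_assoc[OF \<kappa>[OF x] h p, symmetric] by (rule precomp_comp[OF \<kappa>[OF x] comp_mors[OF h p]])
   finally show ?thesis .
  qed
  show "precomp (h \<odot> \<kappa> i) (D i) (incl (?T i) W) = precomp (h \<odot> \<kappa> j) (D j) \<mu>"
  \<comment> \<open>The overlap is an open part of a chart, hence a graded domain and an n-manifold,
    so uniqueness is available on it.\<close>
  proof (rule derivations_eqI[OF nW comp_mors[OF \<iota> hi] precomp_derivation[OF \<iota> hi D(1)[OF i] Ti.sheaf]])
   show "precomp (h \<odot> \<kappa> j) (D j) \<mu> \<in> ders ((h \<odot> \<kappa> i) \<odot> incl (?T i) W) k"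
    unfolding hh by (rule precomp_derivation[OF \<mu>' hj D(1)[OF j] Tj.sheaf])
   show "tangent p1 (precomp (h \<odot> \<kappa> i) (D i) (incl (?T i) W)) = tangent p1 (precomp (h \<odot> \<kappa> j) (D j) \<mu>)"
    unfolding p[OF i p1 D(2)[OF i]] p[OF j p1 D(2)[OF j]] e ..
   show "tangent p2 (precomp (h \<odot> \<kappa> i) (D i) (incl (?T i) W)) = tangent p2 (precomp (h \<odot> \<kappa> j) (D j) \<mu>)"
    unfolding p[OF i p2 D(3)[OF i]] p[OF j p2 D(3)[OF j]] e ..
  qed
 qed
 then obtain E where E: "E \<in> ders h k" "\<And>i. i \<in> points K ==> precomp h E (\<kappa> i) = D i" by blast
 have "tangent p1 E = A"
  by (rule open_cover.derivations_cover_eqI[OF cov hp1 tangent_derivation[OF h p1 E(1)] A])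
    (simp add: precomp_tangent[OF h p1] E(2) D(2))
 moreover have "tangent p2 E = B"
  by (rule open_cover.derivations_cover_eqI[OF cov hp2 tangent_derivation[OF h p2 E(1)] B])
    (simp add: precomp_tangent[OF h p2] E(2) D(3))
 ultimately show ?thesis using E(1) by blast
qed

end

section \<open>Vector fields on a graded Lie groupoid\<close>

lemma tangent_precomp:
 "morphic \<phi> ==> morphic \<psi> ==> mcod \<phi> = mdom \<psi> ==> tangent \<psi> (precomp \<phi> D \<kappa>) = precomp (\<psi> \<odot> \<phi>) (tangent \<psi> D) \<kappa>"
 using precomp_tangent[of \<phi> "mdom \<phi>" "mcod \<phi>" \<psi> "mcod \<psi>" D \<kappa>] by (simp add: morphic_def)

lemma precomp_precomp:
 "\<omega> = \<phi> \<odot> \<kappa> ==> morphic \<kappa> ==> morphic \<phi> ==> mcod \<kappa> = mdom \<phi> ==> precomp \<omega> (precomp \<phi> D \<kappa>) \<mu> = precomp \<phi> D (\<kappa> \<odot> \<mu>)"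
 using precomp_comp[of \<kappa> "mdom \<kappa>" "mcod \<kappa>" \<phi> "mcod \<phi>"] by (simp add: morphic_def)

lemma morphic_precomp_0: "morphic \<kappa> ==> precomp \<phi> 0 \<kappa> = 0"
 using precomp_0[of \<kappa> "mdom \<kappa>" "mcod \<kappa>"] by (simp add: morphic_def)

text \<open>In \<open>precomp\<close> the identity of \<open>N\<close> leaves a preimage behind,
  which is harmless over open sets; elsewhere the normalization makes both sides agree. What remains
  is that the pullback intertwines the two fields.\<close>

lemma related_iff:
 assumes \<phi>: "\<phi> \<in> mors M N" and Y: "Y \<in> vector_fields N k" and N: "graded_sheaf N"
 shows "tangent \<phi> X = precomp (id_mor N) Y \<phi> \<longleftrightarrow> (\<forall>V f. X (preim \<phi> V) (pull \<phi> V f) = pull \<phi> V (Y V f))"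
proof -
 interpret \<phi>: morphism M N \<phi> by (rule morphismI[OF \<phi>])
 interpret Y: derivation N N "id_mor N" k Y by (rule derivationI[OF id_mors[OF N] Y[unfolded vector_fields_def]])
 have "pull \<phi> (preim (id_mor N) V) (Y V f) = pull \<phi> V (Y V f)" for V f
  by (cases "gopen N V") (simp_all add: preim_id[OF openin_subset] Y.der_junk)
 then show ?thesis by (simp add: tangent_def precomp_def fun_eq_iff)
qed

lemma commutator_derivation:
 assumes M: "graded_sheaf M" and X: "X \<in> vector_fields M k" and Y: "Y \<in> vector_fields M l"
 shows "commutator k l X Y \<in> vector_fields M (k + l)"
proof -
 interpret M: gsheaf M by (simp add: gsheaf_def M)
 note i = id_mors[OF M]
 interpret X: derivation M M "id_mor M" k X by (rule derivationI[OF i X[unfolded vector_fields_def]])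
 interpret Y: derivation M M "id_mor M" l Y by (rule derivationI[OF i Y[unfolded vector_fields_def]])
 define c :: real where "c = (-1) powi (k * l)"
 have C: "commutator k l X Y V f = X V (Y V f) - c *\<^sub>R Y V (X V f)" for V f by (simp add: commutator_def c_def)
 have pre: "preim (id_mor M) V = V" if "gopen M V" for V by (rule preim_id[OF openin_subset[OF that]])
 have cl: "X V f \<in> gsec M V (j + k)" "Y V f \<in> gsec M V (j + l)" if "gopen M V" "f \<in> gsec M V j" for V f j
  using X.der_closed[OF that] Y.der_closed[OF that] pre[OF that(1)] by simp_all
 have XY: "X V (Y V f) \<in> gsec M V (j + (k + l))" "Y V (X V f) \<in> gsec M V (j + (k + l))" if "gopen M V" "f \<in> gsec M V j" for V f j
  using cl(1)[OF that(1) cl(2)[OF that]] cl(2)[OF that(1) cl(1)[OF that]] by (simp_all add: ac_simps)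
 note sub = M.subspace
 show ?thesis unfolding vector_fields_def
 proof (rule derivations_alongI[OF i])
  fix V f assume "\<not> (gopen M V \<and> f \<in> homogeneous M V)"
  then show "commutator k l X Y V f = 0" by (simp add: C X.der_junk Y.der_junk)
 next
  fix V f j assume V: "gopen M V" and f: "f \<in> gsec M V j"
  show "commutator k l X Y V f \<in> gsec M (preim (id_mor M) V) (j + (k + l))"
   unfolding C pre[OF V] by (intro subspace_diff subspace_scale sub V XY f)
 next
  fix V j assume V: "gopen M V"
  show "linear_map_on (gsec M V j) (commutator k l X Y V)"
   unfolding linear_map_on_def
   by (auto simp: C X.der_add[OF V] Y.der_add[OF V] X.der_scale[OF V] Y.der_scale[OF V] X.der_add[OF V cl(2)[OF V] cl(2)[OF V]]
     Y.der_add[OF V cl(1)[OF V] cl(1)[OF V]] X.der_scale[OF V cl(2)[OF V]] Y.der_scale[OF V cl(1)[OF V]] algebra_simps)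
 next
  fix V f g j assume V: "gopen M V" and f: "f \<in> gsec M V j" and "g \<in> homogeneous M V"
  then obtain d where g: "g \<in> gsec M V d" by (auto simp: homogeneous_def)
  interpret A: gc_algebra "gsec M V" "gmult M V" "gone M V" by (rule M.gca[OF V])
  let ?m = "gmult M V"
  have H: "h \<in> homogeneous M V" if "h \<in> gsec M V a" for h a using homogeneousI[OF that] .
  have L: "X V (?m a b) = ?m (X V a) b + ((-1) powi (k * p)) *\<^sub>R ?m a (X V b)" "Y V (?m a b) = ?m (Y V a) b + ((-1) powi (l * p)) *\<^sub>R ?m a (Y V b)"
   if "a \<in> gsec M V p" "b \<in> gsec M V q" for a b p q
   using X.leibniz[OF V that(1) H[OF that(2)]] Y.leibniz[OF V that(1) H[OF that(2)]] id_pull[OF V H[OF that(1)]] id_pull[OF V H[OF that(2)]]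
   by (simp_all add: pre[OF V])
  note fX = cl(1)[OF V f] and fY = cl(2)[OF V f] and gX = cl(1)[OF V g] and gY = cl(2)[OF V g]
  have deg: "?m f (Y V g) \<in> gsec M V (j + d + l)" "?m (Y V f) g \<in> gsec M V (j + d + l)" "?m f (X V g) \<in> gsec M V (j + d + k)" "?m (X V f) g \<in> gsec M V (j + d + k)"
   using A.closed[OF f gY] A.closed[OF fY g] A.closed[OF f gX] A.closed[OF fX g] by (simp_all add: ac_simps)
  have 1: "X V (Y V (?m f g)) = X V (?m (Y V f) g) + ((-1) powi (l * j)) *\<^sub>R X V (?m f (Y V g))"
   unfolding L(2)[OF f g] using X.der_add[OF V deg(2) A.scale[OF deg(1)]] X.der_scale[OF V deg(1)] by simp
  have 2: "Y V (X V (?m f g)) = Y V (?m (X V f) g) + ((-1) powi (k * j)) *\<^sub>R Y V (?m f (X V g))"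
   unfolding L(1)[OF f g] using Y.der_add[OF V deg(4) A.scale[OF deg(3)]] Y.der_scale[OF V deg(3)] by simp
  \<comment> \<open>These signs make the mixed terms, with one field on \<open>f\<close> and the
    other on \<open>g\<close>, cancel; \<open>c * c = 1\<close> is needed for one of the two
    pairs.\<close>
  have s: "(-1::real) powi (k * (j + l)) = (-1) powi (k * j) * c" "(-1::real) powi (l * (j + k)) = (-1) powi (l * j) * c"
   "(-1::real) powi ((k + l) * j) = (-1) powi (k * j) * (-1) powi (l * j)"
   by (simp_all add: c_def distrib_left distrib_right power_int_add mult.commute[of l k])
  have cc: "c * c = 1" unfolding c_def by (simp add: power_int_add[symmetric] power_int_minus_one_mult_self)
  have "commutator k l X Y V (?m f g) = ?m (X V (Y V f)) g - c *\<^sub>R ?m (Y V (X V f)) g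
   + ((-1) powi ((k + l) * j)) *\<^sub>R (?m f (X V (Y V g)) - c *\<^sub>R ?m f (Y V (X V g)))"
   unfolding C 1 2 L(1)[OF fY g] L(1)[OF f gY] L(2)[OF fX g] L(2)[OF f gX] s
   using cc by (simp add: algebra_simps)
  also have "?m (X V (Y V f)) g - c *\<^sub>R ?m (Y V (X V f)) g = ?m (commutator k l X Y V f) g"
   unfolding C using linear_map_on_diff[OF A.lin_left[OF g] sub[OF V] XY(1)[OF V f] A.scale[OF XY(2)[OF V f]]] A.scale_left[OF XY(2)[OF V f] g] by simp
  also have "?m f (X V (Y V g)) - c *\<^sub>R ?m f (Y V (X V g)) = ?m f (commutator k l X Y V g)"
   unfolding C using linear_map_on_diff[OF A.lin_right[OF f] sub[OF V] XY(1)[OF V g] A.scale[OF XY(2)[OF V g]]] A.scale_right[OF f XY(2)[OF V g]] by simp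
  finally show "commutator k l X Y V (gmult M V f g) = gmult M (preim (id_mor M) V) (commutator k l X Y V f) (pull (id_mor M) V g)
       + ((-1) powi ((k + l) * j)) *\<^sub>R gmult M (preim (id_mor M) V) (pull (id_mor M) V f) (commutator k l X Y V g)"
   by (simp add: pre[OF V] id_pull[OF V H[OF f]] id_pull[OF V H[OF g]])
 next
  fix V W f assume V: "gopen M V" and W: "gopen M W" "W \<subseteq> V" and "f \<in> homogeneous M V"
  then obtain j where f: "f \<in> gsec M V j" by (auto simp: homogeneous_def)
  have r: "X W (gres M V W h) = gres M V W (X V h)" "Y W (gres M V W h) = gres M V W (Y V h)" if "h \<in> gsec M V a" for h a
   using X.der_res[OF V W homogeneousI[OF that]] Y.der_res[OF V W homogeneousI[OF that]] by (simp_all add: pre V W)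
  show "commutator k l X Y W (gres M V W f) = gres M (preim (id_mor M) V) (preim (id_mor M) W) (commutator k l X Y V f)"
   unfolding C pre[OF V] pre[OF W(1)] r[OF f] r(1)[OF cl(2)[OF V f]] r(2)[OF cl(1)[OF V f]]
   using linear_map_on_diff[OF M.res_linear[OF V W] sub[OF V] XY(1)[OF V f] subspace_scale[OF sub[OF V] XY(2)[OF V f]]]
    linear_map_on_scale[OF M.res_linear[OF V W] XY(2)[OF V f]] by simp
 qed
qed

lemma commutator_related:
 assumes \<phi>: "\<phi> \<in> mors M N" and M: "graded_sheaf M" and N: "graded_sheaf N"
  and X: "X \<in> vector_fields M k" and X': "X' \<in> vector_fields N k" and XX: "tangent \<phi> X = precomp (id_mor N) X' \<phi>"
  and Y: "Y \<in> vector_fields M l" and Y': "Y' \<in> vector_fields N l" and YY: "tangent \<phi> Y = precomp (id_mor N) Y' \<phi>"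
 shows "tangent \<phi> (commutator k l X Y) = precomp (id_mor N) (commutator k l X' Y') \<phi>"
 unfolding related_iff[OF \<phi> commutator_derivation[OF N X' Y'] N]
proof (intro allI)
 fix V f
 interpret \<phi>: morphism M N \<phi> by (rule morphismI[OF \<phi>])
 note i = id_mors[OF N]
 interpret X': derivation N N "id_mor N" k X' by (rule derivationI[OF i X'[unfolded vector_fields_def]])
 interpret Y': derivation N N "id_mor N" l Y' by (rule derivationI[OF i Y'[unfolded vector_fields_def]])
 have rX: "X (preim \<phi> V) (pull \<phi> V h) = pull \<phi> V (X' V h)" for h using XX unfolding related_iff[OF \<phi> X' N] by blast
 have rY: "Y (preim \<phi> V) (pull \<phi> V h) = pull \<phi> V (Y' V h)" for h using YY unfolding related_iff[OF \<phi> Y' N] by blast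
 have "pull \<phi> V (X' V (Y' V f) - ((-1) powi (k * l)) *\<^sub>R Y' V (X' V f))
  = pull \<phi> V (X' V (Y' V f)) - ((-1) powi (k * l)) *\<^sub>R pull \<phi> V (Y' V (X' V f))"
 proof (cases "gopen N V \<and> f \<in> homogeneous N V")
  case True
  then obtain j where V: "gopen N V" and f: "f \<in> gsec N V j" by (auto simp: homogeneous_def)
  have pre: "preim (id_mor N) V = V" by (rule preim_id[OF openin_subset[OF V]])
  have "X' V (Y' V f) \<in> gsec N V (j + l + k)" "Y' V (X' V f) \<in> gsec N V (j + l + k)"
   using X'.der_closed[OF V Y'.der_closed[OF V f, unfolded pre]] Y'.der_closed[OF V X'.der_closed[OF V f, unfolded pre]] by (simp_all add: pre ac_simps)
  then show ?thesis
   using \<phi>.pull_diff[OF V _ subspace_scale[OF gsheaf.subspace[OF gsheaf.intro[OF N] V]] N] \<phi>.scale[OF V] by simp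
 qed (simp add: X'.der_junk Y'.der_junk)
 then show "commutator k l X Y (preim \<phi> V) (pull \<phi> V f) = pull \<phi> V (commutator k l X' Y' V f)"
  by (simp add: commutator_def rX rY)
qed

lemma commutator_0:
 assumes "graded_sheaf N" "X \<in> vector_fields N k" shows "commutator k l X 0 = 0"
 using derivation.der_0[OF derivationI[OF id_mors[OF assms(1)] assms(2)[unfolded vector_fields_def]]]
 by (auto simp: commutator_def fun_eq_iff)

text \<open>The groupoid axioms with the existential quantifiers unpacked. The morphism
  \<open>h\<close> sends \<open>g\<close> to the pair of the unit at its target and
  \<open>g\<close>. On a triple \<open>(g, g', g'')\<close> of \<open>E\<close> the morphism
  \<open>e\<close> is \<open>(g, g')\<close>, \<open>r\<close> is \<open>g''\<close>, and
  \<open>l\<close>, \<open>x\<close>, \<open>y\<close> are \<open>(g', g'')\<close>,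
  \<open>(g g', g'')\<close>, \<open>(g, g' g'')\<close>.\<close>

locale lie_groupoid = fibre_product n G G M P s t p q
 for n :: nat and G :: "('q, 'b::real_vector) graded_space" and M :: "('p, 'a::real_vector) graded_space"
  and P :: "('r, 'c::real_vector) graded_space" and s t p q +
 fixes m u h and E :: univ_space and e r l x y
 assumes m: "m \<in> mors P G" and u: "u \<in> mors M G" and sm: "s \<odot> m = s \<odot> q" and tm: "t \<odot> m = t \<odot> p"
  and su: "s \<odot> u = id_mor M" and h: "h \<in> mors G P" "p \<odot> h = u \<odot> t" "q \<odot> h = id_mor G" "m \<odot> h = id_mor G"
  and E: "is_fibre_product n (s \<odot> q) t E e r"
  and l: "l \<in> mors E P" "p \<odot> l = q \<odot> e" "q \<odot> l = r" and x: "x \<in> mors E P" "p \<odot> x = m \<odot> e" "q \<odot> x = r"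
  and y: "y \<in> mors E P" "p \<odot> y = p \<odot> e" "q \<odot> y = m \<odot> l" and mxy: "m \<odot> x = m \<odot> y"
begin

text \<open>The triples are again a fibre product along the submersion \<open>t\<close>, so
  derivations into them can be given by components as well.\<close>

sublocale E: fibre_product n P G M E "s \<odot> q" t e r
 using fib_simps(1) Y Z comp_mors[OF fib_simps(3) f] g sub E by unfold_locales

lemmas ms = fib_simps(2,3)[THEN morsD] f[THEN morsD] g[THEN morsD] m[THEN morsD] u[THEN morsD] h(1)[THEN morsD]
 l(1)[THEN morsD] x(1)[THEN morsD] y(1)[THEN morsD] E.fib_simps(2,3)[THEN morsD]
 id_mors[OF n_manifold_sheaf[OF X], THEN morsD] id_mors[OF n_manifold_sheaf[OF Z], THEN morsD] id_mors[OF n_manifold_sheaf[OF fib_simps(1)], THEN morsD]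

lemmas rw = comp_rw[OF sm] comp_rw[OF tm] comp_rw[OF su] comp_rw[OF h(2)] comp_rw[OF h(3)] comp_rw[OF h(4)] comp_rw[OF l(2)] comp_rw[OF l(3)]
 comp_rw[OF x(2)] comp_rw[OF x(3)] comp_rw[OF y(2)] comp_rw[OF y(3)] comp_rw[OF mxy] comp_rw[OF fib_simps(4)]

text \<open>A right-invariant field is related along the multiplication to the field \<open>(R, 0)\<close> on composable pairs. This
 comes from associativity applied to the triples \<open>(u(t(g)), g, h)\<close>, moved in the first entry only.\<close>

lemma right_invariant:
 assumes a: "a \<in> ders u k" and D: "D \<in> ders h k" "tangent p D = precomp u a t" "tangent q D = 0"
  and R': "R' \<in> vector_fields P k" "tangent p R' = precomp (id_mor G) (tangent m D) p" "tangent q R' = 0"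
 shows "tangent m R' = precomp (id_mor G) (tangent m D) m"
proof -
 define R where "R = tangent m D"
 note ss = n_manifold_sheaf[OF X] n_manifold_sheaf[OF fib_simps(1)]
 note R1 = R'(1)[unfolded vector_fields_def]
 have R: "R \<in> ders (id_mor G) k" unfolding R_def using tangent_derivation[OF h(1) m D(1)] h(4) by simp
 have mi: "m \<odot> id_mor P = m" "p \<odot> id_mor P = p" "q \<odot> id_mor P = q"
  by (rule comp_id[OF ss(2) m], rule comp_id[OF ss(2) fib_simps(2)], rule comp_id[OF ss(2) fib_simps(3)])
 \<comment> \<open>The space of composable pairs may have any type, whereas the universal property
   of \<open>E\<close> yields maps from a \<open>univ_space\<close> only. So the identity is checked
   in charts.\<close>
 have "\<forall>z\<in>points P. gopen P (points P) \<and> z \<in> points P" by simp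
 from chart_cover[OF fib_simps(1) this] obtain m' w U \<iota> where cov: "open_cover P (points P) (\<lambda>z. gdom (m' z) (w z) (U z)) \<iota>"
  and c: "\<forall>z\<in>points P. gdomain (m' z) (w z) (U z) \<and> (\<forall>d\<in>set (w z). d \<le> n)" by blast
 show ?thesis unfolding R_def[symmetric]
 proof (rule open_cover.derivations_cover_eqI[OF cov m])
  show "tangent m R' \<in> ders m k" using tangent_derivation[OF id_mors[OF ss(2)] m R1] mi(1) by simp
  show "precomp (id_mor G) R m \<in> ders m k"
   using precomp_derivation[OF m id_mors[OF ss(1)] R ss(1)] ms by simp
  fix z assume z: "z \<in> points P"
  define T where "T = gdom (m' z) (w z) (U z)"
  have nT: "n_manifold n T" unfolding T_def using c z gdomain.n_manifold_domain by blast
  note shT = n_manifold_sheaf[OF nT]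
  define i where "i = \<iota> z"
  have i: "i \<in> mors T P" unfolding i_def T_def by (rule open_cover.chart_mors[OF cov z])
  note ms1 = ms i[THEN morsD]
  \<comment> \<open>If \<open>i\<close> stands for the pair \<open>(g, g')\<close>, then
    \<open>\<kappa>\<close> is the triple \<open>(1, g, g')\<close>: its first two entries are
    \<open>h\<close> applied to \<open>g\<close>.\<close>
  have "\<exists>!\<kappa>. \<kappa> \<in> mors T E \<and> e \<odot> \<kappa> = h \<odot> (p \<odot> i) \<and> r \<odot> \<kappa> = q \<odot> i"
   using E nT ms1 unfolding is_fibre_product_def by (simp add: mors_iff rw)
  then obtain \<kappa> where \<kappa>: "\<kappa> \<in> mors T E" "e \<odot> \<kappa> = h \<odot> (p \<odot> i)" "r \<odot> \<kappa> = q \<odot> i" by blast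
  note ms2 = ms1 \<kappa>(1)[THEN morsD]
  note rw2 = rw \<kappa>(2,3) comp_rw[OF \<kappa>(2)] comp_rw[OF \<kappa>(3)]
  \<comment> \<open>The variation of the pair \<open>(1, g)\<close> that moves the unit by
    \<open>a\<close> and leaves \<open>g\<close> fixed.\<close>
  define A where "A = precomp h D (p \<odot> i)"
  have A: "A \<in> ders (e \<odot> \<kappa>) k"
   unfolding A_def \<kappa>(2) by (rule precomp_derivation[OF comp_mors[OF i fib_simps(2)] h(1) D(1) ss(1)])
  have qA: "tangent q A = 0" unfolding A_def using ms1 D(3) by (simp only: tangent_precomp morphic_precomp_0 morphic_comp comp_simps)
  have pA: "tangent p A = precomp u a (t \<odot> (p \<odot> i))"
   unfolding A_def using ms1 D(2) by (simp add: tangent_precomp precomp_precomp h(2))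
  have mA: "tangent m A = precomp (id_mor G) R (p \<odot> i)" unfolding A_def R_def using ms1 by (simp add: tangent_precomp h(4))
  have z0: "0 \<in> ders (r \<odot> \<kappa>) k" by (rule zero_derivation[OF shT comp_mors[OF \<kappa>(1) E.fib_simps(3)]])
  have "tangent (s \<odot> q) A = tangent t 0"
   using qA ms1 by (simp only: morphic_tangent tangent_0)
  then obtain \<Delta> where \<Delta>: "\<Delta> \<in> ders \<kappa> k" "tangent e \<Delta> = A" "tangent r \<Delta> = 0"
   using E.derivation_exists[OF nT \<kappa>(1) A z0] by blast
  \<comment> \<open>The triple is sent to \<open>(g, g')\<close> by \<open>l\<close> and by
    \<open>x\<close>, and to \<open>(1, g g')\<close> by \<open>y\<close>. Accordingly its variation
    \<open>\<Delta>\<close> becomes \<open>0\<close>, the lift \<open>R'\<close>, and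
    \<open>D\<close> at the product; comparing \<open>m \<odot> x\<close> with
    \<open>m \<odot> y\<close> then gives the claim.\<close>
  have l\<kappa>: "l \<odot> \<kappa> = i" by (rule eqI[OF nT comp_mors[OF \<kappa>(1) l(1)] i]) (use ms2 in "simp_all add: rw2")
  have x\<kappa>: "x \<odot> \<kappa> = i" by (rule eqI[OF nT comp_mors[OF \<kappa>(1) x(1)] i]) (use ms2 in "simp_all add: rw2")
  have hmi: "h \<odot> (m \<odot> i) \<in> mors T P" using ms2 by (simp add: mors_iff)
  have y\<kappa>: "y \<odot> \<kappa> = h \<odot> (m \<odot> i)" by (rule eqI[OF nT comp_mors[OF \<kappa>(1) y(1)] hmi]) (use ms2 in "simp_all add: rw2 l\<kappa>")
  have l\<Delta>: "tangent l \<Delta> = 0"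
  proof (rule derivations_eqI[OF nT i])
   show "tangent l \<Delta> \<in> ders i k" using tangent_derivation[OF \<kappa>(1) l(1) \<Delta>(1)] l\<kappa> by simp
   show "0 \<in> ders i k" by (rule zero_derivation[OF shT i])
   show "tangent p (tangent l \<Delta>) = tangent p 0" "tangent q (tangent l \<Delta>) = tangent q 0"
    using ms2 \<Delta>(2,3) qA by (simp_all only: rw2 morphic_tangent tangent_0)
  qed
  have iP: "precomp (id_mor P) R' i \<in> ders i k" using precomp_derivation[OF i id_mors[OF ss(2)] R1 ss(2)] ms1 by simp
  have x\<Delta>: "tangent x \<Delta> = precomp (id_mor P) R' i"
  proof (rule derivations_eqI[OF nT i _ iP])
   show "tangent x \<Delta> \<in> ders i k" using tangent_derivation[OF \<kappa>(1) x(1) \<Delta>(1)] x\<kappa> by simp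
   show "tangent p (tangent x \<Delta>) = tangent p (precomp (id_mor P) R' i)"
    using ms2 \<Delta>(2) mA R'(2) by (simp add: rw2 tangent_precomp mi precomp_precomp R_def)
   show "tangent q (tangent x \<Delta>) = tangent q (precomp (id_mor P) R' i)"
    using ms2 \<Delta>(3) R'(3) by (simp only: rw2 tangent_precomp mi morphic_precomp_0)
  qed
  have y\<Delta>: "tangent y \<Delta> = precomp h D (m \<odot> i)"
  proof (rule derivations_eqI[OF nT hmi])
   show "tangent y \<Delta> \<in> ders (h \<odot> (m \<odot> i)) k" using tangent_derivation[OF \<kappa>(1) y(1) \<Delta>(1)] y\<kappa> by simp
   show "precomp h D (m \<odot> i) \<in> ders (h \<odot> (m \<odot> i)) k" by (rule precomp_derivation[OF comp_mors[OF i m] h(1) D(1) ss(1)])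
   show "tangent p (tangent y \<Delta>) = tangent p (precomp h D (m \<odot> i))"
    using ms2 \<Delta>(2) pA D(2) by (simp add: rw2 tangent_precomp precomp_precomp h(2))
   have "tangent q (precomp h D (m \<odot> i)) = 0" using ms2 D(3) by (simp only: tangent_precomp morphic_precomp_0 morphic_comp comp_simps)
   then show "tangent q (tangent y \<Delta>) = tangent q (precomp h D (m \<odot> i))"
    using ms2 l\<Delta> by (simp only: rw2 morphic_tangent tangent_0)
  qed
  have "precomp m (tangent m R') i = tangent m (tangent x \<Delta>)" unfolding x\<Delta> using ms2 by (simp add: tangent_precomp mi)
  also have "\<dots> = tangent m (tangent y \<Delta>)" using ms2 by (simp add: rw2)
  also have "\<dots> = precomp m (precomp (id_mor G) R m) i" unfolding y\<Delta> using ms2 by (simp add: tangent_precomp precomp_precomp h(4) R_def)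
  finally show "precomp m (tangent m R') (\<iota> z) = precomp m (precomp (id_mor G) R m) (\<iota> z)" unfolding i_def .
 qed
qed

theorem commutator_eq_0:
 assumes a: "a \<in> ders u k" "tangent s a = 0" and D: "D \<in> ders h k" "tangent p D = precomp u a t" "tangent q D = 0"
  and Q: "Q \<in> vector_fields G j" and Q': "Q' \<in> vector_fields P j" "tangent p Q' = precomp (id_mor G) Q p" "tangent q Q' = precomp (id_mor G) Q q"
   "tangent m Q' = precomp (id_mor G) Q m"
  and C0: "precomp (id_mor G) (commutator j k Q (tangent m D)) u = 0"
 shows "commutator j k Q (tangent m D) = 0"
proof -
 note ss = n_manifold_sheaf[OF X] n_manifold_sheaf[OF fib_simps(1)]
 define R where "R = tangent m D"
 have R: "R \<in> vector_fields G k" unfolding R_def vector_fields_def using tangent_derivation[OF h(1) m D(1)] h(4) by simp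
 have sR: "tangent s R = 0" unfolding R_def using ms D(3) by (simp only: rw morphic_tangent tangent_0)
 have pi: "p \<odot> id_mor P = p" "q \<odot> id_mor P = q" "m \<odot> id_mor P = m"
  by (rule comp_id[OF ss(2) fib_simps(2)], rule comp_id[OF ss(2) fib_simps(3)], rule comp_id[OF ss(2) m])
 \<comment> \<open>The first entry of a composable pair may move along \<open>R\<close> while the
   second rests, because \<open>R\<close> is tangent to the fibres of the source map.\<close>
 have "\<exists>R'\<in>ders (id_mor P) k. tangent p R' = precomp (id_mor G) R p \<and> tangent q R' = 0"
 proof (rule derivation_exists[OF fib_simps(1) id_mors[OF ss(2)]])
  show "precomp (id_mor G) R p \<in> ders (p \<odot> id_mor P) k"
   using precomp_derivation[OF fib_simps(2) id_mors[OF ss(1)] R[unfolded vector_fields_def] ss(1)] ms by (simp add: pi)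
  show "0 \<in> ders (q \<odot> id_mor P) k" unfolding pi by (rule zero_derivation[OF ss(2) fib_simps(3)])
  show "tangent s (precomp (id_mor G) R p) = tangent t 0" using ms sR by (simp only: tangent_precomp morphic_precomp_0 tangent_0 id_simps)
 qed
 then obtain R' where R': "R' \<in> vector_fields P k" "tangent p R' = precomp (id_mor G) R p" "tangent q R' = 0" unfolding vector_fields_def by blast
 have mR: "tangent m R' = precomp (id_mor G) R m" unfolding R_def by (rule right_invariant[OF a(1) D R'[unfolded R_def]])
 have zG: "0 \<in> vector_fields G k" unfolding vector_fields_def by (rule zero_derivation[OF ss(1) id_mors[OF ss(1)]])
 have zq: "tangent q R' = precomp (id_mor G) 0 q" using R'(3) ms by (simp only: morphic_precomp_0)
 define C C' where "C = commutator j k Q R" and "C' = commutator j k Q' R'"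
 have C': "C' \<in> ders (id_mor P) (j + k)" unfolding C'_def using commutator_derivation[OF ss(2) Q'(1) R'(1)] unfolding vector_fields_def .
 have C: "C \<in> ders (id_mor G) (j + k)" unfolding C_def using commutator_derivation[OF ss(1) Q R] unfolding vector_fields_def .
 note rel = commutator_related[OF _ ss(2,1) Q'(1) Q _ R'(1)]
 have pC: "tangent p C' = precomp (id_mor G) C p" unfolding C_def C'_def by (rule rel[OF fib_simps(2) Q'(2) R R'(2)])
 have mC: "tangent m C' = precomp (id_mor G) C m" unfolding C_def C'_def by (rule rel[OF m Q'(4) R mR])
 have "tangent q C' = precomp (id_mor G) (commutator j k Q 0) q" unfolding C'_def by (rule rel[OF fib_simps(3) Q'(3) zG zq])
 then have qC: "tangent q C' = 0" unfolding commutator_0[OF ss(1) Q] using ms by (simp only: morphic_precomp_0)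
 have H: "precomp (id_mor P) C' h = 0"
 proof (rule derivations_eqI[OF X h(1)])
  show "precomp (id_mor P) C' h \<in> ders h (j + k)" using precomp_derivation[OF h(1) id_mors[OF ss(2)] C' ss(2)] ms by simp
  show "0 \<in> ders h (j + k)" by (rule zero_derivation[OF ss(1) h(1)])
  have "tangent p (precomp (id_mor P) C' h) = precomp (id_mor G) C (u \<odot> t)"
   using ms pC by (simp add: tangent_precomp pi precomp_precomp h(2))
  also have "\<dots> = precomp u (precomp (id_mor G) C u) t" using ms by (simp add: precomp_precomp)
  also have "\<dots> = 0" unfolding C_def R_def C0 using ms by (simp only: morphic_precomp_0)
  finally show "tangent p (precomp (id_mor P) C' h) = tangent p 0" unfolding tangent_0 .
  show "tangent q (precomp (id_mor P) C' h) = tangent q 0" using ms qC by (simp only: tangent_precomp pi morphic_precomp_0 tangent_0 id_simps)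
 qed
 have "precomp (id_mor G) C (id_mor G) = precomp (id_mor G) C (m \<odot> h)" unfolding h(4) ..
 also have "\<dots> = tangent m (precomp (id_mor P) C' h)" using ms mC by (simp add: tangent_precomp pi precomp_precomp)
 also have "\<dots> = 0" unfolding H tangent_0 ..
 finally have CC: "precomp (id_mor G) C (id_mor G) = 0" .
 interpret C: derivation G G "id_mor G" "j + k" C by (rule derivationI[OF id_mors[OF ss(1)] C])
 \<comment> \<open>Precomposition with the identity does nothing to homogeneous sections over open
   sets, and elsewhere the derivation is \<open>0\<close> by normalization.\<close>
 have "C V f = 0" for V f
 proof (cases "gopen G V \<and> f \<in> homogeneous G V")
  case True
  then have "preim (id_mor G) V = V" using preim_id[OF openin_subset] by blast
  then have "pull (id_mor G) V (C V f) = 0" "C V f \<in> homogeneous G V"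
   using fun_cong[OF fun_cong[OF CC, of V], of f] C.der_homog[of V f] True by (simp_all add: precomp_def)
  then show ?thesis using id_pull True by metis
 qed (rule C.der_junk)
 then have "C = 0" by (auto simp: fun_eq_iff)
 then show ?thesis unfolding C_def R_def .
qed

end

section \<open>Translation to the definitions of the statement\<close>

lemma tangent_pair:
 assumes fp: "fibre_product n (arrows \<G>) (arrows \<G>) M (pairs \<G>) s t (pr\<^sub>1 \<G>) (pr\<^sub>2 \<G>)" and K: "n_manifold n K"
  and h: "is_pairing \<G> a b h" "mdom a = K" and A: "A \<in> ders a k" and B: "B \<in> ders b k" and AB: "tangent s A = tangent t B"
 shows "tangent_pair \<G> k a A b B \<in> ders h k \<and> tangent (pr\<^sub>1 \<G>) (tangent_pair \<G> k a A b B) = A \<and>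
  tangent (pr\<^sub>2 \<G>) (tangent_pair \<G> k a A b B) = B"
proof -
 interpret fibre_product n "arrows \<G>" "arrows \<G>" M "pairs \<G>" s t "pr\<^sub>1 \<G>" "pr\<^sub>2 \<G>" by (rule fp)
 have h': "h \<in> mors K (pairs \<G>)" "pr\<^sub>1 \<G> \<odot> h = a" "pr\<^sub>2 \<G> \<odot> h = b" using h by (simp_all add: is_pairing_def)
 obtain D where D: "D \<in> ders h k" "tangent (pr\<^sub>1 \<G>) D = A" "tangent (pr\<^sub>2 \<G>) D = B"
  using derivation_exists[OF K h'(1), of A k B] A B AB h'(2,3) by auto
 have "tangent_pair \<G> k a A b B = D"
  unfolding tangent_pair_def
 \<comment> \<open>The description quantifies over pairings too, so uniqueness is needed twice: for
   the pairing and for the derivation along it.\<close>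
 proof (rule the_equality)
  show "\<exists>h. is_pairing \<G> a b h \<and> D \<in> ders h k \<and> tangent (pr\<^sub>1 \<G>) D = A \<and> tangent (pr\<^sub>2 \<G>) D = B" using h(1) D by blast
  fix D' assume "\<exists>h. is_pairing \<G> a b h \<and> D' \<in> ders h k \<and> tangent (pr\<^sub>1 \<G>) D' = A \<and> tangent (pr\<^sub>2 \<G>) D' = B"
  then obtain h1 where h1: "is_pairing \<G> a b h1" "D' \<in> ders h1 k" "tangent (pr\<^sub>1 \<G>) D' = A" "tangent (pr\<^sub>2 \<G>) D' = B" by blast
  have "h1 = h" by (rule eqI[OF K _ h'(1)]) (use h1(1) h(2) h'(2,3) in "simp_all add: is_pairing_def")
  then show "D' = D" using derivations_eqI[OF K h'(1) _ D(1)] h1 D by simp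
 qed
 then show ?thesis using D by simp
qed

text \<open>For elements of degree one the mixed brackets \<open>[Q, q]\<close> and
  \<open>[q, Q]\<close> agree, so the factor \<open>1/2\<close> cancels in them just as in
  \<open>[Q, Q] = 2 Q^2\<close>. The sign in \<open>L_action\<close> turns the section component
  into \<open>- B\<close>, whose vanishing is that of \<open>B\<close>.\<close>

lemma maurer_cartan_iff:
 fixes q :: "'q set => 'b::real_vector => 'a::real_vector"
 shows "(q, Q) \<in> maurer_cartan (L_space \<G>) (L_diff \<G>) (L_bracket \<G>) \<longleftrightarrow> q \<in> algebroid_sections \<G> 2 \<and> Q \<in> multiplicative_fields \<G> 1 \<and>
  precomp (id_mor (arrows \<G>)) (commutator 1 2 Q (right_inv \<G> 2 q)) (unt \<G>) = 0 \<and>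
  (\<lambda>V f. Q V (Q V f)) = left_inv \<G> 2 q - right_inv \<G> 2 q"
proof -
 define B where "B = precomp (id_mor (arrows \<G>)) (commutator 1 2 Q (right_inv \<G> 2 q)) (unt \<G>)"
 define QQ where "QQ = (\<lambda>V f. Q V (Q V f))"
 have act: "L_action \<G> 1 1 Q q = - B" by (simp add: L_action_def B_def)
 have com: "commutator 1 1 Q Q = 2 *\<^sub>R QQ" by (simp add: commutator_def QQ_def scaleR_fun_def scaleR_2 fun_eq_iff)
 have br: "L_bracket \<G> 1 1 (q, Q) (q, Q) = (- B - (-1) *\<^sub>R (- B), 2 *\<^sub>R QQ)" by (simp add: L_bracket_def act com)
 have df: "L_diff \<G> 1 (q, Q) = (0, right_inv \<G> 2 q - left_inv \<G> 2 q)" by (simp add: L_diff_def)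
 have B2: "(1/2) *\<^sub>R (- B - (-1) *\<^sub>R (- B)) = - B"
 proof -
  have "- B - (-1) *\<^sub>R (- B) = 2 *\<^sub>R (- B)" by (simp add: scaleR_2 del: scaleR_minus_right)
  then show ?thesis by simp
 qed
 have eq: "L_diff \<G> 1 (q, Q) + (1/2) *\<^sub>R L_bracket \<G> 1 1 (q, Q) (q, Q) = (- B, right_inv \<G> 2 q - left_inv \<G> 2 q + QQ)"
  unfolding br df scaleR_prod_def fst_conv snd_conv B2 plus_prod_def by simp
 have "(- B, right_inv \<G> 2 q - left_inv \<G> 2 q + QQ) = 0 \<longleftrightarrow> B = 0 \<and> QQ = left_inv \<G> 2 q - right_inv \<G> 2 q"
  unfolding zero_prod_def prod.inject neg_equal_0_iff_equal by (simp add: eq_neg_iff_add_eq_0[symmetric] add.commute[of _ QQ])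
 then show ?thesis unfolding maurer_cartan_def mem_Collect_eq eq unfolding L_space_def B_def QQ_def by auto
qed

theorem proposition2p13:
  fixes n :: nat
    and \<G> :: "('p, 'a::real_vector, 'q, 'b::real_vector, 'r, 'c::real_vector) groupoid_data"
  assumes "graded_lie_groupoid n \<G>"
  shows "bij_betw (\<lambda>(q, Q). (Q, q))
           (maurer_cartan (L_space \<G>) (L_diff \<G>) (L_bracket \<G>))
           (quasi_Q_structures \<G>)"
proof -
 let ?G = "arrows \<G>" and ?M = "objects \<G>" and ?p = "pr\<^sub>1 \<G>" and ?q = "pr\<^sub>2 \<G>" and ?s = "src \<G>" and ?t = "tgt \<G>"
  and ?m = "mul \<G>" and ?u = "unt \<G>"
 have zero: "commutator 1 2 Q (right_inv \<G> 2 a) = 0"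
  if a: "a \<in> algebroid_sections \<G> 2" and Q: "Q \<in> multiplicative_fields \<G> 1"
   and C0: "precomp (id_mor ?G) (commutator 1 2 Q (right_inv \<G> 2 a)) ?u = 0" for a Q
 proof -
  note gr = assms[unfolded graded_lie_groupoid_def Let_def]
  have gr1: "n_manifold n ?M" "n_manifold n ?G" "src \<G> \<in> mors ?G ?M" "tgt \<G> \<in> mors ?G ?M"
   "unt \<G> \<in> mors ?M ?G" "mul \<G> \<in> mors (pairs \<G>) ?G" "submersion ?t"
   "is_fibre_product n ?s ?t (pairs \<G>) ?p ?q"
   "src \<G> \<odot> mul \<G> = src \<G> \<odot> pr\<^sub>2 \<G>" "tgt \<G> \<odot> mul \<G> = tgt \<G> \<odot> pr\<^sub>1 \<G>" "src \<G> \<odot> unt \<G> = id_mor ?M"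
   using gr by - (elim conjE, assumption)+
  obtain h where hp: "is_pairing \<G> (unt \<G> \<odot> tgt \<G>) (id_mor ?G) h" "mul \<G> \<odot> h = id_mor ?G" using gr by (elim conjE exE) (rule that)
  obtain E :: univ_space and e r l x y where E: "is_fibre_product n (src \<G> \<odot> pr\<^sub>2 \<G>) ?t E e r"
   "is_pairing \<G> (pr\<^sub>2 \<G> \<odot> e) r l" "is_pairing \<G> (mul \<G> \<odot> e) r x" "is_pairing \<G> (pr\<^sub>1 \<G> \<odot> e) (mul \<G> \<odot> l) y" "mul \<G> \<odot> x = mul \<G> \<odot> y"
   using gr by (elim conjE exE) (rule that)
  have dt: "mdom ?t = arrows \<G>" "mdom ?s = arrows \<G>" using gr1(3,4) by (simp_all add: mors_iff)
  have de: "mdom ?p = pairs \<G>" "mdom ?q = pairs \<G>" "mdom ?m = pairs \<G>" "mdom e = E"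
   using E(1) gr1(6,8) by (simp_all add: is_fibre_product_def mors_iff)
  interpret lie_groupoid n "arrows \<G>" "objects \<G>" "pairs \<G>" "src \<G>" "tgt \<G>" "pr\<^sub>1 \<G>" "pr\<^sub>2 \<G>" "mul \<G>" "unt \<G>" h E e r l x y
   using gr1 hp E by unfold_locales (simp_all add: is_pairing_def de dt)
  note ss = n_manifold_sheaf[OF X] n_manifold_sheaf[OF fib_simps(1)]
  have a0: "a \<in> ders ?u 2" "tangent ?s a = 0" using a by (simp_all only: algebroid_sections_def mem_Collect_eq)
  let ?D = "tangent_pair \<G> 2 (unt \<G> \<odot> tgt \<G>) (precomp ?u a ?t) (id_mor ?G) 0"
  have D: "?D \<in> ders h 2" "tangent ?p ?D = precomp ?u a ?t" "tangent ?q ?D = 0"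
  proof -
   have "tangent ?s (precomp ?u a ?t) = tangent ?t 0" using ms a0(2) by (simp only: tangent_precomp morphic_precomp_0 tangent_0)
   from tangent_pair[OF fibre_product_axioms X hp(1) _ precomp_derivation[OF g u a0(1) n_manifold_sheaf[OF Z]] zero_derivation[OF ss(1) id_mors[OF ss(1)]] this]
   show "?D \<in> ders h 2" "tangent ?p ?D = precomp ?u a ?t" "tangent ?q ?D = 0"
    using dt by simp_all
  qed
  have R: "right_inv \<G> 2 a = tangent ?m ?D" by (simp add: right_inv_def)
  obtain Q0 where Q0: "Q \<in> vector_fields ?G 1" "tangent ?s Q = precomp (id_mor ?M) Q0 ?s"
   "tangent ?t Q = precomp (id_mor ?M) Q0 ?t"
   and mQ: "tangent ?m (tangent_pair \<G> 1 ?p (precomp (id_mor ?G) Q ?p) ?q (precomp (id_mor ?G) Q ?q))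
     = precomp (id_mor ?G) Q ?m"
   using Q unfolding multiplicative_fields_def by blast
  let ?Q = "tangent_pair \<G> 1 ?p (precomp (id_mor ?G) Q ?p) ?q (precomp (id_mor ?G) Q ?q)"
  have pQ: "precomp (id_mor ?G) Q \<phi> \<in> ders \<phi> 1" if "\<phi> \<in> mors (pairs \<G>) ?G" for \<phi>
   using precomp_derivation[OF that id_mors[OF ss(1)] Q0(1)[unfolded vector_fields_def] ss(1)] id_comp[OF that] by simp
  have pi: "is_pairing \<G> ?p ?q (id_mor (pairs \<G>))"
   using ms comp_id[OF ss(2) fib_simps(2)] comp_id[OF ss(2) fib_simps(3)] id_mors[OF ss(2)] by (simp add: is_pairing_def)
  \<comment> \<open>Composability of the pair \<open>(Q, Q)\<close>: both entries project to the
    same field \<open>Q0\<close> on objects, along the two equal maps \<open>s \<odot> p\<close> and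
    \<open>t \<odot> q\<close>.\<close>
  have "tangent ?s (precomp (id_mor ?G) Q ?p) = precomp ?s (precomp (id_mor ?M) Q0 ?s) ?p"
   using ms Q0(2) comp_id[OF ss(1) f] by (simp add: tangent_precomp)
  also have "\<dots> = precomp ?t (precomp (id_mor ?M) Q0 ?t) ?q"
   using ms fib_simps(4) by (simp add: precomp_precomp)
  also have "\<dots> = tangent ?t (precomp (id_mor ?G) Q ?q)"
   using ms Q0(3) comp_id[OF ss(1) g] by (simp add: tangent_precomp)
  finally have "tangent ?s (precomp (id_mor ?G) Q ?p) = tangent ?t (precomp (id_mor ?G) Q ?q)" .
  from tangent_pair[OF fibre_product_axioms fib_simps(1) pi _ pQ[OF fib_simps(2)] pQ[OF fib_simps(3)] this]
  have Q': "?Q \<in> vector_fields (pairs \<G>) 1" "tangent ?p ?Q = precomp (id_mor ?G) Q ?p"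
   "tangent ?q ?Q = precomp (id_mor ?G) Q ?q" using ms by (simp_all add: vector_fields_def)
  show ?thesis unfolding R by (rule commutator_eq_0[OF a0 D Q0(1) Q' mQ C0[unfolded R]])
 qed
 have u: "unt \<G> \<in> mors ?M ?G" using assms by (simp add: graded_lie_groupoid_def Let_def)
 have iff: "(a, Q) \<in> maurer_cartan (L_space \<G>) (L_diff \<G>) (L_bracket \<G>) \<longleftrightarrow> (Q, a) \<in> quasi_Q_structures \<G>" for a Q
 proof -
  have "precomp (id_mor ?G) (commutator 1 2 Q (right_inv \<G> 2 a)) ?u = 0 \<longleftrightarrow> commutator 1 2 Q (right_inv \<G> 2 a) = 0"
   if "a \<in> algebroid_sections \<G> 2" "Q \<in> multiplicative_fields \<G> 1"
   using zero[OF that] precomp_0[OF u, of "id_mor ?G"] by (intro iffI) (assumption, simp only:)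
  then show ?thesis unfolding maurer_cartan_iff quasi_Q_structures_def mem_Collect_eq prod.case by blast
 qed
 show ?thesis
  by (rule bij_betw_byWitness[where f' = "\<lambda>(Q, q). (q, Q)"]) (use iff in auto)
qed

end
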